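(* Let $a\in\mathbb{R}\setminus\{0\}$, $m>0$, $e>0$, and $Q,I\in\mathbb R$ with $Q=I\pi a$. Then the operator $\mathfrak H:=\hat M\hat H$ described in the context, with domain $C^\infty_c(\mathcal Z^*,\mathbb C^4)$, is essentially self-adjoint in $L^2(\mathcal Z,\mathbb C^4)$ equipped with the standard inner product $(\hat\Phi,\hat\Psi)=\int_{\mathcal Z}\hat\Phi^\dagger\hat\Psi\,d\theta\,d\varphi\,dr$.
   Context: Let $\mathcal Z=\mathbb{R}_r\times[0,\pi]_\theta\times[0,2\pi]_\varphi$ and let $\mathcal Z^*$ be $\mathcal Z$ with the ring $\{r=0,\theta=\pi/2\}$ removed. Put $\varpi=\sqrt{r^2+a^2}$, $\rho=r+ia\cos\theta$, $|\rho|^2=r^2+a^2\cos^2\theta$. Pauli matrices $\sigma_k$; Weyl representation $\gamma^0=\begin{pmatrix}0&\mathbf 1_2\\ \mathbf 1_2&0\end{pmatrix}$, $\gamma^k=\begin{pmatrix}0&-\sigma_k\\ \sigma_k&0\end{pmatrix}$, $\alpha^k=\gamma^0\gamma^k=\mathrm{diag}(\sigma_k,-\sigma_k)$, $\alpha^0=\mathbf 1_4$. Let $\hat M=\alpha^0+\frac{a\sin\theta}{\varpi}\alpha^2$. With $Q=I\pi a$ put $\tilde A_0=-\frac{Qr}{|\rho|\varpi}$, $\mathfrak R=\mathrm{diag}(\rho,\rho,\bar\rho,\bar\rho)$, $M_t=\varpi\gamma^0+a\sin\theta\,\gamma^2$, $M_r=\varpi\gamma^3$, $M_\theta=\gamma^1$,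 $M_\varphi=\frac a\varpi\gamma^0+\csc\theta\,\gamma^2$, and $$\hat H=-i\,M_t^{-1}\Big(M_r\partial_r+M_\theta\partial_\theta+M_\varphi\partial_\varphi+ie|\rho|\gamma^0\tilde A_0+im\mathfrak R\Big).$$ Equivalently $\mathfrak H=\hat M\hat H=\varpi^{-1}\gamma^0\big(-i(M_r\partial_r+M_\theta\partial_\theta+M_\varphi\partial_\varphi)+e|\rho|\gamma^0\tilde A_0+m\mathfrak R\big)$. Bispinor fields are expanded in azimuthal modes $e^{i\kappa\varphi}$ with $\kappa\in\mathbb Z+\tfrac12$.
   Formalization: The domain C_c^∞(Z^*,C^4) is taken as smooth fields that are 2π-antiperiodic in φ (half-integer modes) with compact support in (r,θ) avoiding the axis θ=0,π as well as the ring; for fields not vanishing on the axis the csc θ term is not square integrable. *)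

theory Defs
  imports "HOL-Analysis.Analysis"
begin

(* Points of Z are triples (r, theta, varphi) :: real \<times> real \<times> real.
   Bispinors are elements of complex^4; 4x4 matrices are complex^4^4 (row-major,
   built with 'vector' of rows, acting by '*v'). *)

type_synonym pt = "real \<times> real \<times> real"
type_synonym bisp = "complex ^ 4"
type_synonym field4 = "pt \<Rightarrow> bisp"

definition m4 :: "complex list list \<Rightarrow> complex ^4^4" where
  "m4 xss = vector (map vector xss)"

(* Weyl representation: gamma^0 = [[0,1],[1,0]], gamma^k = [[0,-sigma_k],[sigma_k,0]] *)
definition gamma0 :: "complex^4^4" where
  "gamma0 = m4 [[0,0,1,0],[0,0,0,1],[1,0,0,0],[0,1,0,0]]"
definition gamma1 :: "complex^4^4" where
  "gamma1 = m4 [[0,0,0,-1],[0,0,-1,0],[0,1,0,0],[1,0,0,0]]"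
definition gamma2 :: "complex^4^4" where
  "gamma2 = m4 [[0,0,0,\<i>],[0,0,-\<i>,0],[0,-\<i>,0,0],[\<i>,0,0,0]]"
definition gamma3 :: "complex^4^4" where
  "gamma3 = m4 [[0,0,-1,0],[0,0,0,1],[1,0,0,0],[0,-1,0,0]]"

definition varpi :: "real \<Rightarrow> real \<Rightarrow> real" where
  "varpi a r = sqrt (r\<^sup>2 + a\<^sup>2)"
definition rho :: "real \<Rightarrow> real \<Rightarrow> real \<Rightarrow> complex" where
  "rho a r \<theta> = Complex r (a * cos \<theta>)"
definition absrho :: "real \<Rightarrow> real \<Rightarrow> real \<Rightarrow> real" where
  "absrho a r \<theta> = sqrt (r\<^sup>2 + a\<^sup>2 * (cos \<theta>)\<^sup>2)"

definition A0t :: "real \<Rightarrow> real \<Rightarrow> real \<Rightarrow> real \<Rightarrow> real" where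
  "A0t a Q r \<theta> = - (Q * r) / (absrho a r \<theta> * varpi a r)"

definition frakR :: "real \<Rightarrow> real \<Rightarrow> real \<Rightarrow> complex^4^4" where
  "frakR a r \<theta> = m4 [[rho a r \<theta>,0,0,0],[0,rho a r \<theta>,0,0],
                        [0,0,cnj (rho a r \<theta>),0],[0,0,0,cnj (rho a r \<theta>)]]"

definition Mr :: "real \<Rightarrow> real \<Rightarrow> complex^4^4" where
  "Mr a r = varpi a r *\<^sub>R gamma3" 
definition Mtheta :: "complex^4^4" where
  "Mtheta = gamma1"
definition Mphi :: "real \<Rightarrow> real \<Rightarrow> real \<Rightarrow> complex^4^4" where
  "Mphi a r \<theta> = (a / varpi a r) *\<^sub>R gamma0 + (1 / sin \<theta>) *\<^sub>R gamma2"

definition d_r :: "field4 \<Rightarrow> field4" where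
  "d_r \<psi> x = frechet_derivative \<psi> (at x) (1, 0, 0)"
definition d_theta :: "field4 \<Rightarrow> field4" where
  "d_theta \<psi> x = frechet_derivative \<psi> (at x) (0, 1, 0)"
definition d_phi :: "field4 \<Rightarrow> field4" where
  "d_phi \<psi> x = frechet_derivative \<psi> (at x) (0, 0, 1)"

definition frakH :: "real \<Rightarrow> real \<Rightarrow> real \<Rightarrow> real \<Rightarrow> field4 \<Rightarrow> field4" where
  "frakH a m e Q \<psi> x = (case x of (r, \<theta>, \<phi>) \<Rightarrow>
     complex_of_real (1 / varpi a r) *s (gamma0 *v
       ( (- \<i>) *s (Mr a r *v d_r \<psi> x + Mtheta *v d_theta \<psi> x + Mphi a r \<theta> *v d_phi \<psi> x)
       + complex_of_real (e * absrho a r \<theta> * A0t a Q r \<theta>) *s (gamma0 *v \<psi> x)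
       + complex_of_real m *s (frakR a r \<theta> *v \<psi> x))))"

fun iter_deriv :: "('a::real_normed_vector \<Rightarrow> 'b::real_normed_vector) \<Rightarrow> 'a list \<Rightarrow> 'a \<Rightarrow> 'b" where
  "iter_deriv f [] = f"
| "iter_deriv f (v # vs) = (\<lambda>x. frechet_derivative (iter_deriv f vs) (at x) v)"

definition smooth_on :: "'a::real_normed_vector set \<Rightarrow> ('a \<Rightarrow> 'b::real_normed_vector) \<Rightarrow> bool" where
  "smooth_on S f \<longleftrightarrow> (\<forall>vs. iter_deriv f vs differentiable_on S)"

definition Zset :: "pt set" where
  "Zset = UNIV \<times> {0..pi} \<times> {0..2*pi}"

(* the (r,theta)-region of Z^* with the poles theta = 0, pi and the ring r=0, theta=pi/2 removed *)
definition RTstar :: "(real \<times> real) set" where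
  "RTstar = {(r, \<theta>). 0 < \<theta> \<and> \<theta> < pi \<and> (r, \<theta>) \<noteq> (0, pi/2)}"

(* C_c^infty(Z^*, C^4): smooth bispinor fields, 2pi-antiperiodic in varphi (half-integer
   azimuthal modes kappa \<in> Z + 1/2), with (r,theta)-support a compact subset of RTstar *)
definition Dom :: "field4 set" where
  "Dom = {\<psi>. smooth_on UNIV \<psi>
             \<and> (\<forall>r \<theta> \<phi>. \<psi> (r, \<theta>, \<phi> + 2*pi) = - \<psi> (r, \<theta>, \<phi>))
             \<and> (\<exists>K. compact K \<and> K \<subseteq> RTstar \<and> (\<forall>r \<theta> \<phi>. (r, \<theta>) \<notin> K \<longrightarrow> \<psi> (r, \<theta>, \<phi>) = 0))}"

definition L2 :: "field4 \<Rightarrow> bool" where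
  "L2 f \<longleftrightarrow> f \<in> borel_measurable lborel \<and> integrable lborel (\<lambda>x. indicator Zset x * (norm (f x))\<^sup>2)"

definition ip :: "field4 \<Rightarrow> field4 \<Rightarrow> complex" where
  "ip f g = (LINT x|lborel. indicator Zset x * (\<Sum>i\<in>UNIV. cnj (f x $ i) * g x $ i))"

definition dist2 :: "field4 \<Rightarrow> field4 \<Rightarrow> real" where
  "dist2 f g = (LINT x|lborel. indicator Zset x * (norm (f x - g x))\<^sup>2)"

(* operators are treated via graphs, i.e. relations between L^2 representatives *)
definition op_graph :: "field4 set \<Rightarrow> (field4 \<Rightarrow> field4) \<Rightarrow> (field4 \<times> field4) set" where
  "op_graph D T = {(\<psi>, T \<psi>) | \<psi>. \<psi> \<in> D}"

definition graph_closure :: "(field4 \<times> field4) set \<Rightarrow> (field4 \<times> field4) set" where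
  "graph_closure G = {(u, v). L2 u \<and> L2 v \<and>
      (\<exists>s. (\<forall>n. s n \<in> G) \<and> (\<lambda>n. dist2 (fst (s n)) u) \<longlonglongrightarrow> 0
                          \<and> (\<lambda>n. dist2 (snd (s n)) v) \<longlonglongrightarrow> 0)}"

definition graph_adjoint :: "(field4 \<times> field4) set \<Rightarrow> (field4 \<times> field4) set" where
  "graph_adjoint G = {(u, v). L2 u \<and> L2 v \<and> (\<forall>(x, y)\<in>G. ip y u = ip x v)}"

definition dense_L2 :: "field4 set \<Rightarrow> bool" where
  "dense_L2 D \<longleftrightarrow> (\<forall>f. L2 f \<longrightarrow> (\<forall>\<epsilon>>0. \<exists>\<psi>\<in>D. dist2 f \<psi> < \<epsilon>))"

definition ess_self_adjoint :: "field4 set \<Rightarrow> (field4 \<Rightarrow> field4) \<Rightarrow> bool" where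
  "ess_self_adjoint D T \<longleftrightarrow> (\<forall>\<psi>\<in>D. L2 \<psi> \<and> L2 (T \<psi>)) \<and> dense_L2 D
     \<and> graph_adjoint (graph_closure (op_graph D T)) = graph_closure (op_graph D T)"

end

theory Submission
  imports Defs
begin

text \<open>
  Separating variables in the massless operator with \<open>Q = 0\<close>, every eigenfunction pair of the angular
  operator of mode \<open>\<kappa>\<close> spans a block on which the operator is a symmetric first order system in \<open>r\<close> on
  the whole line, with bounded zeroth order part; cutting off the exact solutions of the constant
  coefficient system and perturbing shows that the ranges of this system shifted by \<open>\<plusminus>\<i>\<close> are dense.
  Because half-integer modes are at worst of size \<open>sqrt (sin \<theta>)\<close> at the poles, and because the poles and the ring
  have codimension two and hence zero capacity, logarithmic cutoffs put the separated fields into the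
  domain of the closure. Weierstrass approximation and a Dynkin argument show that they span a dense
  subspace, which yields dense ranges for the massless operator. The mass and the potential are bounded
  Hermitian matrices, so the lower bound \<open>norm \<psi> \<le> norm ((H \<plusminus> \<i>) \<psi>)\<close> is uniform along the homotopy that
  switches them on, and density of the ranges persists.
\<close>

section \<open>Square-integrable functions\<close>

text \<open>The coefficients look singular on the ring, yet the factor \<open>absrho\<close> in the
  operator cancels the one in the denominator of \<open>A0t\<close>: what remains of the potential
  is \<open>- e * Q * r / (varpi a r) ^ 2\<close>. Mass and charge are nevertheless kept out of the
  separated problem, because \<open>rho\<close> involves \<open>r\<close> and
  \<open>cos \<theta>\<close> jointly and links components 1, 2 with components 3, 4, so that no
  two-component block would stay invariant. The obstacle is that the critical case occurs at both
  singular sets. The reference measure is flat, without the weight \<open>sin \<theta>\<close>, so a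
  pole is a boundary strip of width \<open>s\<close> rather than a disc; a cutoff gradient
  \<open>1 / s\<close> on it has norm of order \<open>s ^ (-1/2)\<close>, and only the decay
  \<open>sqrt (sin \<theta>)\<close> of half-integer modes brings this back to order 1. It never
  becomes small for a single cutoff. Limits in the Hilbert space are never constructed: closures,
  ranges and adjoints are all described by approximation with concrete functions.\<close>

definition l2 :: "'p measure \<Rightarrow> ('p \<Rightarrow> 'v::{second_countable_topology,real_normed_vector}) \<Rightarrow> bool" where
  "l2 M f \<longleftrightarrow> f \<in> borel_measurable M \<and> integrable M (\<lambda>x. (norm (f x))\<^sup>2)"

text \<open>Outside square-integrable functions the Bochner integral defaults to 0, and so does
  \<open>nrm\<close>; estimates therefore carry \<open>l2\<close> for the dominating function.
  Arguments are functions and not classes, matching operators given as graphs of fields. The value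
  type is general because pairs of complex functions on the line and bispinor fields both
  occur.\<close>

definition nrm :: "'p measure \<Rightarrow> ('p \<Rightarrow> 'v::real_normed_vector) \<Rightarrow> real" where
  "nrm M f = sqrt (LINT x|M. (norm (f x))\<^sup>2)"

lemma l2_measurable: "l2 M f \<Longrightarrow> f \<in> borel_measurable M"
  by (simp add: l2_def)

lemma nrm_nonneg [simp]: "nrm M f \<ge> 0"
  by (simp add: nrm_def)

lemma nrm_sq: "(nrm M f)\<^sup>2 = (LINT x|M. (norm (f x))\<^sup>2)"
  by (simp add: nrm_def)

lemma nrm_mono:
  assumes "l2 M g" "\<And>x. x \<in> space M \<Longrightarrow> norm (f x) \<le> norm (g x)"
  shows "nrm M f \<le> nrm M g"
proof (cases "integrable M (\<lambda>x. (norm (f x))\<^sup>2)")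
  case True
  show ?thesis unfolding nrm_def
    by (intro real_sqrt_le_mono integral_mono True) (use assms in \<open>auto simp: l2_def intro: power_mono\<close>)
next
  case False
  then have "nrm M f = 0" by (simp add: nrm_def not_integrable_integral_eq)
  then show ?thesis by simp
qed

lemma l2_bound:
  fixes f :: "'p \<Rightarrow> 'v::{second_countable_topology,real_normed_vector}"
    and g :: "'p \<Rightarrow> 'w::{second_countable_topology,real_normed_vector}"
  assumes "l2 M g" "f \<in> borel_measurable M" "\<And>x. x \<in> space M \<Longrightarrow> norm (f x) \<le> norm (g x)"
  shows "l2 M f"
proof -
  have "integrable M (\<lambda>x. (norm (f x))\<^sup>2)"
    by (rule Bochner_Integration.integrable_bound[of M "\<lambda>x. (norm (g x))\<^sup>2"])
      (use assms in \<open>auto simp: l2_def intro: power_mono\<close>)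
  then show ?thesis using assms by (simp add: l2_def)
qed

lemma l2_add:
  assumes "l2 M f" "l2 M g" shows "l2 M (\<lambda>x. f x + g x)"
proof -
  have m: "(\<lambda>x. f x + g x) \<in> borel_measurable M"
    using assms by (auto simp: l2_def)
  have b: "(norm (f x + g x))\<^sup>2 \<le> 2 * (norm (f x))\<^sup>2 + 2 * (norm (g x))\<^sup>2" for x
  proof -
    have "(norm (f x + g x))\<^sup>2 \<le> (norm (f x) + norm (g x))\<^sup>2"
      by (intro power_mono norm_triangle_ineq) auto
    also have "\<dots> \<le> 2 * (norm (f x))\<^sup>2 + 2 * (norm (g x))\<^sup>2"
      using sum_squares_bound[of "norm (f x)" "norm (g x)"] by (simp add: power2_sum)
    finally show ?thesis .
  qed
  have "integrable M (\<lambda>x. (norm (f x + g x))\<^sup>2)"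
    by (rule Bochner_Integration.integrable_bound[of M "\<lambda>x. 2 * (norm (f x))\<^sup>2 + 2 * (norm (g x))\<^sup>2"])
      (use assms m b in \<open>auto simp: l2_def\<close>)
  with m show ?thesis by (simp add: l2_def)
qed

lemma l2_uminus: "l2 M f \<Longrightarrow> l2 M (\<lambda>x. - f x)"
  by (auto simp: l2_def)

lemma l2_diff:
  assumes "l2 M f" "l2 M g" shows "l2 M (\<lambda>x. f x - g x)"
  using l2_add[OF assms(1) l2_uminus[OF assms(2)]] by simp

lemma l2_zero: "l2 M (\<lambda>_. 0)"
  by (simp add: l2_def)

text \<open>Young's inequality, integrated, gives \<open>2 * C \<le> t * A + B / t\<close> for every
  \<open>t > 0\<close>, and the optimum \<open>t = sqrt B / sqrt A\<close> is the claim. If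
  \<open>A\<close> or \<open>B\<close> vanishes there is no optimum; a suitable \<open>t\<close>
  then refutes \<open>C > 0\<close>.\<close>

lemma cauchy_schwarz_real:
  fixes u v :: "'p \<Rightarrow> real"
  assumes [measurable]: "u \<in> borel_measurable M" "v \<in> borel_measurable M"
    and iu: "integrable M (\<lambda>x. (u x)\<^sup>2)" and iv: "integrable M (\<lambda>x. (v x)\<^sup>2)"
  shows "integrable M (\<lambda>x. u x * v x)"
    and "(LINT x|M. u x * v x) \<le> sqrt (LINT x|M. (u x)\<^sup>2) * sqrt (LINT x|M. (v x)\<^sup>2)"
proof -
  have young: "2 * (p * q) \<le> t * p\<^sup>2 + q\<^sup>2 / t" if "t > 0" for p q t :: real
  proof -
    have "0 \<le> (t * p - q)\<^sup>2 / t" using that by simp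
    then show ?thesis using that by (simp add: power2_eq_square field_simps)
  qed
  show i: "integrable M (\<lambda>x. u x * v x)"
  proof (rule Bochner_Integration.integrable_bound[of M "\<lambda>x. (u x)\<^sup>2 + (v x)\<^sup>2"])
    show "AE x in M. norm (u x * v x) \<le> norm ((u x)\<^sup>2 + (v x)\<^sup>2)"
    proof (intro AE_I2)
      fix x
      have "2 * (\<bar>u x\<bar> * \<bar>v x\<bar>) \<le> (u x)\<^sup>2 + (v x)\<^sup>2" using young[of 1 "\<bar>u x\<bar>" "\<bar>v x\<bar>"] by simp
      moreover have "0 \<le> \<bar>u x\<bar> * \<bar>v x\<bar>" by simp
      ultimately have "\<bar>u x\<bar> * \<bar>v x\<bar> \<le> (u x)\<^sup>2 + (v x)\<^sup>2" by linarith
      then show "norm (u x * v x) \<le> norm ((u x)\<^sup>2 + (v x)\<^sup>2)" by (simp add: abs_mult)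
    qed
  qed (use iu iv in auto)
  define A where "A = (LINT x|M. (u x)\<^sup>2)"
  define B where "B = (LINT x|M. (v x)\<^sup>2)"
  define C where "C = (LINT x|M. u x * v x)"
  have A0: "A \<ge> 0" and B0: "B \<ge> 0" by (auto simp: A_def B_def)
  have key: "2 * C \<le> t * A + B / t" if "t > 0" for t
  proof -
    have "(LINT x|M. 2 * (u x * v x)) \<le> (LINT x|M. t * (u x)\<^sup>2 + (v x)\<^sup>2 / t)"
      by (intro integral_mono young that) (use i iu iv in auto)
    also have "\<dots> = t * A + B / t" using iu iv by (simp add: A_def B_def)
    finally show ?thesis by (simp add: C_def)
  qed
  have "C \<le> sqrt A * sqrt B"
  proof (cases "A = 0 \<or> B = 0")
    case True
    have "C \<le> 0"
    proof (rule ccontr)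
      assume "\<not> C \<le> 0"
      then have C0: "C > 0" by simp
      show False
      proof (cases "A = 0")
        case True
        \<comment> \<open>With \<open>A = 0\<close> a large \<open>t\<close> is wanted: this one
          makes \<open>B / t\<close> equal to \<open>C * (B / (B + 1))\<close>, which is below
          \<open>2 * C\<close>.\<close>
        have t: "(B + 1) / C > 0" using B0 C0 by simp
        have "2 * C \<le> B / ((B + 1) / C)" using key[OF t] True by simp
        also have "\<dots> = C * (B / (B + 1))" by simp
        also have "\<dots> \<le> C * 1" using C0 B0 by (intro mult_left_mono) auto
        finally show False using C0 by simp
      next
        case False
        with True have "B = 0" by simp
        have t: "C / (A + 1) > 0" using A0 C0 by simp
        have "2 * C \<le> C * (A / (A + 1))" using key[OF t] \<open>B = 0\<close> by simp
        also have "\<dots> \<le> C * 1" using C0 A0 by (intro mult_left_mono) auto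
        finally show False using C0 by simp
      qed
    qed
    then show ?thesis using True by auto
  next
    case False
    then have AB: "A > 0" "B > 0" using A0 B0 by auto
    have t: "sqrt B / sqrt A > 0" using AB by simp
    have "2 * C \<le> sqrt B / sqrt A * A + B / (sqrt B / sqrt A)" by (rule key[OF t])
    also have "sqrt B / sqrt A * A = sqrt B * sqrt A" using AB
      by (simp add: field_simps)
    also have "B / (sqrt B / sqrt A) = sqrt B * sqrt A" using AB
      by (simp add: field_simps)
    finally show ?thesis by (simp add: mult.commute)
  qed
  then show "(LINT x|M. u x * v x) \<le> sqrt (LINT x|M. (u x)\<^sup>2) * sqrt (LINT x|M. (v x)\<^sup>2)"
    by (simp add: A_def B_def C_def)
qed

lemma nrm_triangle:
  assumes f: "l2 M f" and g: "l2 M g"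
  shows "nrm M (\<lambda>x. f x + g x) \<le> nrm M f + nrm M g"
proof -
  have [measurable]: "f \<in> borel_measurable M" "g \<in> borel_measurable M" using f g by (auto simp: l2_def)
  have i: "integrable M (\<lambda>x. (norm (f x))\<^sup>2)" "integrable M (\<lambda>x. (norm (g x))\<^sup>2)" using f g by (auto simp: l2_def)
  note cs = cauchy_schwarz_real[OF _ _ i]
  have ifg: "integrable M (\<lambda>x. norm (f x) * norm (g x))" by (rule cs) auto
  have "(nrm M (\<lambda>x. f x + g x))\<^sup>2 \<le> (LINT x|M. (norm (f x))\<^sup>2 + (norm (g x))\<^sup>2 + 2 * (norm (f x) * norm (g x)))"
    unfolding nrm_sq
  proof (rule integral_mono)
    show "integrable M (\<lambda>x. (norm (f x + g x))\<^sup>2)" using l2_add[OF f g] by (simp add: l2_def)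
    show "(norm (f x + g x))\<^sup>2 \<le> (norm (f x))\<^sup>2 + (norm (g x))\<^sup>2 + 2 * (norm (f x) * norm (g x))" for x
      using power_mono[OF norm_triangle_ineq[of "f x" "g x"], of 2] by (simp add: power2_sum)
  qed (use i ifg in auto)
  also have "\<dots> = (nrm M f)\<^sup>2 + (nrm M g)\<^sup>2 + 2 * (LINT x|M. norm (f x) * norm (g x))"
    unfolding nrm_sq using i ifg by simp
  also have "\<dots> \<le> (nrm M f)\<^sup>2 + (nrm M g)\<^sup>2 + 2 * (nrm M f * nrm M g)"
    using cs(2)  by (simp add: nrm_def)
  also have "\<dots> = (nrm M f + nrm M g)\<^sup>2" by (simp add: power2_sum)
  finally show ?thesis by (rule power2_le_imp_le) simp
qed

lemma nrm_uminus [simp]: "nrm M (\<lambda>x. - f x) = nrm M f"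
  by (simp add: nrm_def)

lemma nrm_zero [simp]: "nrm M (\<lambda>x. 0) = 0"
  by (simp add: nrm_def)

lemma nrm_minus_commute: "nrm M (\<lambda>x. f x - g x) = nrm M (\<lambda>x. g x - f x)"
  by (simp add: nrm_def norm_minus_commute)

lemma nrm_triangle3:
  assumes "l2 M f" "l2 M g" "l2 M h"
  shows "nrm M (\<lambda>x. f x - h x) \<le> nrm M (\<lambda>x. f x - g x) + nrm M (\<lambda>x. g x - h x)"
  using nrm_triangle[OF l2_diff[OF assms(1,2)] l2_diff[OF assms(2,3)]] by simp

lemma nrm_dominated:
  fixes s :: "nat \<Rightarrow> 'p \<Rightarrow> 'v::{second_countable_topology,real_normed_vector}"
  assumes g: "l2 M g" and s: "\<And>n. s n \<in> borel_measurable M"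
    and b: "\<And>n. AE x in M. norm (s n x) \<le> norm (g x)"
    and lim: "AE x in M. (\<lambda>n. s n x) \<longlonglongrightarrow> 0"
  shows "(\<lambda>n. nrm M (s n)) \<longlonglongrightarrow> 0"
proof -
  have "(\<lambda>n. LINT x|M. (norm (s n x))\<^sup>2) \<longlonglongrightarrow> (LINT x|M. 0)"
  proof (rule integral_dominated_convergence[where w="\<lambda>x. (norm (g x))\<^sup>2"])
    show "integrable M (\<lambda>x. (norm (g x))\<^sup>2)" using g by (simp add: l2_def)
    show "AE x in M. (\<lambda>n. (norm (s n x))\<^sup>2) \<longlonglongrightarrow> 0"
    proof -
      have "(\<lambda>n. (norm (s n x))\<^sup>2) \<longlonglongrightarrow> 0" if "(\<lambda>n. s n x) \<longlonglongrightarrow> 0" for x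
        using tendsto_power[OF tendsto_norm[OF that], of 2] by simp
      then show ?thesis using lim by auto
    qed
    show "AE x in M. norm ((norm (s n x))\<^sup>2) \<le> (norm (g x))\<^sup>2" for n
      using b[of n] by (auto intro: power_mono)
  qed (use s in \<open>auto intro!: borel_measurable_power borel_measurable_norm\<close>)
  then show ?thesis unfolding nrm_def using tendsto_real_sqrt by force
qed

section \<open>Perturbation of operators with dense range\<close>

text \<open>An affine family \<open>A + t K\<close> on a common domain \<open>D\<close>, with
  \<open>Y\<close> a space of targets containing \<open>D\<close>. Only additivity and real scaling
  of targets are asked, so that the radial systems (with \<open>Y = D\<close>) and the bispinor
  operator (with \<open>Y\<close> all square-integrable fields) are both instances.\<close>

locale dense_range_perturbation =
  fixes M :: "'p measure" and Y D :: "('p \<Rightarrow> 'v::{second_countable_topology,real_normed_vector}) set"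
    and A K :: "('p \<Rightarrow> 'v) \<Rightarrow> ('p \<Rightarrow> 'v)"
  assumes Yl2: "\<And>h. h \<in> Y \<Longrightarrow> l2 M h" and DY: "D \<subseteq> Y" and D0: "(\<lambda>_. 0) \<in> D"
    and Dadd: "\<And>x y. x \<in> D \<Longrightarrow> y \<in> D \<Longrightarrow> (\<lambda>p. x p + y p) \<in> D"
    and Yadd: "\<And>x y. x \<in> Y \<Longrightarrow> y \<in> Y \<Longrightarrow> (\<lambda>p. x p + y p) \<in> Y"
    and Yscale: "\<And>x c. x \<in> Y \<Longrightarrow> (\<lambda>p. c *\<^sub>R x p) \<in> Y"
    and AY: "\<And>x. x \<in> D \<Longrightarrow> A x \<in> Y" and KY: "\<And>x. x \<in> D \<Longrightarrow> K x \<in> Y"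
    and Aadd: "\<And>x y. x \<in> D \<Longrightarrow> y \<in> D \<Longrightarrow> A (\<lambda>p. x p + y p) = (\<lambda>p. A x p + A y p)"
    and Kadd: "\<And>x y. x \<in> D \<Longrightarrow> y \<in> D \<Longrightarrow> K (\<lambda>p. x p + y p) = (\<lambda>p. K x p + K y p)"
    and A0: "A (\<lambda>_. 0) = (\<lambda>_. 0)" and K0: "K (\<lambda>_. 0) = (\<lambda>_. 0)"
begin

definition dense_range :: "(('p \<Rightarrow> 'v) \<Rightarrow> ('p \<Rightarrow> 'v)) \<Rightarrow> bool" where
  "dense_range B \<longleftrightarrow> (\<forall>h\<in>Y. \<forall>\<epsilon>>0. \<exists>x\<in>D. nrm M (\<lambda>p. B x p - h p) < \<epsilon>)"

lemma Ydiff: "x \<in> Y \<Longrightarrow> y \<in> Y \<Longrightarrow> (\<lambda>p. x p - y p) \<in> Y"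
  using Yadd[OF _ Yscale[of y "-1"]] by simp

text \<open>A Neumann series without inverses. Solving with the unperturbed operator up to an error
  \<open>r\<close> leaves a residual for the perturbed one, and its norm is about \<open>q\<close>
  times that of \<open>h\<close>, because \<open>low\<close> bounds the approximate solution by its
  image. Treating the residual in the same way \<open>k\<close> times yields the factor
  \<open>q ^ k\<close>, and no series has to converge in a complete space.\<close>

lemma dense_range_step:
  assumes dr: "dense_range (\<lambda>x p. A x p + t *\<^sub>R K x p)"
    and low: "\<And>x. x \<in> D \<Longrightarrow> nrm M x \<le> nrm M (\<lambda>p. A x p + t *\<^sub>R K x p)"
    and q: "0 \<le> q" "q < 1" and Kq: "\<And>x. x \<in> D \<Longrightarrow> nrm M (\<lambda>p. d *\<^sub>R K x p) \<le> q * nrm M x"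
  shows "dense_range (\<lambda>x p. A x p + (t + d) *\<^sub>R K x p)"
proof -
  let ?B = "\<lambda>x p. A x p + t *\<^sub>R K x p"
  let ?C = "\<lambda>x p. A x p + (t + d) *\<^sub>R K x p"
  have BY: "?B x \<in> Y" if "x \<in> D" for x using that by (intro Yadd Yscale AY KY)
  have CY: "?C x \<in> Y" if "x \<in> D" for x using that by (intro Yadd Yscale AY KY)
  \<comment> \<open>The arbitrary summand \<open>\<epsilon>\<close> absorbs the errors of inexact
    solution; quantifying over all \<open>h\<close> lets the induction hypothesis be applied to the
    residual.\<close>
  have iter: "\<forall>h\<in>Y. \<forall>\<epsilon>>0. \<exists>x\<in>D. nrm M (\<lambda>p. ?C x p - h p) \<le> q ^ k * nrm M h + \<epsilon>" for k
  proof (induction k)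
    case 0
    show ?case
    proof (intro ballI allI impI bexI[OF _ D0])
      fix h and e :: real assume "h \<in> Y" "e > 0"
      then show "nrm M (\<lambda>p. ?C (\<lambda>_. 0) p - h p) \<le> q ^ 0 * nrm M h + e" by (simp add: A0 K0)
    qed
  next
    case (Suc k)
    show ?case
    proof (intro ballI allI impI)
      fix h and e :: real assume h: "h \<in> Y" and e: "e > 0"
      \<comment> \<open>Chosen so that the contributions \<open>r\<close> and \<open>q * r\<close>
        to the residual add up to \<open>e / 2\<close>.\<close>
      define r where "r = e / (2 * (1 + q))"
      have r: "r > 0" using e q by (simp add: r_def)
      obtain x0 where x0: "x0 \<in> D" "nrm M (\<lambda>p. ?B x0 p - h p) < r"
        using dr h r unfolding dense_range_def by blast
      define h1 where "h1 = (\<lambda>p. h p - ?C x0 p)"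
      have h1: "h1 \<in> Y" unfolding h1_def by (intro Ydiff h CY x0)
      have "nrm M x0 \<le> nrm M (?B x0)" by (rule low[OF x0(1)])
      also have "\<dots> \<le> nrm M (\<lambda>p. ?B x0 p - h p) + nrm M h"
        using nrm_triangle[OF l2_diff[OF Yl2[OF BY[OF x0(1)]] Yl2[OF h]] Yl2[OF h]] by simp
      finally have nx0: "nrm M x0 \<le> r + nrm M h" using x0(2) by simp
      have "nrm M h1 = nrm M (\<lambda>p. (?B x0 p - h p) + d *\<^sub>R K x0 p)"
        unfolding h1_def by (subst nrm_minus_commute) (simp add: algebra_simps)
      also have "\<dots> \<le> nrm M (\<lambda>p. ?B x0 p - h p) + nrm M (\<lambda>p. d *\<^sub>R K x0 p)"
        by (intro nrm_triangle Yl2 Ydiff BY Yscale KY h x0)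
      also have "\<dots> \<le> r + q * (r + nrm M h)"
        using x0(2) Kq[OF x0(1)] mult_left_mono[OF nx0 q(1)] by linarith
      finally have "nrm M h1 \<le> r + q * (r + nrm M h)" .
      then have nh1: "nrm M h1 \<le> q * nrm M h + e / 2" proof -
        have "(1 + q) * r = e / 2" using q unfolding r_def by (subst times_divide_eq_right, subst divide_eq_eq) auto
        then show ?thesis using \<open>nrm M h1 \<le> r + q * (r + nrm M h)\<close> by (simp add: algebra_simps)
      qed
      obtain x1 where x1: "x1 \<in> D" "nrm M (\<lambda>p. ?C x1 p - h1 p) \<le> q ^ k * nrm M h1 + e / 2"
        using Suc.IH h1 e by (meson half_gt_zero)
      have "(\<lambda>p. ?C (\<lambda>p. x0 p + x1 p) p - h p) = (\<lambda>p. ?C x1 p - h1 p)"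
        by (auto simp: h1_def Aadd[OF x0(1) x1(1)] Kadd[OF x0(1) x1(1)] algebra_simps)
      then have "nrm M (\<lambda>p. ?C (\<lambda>p. x0 p + x1 p) p - h p) \<le> q ^ k * nrm M h1 + e / 2" using x1(2) by simp
      also have "\<dots> \<le> q ^ k * (q * nrm M h + e / 2) + e / 2"
        using nh1 q by (intro add_right_mono mult_left_mono) auto
      also have "\<dots> \<le> q ^ Suc k * nrm M h + e"
      proof -
        have "q ^ k * (e / 2) \<le> 1 * (e / 2)"
          using q e by (intro mult_right_mono power_le_one) auto
        then show ?thesis by (simp add: algebra_simps)
      qed
      finally show "\<exists>x\<in>D. nrm M (\<lambda>p. ?C x p - h p) \<le> q ^ Suc k * nrm M h + e"
        using Dadd[OF x0(1) x1(1)] by blast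
    qed
  qed
  show ?thesis unfolding dense_range_def
  proof (intro ballI allI impI)
    fix h and e :: real assume h: "h \<in> Y" and e: "e > 0"
    have "(\<lambda>k. q ^ k * nrm M h) \<longlonglongrightarrow> 0 * nrm M h"
      by (intro tendsto_mult LIMSEQ_power_zero tendsto_const) (use q in auto)
    then have "eventually (\<lambda>k. q ^ k * nrm M h < e / 2) sequentially"
      using e by (intro order_tendstoD(2)[where y="0 * nrm M h"]) auto
    then obtain k where k: "q ^ k * nrm M h < e / 2" by (auto simp: eventually_sequentially)
    obtain x where "x \<in> D" "nrm M (\<lambda>p. ?C x p - h p) \<le> q ^ k * nrm M h + e / 3"
      using iter[of k] h e by (metis divide_pos_pos zero_less_numeral)
    then show "\<exists>x\<in>D. nrm M (\<lambda>p. ?C x p - h p) < e" using k e by (intro bexI[of _ x]) auto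
  qed
qed

text \<open>Since \<open>low\<close> holds with constant 1 at every \<open>t\<close>, one step
  length serves along the whole segment from \<open>A\<close> to \<open>A + K\<close>:
  \<open>N\<close> steps of length \<open>1 / N\<close> suffice once
  \<open>\<bar>c\<bar> / N < 1\<close>.\<close>

lemma dense_range_perturb:
  assumes dr: "dense_range A"
    and low: "\<And>x t. x \<in> D \<Longrightarrow> nrm M x \<le> nrm M (\<lambda>p. A x p + t *\<^sub>R K x p)"
    and Kc: "\<And>x. x \<in> D \<Longrightarrow> nrm M (K x) \<le> c * nrm M x"
  shows "dense_range (\<lambda>x p. A x p + K x p)"
proof -
  obtain N :: nat where N: "\<bar>c\<bar> + 1 \<le> real N" using real_arch_simple by blast
  have N0: "real N > 0" using N by linarith
  define d where "d = 1 / real N"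
  have d: "d > 0" using N0 by (simp add: d_def)
  have step: "dense_range (\<lambda>x p. A x p + (of_nat j * d) *\<^sub>R K x p)" for j
  proof (induction j)
    case 0
    then show ?case using dr by simp
  next
    case (Suc j)
    have "dense_range (\<lambda>x p. A x p + (of_nat j * d + d) *\<^sub>R K x p)"
    proof (rule dense_range_step[where q="\<bar>c\<bar> / real N", OF Suc.IH low])
      show "\<bar>c\<bar> / real N < 1" using N N0 by simp
      fix x assume x: "x \<in> D"
      have "nrm M (\<lambda>p. d *\<^sub>R K x p) = d * nrm M (K x)"
        using d by (simp add: nrm_def power_mult_distrib real_sqrt_mult)
      also have "\<dots> \<le> d * (\<bar>c\<bar> * nrm M x)"
        using d Kc[OF x] mult_right_mono[OF abs_ge_self[of c], of "nrm M x"] by (intro mult_left_mono) auto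
      finally show "nrm M (\<lambda>p. d *\<^sub>R K x p) \<le> \<bar>c\<bar> / real N * nrm M x" by (simp add: d_def)
    qed auto
    then show ?case by (simp add: algebra_simps)
  qed
  show ?thesis using step[of N] N0 by (simp add: d_def)
qed

end

section \<open>The Hilbert space of bispinor fields and a range criterion\<close>

text \<open>A density on the whole space instead of a restriction to \<open>Zset\<close>: fields
  remain functions on all of \<open>pt\<close>, measurability is plain Borel measurability, and only
  integrals and almost-everywhere statements see \<open>Zset\<close>.\<close>

definition MZ :: "pt measure" where
  "MZ = density lborel (\<lambda>x. ennreal (indicator Zset x))"

definition hin :: "bisp \<Rightarrow> bisp \<Rightarrow> complex" where
  "hin u v = (\<Sum>i\<in>UNIV. cnj (u $ i) * v $ i)"

lemma Zset_borel [measurable]: "Zset \<in> sets borel"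
proof -
  have "closed Zset" unfolding Zset_def by (intro closed_Times) auto
  then show ?thesis by (rule borel_closed)
qed

lemma sets_MZ [measurable_cong, simp]: "sets MZ = sets borel"
  by (simp add: MZ_def)

lemma space_MZ [simp]: "space MZ = UNIV"
  by (simp add: MZ_def)

lemma borel_measurable_MZ [simp]: "borel_measurable MZ = borel_measurable borel"
  by (rule measurable_cong_sets) auto

lemma integral_MZ:
  fixes g :: "pt \<Rightarrow> 'b::{banach, second_countable_topology}"
  assumes "g \<in> borel_measurable borel"
  shows "(LINT x|MZ. g x) = (LINT x|lborel. indicator Zset x *\<^sub>R g x)"
  unfolding MZ_def by (rule integral_density) (use assms in auto)

lemma integrable_MZ:
  fixes g :: "pt \<Rightarrow> 'b::{banach, second_countable_topology}"
  assumes "g \<in> borel_measurable borel"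
  shows "integrable MZ g \<longleftrightarrow> integrable lborel (\<lambda>x. indicator Zset x *\<^sub>R g x)"
  unfolding MZ_def by (rule integrable_density) (use assms in auto)

lemma vec_nth_measurable [measurable]:
  assumes "f \<in> borel_measurable M"
  shows "(\<lambda>x. (f x :: bisp) $ i) \<in> borel_measurable M"
  by (rule measurable_compose[OF assms borel_measurable_continuous_onI])
    (intro linear_continuous_on bounded_linear_vec_nth)

lemma cnj_measurable [measurable]:
  assumes "f \<in> borel_measurable M"
  shows "(\<lambda>x. cnj (f x)) \<in> borel_measurable M"
  by (rule measurable_compose[OF assms borel_measurable_continuous_onI])
    (intro linear_continuous_on bounded_linear_cnj)

lemma vec_measurableI:
  fixes f :: "'p \<Rightarrow> bisp"
  assumes [measurable]: "\<And>i. (\<lambda>x. f x $ i) \<in> borel_measurable M"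
  shows "f \<in> borel_measurable M"
proof (subst borel_measurable_euclidean_space, intro ballI)
  fix b :: bisp assume "b \<in> Basis"
  then obtain i u where "b = axis i u" by (auto simp: Basis_vec_def)
  then show "(\<lambda>x. f x \<bullet> b) \<in> borel_measurable M" by (simp add: inner_axis)
qed

lemma smult_measurable [measurable]:
  assumes [measurable]: "c \<in> borel_measurable M" "f \<in> borel_measurable M"
  shows "(\<lambda>x. c x *s (f x :: bisp)) \<in> borel_measurable M"
  by (rule vec_measurableI) simp

section \<open>Translation of the given notions into norms and products over
  \<open>MZ\<close>\<close>

lemma L2_iff: "L2 f \<longleftrightarrow> l2 MZ f"
proof (cases "f \<in> borel_measurable borel")
  case True
  then have "(\<lambda>x. (norm (f x))\<^sup>2) \<in> borel_measurable borel" by measurable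
  from integrable_MZ[OF this] True show ?thesis by (simp add: L2_def l2_def)
qed (simp add: L2_def l2_def)

lemma dist2_eq:
  assumes "l2 MZ f" "l2 MZ g"
  shows "dist2 f g = (nrm MZ (\<lambda>x. f x - g x))\<^sup>2"
proof -
  have [measurable]: "f \<in> borel_measurable borel" "g \<in> borel_measurable borel"
    using assms by (auto simp: l2_def)
  have "(\<lambda>x. (norm (f x - g x))\<^sup>2) \<in> borel_measurable borel" by measurable
  from integral_MZ[OF this] show ?thesis by (simp add: nrm_sq dist2_def)
qed

lemma ip_eq:
  assumes "l2 MZ f" "l2 MZ g"
  shows "ip f g = (LINT x|MZ. hin (f x) (g x))"
proof -
  have [measurable]: "f \<in> borel_measurable borel" "g \<in> borel_measurable borel"
    using assms by (auto simp: l2_def)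
  have "(\<lambda>x. hin (f x) (g x)) \<in> borel_measurable borel" unfolding hin_def by measurable
  from integral_MZ[OF this] show ?thesis
    by (auto simp: ip_def hin_def indicator_def intro!: Bochner_Integration.integral_cong)
qed

lemma norm_hin: "norm (hin u v) \<le> norm u * norm v"
proof -
  have "norm (hin u v) \<le> (\<Sum>i\<in>UNIV. norm (cnj (u $ i) * v $ i))"
    unfolding hin_def by (rule norm_sum)
  also have "\<dots> = (\<Sum>i\<in>UNIV. \<bar>norm (u $ i)\<bar> * \<bar>norm (v $ i)\<bar>)" by (simp add: norm_mult)
  also have "\<dots> \<le> norm u * norm v" unfolding norm_vec_def by (rule L2_set_mult_ineq)
  finally show ?thesis .
qed

lemma hin_self: "hin u u = complex_of_real ((norm u)\<^sup>2)"
  by (simp add: hin_def norm_vec_def L2_set_def sum_nonneg complex_norm_square mult.commute del: of_real_power)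

lemma hin_add_left: "hin (u + v) w = hin u w + hin v w"
  and hin_add_right: "hin u (v + w) = hin u v + hin u w"
  and hin_diff_left: "hin (u - v) w = hin u w - hin v w"
  and hin_diff_right: "hin u (v - w) = hin u v - hin u w"
  and hin_smult_left: "hin (c *s u) w = cnj c * hin u w"
  and hin_smult_right: "hin u (c *s w) = c * hin u w"
  by (auto simp: hin_def algebra_simps sum.distrib sum_subtractf sum_distrib_left)

lemma norm_smult_vec: "norm (c *s (u::bisp)) = norm c * norm u"
  by (simp add: norm_vec_def L2_set_def norm_mult power_mult_distrib real_sqrt_mult
      flip: sum_distrib_left)

lemma l2_smult: "l2 MZ (f :: field4) \<Longrightarrow> l2 MZ (\<lambda>x. c *s f x)"
  using smult_measurable[of "\<lambda>_. c" MZ f]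
  by (auto simp: l2_def norm_smult_vec power_mult_distrib)

lemma nrm_smult: "nrm M (\<lambda>x. c *s (f x :: bisp)) = norm c * nrm M f"
  by (simp add: nrm_def norm_smult_vec power_mult_distrib real_sqrt_mult)

lemma hin_integrable:
  assumes f: "l2 MZ f" and g: "l2 MZ g"
  shows "integrable MZ (\<lambda>x. hin (f x) (g x))" "norm (ip f g) \<le> nrm MZ f * nrm MZ g"
proof -
  have [measurable]: "f \<in> borel_measurable borel" "g \<in> borel_measurable borel"
    using assms by (auto simp: l2_def)
  have i: "integrable MZ (\<lambda>x. (norm (f x))\<^sup>2)" "integrable MZ (\<lambda>x. (norm (g x))\<^sup>2)" using f g by (auto simp: l2_def)
  note cs = cauchy_schwarz_real[OF _ _ i]
  have ifg: "integrable MZ (\<lambda>x. norm (f x) * norm (g x))" by (rule cs) auto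
  show ih: "integrable MZ (\<lambda>x. hin (f x) (g x))"
    by (rule Bochner_Integration.integrable_bound[OF ifg]) (auto simp: hin_def[abs_def] norm_hin[unfolded hin_def])
  have "norm (ip f g) \<le> (LINT x|MZ. norm (hin (f x) (g x)))"
    unfolding ip_eq[OF f g] by (rule integral_norm_bound)
  also have "\<dots> \<le> (LINT x|MZ. norm (f x) * norm (g x))"
    by (intro integral_mono integrable_norm ih ifg norm_hin)
  also have "\<dots> \<le> nrm MZ f * nrm MZ g" unfolding nrm_def by (rule cs) auto
  finally show "norm (ip f g) \<le> nrm MZ f * nrm MZ g" .
qed

lemma ip_add_left: "l2 MZ f \<Longrightarrow> l2 MZ g \<Longrightarrow> l2 MZ h \<Longrightarrow> ip (\<lambda>x. f x + g x) h = ip f h + ip g h"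
  by (simp add: ip_eq l2_add hin_add_left hin_integrable(1))

lemma ip_diff_left: "l2 MZ f \<Longrightarrow> l2 MZ g \<Longrightarrow> l2 MZ h \<Longrightarrow> ip (\<lambda>x. f x - g x) h = ip f h - ip g h"
  by (simp add: ip_eq l2_diff hin_diff_left hin_integrable(1))

lemma ip_diff_right: "l2 MZ f \<Longrightarrow> l2 MZ g \<Longrightarrow> l2 MZ h \<Longrightarrow> ip f (\<lambda>x. g x - h x) = ip f g - ip f h"
  by (simp add: ip_eq l2_diff hin_diff_right hin_integrable(1))

lemma ip_add_right: "l2 MZ f \<Longrightarrow> l2 MZ g \<Longrightarrow> l2 MZ h \<Longrightarrow> ip f (\<lambda>x. g x + h x) = ip f g + ip f h"
  by (simp add: ip_eq l2_add hin_add_right hin_integrable(1))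

lemma ip_smult_left: "l2 MZ f \<Longrightarrow> l2 MZ g \<Longrightarrow> ip (\<lambda>x. c *s f x) g = cnj c * ip f g"
  by (simp add: ip_eq l2_smult hin_smult_left hin_integrable(1))

lemma ip_smult_right: "l2 MZ f \<Longrightarrow> l2 MZ g \<Longrightarrow> ip f (\<lambda>x. c *s g x) = c * ip f g"
  by (simp add: ip_eq l2_smult hin_smult_right hin_integrable(1))

lemma ip_self: "l2 MZ f \<Longrightarrow> ip f f = complex_of_real ((nrm MZ f)\<^sup>2)"
  unfolding ip_eq hin_self nrm_sq by (rule integral_complex_of_real)

text \<open>In the square of the norm of \<open>y + \<sigma> \<i> x\<close> the cross terms cancel
  by symmetry, and the squares of the norms of \<open>y\<close> and \<open>x\<close> remain. The
  second disjunct merely carries the condition \<open>\<sigma> ^ 2 = 1\<close>.\<close>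

lemma nrm_shift_ge:
  assumes x: "l2 MZ x" and y: "l2 MZ y" and sym: "ip y x = ip x y"
  shows "nrm MZ x \<le> nrm MZ (\<lambda>p. y p + (complex_of_real \<sigma> * \<i>) *s x p) \<or> \<sigma>\<^sup>2 \<noteq> 1"
proof (cases "\<sigma>\<^sup>2 = 1")
  case True
  let ?c = "complex_of_real \<sigma> * \<i>"
  have "cnj ?c * ?c = complex_of_real (\<sigma>\<^sup>2)" by (simp add: power2_eq_square algebra_simps)
  then have cc: "cnj ?c * ?c = 1" using True by simp
  have "ip (\<lambda>p. y p + ?c *s x p) (\<lambda>p. y p + ?c *s x p) = ip y y + ?c * ip y x + cnj ?c * ip x y + cnj ?c * ?c * ip x x"
    using x y by (simp add: ip_add_left ip_add_right ip_smult_left ip_smult_right l2_smult l2_add algebra_simps)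
  also have "\<dots> = ip y y + ip x x" unfolding cc sym by (simp add: algebra_simps)
  finally have "(nrm MZ (\<lambda>p. y p + ?c *s x p))\<^sup>2 = (nrm MZ y)\<^sup>2 + (nrm MZ x)\<^sup>2"
    using x y by (simp add: ip_self l2_add l2_smult flip: of_real_add of_real_power)
  then have "(nrm MZ x)\<^sup>2 \<le> (nrm MZ (\<lambda>p. y p + ?c *s x p))\<^sup>2" by simp
  then show ?thesis by (auto intro: power2_le_imp_le)
qed simp

text \<open>The functional \<open>ip _ w\<close> is bounded by \<open>c\<close> only on certain
  elements, but these come arbitrarily close to \<open>w\<close>; evaluated near \<open>w\<close>
  itself it gives the square of the norm of \<open>w\<close>. In this way a bound against a dense
  range becomes a bound of the norm.\<close>

lemma nrm_le_of_approx:
  assumes w: "l2 MZ w" and c: "c \<ge> 0"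
    and X: "\<And>\<delta>. \<delta> > 0 \<Longrightarrow> \<exists>z. l2 MZ z \<and> nrm MZ (\<lambda>p. z p - w p) < \<delta> \<and> norm (ip z w) \<le> c * nrm MZ z"
  shows "nrm MZ w \<le> c"
proof (rule ccontr)
  assume "\<not> nrm MZ w \<le> c"
  then have g: "nrm MZ w > c" by simp
  define N where "N = nrm MZ w"
  have N: "N > 0" "N > c" using g c by (auto simp: N_def)
  \<comment> \<open>Small enough that the errors \<open>c * d\<close> and \<open>d * N\<close>
    together use up only half of the gap \<open>N * (N - c)\<close>.\<close>
  define d where "d = (N * (N - c)) / (2 * (c + N))"
  have d: "d > 0" using N c by (simp add: d_def)
  obtain z where z: "l2 MZ z" "nrm MZ (\<lambda>p. z p - w p) < d" "norm (ip z w) \<le> c * nrm MZ z" using X[OF d] by blast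
  have nz: "nrm MZ z \<le> d + N"
    using nrm_triangle[OF l2_diff[OF z(1) w] w] z(2) by (simp add: N_def)
  have "ip w w = ip z w - ip (\<lambda>p. z p - w p) w" using z w by (simp add: ip_diff_left)
  then have "norm (ip w w) \<le> norm (ip z w) + norm (ip (\<lambda>p. z p - w p) w)"
    by (simp only: norm_triangle_ineq4)
  moreover have "norm (ip w w) = N * N" by (simp add: ip_self[OF w] N_def power2_eq_square norm_mult)
  moreover have "norm (ip (\<lambda>p. z p - w p) w) \<le> d * N"
  proof -
    have "nrm MZ (\<lambda>p. z p - w p) * N \<le> d * N" using z(2) N by (intro mult_right_mono) auto
    then show ?thesis using hin_integrable(2)[OF l2_diff[OF z(1) w] w] by (simp add: N_def)
  qed
  moreover have "c * nrm MZ z \<le> c * (d + N)" using nz c by (rule mult_left_mono)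
  ultimately have "N * N \<le> c * (d + N) + d * N" using z(3) by linarith
  then have "N * (N - c) \<le> d * (c + N)" by (simp add: algebra_simps)
  also have "d * (c + N) = N * (N - c) / 2"
  proof -
    have "(c + N) / (2 * (c + N)) = 1 / 2" using N c by simp
    then show ?thesis unfolding d_def by (metis (no_types, opaque_lifting) times_divide_eq_left times_divide_eq_right mult.right_neutral)
  qed
  finally have "N * (N - c) \<le> 0" by simp
  moreover have "N * (N - c) > 0" using N by (intro mult_pos_pos) auto
  ultimately show False by linarith
qed

lemma ip_tendsto:
  assumes s: "\<And>n. l2 MZ (s n)" "\<And>n. l2 MZ (t n)" and u: "l2 MZ u" and v: "l2 MZ v"
    and ls: "(\<lambda>n. nrm MZ (\<lambda>p. s n p - u p)) \<longlonglongrightarrow> 0" and lt: "(\<lambda>n. nrm MZ (\<lambda>p. t n p - v p)) \<longlonglongrightarrow> 0"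
  shows "(\<lambda>n. ip (s n) (t n)) \<longlonglongrightarrow> ip u v"
proof -
  have "(\<lambda>n. ip (s n) (t n) - ip u v) \<longlonglongrightarrow> 0"
  proof (rule Lim_null_comparison)
    show "\<forall>\<^sub>F n in sequentially. norm (ip (s n) (t n) - ip u v) \<le>
       nrm MZ (\<lambda>p. s n p - u p) * (nrm MZ (\<lambda>p. t n p - v p) + nrm MZ v) + nrm MZ u * nrm MZ (\<lambda>p. t n p - v p)"
    proof (intro always_eventually allI)
      fix n
      have "ip (s n) (t n) - ip u v = ip (\<lambda>p. s n p - u p) (t n) + ip u (\<lambda>p. t n p - v p)"
        using s u v by (simp add: ip_diff_left ip_diff_right)
      then have "norm (ip (s n) (t n) - ip u v) \<le> norm (ip (\<lambda>p. s n p - u p) (t n)) + norm (ip u (\<lambda>p. t n p - v p))"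
        by (simp only: norm_triangle_ineq)
      also have "\<dots> \<le> nrm MZ (\<lambda>p. s n p - u p) * nrm MZ (t n) + nrm MZ u * nrm MZ (\<lambda>p. t n p - v p)"
        by (intro add_mono hin_integrable(2) l2_diff s u v)
      also have "\<dots> \<le> nrm MZ (\<lambda>p. s n p - u p) * (nrm MZ (\<lambda>p. t n p - v p) + nrm MZ v) + nrm MZ u * nrm MZ (\<lambda>p. t n p - v p)"
        using nrm_triangle[OF l2_diff[OF s(2)[of n] v] v] by (intro add_right_mono mult_left_mono) auto
      finally show "norm (ip (s n) (t n) - ip u v) \<le>
         nrm MZ (\<lambda>p. s n p - u p) * (nrm MZ (\<lambda>p. t n p - v p) + nrm MZ v) + nrm MZ u * nrm MZ (\<lambda>p. t n p - v p)" .
    qed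
    have "(\<lambda>n. nrm MZ (\<lambda>p. s n p - u p) * (nrm MZ (\<lambda>p. t n p - v p) + nrm MZ v) + nrm MZ u * nrm MZ (\<lambda>p. t n p - v p))
      \<longlonglongrightarrow> 0 * (0 + nrm MZ v) + nrm MZ u * 0"
      by (intro tendsto_intros ls lt)
    then show "(\<lambda>n. nrm MZ (\<lambda>p. s n p - u p) * (nrm MZ (\<lambda>p. t n p - v p) + nrm MZ v) + nrm MZ u * nrm MZ (\<lambda>p. t n p - v p)) \<longlonglongrightarrow> 0"
      by simp
  qed
  then show ?thesis by (simp add: LIM_zero_iff)
qed

text \<open>The approximating sequence of an element \<open>(u, v)\<close> of the adjoint is read off from
  \<open>(T + \<i>) \<psi> \<approx> v + \<i> u\<close>; density of the range of \<open>T - \<i>\<close> then controls \<open>u - \<psi>\<close>, so that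
  completeness of the Hilbert space is never needed.\<close>

lemma ess_self_adjoint_if_dense_ranges:
  assumes D: "\<And>\<psi>. \<psi> \<in> D \<Longrightarrow> l2 MZ \<psi>" and TD: "\<And>\<psi>. \<psi> \<in> D \<Longrightarrow> l2 MZ (T \<psi>)"
    and sym: "\<And>\<psi> \<eta>. \<psi> \<in> D \<Longrightarrow> \<eta> \<in> D \<Longrightarrow> ip (T \<psi>) \<eta> = ip \<psi> (T \<eta>)"
    and dens: "\<And>h \<epsilon>. l2 MZ h \<Longrightarrow> \<epsilon> > 0 \<Longrightarrow> \<exists>\<psi>\<in>D. nrm MZ (\<lambda>p. \<psi> p - h p) < \<epsilon>"
    and rng: "\<And>h \<sigma> \<epsilon>. l2 MZ h \<Longrightarrow> \<sigma> \<in> {1,-1::real} \<Longrightarrow> \<epsilon> > 0 \<Longrightarrow>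
        \<exists>\<psi>\<in>D. nrm MZ (\<lambda>p. T \<psi> p + (complex_of_real \<sigma> * \<i>) *s \<psi> p - h p) < \<epsilon>"
  shows "ess_self_adjoint D T"
proof -
  let ?G = "op_graph D T"
  have dense: "dense_L2 D" unfolding dense_L2_def
  proof (intro allI impI)
    fix f and e :: real assume f: "L2 f" and e: "0 < e"
    obtain \<psi> where \<psi>: "\<psi> \<in> D" "nrm MZ (\<lambda>p. \<psi> p - f p) < sqrt e"
      using dens[of f "sqrt e"] f e by (auto simp: L2_iff)
    have "dist2 f \<psi> = (nrm MZ (\<lambda>p. \<psi> p - f p))\<^sup>2"
      using f \<psi>(1) D by (simp add: dist2_eq L2_iff nrm_minus_commute[of _ f])
    also have "\<dots> < (sqrt e)\<^sup>2" using \<psi>(2) by (intro power_strict_mono) auto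
    finally show "\<exists>\<psi>\<in>D. dist2 f \<psi> < e" using e \<psi>(1) by auto
  qed
  have lim_iff: "((\<lambda>n. dist2 (s n) u) \<longlonglongrightarrow> 0) \<longleftrightarrow> ((\<lambda>n. nrm MZ (\<lambda>p. s n p - u p)) \<longlonglongrightarrow> 0)"
    if "\<And>n. l2 MZ (s n)" "l2 MZ u" for s :: "nat \<Rightarrow> field4" and u
  proof -
    have "(\<lambda>n. dist2 (s n) u) = (\<lambda>n. (nrm MZ (\<lambda>p. s n p - u p))\<^sup>2)" using that by (simp add: dist2_eq)
    then show ?thesis by (simp add: power_tendsto_0_iff)
  qed
  have clos_iff: "(u, v) \<in> graph_closure ?G \<longleftrightarrow> l2 MZ u \<and> l2 MZ v \<and>
      (\<exists>\<psi>. (\<forall>n. \<psi> n \<in> D) \<and> (\<lambda>n. nrm MZ (\<lambda>p. \<psi> n p - u p)) \<longlonglongrightarrow> 0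
        \<and> (\<lambda>n. nrm MZ (\<lambda>p. T (\<psi> n) p - v p)) \<longlonglongrightarrow> 0)" (is "_ \<longleftrightarrow> ?R") for u v
  proof
    assume "(u, v) \<in> graph_closure ?G"
    then obtain s where uv: "l2 MZ u" "l2 MZ v" and s: "\<And>n. s n \<in> ?G"
      "(\<lambda>n. dist2 (fst (s n)) u) \<longlonglongrightarrow> 0" "(\<lambda>n. dist2 (snd (s n)) v) \<longlonglongrightarrow> 0"
      by (auto simp: graph_closure_def L2_iff)
    have s1: "fst (s n) \<in> D \<and> snd (s n) = T (fst (s n))" for n using s(1)[of n] by (auto simp: op_graph_def)
    show ?R using uv s(2,3) s1 D TD
      by (intro conjI exI[of _ "\<lambda>n. fst (s n)"] allI) (auto simp: lim_iff)
  next
    assume ?R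
    then obtain \<psi> where uv: "l2 MZ u" "l2 MZ v" and s: "\<And>n. \<psi> n \<in> D"
      "(\<lambda>n. nrm MZ (\<lambda>p. \<psi> n p - u p)) \<longlonglongrightarrow> 0" "(\<lambda>n. nrm MZ (\<lambda>p. T (\<psi> n) p - v p)) \<longlonglongrightarrow> 0" by blast
    have "\<exists>s. (\<forall>n. s n \<in> ?G) \<and> (\<lambda>n. dist2 (fst (s n)) u) \<longlonglongrightarrow> 0 \<and> (\<lambda>n. dist2 (snd (s n)) v) \<longlonglongrightarrow> 0"
      using s uv D TD by (intro exI[of _ "\<lambda>n. (\<psi> n, T (\<psi> n))"]) (auto simp: op_graph_def lim_iff)
    then show "(u, v) \<in> graph_closure ?G" using uv by (auto simp: graph_closure_def L2_iff)
  qed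
  have low: "nrm MZ \<psi> \<le> nrm MZ (\<lambda>p. T \<psi> p + (complex_of_real \<sigma> * \<i>) *s \<psi> p)"
    if "\<psi> \<in> D" "\<sigma> \<in> {1,-1}" for \<psi> and \<sigma> :: real
    using nrm_shift_ge[OF D[OF that(1)] TD[OF that(1)] sym[OF that(1) that(1)], of \<sigma>] that(2) by auto
  have sub1: "graph_closure ?G \<subseteq> graph_adjoint (graph_closure ?G)"
  proof
    fix w assume w: "w \<in> graph_closure ?G"
    obtain u v where [simp]: "w = (u, v)" by force
    obtain \<psi> where uv: "l2 MZ u" "l2 MZ v" and \<psi>: "\<And>n. \<psi> n \<in> D"
      "(\<lambda>n. nrm MZ (\<lambda>p. \<psi> n p - u p)) \<longlonglongrightarrow> 0" "(\<lambda>n. nrm MZ (\<lambda>p. T (\<psi> n) p - v p)) \<longlonglongrightarrow> 0"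
      using w clos_iff by auto
    have "ip y u = ip x v" if xyG: "(x, y) \<in> graph_closure ?G" for x y
    proof -
      obtain \<eta> where xy: "l2 MZ x" "l2 MZ y" and \<eta>: "\<And>n. \<eta> n \<in> D"
        "(\<lambda>n. nrm MZ (\<lambda>p. \<eta> n p - x p)) \<longlonglongrightarrow> 0" "(\<lambda>n. nrm MZ (\<lambda>p. T (\<eta> n) p - y p)) \<longlonglongrightarrow> 0"
        using xyG[unfolded clos_iff] by blast
      have "(\<lambda>n. ip (T (\<eta> n)) (\<psi> n)) \<longlonglongrightarrow> ip y u"
        by (intro ip_tendsto TD D \<eta> \<psi> xy uv)
      moreover have "(\<lambda>n. ip (\<eta> n) (T (\<psi> n))) \<longlonglongrightarrow> ip x v"
        by (intro ip_tendsto TD D \<eta> \<psi> xy uv)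
      ultimately show ?thesis using LIMSEQ_unique sym[OF \<eta>(1) \<psi>(1)] by simp
    qed
    then show "w \<in> graph_adjoint (graph_closure ?G)" using uv by (auto simp: graph_adjoint_def L2_iff)
  qed
  have sub2: "graph_adjoint (graph_closure ?G) \<subseteq> graph_closure ?G"
  proof
    fix w assume w: "w \<in> graph_adjoint (graph_closure ?G)"
    obtain u v where [simp]: "w = (u, v)" by force
    have u: "l2 MZ u" and v: "l2 MZ v" using w by (auto simp: graph_adjoint_def L2_iff)
    \<comment> \<open>Constant sequences place the operator inside its closure, so the adjoint
      relation may be tested on \<open>D\<close>.\<close>
    have G: "(\<eta>, T \<eta>) \<in> graph_closure ?G" if "\<eta> \<in> D" for \<eta>
      using that D TD by (subst clos_iff) (auto intro!: exI[of _ "\<lambda>n. \<eta>"])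
    have adj: "ip (T \<eta>) u = ip \<eta> v" if "\<eta> \<in> D" for \<eta>
      using w G[OF that] by (auto simp: graph_adjoint_def)
    have vu: "l2 MZ (\<lambda>p. v p + \<i> *s u p)" by (intro l2_add l2_smult u v)
    define P where "P n \<psi> \<longleftrightarrow> \<psi> \<in> D \<and> nrm MZ (\<lambda>p. T \<psi> p + \<i> *s \<psi> p - (v p + \<i> *s u p)) < 1 / Suc n" for n \<psi>
    have "\<exists>\<psi>. P n \<psi>" for n
      using rng[OF vu, of 1 "1 / Suc n"] unfolding P_def by auto
    then obtain \<psi> where P: "\<And>n. P n (\<psi> n)" by metis
    then have \<psi>: "\<And>n. \<psi> n \<in> D"
      "\<And>n. nrm MZ (\<lambda>p. T (\<psi> n) p + \<i> *s \<psi> n p - (v p + \<i> *s u p)) < 1 / Suc n"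
      unfolding P_def by auto
    have l\<psi>: "l2 MZ (\<psi> n)" "l2 MZ (T (\<psi> n))" for n using D TD \<psi> by auto
    \<comment> \<open>An element of the range of \<open>T - \<i>\<close> pairs with
      \<open>u - \<psi> n\<close> only through the residual of \<open>(T + \<i>) \<psi> n\<close>,
      whose norm is below \<open>1 / Suc n\<close>; and such elements come arbitrarily close to
      \<open>u - \<psi> n\<close>.\<close>
    have le: "nrm MZ (\<lambda>p. u p - \<psi> n p) \<le> 1 / Suc n" for n
    proof (rule nrm_le_of_approx)
      show uw: "l2 MZ (\<lambda>p. u p - \<psi> n p)" by (intro l2_diff u l\<psi>)
      fix d :: real assume d: "d > 0"
      obtain \<eta> where \<eta>: "\<eta> \<in> D" "nrm MZ (\<lambda>p. T \<eta> p + (complex_of_real (-1) * \<i>) *s \<eta> p - (u p - \<psi> n p)) < d"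
        using rng[OF uw, of "-1" d] d by blast
      let ?z = "\<lambda>p. T \<eta> p - \<i> *s \<eta> p"
      have l\<eta>: "l2 MZ \<eta>" "l2 MZ (T \<eta>)" using D TD \<eta> by auto
      have lz: "l2 MZ ?z" by (intro l2_diff l2_smult l\<eta>)
      have e1: "ip ?z u = ip \<eta> (\<lambda>p. v p + \<i> *s u p)"
        using adj[OF \<eta>(1)] l\<eta> u v by (simp add: ip_diff_left ip_add_right ip_smult_left ip_smult_right l2_smult)
      have e2: "ip ?z (\<psi> n) = ip \<eta> (\<lambda>p. T (\<psi> n) p + \<i> *s \<psi> n p)"
        using sym[OF \<eta>(1) \<psi>(1)] l\<eta> l\<psi> by (simp add: ip_diff_left ip_add_right ip_smult_left ip_smult_right l2_smult)
      have "ip ?z (\<lambda>p. u p - \<psi> n p) = - ip \<eta> (\<lambda>p. T (\<psi> n) p + \<i> *s \<psi> n p - (v p + \<i> *s u p))"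
        using e1 e2 lz u l\<psi> l\<eta> vu by (simp add: ip_diff_right l2_add l2_smult)
      then have "norm (ip ?z (\<lambda>p. u p - \<psi> n p)) \<le> nrm MZ \<eta> * nrm MZ (\<lambda>p. T (\<psi> n) p + \<i> *s \<psi> n p - (v p + \<i> *s u p))"
        using hin_integrable(2)[OF l\<eta>(1), of "\<lambda>p. T (\<psi> n) p + \<i> *s \<psi> n p - (v p + \<i> *s u p)"] l\<psi> vu
        by (simp add: l2_diff l2_add l2_smult)
      \<comment> \<open>The lower bound for \<open>T - \<i>\<close> replaces \<open>\<eta>\<close>
        by its image \<open>?z\<close>.\<close>
      also have "\<dots> \<le> nrm MZ ?z * (1 / Suc n)"
        using low[OF \<eta>(1), of "-1"] \<psi>(2)[of n] by (intro mult_mono) auto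
      finally show "\<exists>z. l2 MZ z \<and> nrm MZ (\<lambda>p. z p - (u p - \<psi> n p)) < d \<and>
          norm (ip z (\<lambda>p. u p - \<psi> n p)) \<le> 1 / Suc n * nrm MZ z"
        using lz \<eta>(2) by (intro exI[of _ ?z]) (auto simp: mult.commute)
    qed simp
    have lim0: "(\<lambda>n. 2 / real (Suc n)) \<longlonglongrightarrow> 0"
      using tendsto_mult[OF tendsto_const[of 2] LIMSEQ_inverse_real_of_nat] by (simp add: divide_inverse)
    have c1: "(\<lambda>n. nrm MZ (\<lambda>p. \<psi> n p - u p)) \<longlonglongrightarrow> 0"
    proof (rule Lim_null_comparison[OF _ lim0])
      show "\<forall>\<^sub>F n in sequentially. norm (nrm MZ (\<lambda>p. \<psi> n p - u p)) \<le> 2 / real (Suc n)"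
      proof (intro always_eventually allI)
        fix n
        have "nrm MZ (\<lambda>p. \<psi> n p - u p) \<le> 1 / Suc n" using le[of n] by (subst nrm_minus_commute)
        also have "\<dots> \<le> 2 / Suc n" by (simp add: divide_right_mono)
        finally show "norm (nrm MZ (\<lambda>p. \<psi> n p - u p)) \<le> 2 / real (Suc n)" by simp
      qed
    qed
    have c2: "(\<lambda>n. nrm MZ (\<lambda>p. T (\<psi> n) p - v p)) \<longlonglongrightarrow> 0"
    proof (rule Lim_null_comparison[OF _ lim0])
      show "\<forall>\<^sub>F n in sequentially. norm (nrm MZ (\<lambda>p. T (\<psi> n) p - v p)) \<le> 2 / real (Suc n)"
      proof (intro always_eventually allI)
        fix n
        have "nrm MZ (\<lambda>p. T (\<psi> n) p - v p) =
          nrm MZ (\<lambda>p. (T (\<psi> n) p + \<i> *s \<psi> n p - (v p + \<i> *s u p)) + \<i> *s (u p - \<psi> n p))"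
          by (intro arg_cong[where f="nrm MZ"] ext) (simp add: vector_ssub_ldistrib)
        also have "\<dots> \<le> nrm MZ (\<lambda>p. T (\<psi> n) p + \<i> *s \<psi> n p - (v p + \<i> *s u p)) + nrm MZ (\<lambda>p. \<i> *s (u p - \<psi> n p))"
          by (intro nrm_triangle l2_diff l2_add l2_smult u v l\<psi>)
        also have "\<dots> \<le> 1 / Suc n + 1 / Suc n"
          using \<psi>(2)[of n] le[of n] by (intro add_mono) (auto simp only: nrm_smult norm_ii mult_1)
        finally show "norm (nrm MZ (\<lambda>p. T (\<psi> n) p - v p)) \<le> 2 / real (Suc n)" by simp
      qed
    qed
    show "w \<in> graph_closure ?G" using clos_iff u v \<psi>(1) c1 c2 by auto
  qed
  show ?thesis unfolding ess_self_adjoint_def using D TD dense sub1 sub2 by (auto simp: L2_iff)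
qed

section \<open>Smooth functions of one real variable\<close>

text \<open>\<open>n\<close>-fold differentiability with two-sided derivatives at the points of
  \<open>S\<close>, whence the openness assumptions in the rules. Continuity of the top derivative
  is not demanded; over all \<open>n\<close> it follows, and every closure property becomes an
  induction with one derivative rule.\<close>

fun Ck :: "nat \<Rightarrow> real set \<Rightarrow> (real \<Rightarrow> 'b::real_normed_vector) \<Rightarrow> bool" where
  "Ck 0 S f = True"
| "Ck (Suc n) S f = ((\<forall>x\<in>S. f differentiable (at x)) \<and> Ck n S (\<lambda>x. vector_derivative f (at x)))"

definition Cinf :: "real set \<Rightarrow> (real \<Rightarrow> 'b::real_normed_vector) \<Rightarrow> bool" where
  "Cinf S f \<longleftrightarrow> (\<forall>n. Ck n S f)"

lemma Ck_cong:
  assumes "open S" "\<And>x. x \<in> S \<Longrightarrow> f x = g x" "Ck n S f"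
  shows "Ck n S g"
  using assms(2,3)
proof (induction n arbitrary: f g)
  case (Suc n)
  have d: "(g has_vector_derivative vector_derivative f (at x)) (at x)" if "x \<in> S" for x
  proof (rule has_vector_derivative_transform_within_open[OF _ assms(1) that])
    show "(f has_vector_derivative vector_derivative f (at x)) (at x)"
      using Suc.prems that by (simp add: vector_derivative_works[symmetric])
  qed (rule Suc.prems(1))
  then have eq: "vector_derivative f (at x) = vector_derivative g (at x)" if "x \<in> S" for x
    using d[OF that] by (simp add: vector_derivative_at)
  have "Ck n S (\<lambda>x. vector_derivative f (at x))" using Suc.prems(2) by simp
  with eq have "Ck n S (\<lambda>x. vector_derivative g (at x))"
    by (rule Suc.IH[of "\<lambda>x. vector_derivative f (at x)" "\<lambda>x. vector_derivative g (at x)"])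
  then show ?case using d by (auto intro: differentiableI_vector)
qed simp

lemma Ck_SucI:
  assumes "open S" "\<And>x. x \<in> S \<Longrightarrow> (f has_vector_derivative f' x) (at x)" "Ck n S f'"
  shows "Ck (Suc n) S f"
proof -
  have "Ck n S (\<lambda>x. vector_derivative f (at x))"
    by (rule Ck_cong[OF assms(1) _ assms(3)]) (simp add: vector_derivative_at[OF assms(2)])
  then show ?thesis using assms(2) by (auto intro: differentiableI_vector)
qed

lemma Ck_SucD: "Ck (Suc n) S f \<Longrightarrow> x \<in> S \<Longrightarrow> (f has_vector_derivative vector_derivative f (at x)) (at x)"
  by (simp add: vector_derivative_works[symmetric])

lemma Ck_mono: "Ck (Suc n) S f \<Longrightarrow> Ck n S f"
  by (induction n arbitrary: f) auto

lemma Ck_const: "open S \<Longrightarrow> Ck n S (\<lambda>_. c)"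
proof (induction n arbitrary: c)
  case (Suc n)
  show ?case by (rule Ck_SucI[where f'="\<lambda>_. 0"]) (use Suc in auto)
qed simp

lemma Ck_id: "open S \<Longrightarrow> Ck n S (\<lambda>x. x)"
proof (cases n)
  case (Suc m)
  assume "open S"
  then show ?thesis unfolding Suc by (intro Ck_SucI[where f'="\<lambda>_. 1"]) (auto intro: Ck_const)
qed simp

lemma Ck_add: "open S \<Longrightarrow> Ck n S f \<Longrightarrow> Ck n S g \<Longrightarrow> Ck n S (\<lambda>x. f x + g x)"
proof (induction n arbitrary: f g)
  case (Suc n)
  show ?case
    by (rule Ck_SucI[OF Suc.prems(1) has_vector_derivative_add[OF Ck_SucD[OF Suc.prems(2)] Ck_SucD[OF Suc.prems(3)]]])
      (use Suc in auto)
qed simp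

lemma Ck_linear:
  assumes L: "bounded_linear L" shows "open S \<Longrightarrow> Ck n S f \<Longrightarrow> Ck n S (\<lambda>x. L (f x))"
proof (induction n arbitrary: f)
  case (Suc n)
  show ?case
    by (rule Ck_SucI[OF Suc.prems(1) bounded_linear.has_vector_derivative[OF L Ck_SucD[OF Suc.prems(2)]]])
      (use Suc in auto)
qed simp

lemma Ck_bilinear:
  assumes B: "bounded_bilinear B"
  shows "open S \<Longrightarrow> Ck n S f \<Longrightarrow> Ck n S g \<Longrightarrow> Ck n S (\<lambda>x. B (f x) (g x))"
proof (induction n arbitrary: f g)
  case (Suc n)
  have m: "Ck n S f" "Ck n S g" using Suc.prems(2,3) by (auto dest: Ck_mono simp del: Ck.simps)
  have d: "Ck n S (\<lambda>x. vector_derivative f (at x))" "Ck n S (\<lambda>x. vector_derivative g (at x))" using Suc.prems by auto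
  show ?case
    by (rule Ck_SucI[OF Suc.prems(1) bounded_bilinear.has_vector_derivative[OF B Ck_SucD[OF Suc.prems(2)] Ck_SucD[OF Suc.prems(3)]]])
      (auto intro!: Ck_add Suc.IH m d Suc.prems(1))
qed simp

lemma Ck_compose:
  fixes g :: "real \<Rightarrow> real"
  assumes S: "open S" and T: "open T" "g ` S \<subseteq> T"
  shows "Ck n S g \<Longrightarrow> Ck n T f \<Longrightarrow> Ck n S (\<lambda>x. f (g x))"
proof (induction n arbitrary: f)
  case (Suc n)
  show ?case
  proof (rule Ck_SucI[OF S])
    fix x assume x: "x \<in> S"
    then have gx: "g x \<in> T" using T by auto
    show "((\<lambda>x. f (g x)) has_vector_derivative vector_derivative g (at x) *\<^sub>R vector_derivative f (at (g x))) (at x)"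
      using vector_diff_chain_at[OF Ck_SucD[OF Suc.prems(1) x] Ck_SucD[OF Suc.prems(2) gx]] by (simp add: o_def)
  next
    have "Ck n S (\<lambda>x. vector_derivative f (at (g x)))"
      using Suc.prems by (intro Suc.IH Ck_mono[of n S g]) auto
    moreover have "Ck n S (\<lambda>x. vector_derivative g (at x))" using Suc.prems by simp
    ultimately show "Ck n S (\<lambda>x. vector_derivative g (at x) *\<^sub>R vector_derivative f (at (g x)))"
      by (intro Ck_bilinear[OF bounded_bilinear_scaleR] S)
  qed
qed simp

lemma Ck_Un: "Ck n S f \<Longrightarrow> Ck n T f \<Longrightarrow> Ck n (S \<union> T) f"
  by (induction n arbitrary: f) auto

lemma Ck_subset: "Ck n S f \<Longrightarrow> T \<subseteq> S \<Longrightarrow> Ck n T f"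
  by (induction n arbitrary: f) auto

lemma Cinf_cong: "open S \<Longrightarrow> (\<And>x. x \<in> S \<Longrightarrow> f x = g x) \<Longrightarrow> Cinf S f \<Longrightarrow> Cinf S g"
  unfolding Cinf_def by (blast intro: Ck_cong)

lemma Cinf_Un: "Cinf S f \<Longrightarrow> Cinf T f \<Longrightarrow> Cinf (S \<union> T) f"
  unfolding Cinf_def by (blast intro: Ck_Un)

lemma Cinf_subset: "Cinf S f \<Longrightarrow> T \<subseteq> S \<Longrightarrow> Cinf T f"
  unfolding Cinf_def by (blast intro: Ck_subset)

lemma Cinf_const: "open S \<Longrightarrow> Cinf S (\<lambda>_. c)"
  by (simp add: Cinf_def Ck_const)

lemma Cinf_id: "open S \<Longrightarrow> Cinf S (\<lambda>x. x)"
  by (simp add: Cinf_def Ck_id)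

lemma Cinf_add: "open S \<Longrightarrow> Cinf S f \<Longrightarrow> Cinf S g \<Longrightarrow> Cinf S (\<lambda>x. f x + g x)"
  by (simp add: Cinf_def Ck_add)

lemma Cinf_linear: "bounded_linear L \<Longrightarrow> open S \<Longrightarrow> Cinf S f \<Longrightarrow> Cinf S (\<lambda>x. L (f x))"
  by (simp add: Cinf_def Ck_linear)

lemma Cinf_minus: "open S \<Longrightarrow> Cinf S f \<Longrightarrow> Cinf S (\<lambda>x. - f x)"
  using Cinf_linear[OF bounded_linear_minus[OF bounded_linear_ident]] .

lemma Cinf_diff: "open S \<Longrightarrow> Cinf S f \<Longrightarrow> Cinf S g \<Longrightarrow> Cinf S (\<lambda>x. f x - g x)"
  using Cinf_add[OF _ _ Cinf_minus[of S g]] by simp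

lemma Cinf_mult:
  fixes f g :: "real \<Rightarrow> 'b::real_normed_algebra"
  shows "open S \<Longrightarrow> Cinf S f \<Longrightarrow> Cinf S g \<Longrightarrow> Cinf S (\<lambda>x. f x * g x)"
  by (simp add: Cinf_def Ck_bilinear[OF bounded_bilinear_mult])

lemma Cinf_power:
  fixes f :: "real \<Rightarrow> 'b::real_normed_algebra_1"
  shows "open S \<Longrightarrow> Cinf S f \<Longrightarrow> Cinf S (\<lambda>x. f x ^ n)"
  by (induction n) (auto intro: Cinf_const Cinf_mult)

lemma Cinf_sum: "open S \<Longrightarrow> (\<And>i. i \<in> A \<Longrightarrow> Cinf S (f i)) \<Longrightarrow> Cinf S (\<lambda>x. \<Sum>i\<in>A. f i x)"
  by (induction A rule: infinite_finite_induct) (auto intro: Cinf_const Cinf_add)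

lemma Cinf_of_real:
  "open S \<Longrightarrow> Cinf S f \<Longrightarrow> Cinf S (\<lambda>x. of_real (f x) :: 'b::real_normed_algebra_1)"
  by (rule Cinf_linear[OF bounded_linear_of_real])

lemma Cinf_compose:
  fixes g :: "real \<Rightarrow> real"
  assumes "open S" "open T" "g ` S \<subseteq> T" "Cinf S g" "Cinf T f"
  shows "Cinf S (\<lambda>x. f (g x))"
  using assms by (simp add: Cinf_def Ck_compose)

lemma Cinf_derivative: "Cinf S f \<Longrightarrow> Cinf S (\<lambda>x. vector_derivative f (at x))"
  unfolding Cinf_def by (metis Ck.simps(2))

lemma Cinf_D: "Cinf S f \<Longrightarrow> x \<in> S \<Longrightarrow> (f has_vector_derivative vector_derivative f (at x)) (at x)"
  unfolding Cinf_def using Ck_SucD by blast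

lemma Cinf_continuous_on: "Cinf S f \<Longrightarrow> continuous_on S f"
  by (intro continuous_at_imp_continuous_on ballI) (auto dest!: Cinf_D intro: has_vector_derivative_continuous)

text \<open>Bootstrap: if the derivative is built from \<open>f\<close> itself and smooth functions,
  then \<open>n\<close>-fold differentiability of \<open>f\<close> passes to \<open>f'\<close> and
  yields one more order. It covers \<open>exp\<close>, reciprocals and
  \<open>1 / varpi\<close>.\<close>

lemma Cinf_I:
  assumes "open S" "\<And>x. x \<in> S \<Longrightarrow> (f has_vector_derivative f' x) (at x)" "\<And>n. Ck n S f \<Longrightarrow> Ck n S f'"
  shows "Cinf S f"
  unfolding Cinf_def
proof
  show "Ck n S f" for n
    by (induction n) (auto intro: Ck_SucI assms simp del: Ck.simps(2))
qed

lemma Cinf_I':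
  assumes "open S" "\<And>x. x \<in> S \<Longrightarrow> (f has_vector_derivative f' x) (at x)" "Cinf S f'"
  shows "Cinf S f"
  by (rule Cinf_I[OF assms(1,2)]) (use assms in \<open>auto simp: Cinf_def\<close>)

lemma Ck_mult:
  fixes f g :: "real \<Rightarrow> 'b::real_normed_algebra"
  shows "open S \<Longrightarrow> Ck n S f \<Longrightarrow> Ck n S g \<Longrightarrow> Ck n S (\<lambda>x. f x * g x)"
  by (rule Ck_bilinear[OF bounded_bilinear_mult])

lemma Cinf_inverse:
  fixes f :: "real \<Rightarrow> real"
  assumes S: "open S" and f: "Cinf S f" and nz: "\<And>x. x \<in> S \<Longrightarrow> f x \<noteq> 0"
  shows "Cinf S (\<lambda>x. inverse (f x))"
proof (rule Cinf_I[OF S])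
  fix x assume x: "x \<in> S"
  have "(f has_field_derivative vector_derivative f (at x)) (at x)"
    using Cinf_D[OF f x] by (simp add: has_real_derivative_iff_has_vector_derivative)
  then show "((\<lambda>x. inverse (f x)) has_vector_derivative
      - 1 * (vector_derivative f (at x) * (inverse (f x) * inverse (f x)))) (at x)"
    unfolding has_real_derivative_iff_has_vector_derivative[symmetric]
    by (auto intro!: derivative_eq_intros simp: nz[OF x] field_simps)
next
  fix n assume "Ck n S (\<lambda>x. inverse (f x))"
  then show "Ck n S (\<lambda>x. - 1 * (vector_derivative f (at x) * (inverse (f x) * inverse (f x))))"
    using Cinf_derivative[OF f] S by (intro Ck_mult Ck_const) (auto simp: Cinf_def)
qed

lemma Cinf_sin_cos: "open S \<Longrightarrow> Cinf S (sin :: real \<Rightarrow> real)" "open S \<Longrightarrow> Cinf S (cos :: real \<Rightarrow> real)"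
proof -
  assume S: "open S"
  have "Ck n S (sin :: real \<Rightarrow> real) \<and> Ck n S (cos :: real \<Rightarrow> real)" for n
  proof (induction n)
    case (Suc n)
    have m: "Ck n S (\<lambda>x::real. (-1) * sin x)" using Suc S by (intro Ck_mult Ck_const) auto
    have "((sin :: real \<Rightarrow> real) has_vector_derivative cos x) (at x)"
      "((cos :: real \<Rightarrow> real) has_vector_derivative ((-1) * sin x)) (at x)" for x :: real
      unfolding has_real_derivative_iff_has_vector_derivative[symmetric]
      by (auto intro!: derivative_eq_intros)
    note d = this
    show ?case using Suc m S Ck_SucI[OF S d(1)] Ck_SucI[OF S d(2)] by auto
  qed simp
  then show "Cinf S (sin :: real \<Rightarrow> real)" "Cinf S (cos :: real \<Rightarrow> real)" by (auto simp: Cinf_def)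
qed

lemma Cinf_exp: "open S \<Longrightarrow> Cinf S (exp :: real \<Rightarrow> real)"
proof (rule Cinf_I)
  show "((exp :: real \<Rightarrow> real) has_vector_derivative exp x) (at x)" for x
    unfolding has_real_derivative_iff_has_vector_derivative[symmetric] by (auto intro!: derivative_eq_intros)
qed

subsection \<open>Bump functions\<close>

text \<open>The classical flat function divided by powers of \<open>x\<close>. The family is closed
  under differentiation: the derivative of \<open>flat k\<close> is
  \<open>flat (k + 2) - k * flat (k + 1)\<close>, so all members are smooth by a single
  induction.\<close>

definition flat :: "nat \<Rightarrow> real \<Rightarrow> real" where
  "flat k x = (if x \<le> 0 then 0 else exp (- (1 / x)) / x ^ k)"

lemma flat_nonneg: "flat k x \<ge> 0"
  by (simp add: flat_def)

text \<open>The inequality \<open>y \<le> exp y\<close> at \<open>y = 1 / ((k + 1) * x)\<close>,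
  raised to the power \<open>k + 1\<close>, beats the denominator \<open>x ^ k\<close> with one
  factor \<open>x\<close> to spare.\<close>

lemma flat_le: "flat k x \<le> real (Suc k) ^ Suc k * \<bar>x\<bar>"
proof (cases "x \<le> 0")
  case False
  then have x: "x > 0" by simp
  let ?n = "Suc k"
  have "(1 / (real ?n * x)) ^ ?n \<le> exp (1 / (real ?n * x)) ^ ?n"
    using x by (intro power_mono order.trans[OF _ exp_ge_add_one_self]) auto
  also have "\<dots> = exp (1 / x)" by (subst exp_of_nat_mult[symmetric]) (use x in simp)
  finally have "1 / (real ?n ^ ?n * x ^ ?n) \<le> exp (1 / x)" by (simp only: power_mult_distrib power_one_over power_divide power_one)
  then have "exp (- (1 / x)) \<le> real ?n ^ ?n * x ^ ?n"
    using x by (simp add: exp_minus field_simps del: power_Suc)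
  then have "exp (- (1 / x)) / x ^ k \<le> real ?n ^ ?n * x ^ ?n / x ^ k"
    using x by (intro divide_right_mono) auto
  also have "\<dots> = real ?n ^ ?n * x" using x by simp
  finally show ?thesis using x by (simp add: flat_def)
next
  case True
  have "0 \<le> real (Suc k) ^ Suc k * \<bar>x\<bar>" by (intro mult_nonneg_nonneg) auto
  then show ?thesis using True by (simp only: flat_def if_True)
qed

lemma flat_tendsto_0: "flat k \<midarrow>0\<rightarrow> 0"
proof (rule Lim_null_comparison)
  show "\<forall>\<^sub>F x in at 0. norm (flat k x) \<le> real (Suc k) ^ Suc k * \<bar>x\<bar>"
    using flat_le[of k] flat_nonneg[of k] by (intro always_eventually) auto
  show "(\<lambda>x. real (Suc k) ^ Suc k * \<bar>x\<bar>) \<midarrow>0\<rightarrow> 0"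
    by (auto intro!: tendsto_eq_intros)
qed

lemma flat_derivative:
  "(flat k has_vector_derivative (flat (Suc (Suc k)) x + (- real k) * flat (Suc k) x)) (at x)"
proof -
  consider "x < 0" | "x > 0" | "x = 0" by linarith
  then show ?thesis
  proof cases
    case 1
    have "((\<lambda>_. 0) has_vector_derivative 0) (at x)" by simp
    then have "(flat k has_vector_derivative 0) (at x)"
      by (rule has_vector_derivative_transform_within_open[where S="{..<0}"]) (use 1 in \<open>auto simp: flat_def\<close>)
    then show ?thesis using 1 by (simp add: flat_def)
  next
    case 2
    have "((\<lambda>x. exp (- inverse x) * inverse x ^ k) has_field_derivative
        exp (- inverse x) * (inverse x)\<^sup>2 * inverse x ^ k
        + exp (- inverse x) * (real k * inverse x ^ (k - 1) * (- (inverse x)\<^sup>2))) (at x)"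
      using 2 by (auto intro!: derivative_eq_intros simp: power2_eq_square)
    also have "exp (- inverse x) * (inverse x)\<^sup>2 * inverse x ^ k
        + exp (- inverse x) * (real k * inverse x ^ (k - 1) * (- (inverse x)\<^sup>2))
        = flat (Suc (Suc k)) x + (- real k) * flat (Suc k) x"
      using 2 by (cases k) (auto simp: flat_def divide_inverse power_inverse[symmetric] power2_eq_square algebra_simps)
    finally have "((\<lambda>x. exp (- (1 / x)) / x ^ k) has_vector_derivative
        (flat (Suc (Suc k)) x + (- real k) * flat (Suc k) x)) (at x)"
      unfolding has_real_derivative_iff_has_vector_derivative by (simp add: divide_inverse power_inverse)
    then show ?thesis
      by (rule has_vector_derivative_transform_within_open[where S="{0<..}"]) (use 2 in \<open>auto simp: flat_def\<close>)
  next
    case 3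
    \<comment> \<open>The difference quotient of \<open>flat k\<close> at 0 is
      \<open>flat (k + 1)\<close>, again a member of the family, and tends to 0.\<close>
    have "(flat k has_field_derivative 0) (at 0)"
      unfolding has_field_derivative_iff
    proof (rule Lim_transform_eventually[OF flat_tendsto_0[of "Suc k"]])
      show "\<forall>\<^sub>F h in at 0. flat (Suc k) h = (flat k h - flat k 0) / (h - 0)"
        by (intro always_eventually) (auto simp: flat_def)
    qed
    then show ?thesis using 3 by (simp add: flat_def has_real_derivative_iff_has_vector_derivative)
  qed
qed

lemma Cinf_flat: "Cinf UNIV (flat k)"
  unfolding Cinf_def
proof
  show "Ck n UNIV (flat k)" for n
  proof (induction n arbitrary: k)
    case (Suc n)
    show ?case
      by (rule Ck_SucI[OF _ flat_derivative]) (intro Ck_add Ck_mult Ck_const Suc.IH open_UNIV)+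
  qed simp
qed

definition smooth_step :: "real \<Rightarrow> real" where
  "smooth_step t = flat 0 t * inverse (flat 0 t + flat 0 (1 - t))"

text \<open>Equal to 1 for \<open>\<bar>t\<bar> \<le> 1/2\<close> and to 0 for
  \<open>\<bar>t\<bar> \<ge> 1\<close>. The derivative lives on the shell in between, and the ratio
  2 of its radii decides which cutoff scales have disjoint shells.\<close>

definition bump :: "real \<Rightarrow> real" where
  "bump t = smooth_step (2 - 2 * t) * smooth_step (2 + 2 * t)"

lemma flat0_pos: "flat 0 t + flat 0 (1 - t) > 0"
  using flat_nonneg[of 0 t] flat_nonneg[of 0 "1-t"] by (auto simp: flat_def add_pos_nonneg)

lemma smooth_step_0: "t \<le> 0 \<Longrightarrow> smooth_step t = 0"
  and smooth_step_1: "t \<ge> 1 \<Longrightarrow> smooth_step t = 1"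
  by (auto simp: smooth_step_def flat_def)

lemma smooth_step_bounds: "0 \<le> smooth_step t" "smooth_step t \<le> 1"
  using flat_nonneg[of 0 t] flat_nonneg[of 0 "1-t"] flat0_pos[of t]
  by (auto simp: smooth_step_def field_simps)

lemma Cinf_affine: "Cinf UNIV (\<lambda>x::real. c * x + d)"
  by (intro Cinf_add Cinf_mult Cinf_const Cinf_id) auto

lemma Cinf_smooth_step: "Cinf UNIV smooth_step"
  unfolding smooth_step_def[abs_def]
proof (intro Cinf_mult Cinf_inverse Cinf_add Cinf_flat)
  show "Cinf UNIV (\<lambda>x. flat 0 (1 - x))"
    using Cinf_compose[OF _ _ _ Cinf_affine[of "-1" 1] Cinf_flat[of 0]] by simp
  show "flat 0 x + flat 0 (1 - x) \<noteq> 0" for x using flat0_pos[of x] by simp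
qed auto

lemma Cinf_bump: "Cinf UNIV bump"
  unfolding bump_def[abs_def]
proof (intro Cinf_mult)
  show "Cinf UNIV (\<lambda>x. smooth_step (2 - 2 * x))" "Cinf UNIV (\<lambda>x. smooth_step (2 + 2 * x))"
    using Cinf_compose[OF _ _ _ Cinf_affine[of "-2" 2] Cinf_smooth_step]
      Cinf_compose[OF _ _ _ Cinf_affine[of "2" 2] Cinf_smooth_step] by (simp_all add: add.commute)
qed auto

lemma bump_1: "\<bar>t\<bar> \<le> 1/2 \<Longrightarrow> bump t = 1"
  and bump_0: "\<bar>t\<bar> \<ge> 1 \<Longrightarrow> bump t = 0"
  by (auto simp: bump_def smooth_step_1 smooth_step_0 abs_if split: if_splits)

lemma bump_bounds: "0 \<le> bump t" "bump t \<le> 1"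
  using smooth_step_bounds by (auto simp: bump_def intro: mult_le_one)

definition dbump :: "real \<Rightarrow> real" where
  "dbump t = vector_derivative bump (at t)"

lemma bump_derivative: "(bump has_vector_derivative dbump t) (at t)"
  unfolding dbump_def by (rule Cinf_D[OF Cinf_bump]) simp

lemma dbump_0: "\<bar>t\<bar> < 1/2 \<or> \<bar>t\<bar> > 1 \<Longrightarrow> dbump t = 0"
proof -
  assume "\<bar>t\<bar> < 1/2 \<or> \<bar>t\<bar> > 1"
  then show ?thesis
  proof
    assume t: "\<bar>t\<bar> < 1/2"
    have "((\<lambda>_. 1) has_vector_derivative 0) (at t)" by simp
    then have "(bump has_vector_derivative 0) (at t)"
      by (rule has_vector_derivative_transform_within_open[where S="{-1/2<..<1/2}"])
        (use t in \<open>auto intro!: bump_1\<close>)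
    then show ?thesis by (simp add: dbump_def vector_derivative_at)
  next
    assume t: "\<bar>t\<bar> > 1"
    have "((\<lambda>_. 0) has_vector_derivative 0) (at t)" by simp
    then have "(bump has_vector_derivative 0) (at t)"
      by (rule has_vector_derivative_transform_within_open[where S="{..<-1} \<union> {1<..}"])
        (use t in \<open>auto intro!: bump_0\<close>)
    then show ?thesis by (simp add: dbump_def vector_derivative_at)
  qed
qed

lemma dbump_bounded: "\<exists>B\<ge>0. \<forall>t. \<bar>dbump t\<bar> \<le> B"
proof -
  have "continuous_on {-1..1} dbump" unfolding dbump_def[abs_def]
    by (rule continuous_on_subset[OF Cinf_continuous_on[OF Cinf_derivative[OF Cinf_bump]]]) auto
  then have "bounded (dbump ` {-1..1})" by (intro compact_imp_bounded compact_continuous_image) auto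
  then obtain B where B: "\<And>t. t \<in> {-1..1} \<Longrightarrow> \<bar>dbump t\<bar> \<le> B" by (auto simp: bounded_iff simp del: atLeastAtMost_iff)
  have "\<bar>dbump t\<bar> \<le> max B 0" for t
  proof (cases "\<bar>t\<bar> > 1")
    case False
    then have "t \<in> {-1..1}" by auto
    from B[OF this] show ?thesis by simp
  qed (simp add: dbump_0)
  then show ?thesis by (intro exI[of _ "max B 0"]) auto
qed

section \<open>The radial operator\<close>

definition Cc :: "(real \<Rightarrow> complex) set" where
  "Cc = {f. Cinf UNIV f \<and> (\<exists>R. \<forall>x. \<bar>x\<bar> > R \<longrightarrow> f x = 0)}"

abbreviation vd :: "(real \<Rightarrow> 'b::real_normed_vector) \<Rightarrow> real \<Rightarrow> 'b" where
  "vd f x \<equiv> vector_derivative f (at x)"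

lemma CcI: "Cinf UNIV f \<Longrightarrow> (\<And>x. \<bar>x\<bar> > R \<Longrightarrow> f x = 0) \<Longrightarrow> f \<in> Cc"
  by (auto simp: Cc_def)

lemma Cc_Cinf: "f \<in> Cc \<Longrightarrow> Cinf UNIV f"
  by (simp add: Cc_def)

lemma Cc_supp:
  assumes "f \<in> Cc"
  shows "\<exists>R>0. \<forall>x. \<bar>x\<bar> > R \<longrightarrow> f x = 0"
proof -
  obtain R where R: "\<forall>x. \<bar>x\<bar> > R \<longrightarrow> f x = 0" using assms by (auto simp: Cc_def)
  show ?thesis by (rule exI[of _ "max R 1"]) (use R in auto)
qed

lemma Cc_D: "f \<in> Cc \<Longrightarrow> (f has_vector_derivative vd f x) (at x)"
  by (rule Cinf_D[OF Cc_Cinf]) auto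

lemma Cc_continuous: "f \<in> Cc \<Longrightarrow> continuous_on S f"
  using Cinf_continuous_on[OF Cc_Cinf] continuous_on_subset by blast

lemma Cc_zero: "(\<lambda>_. 0) \<in> Cc"
  by (rule CcI[where R=0]) (auto intro: Cinf_const)

lemma Cc_add: "f \<in> Cc \<Longrightarrow> g \<in> Cc \<Longrightarrow> (\<lambda>x. f x + g x) \<in> Cc"
proof -
  assume f: "f \<in> Cc" and g: "g \<in> Cc"
  obtain R where "\<And>x. \<bar>x\<bar> > R \<Longrightarrow> f x = 0" using Cc_supp[OF f] by auto
  moreover obtain S where "\<And>x. \<bar>x\<bar> > S \<Longrightarrow> g x = 0" using Cc_supp[OF g] by auto
  ultimately show ?thesis using f g by (intro CcI[where R="max R S"] Cinf_add) (auto dest: Cc_Cinf)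
qed

lemma Cc_mult_left: "Cinf UNIV f \<Longrightarrow> g \<in> Cc \<Longrightarrow> (\<lambda>x. f x * g x) \<in> Cc"
proof -
  assume f: "Cinf UNIV f" and g: "g \<in> Cc"
  obtain R where "\<And>x. \<bar>x\<bar> > R \<Longrightarrow> g x = 0" using Cc_supp[OF g] by auto
  then show ?thesis using f g by (intro CcI[where R=R] Cinf_mult) (auto dest: Cc_Cinf)
qed

lemma Cc_cmult: "g \<in> Cc \<Longrightarrow> (\<lambda>x. c * g x) \<in> Cc"
  by (intro Cc_mult_left Cinf_const) auto

lemma Cc_derivative: "f \<in> Cc \<Longrightarrow> vd f \<in> Cc"
proof -
  assume f: "f \<in> Cc"
  obtain R where R: "R > 0" "\<And>x. \<bar>x\<bar> > R \<Longrightarrow> f x = 0" using Cc_supp[OF f] by auto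
  show ?thesis
  proof (rule CcI)
    show "Cinf UNIV (vd f)" by (rule Cinf_derivative[OF Cc_Cinf[OF f]])
    fix x assume x: "\<bar>x\<bar> > R"
    have "((\<lambda>_. 0) has_vector_derivative 0) (at x)" by simp
    then have "(f has_vector_derivative 0) (at x)"
      by (rule has_vector_derivative_transform_within_open[where S="{..<-R} \<union> {R<..}"])
        (use x R in \<open>auto intro!: R(2)[symmetric]\<close>)
    then show "vd f x = 0" by (simp add: vector_derivative_at)
  qed
qed

lemma Cc_bounded: "f \<in> Cc \<Longrightarrow> \<exists>B>0. \<forall>x. norm (f x) \<le> B"
proof -
  assume f: "f \<in> Cc"
  obtain R where R: "R > 0" "\<And>x. \<bar>x\<bar> > R \<Longrightarrow> f x = 0" using Cc_supp[OF f] by auto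
  have "bounded (f ` {-R..R})"
    by (intro compact_imp_bounded compact_continuous_image Cc_continuous f) auto
  then obtain B where B: "B > 0" "\<And>x. x \<in> {-R..R} \<Longrightarrow> norm (f x) \<le> B" by (auto simp: bounded_pos simp del: atLeastAtMost_iff)
  have "norm (f x) \<le> B" for x
  proof (cases "\<bar>x\<bar> > R")
    case False
    then have "x \<in> {-R..R}" by auto
    from B(2)[OF this] show ?thesis .
  qed (use R B in auto)
  then show ?thesis using B by blast
qed

lemma integrable_compact_support:
  fixes f :: "real \<Rightarrow> 'b::{banach, second_countable_topology}"
  assumes "continuous_on UNIV f" "\<And>x. \<bar>x\<bar> > R \<Longrightarrow> f x = 0"
  shows "integrable lborel f"
proof -
  have "integrable lborel (\<lambda>x. indicator {-R..R} x *\<^sub>R f x)"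
    by (intro borel_integrable_compact) (use assms in \<open>auto intro: continuous_on_subset\<close>)
  also have "(\<lambda>x. indicator {-R..R} x *\<^sub>R f x) = f"
    using assms(2) by (auto simp: indicator_def fun_eq_iff not_le[symmetric] abs_le_iff)
  finally show ?thesis .
qed

lemma l2_compact_support:
  fixes f :: "real \<Rightarrow> 'b::{banach, second_countable_topology}"
  assumes "continuous_on UNIV f" "\<And>x. \<bar>x\<bar> > R \<Longrightarrow> f x = 0"
  shows "l2 lborel f"
  unfolding l2_def using assms
  by (auto intro!: borel_measurable_continuous_onI integrable_compact_support[where R=R] continuous_intros)

lemma l2_Cc: "f \<in> Cc \<Longrightarrow> l2 lborel f"
  using Cc_supp[of f] by (auto intro: l2_compact_support Cc_continuous)

lemma integral_derivative_compact_support: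
  fixes F :: "real \<Rightarrow> real"
  assumes d: "\<And>x. (F has_vector_derivative f x) (at x)" and c: "continuous_on UNIV f"
    and s: "\<And>x. \<bar>x\<bar> \<ge> R \<Longrightarrow> F x = 0" "\<And>x. \<bar>x\<bar> > R \<Longrightarrow> f x = 0" and R: "R \<ge> 0"
  shows "(LINT x|lborel. f x) = 0"
proof -
  have "(LINT x|lborel. indicator {-R..R} x *\<^sub>R f x) = F R - F (-R)"
    by (rule integral_FTC_atLeastAtMost)
      (use d c R in \<open>auto intro: has_vector_derivative_at_within continuous_on_subset\<close>)
  also have "(\<lambda>x. indicator {-R..R} x *\<^sub>R f x) = f"
    using s(2) by (auto simp: indicator_def fun_eq_iff not_le[symmetric] abs_le_iff) (smt (verit))+
  finally show ?thesis using s(1)[of R] s(1)[of "-R"] R by simp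
qed

lemma nrm_le_interval:
  fixes f :: "real \<Rightarrow> complex"
  assumes B: "\<And>x. norm (f x) \<le> B" and s: "\<And>x. \<bar>x\<bar> > R \<Longrightarrow> f x = 0" and R: "R \<ge> 0"
  shows "nrm lborel f \<le> sqrt (2 * R) * B"
proof -
  have B0: "B \<ge> 0" using B[of 0] norm_ge_zero order.trans by blast
  have l: "l2 lborel (\<lambda>x. indicator {-R..R} x * B :: real)"
  proof -
    have "(\<lambda>x. (norm (indicator {-R..R} x * B :: real))\<^sup>2) = (\<lambda>x. indicator {-R..R} x *\<^sub>R B\<^sup>2)"
      by (auto simp: indicator_def fun_eq_iff)
    moreover have "integrable lborel (\<lambda>x. indicator {-R..R} x *\<^sub>R B\<^sup>2)"
      by (intro borel_integrable_compact) auto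
    ultimately show ?thesis unfolding l2_def by simp
  qed
  have "nrm lborel f \<le> nrm lborel (\<lambda>x. indicator {-R..R} x * B :: real)"
  proof (rule nrm_mono[OF l])
    show "norm (f x) \<le> norm (indicator {-R..R} x * B :: real)" for x
      using B[of x] s[of x] by (auto simp: indicator_def)
  qed
  also have "\<dots> = sqrt (LINT x|lborel. indicator {-R..R} x *\<^sub>R B\<^sup>2)"
    unfolding nrm_def by (intro arg_cong[where f=sqrt] Bochner_Integration.integral_cong) (auto simp: indicator_def)
  also have "\<dots> = sqrt (2 * R * B\<^sup>2)" using R by simp
  also have "\<dots> = sqrt (2 * R) * B" using B0 by (simp add: real_sqrt_mult)
  finally show ?thesis .
qed

lemma has_primitive_compact_support:
  fixes g :: "real \<Rightarrow> complex"
  assumes c: "continuous_on UNIV g" and s: "\<And>x. \<bar>x\<bar> > R \<Longrightarrow> g x = 0" and R: "R > 0"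
  obtains G where "\<And>x. (G has_vector_derivative g x) (at x)" "\<And>x. x \<le> - R \<Longrightarrow> G x = 0" "\<And>x. x \<ge> R \<Longrightarrow> G x = G R"
proof -
  \<comment> \<open>The base point lies one unit to the left of the support, so that every point
    from \<open>- R\<close> onwards is interior to an interval of integration.\<close>
  define G where "G x = integral {- R - 1..x} g" for x
  have int: "g integrable_on {u..v}" for u v
    by (intro integrable_continuous_real continuous_on_subset[OF c]) auto
  have neg: "G x = 0" if "x \<le> - R" for x
  proof -
    have "(g has_integral 0) {-R-1..x}"
    proof (rule has_integral_spike_finite[where S="{-R}" and f="\<lambda>_. 0"])
      show "\<And>y. y \<in> {- R - 1..x} - {- R} \<Longrightarrow> g y = 0" using that R by (intro s) auto
    qed auto
    then show ?thesis unfolding G_def by (rule integral_unique)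
  qed
  have d: "(G has_vector_derivative g x) (at x)" for x
  proof (cases "x < - R")
    case True
    have "((\<lambda>_. 0) has_vector_derivative 0) (at x)" by simp
    then have "(G has_vector_derivative 0) (at x)"
      by (rule has_vector_derivative_transform_within_open[where S="{..<-R}"])
        (use True in \<open>auto simp: neg\<close>)
    then show ?thesis using s[of x] True R by simp
  next
    case False
    have "(G has_vector_derivative g x) (at x within {-R-1..x+1})"
      unfolding G_def by (rule integral_has_vector_derivative) (use False in \<open>auto intro: continuous_on_subset[OF c]\<close>)
    then show ?thesis using False by (subst (asm) at_within_interior) auto
  qed
  have pos: "G x = G R" if "x \<ge> R" for x
  proof -
    have "G x = integral {-R-1..R} g + integral {R..x} g"
      unfolding G_def by (rule Henstock_Kurzweil_Integration.integral_combine[symmetric]) (use that R int in auto)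
    moreover have "(g has_integral 0) {R..x}"
    proof (rule has_integral_spike_finite[where S="{R}" and f="\<lambda>_. 0"])
      show "\<And>y. y \<in> {R..x} - {R} \<Longrightarrow> g y = 0" using R by (intro s) auto
    qed auto
    ultimately show ?thesis by (simp add: G_def integral_unique)
  qed
  show ?thesis using that d neg pos by blast
qed

lemma Cinf_mult_real_complex: "Cinf UNIV (e :: real \<Rightarrow> real) \<Longrightarrow> Cinf UNIV f \<Longrightarrow> Cinf UNIV (\<lambda>x. complex_of_real (e x) * f x)"
  by (intro Cinf_mult Cinf_of_real) auto

lemma Cinf_exp_minus: "Cinf UNIV (\<lambda>x::real. exp (- x))"
  using Cinf_compose[OF _ _ _ Cinf_affine[of "-1" 0] Cinf_exp[of UNIV]] by simp

lemma Cc_reflect: "f \<in> Cc \<Longrightarrow> (\<lambda>x. f (- x)) \<in> Cc"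
proof -
  assume f: "f \<in> Cc"
  obtain R where R: "R > 0" "\<And>x. \<bar>x\<bar> > R \<Longrightarrow> f x = 0" using Cc_supp[OF f] by auto
  show ?thesis
    using Cinf_compose[OF _ _ _ Cinf_affine[of "-1" 0] Cc_Cinf[OF f]] R by (intro CcI[where R=R]) auto
qed

lemma vd_reflect: "f \<in> Cc \<Longrightarrow> vd (\<lambda>x. f (- x)) x = - vd f (- x)"
proof -
  assume f: "f \<in> Cc"
  have "((\<lambda>x. - x) has_vector_derivative (-1)) (at x)" by (auto intro!: derivative_eq_intros)
  from vector_diff_chain_at[OF this Cc_D[OF f]] show ?thesis by (intro vector_derivative_at) (simp add: o_def)
qed

lemma bump_scaled:
  assumes "r > 0"
  shows "Cinf UNIV (\<lambda>x. bump ((x - c) / r))"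
    and "((\<lambda>x. bump ((x - c) / r)) has_vector_derivative dbump ((x - c) / r) / r) (at x)"
proof -
  show "Cinf UNIV (\<lambda>x. bump ((x - c) / r))"
    using Cinf_compose[OF _ _ _ Cinf_affine[of "1 / r" "- c / r"] Cinf_bump] by (simp add: diff_divide_distrib)
  have "((\<lambda>x. (x - c) / r) has_vector_derivative (1 / r)) (at x)"
    unfolding has_real_derivative_iff_has_vector_derivative[symmetric]
    using assms by (auto intro!: derivative_eq_intros)
  from vector_diff_chain_at[OF this bump_derivative[of "(x - c) / r"]]
  show "((\<lambda>x. bump ((x - c) / r)) has_vector_derivative dbump ((x - c) / r) / r) (at x)" by (simp add: o_def)
qed

text \<open>The exact solution of \<open>f' + f = h\<close> that vanishes near \<open>-\<infinity>\<close> is bounded; cutting it off at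
  radius \<open>N\<close> costs an error of size \<open>1 / N\<close> on an interval of length \<open>2 N\<close>.\<close>

lemma first_order_dense_plus:
  assumes h: "h \<in> Cc" and e: "\<epsilon> > 0"
  shows "\<exists>f\<in>Cc. nrm lborel (\<lambda>x. vd f x + f x - h x) < \<epsilon>"
proof -
  obtain R where R: "R > 0" "\<And>x. \<bar>x\<bar> > R \<Longrightarrow> h x = 0" using Cc_supp[OF h] by auto
  have "Cinf UNIV (\<lambda>x. complex_of_real (exp x) * h x)"
    by (intro Cinf_mult_real_complex Cinf_exp Cc_Cinf h) auto
  then have "continuous_on UNIV (\<lambda>x. complex_of_real (exp x) * h x)" by (rule Cinf_continuous_on)
  then obtain G where G: "\<And>x. (G has_vector_derivative complex_of_real (exp x) * h x) (at x)"
    "\<And>x. x \<le> - R \<Longrightarrow> G x = 0" "\<And>x. x \<ge> R \<Longrightarrow> G x = G R"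
    by (rule has_primitive_compact_support[of _ R]) (use R in auto)
  have CG: "Cinf UNIV G"
    by (rule Cinf_I'[OF _ G(1)]) (auto intro!: Cinf_mult_real_complex Cinf_exp Cc_Cinf[OF h])
  define u where "u x = complex_of_real (exp (- x)) * G x" for x
  have Cu: "Cinf UNIV u" unfolding u_def[abs_def] by (intro Cinf_mult_real_complex Cinf_exp_minus CG)
  have du: "(u has_vector_derivative (h x - u x)) (at x)" for x
  proof -
    have "((\<lambda>x. exp (- x)) has_field_derivative (- exp (- x))) (at x)"
      by (auto intro!: derivative_eq_intros)
    from has_vector_derivative_mult[OF has_vector_derivative_of_real[OF this] G(1)]
    have "(u has_vector_derivative (of_real (exp (- x)) * (of_real (exp x) * h x) + of_real (- exp (- x)) * G x)) (at x)"
      unfolding u_def[abs_def] .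
    also have "of_real (exp (- x)) * (of_real (exp x) * h x) + of_real (- exp (- x)) * G x = h x - u x"
      by (simp add: u_def exp_minus field_simps)
    finally show ?thesis .
  qed
  have "bounded (u ` {-R..R})"
    by (intro compact_imp_bounded compact_continuous_image continuous_on_subset[OF Cinf_continuous_on[OF Cu]]) auto
  then obtain B0 where B0: "\<And>x. x \<in> {-R..R} \<Longrightarrow> norm (u x) \<le> B0" by (auto simp: bounded_iff simp del: atLeastAtMost_iff)
  \<comment> \<open>To the left of the support \<open>u\<close> vanishes; to the right it is
    \<open>exp (- x) * G R\<close>, bounded by \<open>G R\<close> because
    \<open>R > 0\<close>.\<close>
  define B where "B = max B0 (norm (G R))"
  have B: "norm (u x) \<le> B" for x
  proof -
    consider "x < - R" | "x \<in> {-R..R}" | "x > R" by fastforce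
    then show ?thesis
    proof cases
      case 1 then show ?thesis using G(2)[of x] by (simp add: u_def B_def le_max_iff_disj)
    next
      case 2 then show ?thesis using B0[of x] by (simp add: B_def)
    next
      case 3
      then have "norm (u x) \<le> 1 * norm (G R)"
        using G(3)[of x] R(1) unfolding u_def norm_mult by (intro mult_mono) auto
      then show ?thesis by (simp add: B_def)
    qed
  qed
  have Bnn: "B \<ge> 0" by (simp add: B_def le_max_iff_disj)
  obtain C where C: "C \<ge> 0" "\<And>t. \<bar>dbump t\<bar> \<le> C" using dbump_bounded by blast
  \<comment> \<open>For \<open>N \<ge> 2 * R\<close> the cutoff equals 1 on the support of
    \<open>h\<close>, so the derivative of the cutoff times \<open>u\<close> is the whole
    error.\<close>
  have est: "\<exists>f\<in>Cc. nrm lborel (\<lambda>x. vd f x + f x - h x) \<le> sqrt (2 * N) * (C * B / N)" if N: "N \<ge> 2 * R" for N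
  proof
    have N0: "N > 0" using N R by simp
    define f where "f x = complex_of_real (bump ((x - 0) / N)) * u x" for x
    show fC: "f \<in> Cc"
      unfolding f_def[abs_def]
      by (rule CcI[where R=N], intro Cinf_mult_real_complex bump_scaled Cu N0) (use N0 in \<open>auto simp: bump_0\<close>)
    have df: "vd f x = of_real (bump (x / N)) * (h x - u x) + of_real (dbump (x / N) / N) * u x" for x
      unfolding f_def[abs_def]
      using vector_derivative_at[OF has_vector_derivative_mult[OF has_vector_derivative_of_real[OF has_real_derivative_iff_has_vector_derivative[THEN iffD2, OF bump_scaled(2)[OF N0, of 0 x]]] du]]
      by simp
    have bh: "of_real (bump (x / N)) * h x = h x" for x
    proof (cases "\<bar>x\<bar> > R")
      case False
      then have "\<bar>x / N\<bar> \<le> 1 / 2" using N N0 by (simp add: field_simps)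
      then show ?thesis by (simp add: bump_1)
    qed (simp add: R)
    have err: "vd f x + f x - h x = of_real (dbump (x / N) / N) * u x" for x
      using bh[of x] by (simp add: df f_def algebra_simps)
    show "nrm lborel (\<lambda>x. vd f x + f x - h x) \<le> sqrt (2 * N) * (C * B / N)"
      unfolding err
    proof (rule nrm_le_interval)
      fix x
      have "norm (of_real (dbump (x / N) / N) * u x) = \<bar>dbump (x / N)\<bar> * norm (u x) / N"
        using N0 by (simp add: norm_mult norm_divide)
      also have "\<dots> \<le> C * B / N" using C B Bnn N0 by (intro divide_right_mono mult_mono) auto
      finally show "norm (of_real (dbump (x / N) / N) * u x) \<le> C * B / N" .
    qed (use N0 in \<open>auto simp: dbump_0\<close>)
  qed
  have "((\<lambda>N. sqrt (2 * N) * (C * B / N)) \<longlongrightarrow> 0) at_top"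
  proof -
    have "((\<lambda>N. sqrt 2 * C * B * inverse (sqrt N)) \<longlongrightarrow> sqrt 2 * C * B * 0) at_top"
      by (intro tendsto_intros tendsto_inverse_0_at_top sqrt_at_top)
    moreover have "\<forall>\<^sub>F N in at_top. sqrt 2 * C * B * inverse (sqrt N) = sqrt (2 * N) * (C * B / N)"
      using eventually_gt_at_top[of 0]
    proof eventually_elim
      case (elim N)
      have "sqrt N / N = inverse (sqrt N)" using elim
        by (metis real_div_sqrt inverse_divide inverse_inverse_eq less_eq_real_def)
      then have "sqrt 2 * C * B * inverse (sqrt N) = sqrt 2 * C * B * (sqrt N / N)" by simp
      then show ?case by (simp add: real_sqrt_mult)
    qed
    ultimately show ?thesis by (auto intro: Lim_transform_eventually)
  qed
  then have "\<forall>\<^sub>F N in at_top. sqrt (2 * N) * (C * B / N) < \<epsilon> \<and> N \<ge> 2 * R"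
    using e by (intro eventually_conj order_tendstoD(2) eventually_ge_at_top)
  then obtain N where "sqrt (2 * N) * (C * B / N) < \<epsilon> \<and> N \<ge> 2 * R"
    using eventually_happens[of _ "at_top :: real filter"] trivial_limit_at_top_linorder by blast
  then show ?thesis using est[of N] by force
qed

lemma nrm_reflect:
  assumes "f \<in> borel_measurable borel"
  shows "nrm lborel (\<lambda>x::real. f (- x)) = nrm lborel f"
proof -
  have "(LINT x|lborel. (norm (f x))\<^sup>2) = (LINT x|lborel. (norm (f (- x)))\<^sup>2)"
    using lborel_integral_real_affine[of "-1" "\<lambda>x. (norm (f x))\<^sup>2" 0] by simp
  then show ?thesis by (simp add: nrm_def)
qed

text \<open>The reflection \<open>x \<mapsto> - x\<close> exchanges \<open>f' - f\<close> and
  \<open>f' + f\<close> up to sign, so the case with sign \<open>+\<close> covers both.\<close>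

lemma first_order_dense:
  assumes h: "h \<in> Cc" and e: "\<epsilon> > 0" and t: "\<tau> \<in> {1,-1::real}"
  shows "\<exists>f\<in>Cc. nrm lborel (\<lambda>x. vd f x + \<tau> * f x - h x) < \<epsilon>"
proof (cases "\<tau> = 1")
  case True
  then show ?thesis using first_order_dense_plus[OF h e] by simp
next
  case False
  then have t: "\<tau> = -1" using t by simp
  have "(\<lambda>x. (-1) * h (- x)) \<in> Cc" by (intro Cc_cmult Cc_reflect h)
  from first_order_dense_plus[OF this e] obtain f where f: "f \<in> Cc"
    and n: "nrm lborel (\<lambda>x. vd f x + f x + h (- x)) < \<epsilon>" by auto
  let ?g = "\<lambda>x. f (- x)"
  have g: "?g \<in> Cc" by (rule Cc_reflect[OF f])
  have "nrm lborel (\<lambda>x. vd ?g x + \<tau> * ?g x - h x) = nrm lborel (\<lambda>x. - (vd f (- x) + f (- x) + h (- (- x))))"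
    by (intro arg_cong[where f="nrm lborel"] ext) (simp add: vd_reflect[OF f] t)
  also have "\<dots> = nrm lborel (\<lambda>x. vd f x + f x + h (- x))"
    unfolding nrm_uminus
    by (rule nrm_reflect, intro borel_measurable_continuous_onI continuous_intros Cc_continuous f Cc_derivative Cc_reflect h)
  finally show ?thesis using n by (intro bexI[OF _ g]) simp
qed


section \<open>Pointwise estimates for the radial system and its coefficients\<close>

lemma norm_add_i_sq:
  "(norm (u + of_real \<sigma> * \<i> * f))\<^sup>2 = (norm u)\<^sup>2 + \<sigma>\<^sup>2 * (norm f)\<^sup>2 + 2 * \<sigma> * (Im u * Re f - Re u * Im f)"
  unfolding cmod_power2 by (simp add: power2_eq_square algebra_simps)

lemma varpi_pos: "a \<noteq> 0 \<Longrightarrow> varpi a r > 0"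
  by (simp add: varpi_def add_nonneg_pos)

lemma inverse_varpi_le: "a \<noteq> 0 \<Longrightarrow> 1 / varpi a r \<le> 1 / \<bar>a\<bar>"
proof -
  assume a: "a \<noteq> 0"
  have "\<bar>a\<bar> \<le> varpi a r" unfolding varpi_def by (rule real_le_rsqrt) simp
  then show ?thesis using a by (intro divide_left_mono) auto
qed

text \<open>With \<open>w = 1 / varpi\<close> the derivative is \<open>- r * w ^ 3\<close>, a
  polynomial in \<open>r\<close> and \<open>w\<close>, which is the form required by the bootstrap
  rule.\<close>

lemma Cinf_inverse_varpi: "a \<noteq> 0 \<Longrightarrow> Cinf UNIV (\<lambda>r. 1 / varpi a r)"
proof (rule Cinf_I)
  assume a: "a \<noteq> 0"
  fix r
  have p: "r\<^sup>2 + a\<^sup>2 > 0" using a by (simp add: add_nonneg_pos)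
  have v: "varpi a r > 0" by (rule varpi_pos[OF a])
  have "((\<lambda>r. varpi a r) has_field_derivative (r / varpi a r)) (at r)"
    unfolding varpi_def using p by (auto intro!: derivative_eq_intros simp: field_simps)
  from DERIV_inverse_fun[OF this] v
  have "((\<lambda>r. 1 / varpi a r) has_field_derivative (-1) * r * (1 / varpi a r) * (1 / varpi a r) * (1 / varpi a r)) (at r)"
    by (simp add: divide_inverse power2_eq_square mult_ac)
  then show "((\<lambda>r. 1 / varpi a r) has_vector_derivative (-1) * r * (1 / varpi a r) * (1 / varpi a r) * (1 / varpi a r)) (at r)"
    by (simp add: has_real_derivative_iff_has_vector_derivative)
next
  fix n assume "Ck n UNIV (\<lambda>r. 1 / varpi a r)"
  then show "Ck n UNIV (\<lambda>r. (-1) * r * (1 / varpi a r) * (1 / varpi a r) * (1 / varpi a r))"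
    by (intro Ck_mult Ck_const Ck_id) auto
qed auto

text \<open>Two cross terms cancel because the zeroth order part is Hermitian, so only the total
  derivative of \<open>norm g ^ 2 - norm f ^ 2\<close> remains beside the squares.\<close>

lemma radial_pointwise_bound:
  fixes f g f' g' :: complex and s \<sigma> w b :: real
  assumes "s\<^sup>2 = 1" "\<sigma>\<^sup>2 = 1"
  shows "(norm f)\<^sup>2 + (norm g)\<^sup>2 + (\<sigma> * s) * (2 * (g \<bullet> g' - f \<bullet> f')) \<le>
    (norm (s * (- \<i> * (f' + w * g)) + b * f + \<sigma> * \<i> * f))\<^sup>2
    + (norm (s * (\<i> * (g' + w * f)) + b * g + \<sigma> * \<i> * g))\<^sup>2"
proof -
  have "2 * \<sigma> * (Im (s * (- \<i> * (f' + w * g)) + b * f) * Re f - Re (s * (- \<i> * (f' + w * g)) + b * f) * Im f)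
    + 2 * \<sigma> * (Im (s * (\<i> * (g' + w * f)) + b * g) * Re g - Re (s * (\<i> * (g' + w * f)) + b * g) * Im g)
    = (\<sigma> * s) * (2 * (g \<bullet> g' - f \<bullet> f'))"
    by (simp add: inner_complex_def algebra_simps)
  moreover note norm_add_i_sq[of "s * (- \<i> * (f' + w * g)) + b * f" \<sigma> f, unfolded assms(2)]
    norm_add_i_sq[of "s * (\<i> * (g' + w * f)) + b * g" \<sigma> g, unfolded assms(2)]
    zero_le_power2[of "norm (s * (- \<i> * (f' + w * g)) + b * f)"]
    zero_le_power2[of "norm (s * (\<i> * (g' + w * f)) + b * g)"]
  ultimately show ?thesis by linarith
qed

text \<open>Without the terms in \<open>1 / varpi\<close> the system decouples into scalar equations
  \<open>f' \<plusminus> f = h\<close>. Those terms are bounded multiplications, because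
  \<open>varpi\<close> is at least \<open>\<bar>a\<bar>\<close>, and the system is symmetric for
  every strength of them, which supplies the lower bound of the perturbation principle. The
  parameter \<open>\<mu>\<close> stands for an angular eigenvalue;
  \<open>a * \<kappa> / varpi ^ 2\<close> stems from the \<open>gamma0\<close> part of
  \<open>Mphi\<close>.\<close>

lemma radial_operator_dense_range:
  fixes a \<mu> \<kappa> s \<sigma> \<epsilon> :: real
  assumes a: "a \<noteq> 0" and s: "s \<in> {1,-1}" and \<sigma>: "\<sigma> \<in> {1,-1}" and h: "h1 \<in> Cc" "h2 \<in> Cc" and e: "\<epsilon> > 0"
  shows "\<exists>f\<in>Cc. \<exists>g\<in>Cc. nrm lborel (\<lambda>r.
     (of_real s * (- \<i> * (vd f r + of_real (\<mu> / varpi a r) * g r)) + of_real (a * \<kappa> / (varpi a r)\<^sup>2) * f r + of_real \<sigma> * \<i> * f r - h1 r,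
      of_real s * (\<i> * (vd g r + of_real (\<mu> / varpi a r) * f r)) + of_real (a * \<kappa> / (varpi a r)\<^sup>2) * g r + of_real \<sigma> * \<i> * g r - h2 r)) < \<epsilon>"
proof -
  define w where "w r = 1 / varpi a r" for r
  have w: "Cinf UNIV (\<lambda>r. complex_of_real (w r))"
    unfolding w_def by (intro Cinf_of_real Cinf_inverse_varpi a) auto
  have wb: "0 \<le> w r" "w r \<le> 1 / \<bar>a\<bar>" for r
    using inverse_varpi_le[OF a] varpi_pos[OF a, of r] by (auto simp: w_def)
  define D :: "(real \<Rightarrow> complex \<times> complex) set" where
    "D = {x. (\<lambda>r. fst (x r)) \<in> Cc \<and> (\<lambda>r. snd (x r)) \<in> Cc}"
  define A :: "(real \<Rightarrow> complex \<times> complex) \<Rightarrow> real \<Rightarrow> complex \<times> complex" where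
    "A x r = (of_real s * (- \<i>) * vd (\<lambda>r. fst (x r)) r + of_real \<sigma> * \<i> * fst (x r),
       of_real s * \<i> * vd (\<lambda>r. snd (x r)) r + of_real \<sigma> * \<i> * snd (x r))" for x r
  define K :: "(real \<Rightarrow> complex \<times> complex) \<Rightarrow> real \<Rightarrow> complex \<times> complex" where
    "K x r = (of_real s * (- \<i>) * of_real \<mu> * (of_real (w r) * snd (x r)) + of_real (a * \<kappa>) * (of_real (w r) * (of_real (w r) * fst (x r))),
       of_real s * \<i> * of_real \<mu> * (of_real (w r) * fst (x r)) + of_real (a * \<kappa>) * (of_real (w r) * (of_real (w r) * snd (x r))))" for x r
  have vadd: "vd (\<lambda>r. f r + g r) r = vd f r + vd g r" if "f \<in> Cc" "g \<in> Cc" for f g r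
    using that by (intro vector_derivative_at has_vector_derivative_add Cc_D)
  have D_l2: "l2 lborel x" if "x \<in> D" for x
  proof -
    have f: "(\<lambda>r. fst (x r)) \<in> Cc" and g: "(\<lambda>r. snd (x r)) \<in> Cc" using that by (auto simp: D_def)
    obtain R where R: "\<And>r. \<bar>r\<bar> > R \<Longrightarrow> fst (x r) = 0" using Cc_supp[OF f] by auto
    obtain S where S: "\<And>r. \<bar>r\<bar> > S \<Longrightarrow> snd (x r) = 0" using Cc_supp[OF g] by auto
    show ?thesis
    proof (rule l2_compact_support[where R="max R S"])
      have "continuous_on UNIV (\<lambda>r. (fst (x r), snd (x r)))"
        by (intro continuous_on_Pair Cc_continuous f g)
      then show "continuous_on UNIV x" by simp
    qed (auto simp: prod_eq_iff R S)
  qed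
  interpret dense_range_perturbation lborel D D A K
  proof
    show "D \<subseteq> D" by simp
    show "(\<lambda>_. 0) \<in> D" by (simp add: D_def Cc_zero)
    show add: "(\<lambda>p. x p + y p) \<in> D" if "x \<in> D" "y \<in> D" for x y using that by (auto simp: D_def intro: Cc_add)
    show "(\<lambda>p. c *\<^sub>R x p) \<in> D" if "x \<in> D" for x c
      using that Cc_cmult[of _ "of_real c"] by (auto simp: D_def scaleR_conv_of_real)
    show "A x \<in> D" if "x \<in> D" for x
      using that unfolding D_def A_def mem_Collect_eq fst_conv snd_conv
      by (intro conjI Cc_add Cc_cmult Cc_derivative) auto
    show "K x \<in> D" if "x \<in> D" for x
      using that unfolding D_def K_def mem_Collect_eq fst_conv snd_conv
      by (intro conjI Cc_add Cc_cmult Cc_mult_left[OF w]) auto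
    show "A (\<lambda>p. x p + y p) = (\<lambda>p. A x p + A y p)" if "x \<in> D" "y \<in> D" for x y
      using that by (auto simp: A_def D_def vadd fun_eq_iff algebra_simps)
    show "K (\<lambda>p. x p + y p) = (\<lambda>p. K x p + K y p)" for x y
      by (auto simp: K_def fun_eq_iff algebra_simps)
  qed (auto simp: D_l2 A_def K_def zero_prod_def)
  have "dense_range A" unfolding dense_range_def
  proof (intro ballI allI impI)
    fix y and e :: real assume y: "y \<in> D" and e: "e > 0"
    \<comment> \<open>As \<open>s ^ 2 = 1\<close>, the first component of \<open>A\<close> is
      \<open>- s \<i> (f' - s \<sigma> f)\<close> and the second is
      \<open>s \<i> (g' + s \<sigma> g)\<close>; this fixes the factors here and the signs of the
      two scalar equations.\<close>
    have y1: "(\<lambda>r. of_real s * \<i> * fst (y r)) \<in> Cc" and y2: "(\<lambda>r. of_real s * (-\<i>) * snd (y r)) \<in> Cc"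
      using y unfolding D_def mem_Collect_eq by (intro Cc_cmult, blast)+
    have t: "- (s * \<sigma>) \<in> {1,-1}" "s * \<sigma> \<in> {1,-1}" using s \<sigma> by auto
    obtain f where f: "f \<in> Cc" "nrm lborel (\<lambda>x. vd f x + of_real (- (s * \<sigma>)) * f x - of_real s * \<i> * fst (y x)) < e / 2"
      using first_order_dense[OF y1 _ t(1), of "e / 2"] e by auto
    obtain g where g: "g \<in> Cc" "nrm lborel (\<lambda>x. vd g x + of_real (s * \<sigma>) * g x - of_real s * (-\<i>) * snd (y x)) < e / 2"
      using first_order_dense[OF y2 _ t(2), of "e / 2"] e by auto
    let ?x = "\<lambda>r. (f r, g r)"
    let ?u = "\<lambda>r. (vd f r + of_real (- (s * \<sigma>)) * f r - of_real s * \<i> * fst (y r), 0 :: complex)"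
    let ?v = "\<lambda>r. (0 :: complex, vd g r + of_real (s * \<sigma>) * g r - of_real s * (-\<i>) * snd (y r))"
    have ss: "of_real s * of_real s = (1::complex)" using s by auto
    have n1: "norm (of_real s * (- \<i>) * vd f r + of_real \<sigma> * \<i> * f r - fst (y r)) = norm (fst (?u r))" for r
    proof -
      have "of_real s * (- \<i>) * vd f r + of_real \<sigma> * \<i> * f r - fst (y r) = of_real s * (- \<i>) * fst (?u r)"
        using ss by (simp add: algebra_simps) (simp add: mult.assoc[symmetric])
      then show ?thesis using s by (auto simp: norm_mult)
    qed
    have n2: "norm (of_real s * \<i> * vd g r + of_real \<sigma> * \<i> * g r - snd (y r)) = norm (snd (?v r))" for r
    proof -
      have "of_real s * \<i> * vd g r + of_real \<sigma> * \<i> * g r - snd (y r) = of_real s * \<i> * snd (?v r)"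
        using ss by (simp add: algebra_simps) (simp add: mult.assoc[symmetric])
      then show ?thesis using s by (auto simp: norm_mult)
    qed
    have xD: "?x \<in> D" using f g by (simp add: D_def)
    have uD: "?u \<in> D" and vD: "?v \<in> D"
      using y1 y2 f g Cc_add[OF Cc_add[OF Cc_derivative[OF f(1)] Cc_cmult[OF f(1), of "of_real (- (s * \<sigma>))"]] Cc_cmult[OF y1, of "-1"]]
       Cc_add[OF Cc_add[OF Cc_derivative[OF g(1)] Cc_cmult[OF g(1), of "of_real (s * \<sigma>)"]] Cc_cmult[OF y2, of "-1"]]
      by (auto simp: D_def Cc_zero)
    have "nrm lborel (\<lambda>p. A ?x p - y p) = nrm lborel (\<lambda>p. ?u p + ?v p)"
      unfolding nrm_def norm_prod_def A_def by (simp add: n1[simplified] n2[simplified])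
    also have "\<dots> \<le> nrm lborel ?u + nrm lborel ?v" by (intro nrm_triangle D_l2 uD vD)
    also have "\<dots> < e" using f(2) g(2) by (simp add: nrm_def norm_prod_def)
    finally show "\<exists>x\<in>D. nrm lborel (\<lambda>p. A x p - y p) < e" using xD by blast
  qed
  moreover have low: "nrm lborel x \<le> nrm lborel (\<lambda>p. A x p + t *\<^sub>R K x p)" if x: "x \<in> D" for x t
  proof -
    define f where "f r = fst (x r)" for r
    define g where "g r = snd (x r)" for r
    have f: "f \<in> Cc" and g: "g \<in> Cc" using x by (auto simp: D_def f_def[abs_def] g_def[abs_def])
    have ss: "s\<^sup>2 = 1" "\<sigma>\<^sup>2 = 1" using s \<sigma> by auto
    have B: "l2 lborel (\<lambda>p. A x p + t *\<^sub>R K x p)" by (intro D_l2 Yadd Yscale AY KY x)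
    \<comment> \<open>The boundary term of the system. Its derivative is the only contribution
      without a sign in the pointwise bound, and it integrates to 0 by compact support.\<close>
    define F where "F r = g r \<bullet> g r - f r \<bullet> f r" for r
    define F' where "F' r = 2 * (g r \<bullet> vd g r - f r \<bullet> vd f r)" for r
    obtain R where R: "R > 0" "\<And>r. \<bar>r\<bar> > R \<Longrightarrow> f r = 0" using Cc_supp[OF f] by auto
    obtain S where S: "S > 0" "\<And>r. \<bar>r\<bar> > S \<Longrightarrow> g r = 0" using Cc_supp[OF g] by auto
    have dF: "(F has_vector_derivative F' r) (at r)" for r
    proof -
      have "(F has_vector_derivative ((g r \<bullet> vd g r + vd g r \<bullet> g r) - (f r \<bullet> vd f r + vd f r \<bullet> f r))) (at r)"
        unfolding F_def[abs_def]
        by (intro has_vector_derivative_diff bounded_bilinear.has_vector_derivative[OF bounded_bilinear_inner] Cc_D f g)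
      then show ?thesis by (simp add: F'_def inner_commute)
    qed
    have cF: "continuous_on UNIV F'" unfolding F'_def[abs_def]
      by (intro continuous_intros Cc_continuous f g Cc_derivative)
    have sF: "F r = 0" "F' r = 0" if "\<bar>r\<bar> > max R S" for r using that R S by (auto simp: F_def F'_def)
    have I0: "(LINT r|lborel. F' r) = 0"
      by (rule integral_derivative_compact_support[OF dF cF, of "max R S + 1"]) (use R in \<open>auto intro!: sF\<close>)
    have iF: "integrable lborel F'" by (rule integrable_compact_support[OF cF sF(2)])
    have ix: "integrable lborel (\<lambda>r. (norm (x r))\<^sup>2)" using D_l2[OF x] by (simp add: l2_def)
    have pw: "(norm (x r))\<^sup>2 + (\<sigma> * s) * F' r \<le> (norm (A x r + t *\<^sub>R K x r))\<^sup>2" for r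
    proof -
      have "fst (A x r + t *\<^sub>R K x r) = s * (- \<i> * (vd f r + (t * \<mu> * w r) * g r)) + (t * (a * \<kappa> * w r * w r)) * f r + \<sigma> * \<i> * f r"
        "snd (A x r + t *\<^sub>R K x r) = s * (\<i> * (vd g r + (t * \<mu> * w r) * f r)) + (t * (a * \<kappa> * w r * w r)) * g r + \<sigma> * \<i> * g r"
        by (simp_all add: A_def K_def f_def[abs_def] g_def[abs_def] scaleR_conv_of_real algebra_simps)
      moreover have "(norm z)\<^sup>2 = (norm (fst z))\<^sup>2 + (norm (snd z))\<^sup>2" for z :: "complex \<times> complex"
        by (simp add: norm_prod_def)
      ultimately show ?thesis
        using radial_pointwise_bound[OF ss, of "f r" "g r" "vd g r" "vd f r" "t * \<mu> * w r" "t * (a * \<kappa> * w r * w r)"]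
        by (simp add: F'_def f_def g_def)
    qed
    have "(LINT r|lborel. (norm (x r))\<^sup>2) = (LINT r|lborel. (norm (x r))\<^sup>2 + (\<sigma> * s) * F' r)"
      using ix iF I0 by simp
    also have "\<dots> \<le> (LINT r|lborel. (norm (A x r + t *\<^sub>R K x r))\<^sup>2)"
      by (intro integral_mono pw) (use ix iF B in \<open>auto simp: l2_def\<close>)
    finally show ?thesis unfolding nrm_def by (rule real_sqrt_le_mono)
  qed
  moreover have "nrm lborel (K x) \<le> (2 * (\<bar>\<mu>\<bar> / \<bar>a\<bar> + \<bar>\<kappa>\<bar> / \<bar>a\<bar>)) * nrm lborel x" if x: "x \<in> D" for x
  proof -
    define c where "c = \<bar>\<mu>\<bar> / \<bar>a\<bar> + \<bar>\<kappa>\<bar> / \<bar>a\<bar>"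
    have c: "c \<ge> 0" by (simp add: c_def)
    have b1: "\<bar>\<mu>\<bar> * w r \<le> \<bar>\<mu>\<bar> / \<bar>a\<bar>" for r using mult_left_mono[OF wb(2), of "\<bar>\<mu>\<bar>" r] by simp
    have b2: "\<bar>a * \<kappa>\<bar> * w r * w r \<le> \<bar>\<kappa>\<bar> / \<bar>a\<bar>" for r
    proof -
      have "\<bar>a * \<kappa>\<bar> * w r * w r \<le> \<bar>a * \<kappa>\<bar> * (1 / \<bar>a\<bar>) * (1 / \<bar>a\<bar>)"
        by (intro mult_mono wb) (use wb in auto)
      also have "\<dots> = \<bar>\<kappa>\<bar> / \<bar>a\<bar>" using a by (simp add: abs_mult)
      finally show ?thesis .
    qed
    have two: "\<bar>\<mu>\<bar> * w r * p + \<bar>a * \<kappa>\<bar> * w r * w r * q \<le> c * norm z"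
      if "0 \<le> p" "p \<le> norm z" "0 \<le> q" "q \<le> norm z" for r p q and z :: "complex \<times> complex"
    proof -
      have "\<bar>\<mu>\<bar> * w r * p + \<bar>a * \<kappa>\<bar> * w r * w r * q \<le> \<bar>\<mu>\<bar> / \<bar>a\<bar> * norm z + \<bar>\<kappa>\<bar> / \<bar>a\<bar> * norm z"
        by (intro add_mono mult_mono b1 b2 that) auto
      then show ?thesis by (simp add: c_def algebra_simps)
    qed
    have pw: "norm (K x r) \<le> norm ((2 * c) *\<^sub>R x r)" for r
    proof -
      have fs: "norm (fst (x r)) \<le> norm (x r)" "norm (snd (x r)) \<le> norm (x r)"
        by (metis norm_fst_le prod.collapse, metis norm_snd_le prod.collapse)
      have s1: "norm (of_real s :: complex) = 1" using s by auto
      have "norm (fst (K x r)) \<le> \<bar>\<mu>\<bar> * w r * norm (snd (x r)) + \<bar>a * \<kappa>\<bar> * w r * w r * norm (fst (x r))"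
        unfolding K_def fst_conv by (rule order.trans[OF norm_triangle_ineq]) (use wb(1)[of r] s1 in \<open>simp add: norm_mult abs_mult mult.assoc\<close>)
      also have "\<dots> \<le> c * norm (x r)" by (intro two fs) auto
      finally have k1: "norm (fst (K x r)) \<le> c * norm (x r)" .
      have "norm (snd (K x r)) \<le> \<bar>\<mu>\<bar> * w r * norm (fst (x r)) + \<bar>a * \<kappa>\<bar> * w r * w r * norm (snd (x r))"
        unfolding K_def snd_conv by (rule order.trans[OF norm_triangle_ineq]) (use wb(1)[of r] s1 in \<open>simp add: norm_mult abs_mult mult.assoc\<close>)
      also have "\<dots> \<le> c * norm (x r)" by (intro two fs) auto
      finally have k2: "norm (snd (K x r)) \<le> c * norm (x r)" .
      have "norm (K x r) \<le> norm (fst (K x r)) + norm (snd (K x r))"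
        unfolding norm_prod_def by (rule sqrt_sum_squares_le_sum) auto
      with k1 k2 show ?thesis using c by simp
    qed
    have "nrm lborel (K x) \<le> nrm lborel (\<lambda>r. (2 * c) *\<^sub>R x r)"
      by (rule nrm_mono[OF D_l2[OF Yscale[OF x]]]) (rule pw)
    also have "\<dots> = 2 * c * nrm lborel x"
      using c by (simp add: nrm_def power_mult_distrib real_sqrt_mult)
    finally show ?thesis by (simp add: c_def)
  qed
  ultimately have dr: "dense_range (\<lambda>x p. A x p + K x p)" by (rule dense_range_perturb)
  have "(\<lambda>r. (h1 r, h2 r)) \<in> D" using h by (simp add: D_def)
  from dr[unfolded dense_range_def, rule_format, OF this e]
  obtain x where x: "x \<in> D" "nrm lborel (\<lambda>p. A x p + K x p - (h1 p, h2 p)) < \<epsilon>" by auto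
  show ?thesis
  proof (rule bexI[where x="\<lambda>r. fst (x r)"], rule bexI[where x="\<lambda>r. snd (x r)"])
    have "(\<lambda>p. A x p + K x p - (h1 p, h2 p)) = (\<lambda>r.
     (of_real s * (- \<i> * (vd (\<lambda>r. fst (x r)) r + of_real (\<mu> / varpi a r) * snd (x r))) + of_real (a * \<kappa> / (varpi a r)\<^sup>2) * fst (x r) + of_real \<sigma> * \<i> * fst (x r) - h1 r,
      of_real s * (\<i> * (vd (\<lambda>r. snd (x r)) r + of_real (\<mu> / varpi a r) * fst (x r))) + of_real (a * \<kappa> / (varpi a r)\<^sup>2) * snd (x r) + of_real \<sigma> * \<i> * snd (x r) - h2 r))"
      by (auto simp: A_def K_def w_def fun_eq_iff power2_eq_square algebra_simps)
    then show "nrm lborel (\<lambda>r.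
     (of_real s * (- \<i> * (vd (\<lambda>r. fst (x r)) r + of_real (\<mu> / varpi a r) * snd (x r))) + of_real (a * \<kappa> / (varpi a r)\<^sup>2) * fst (x r) + of_real \<sigma> * \<i> * fst (x r) - h1 r,
      of_real s * (\<i> * (vd (\<lambda>r. snd (x r)) r + of_real (\<mu> / varpi a r) * fst (x r))) + of_real (a * \<kappa> / (varpi a r)\<^sup>2) * snd (x r) + of_real \<sigma> * \<i> * snd (x r) - h2 r)) < \<epsilon>"
      using x(2) by simp
  qed (use x(1) in \<open>auto simp: D_def\<close>)
qed

section \<open>Tensor products of smooth functions\<close>

text \<open>Finite sums of products of one-variable functions with constant vectors. Smoothness in
  three variables is thereby reduced to \<open>Cinf\<close>: directional derivatives and sums stay
  in the class, so every \<open>iter_deriv\<close> of a member is again differentiable.\<close>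

inductive TT :: "field4 \<Rightarrow> bool" where
  TT_base: "Cinf UNIV f \<Longrightarrow> Cinf UNIV g \<Longrightarrow> Cinf UNIV h \<Longrightarrow> TT (\<lambda>(r, \<theta>, \<phi>). (f r * g \<theta> * h \<phi>) *s v)"
| TT_add: "TT \<psi> \<Longrightarrow> TT \<eta> \<Longrightarrow> TT (\<lambda>x. \<psi> x + \<eta> x)"

lemma bounded_linear_smult_left: "bounded_linear (\<lambda>c. c *s (v::bisp))"
proof -
  have "linear (\<lambda>c. c *s v)" by (rule linearI) (auto simp: vec_eq_iff algebra_simps)
  then show ?thesis by (simp add: linear_conv_bounded_linear)
qed

lemma bounded_linear_smult_right: "bounded_linear (\<lambda>v::bisp. c *s v)"
proof -
  have "linear (\<lambda>v::bisp. c *s v)" by (rule linearI) (auto simp: vec_eq_iff algebra_simps)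
  then show ?thesis by (simp add: linear_conv_bounded_linear)
qed

lemma product_has_derivative:
  fixes f g h :: "real \<Rightarrow> complex"
  assumes "(f has_vector_derivative f') (at r)" "(g has_vector_derivative g') (at \<theta>)" "(h has_vector_derivative h') (at \<phi>)"
  shows "((\<lambda>(r, \<theta>, \<phi>). (f r * g \<theta> * h \<phi>) *s (v::bisp)) has_derivative
     (\<lambda>(x, y, z). (x *\<^sub>R (f' * g \<theta> * h \<phi>) + y *\<^sub>R (f r * g' * h \<phi>) + z *\<^sub>R (f r * g \<theta> * h')) *s v)) (at (r, \<theta>, \<phi>))"
proof -
  let ?p = "(r, \<theta>, \<phi>) :: pt"
  have c: "((\<lambda>x. k (l x)) has_derivative (\<lambda>d. l d *\<^sub>R k')) (at p)"
    if "(k has_vector_derivative k') (at (l p))" "bounded_linear l"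
    for k :: "real \<Rightarrow> complex" and l :: "pt \<Rightarrow> real" and p k'
    using diff_chain_at[OF bounded_linear.has_derivative[OF that(2) has_derivative_ident] that(1)[unfolded has_vector_derivative_def]]
    by (simp add: o_def)
  have F: "((\<lambda>x. f (fst x)) has_derivative (\<lambda>d. fst d *\<^sub>R f')) (at ?p)"
    by (rule c) (use assms in \<open>auto intro: bounded_linear_fst\<close>)
  have G: "((\<lambda>x. g (fst (snd x))) has_derivative (\<lambda>d. fst (snd d) *\<^sub>R g')) (at ?p)"
    by (rule c) (use assms in \<open>auto intro!: bounded_linear_compose[OF bounded_linear_fst bounded_linear_snd]\<close>)
  have H: "((\<lambda>x. h (snd (snd x))) has_derivative (\<lambda>d. snd (snd d) *\<^sub>R h')) (at ?p)"
    by (rule c) (use assms in \<open>auto intro!: bounded_linear_compose[OF bounded_linear_snd bounded_linear_snd]\<close>)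
  have "((\<lambda>x. (f (fst x) * g (fst (snd x)) * h (snd (snd x))) *s v) has_derivative
     (\<lambda>d. ((f r * g \<theta>) * (snd (snd d) *\<^sub>R h') + (f r * (fst (snd d) *\<^sub>R g') + fst d *\<^sub>R f' * g \<theta>) * h \<phi>) *s v)) (at ?p)"
    using bounded_linear.has_derivative[OF bounded_linear_smult_left[of v] has_derivative_mult[OF has_derivative_mult[OF F G] H]]
    by (simp only: fst_conv snd_conv)
  moreover have "(\<lambda>(r, \<theta>, \<phi>). (f r * g \<theta> * h \<phi>) *s v) = (\<lambda>x. (f (fst x) * g (fst (snd x)) * h (snd (snd x))) *s v)"
    by (simp add: case_prod_unfold)
  moreover have "(\<lambda>(x, y, z). (x *\<^sub>R (f' * g \<theta> * h \<phi>) + y *\<^sub>R (f r * g' * h \<phi>) + z *\<^sub>R (f r * g \<theta> * h')) *s v)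
    = (\<lambda>d. ((f r * g \<theta>) * (snd (snd d) *\<^sub>R h') + (f r * (fst (snd d) *\<^sub>R g') + fst d *\<^sub>R f' * g \<theta>) * h \<phi>) *s v)"
    by (auto simp: fun_eq_iff algebra_simps)
  ultimately show ?thesis by simp
qed

lemma frechet_derivative_add:
  assumes "\<psi> differentiable (at x)" "\<eta> differentiable (at x)"
  shows "frechet_derivative (\<lambda>x. \<psi> x + \<eta> x) (at x) v = frechet_derivative \<psi> (at x) v + frechet_derivative \<eta> (at x) v"
proof -
  have "((\<lambda>x. \<psi> x + \<eta> x) has_derivative (\<lambda>v. frechet_derivative \<psi> (at x) v + frechet_derivative \<eta> (at x) v)) (at x)"
    using assms by (intro has_derivative_add) (simp_all add: frechet_derivative_works[symmetric])
  from frechet_derivative_at[OF this] show ?thesis by metis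
qed

lemma frechet_derivative_smult:
  fixes \<psi> :: field4
  assumes "\<psi> differentiable (at x)"
  shows "frechet_derivative (\<lambda>x. c *s \<psi> x) (at x) v = c *s frechet_derivative \<psi> (at x) v"
proof -
  have "((\<lambda>x. c *s \<psi> x) has_derivative (\<lambda>v. c *s frechet_derivative \<psi> (at x) v)) (at x)"
    using assms by (intro bounded_linear.has_derivative[OF bounded_linear_smult_right]) (simp add: frechet_derivative_works[symmetric])
  from frechet_derivative_at[OF this] show ?thesis by metis
qed

lemma TT_derivative: "TT \<psi> \<Longrightarrow> (\<forall>x. \<psi> differentiable (at x)) \<and> (\<forall>v. TT (\<lambda>x. frechet_derivative \<psi> (at x) v))"
proof (induction rule: TT.induct)
  case (TT_base f g h v)
  have d: "((\<lambda>(r, \<theta>, \<phi>). (f r * g \<theta> * h \<phi>) *s v) has_derivative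
     (\<lambda>(x, y, z). (x *\<^sub>R (vd f r * g \<theta> * h \<phi>) + y *\<^sub>R (f r * vd g \<theta> * h \<phi>) + z *\<^sub>R (f r * g \<theta> * vd h \<phi>)) *s v)) (at (r, \<theta>, \<phi>))" for r \<theta> \<phi>
    by (intro product_has_derivative Cinf_D[where S=UNIV] TT_base) auto
  have "TT (\<lambda>p. frechet_derivative (\<lambda>(r, \<theta>, \<phi>). (f r * g \<theta> * h \<phi>) *s v) (at p) w)" for w
  proof -
    obtain x y z where w: "w = (x, y, z)" by (metis prod_cases3)
    have "TT (\<lambda>p. (\<lambda>(r, \<theta>, \<phi>). (vd f r * g \<theta> * h \<phi>) *s (of_real x *s v)) p
        + ((\<lambda>(r, \<theta>, \<phi>). (f r * vd g \<theta> * h \<phi>) *s (of_real y *s v)) p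
        + (\<lambda>(r, \<theta>, \<phi>). (f r * g \<theta> * vd h \<phi>) *s (of_real z *s v)) p))"
      by (intro TT_add TT.TT_base Cinf_derivative TT_base)
    also have "(\<lambda>p. (\<lambda>(r, \<theta>, \<phi>). (vd f r * g \<theta> * h \<phi>) *s (of_real x *s v)) p
        + ((\<lambda>(r, \<theta>, \<phi>). (f r * vd g \<theta> * h \<phi>) *s (of_real y *s v)) p
        + (\<lambda>(r, \<theta>, \<phi>). (f r * g \<theta> * vd h \<phi>) *s (of_real z *s v)) p))
       = (\<lambda>p. frechet_derivative (\<lambda>(r, \<theta>, \<phi>). (f r * g \<theta> * h \<phi>) *s v) (at p) w)"
    proof
      fix p :: pt
      obtain r \<theta> \<phi> where p: "p = (r, \<theta>, \<phi>)" by (metis prod_cases3)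
      show "(\<lambda>(r, \<theta>, \<phi>). (vd f r * g \<theta> * h \<phi>) *s (of_real x *s v)) p
        + ((\<lambda>(r, \<theta>, \<phi>). (f r * vd g \<theta> * h \<phi>) *s (of_real y *s v)) p
        + (\<lambda>(r, \<theta>, \<phi>). (f r * g \<theta> * vd h \<phi>) *s (of_real z *s v)) p)
         = frechet_derivative (\<lambda>(r, \<theta>, \<phi>). (f r * g \<theta> * h \<phi>) *s v) (at p) w"
        unfolding p frechet_derivative_at[OF d, symmetric] w
        by (simp add: vec_eq_iff algebra_simps scaleR_conv_of_real)
    qed
    finally show ?thesis .
  qed
  moreover have "(\<lambda>(r, \<theta>, \<phi>). (f r * g \<theta> * h \<phi>) *s v) differentiable (at p)" for p
    using d by (metis prod_cases3 differentiableI)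
  ultimately show ?case by blast
next
  case (TT_add \<psi> \<eta>)
  have d: "\<psi> differentiable (at x)" "\<eta> differentiable (at x)" for x using TT_add.IH by blast+
  have "TT (\<lambda>x. frechet_derivative \<psi> (at x) v + frechet_derivative \<eta> (at x) v)" for v
    using TT_add.IH by (intro TT.TT_add) blast+
  then show ?case by (simp add: frechet_derivative_add d del: split_paired_All)
qed

lemma TT_smooth: "TT \<psi> \<Longrightarrow> smooth_on UNIV \<psi>"
proof -
  assume t: "TT \<psi>"
  have "TT (iter_deriv \<psi> vs)" for vs
    by (induction vs) (use t TT_derivative in auto)
  then show ?thesis
    unfolding smooth_on_def using TT_derivative by (auto intro: differentiable_at_imp_differentiable_on)
qed

lemma TT_smult: "TT \<psi> \<Longrightarrow> TT (\<lambda>x. c *s \<psi> x)"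
proof (induction rule: TT.induct)
  case (TT_base f g h v)
  have "(\<lambda>x. c *s (case x of (r, \<theta>, \<phi>) \<Rightarrow> (f r * g \<theta> * h \<phi>) *s v)) = (\<lambda>(r, \<theta>, \<phi>). (f r * g \<theta> * h \<phi>) *s (c *s v))"
    by (auto simp: vec_eq_iff fun_eq_iff)
  then show ?case using TT.TT_base[OF TT_base] by (simp only:)
next
  case (TT_add \<psi> \<eta>)
  then show ?case using TT.TT_add[OF TT_add.IH] by (simp add: vector_add_ldistrib)
qed

section \<open>The operator in components\<close>

lemma vector4_nth [simp]:
  "(vector [p, q, r, s] :: 'x::zero ^ 4) $ 1 = p" "(vector [p, q, r, s] :: 'x::zero ^ 4) $ 2 = q"
  "(vector [p, q, r, s] :: 'x::zero ^ 4) $ 3 = r" "(vector [p, q, r, s] :: 'x::zero ^ 4) $ 4 = s"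
  by (simp_all add: vector_def)

lemma scaleR_complex_of_real: "c *\<^sub>R (z::complex) = of_real c * z"
  by (rule scaleR_conv_of_real)

text \<open>The matrix products are carried out once, and later arguments use these scalar formulas.
  For \<open>m = 0\<close> components 1, 2 and components 3, 4 form two uncoupled pairs.\<close>

lemma frakH_components:
  fixes a m e Q r \<theta> \<phi> :: real
  assumes a: "a \<noteq> 0"
  defines "x \<equiv> (r, \<theta>, \<phi>)"
  shows "frakH a m e Q \<psi> x $ 1 = - \<i> * (d_r \<psi> x $ 1 + of_real (1 / varpi a r) * (d_theta \<psi> x $ 2 + of_real (a / varpi a r) * d_phi \<psi> x $ 1 - \<i> * of_real (1 / sin \<theta>) * d_phi \<psi> x $ 2))
      + of_real (e * absrho a r \<theta> * A0t a Q r \<theta> / varpi a r) * \<psi> x $ 1 + of_real (m / varpi a r) * cnj (rho a r \<theta>) * \<psi> x $ 3"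
   "frakH a m e Q \<psi> x $ 2 = - \<i> * (- d_r \<psi> x $ 2 + of_real (1 / varpi a r) * (d_theta \<psi> x $ 1 + of_real (a / varpi a r) * d_phi \<psi> x $ 2 + \<i> * of_real (1 / sin \<theta>) * d_phi \<psi> x $ 1))
      + of_real (e * absrho a r \<theta> * A0t a Q r \<theta> / varpi a r) * \<psi> x $ 2 + of_real (m / varpi a r) * cnj (rho a r \<theta>) * \<psi> x $ 4"
   "frakH a m e Q \<psi> x $ 3 = - \<i> * (- d_r \<psi> x $ 3 + of_real (1 / varpi a r) * (- d_theta \<psi> x $ 4 + of_real (a / varpi a r) * d_phi \<psi> x $ 3 + \<i> * of_real (1 / sin \<theta>) * d_phi \<psi> x $ 4))
      + of_real (e * absrho a r \<theta> * A0t a Q r \<theta> / varpi a r) * \<psi> x $ 3 + of_real (m / varpi a r) * rho a r \<theta> * \<psi> x $ 1"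
   "frakH a m e Q \<psi> x $ 4 = - \<i> * (d_r \<psi> x $ 4 + of_real (1 / varpi a r) * (- d_theta \<psi> x $ 3 + of_real (a / varpi a r) * d_phi \<psi> x $ 4 - \<i> * of_real (1 / sin \<theta>) * d_phi \<psi> x $ 3))
      + of_real (e * absrho a r \<theta> * A0t a Q r \<theta> / varpi a r) * \<psi> x $ 4 + of_real (m / varpi a r) * rho a r \<theta> * \<psi> x $ 2"
  using varpi_pos[OF a, of r] unfolding x_def
  by (simp_all add: frakH_def gamma0_def gamma1_def gamma2_def gamma3_def Mr_def Mtheta_def Mphi_def frakR_def m4_def
      matrix_vector_mult_def sum_4 scaleR_complex_of_real field_simps)


lemma frakH_add:
  assumes "a \<noteq> 0" "\<psi> differentiable (at x)" "\<eta> differentiable (at x)"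
  shows "frakH a m e Q (\<lambda>x. \<psi> x + \<eta> x) x = frakH a m e Q \<psi> x + frakH a m e Q \<eta> x"
proof -
  obtain r \<theta> \<phi> where x: "x = (r, \<theta>, \<phi>)" by (metis prod_cases3)
  have d: "d_r (\<lambda>x. \<psi> x + \<eta> x) x = d_r \<psi> x + d_r \<eta> x" "d_theta (\<lambda>x. \<psi> x + \<eta> x) x = d_theta \<psi> x + d_theta \<eta> x"
    "d_phi (\<lambda>x. \<psi> x + \<eta> x) x = d_phi \<psi> x + d_phi \<eta> x"
    using assms by (simp_all add: d_r_def d_theta_def d_phi_def frechet_derivative_add)
  show ?thesis using d unfolding vec_eq_iff forall_4 x
    by (simp add: frakH_components[OF assms(1)] algebra_simps add_divide_distrib)
qed

lemma frakH_smult: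
  assumes "a \<noteq> 0" "\<psi> differentiable (at x)"
  shows "frakH a m e Q (\<lambda>x. c *s \<psi> x) x = c *s frakH a m e Q \<psi> x"
proof -
  obtain r \<theta> \<phi> where x: "x = (r, \<theta>, \<phi>)" by (metis prod_cases3)
  have d: "d_r (\<lambda>x. c *s \<psi> x) x = c *s d_r \<psi> x" "d_theta (\<lambda>x. c *s \<psi> x) x = c *s d_theta \<psi> x"
    "d_phi (\<lambda>x. c *s \<psi> x) x = c *s d_phi \<psi> x"
    using assms by (simp_all add: d_r_def d_theta_def d_phi_def frechet_derivative_smult)
  show ?thesis using d unfolding vec_eq_iff forall_4 x
    by (simp add: frakH_components[OF assms(1)] algebra_simps add_divide_distrib)
qed

section \<open>Separated fields of azimuthal mode \<kappa>\<close>

definition tn :: "(real \<Rightarrow> complex) \<Rightarrow> (real \<Rightarrow> complex) \<Rightarrow> real \<Rightarrow> 4 \<Rightarrow> field4" where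
  "tn f g \<kappa> i = (\<lambda>(r, \<theta>, \<phi>). (f r * g \<theta> * cis (\<kappa> * \<phi>)) *s axis i 1)"

lemma tn_nth: "tn f g \<kappa> i (r, \<theta>, \<phi>) $ j = (if i = j then f r * g \<theta> * cis (\<kappa> * \<phi>) else 0)"
  by (simp add: tn_def axis_def)

lemma norm_axis_1: "norm (axis i (1::complex) :: bisp) = 1"
  by (simp add: norm_vec_def L2_set_def axis_def if_distrib[of norm] if_distrib[of "\<lambda>x. x\<^sup>2"] cong: if_cong)

lemma norm_tn: "norm (tn f g \<kappa> i (r, \<theta>, \<phi>)) = norm (f r) * norm (g \<theta>)"
  by (simp add: tn_def norm_smult_vec norm_axis_1 norm_mult)

lemma Cinf_cis: "Cinf UNIV (\<lambda>\<phi>. cis (\<kappa> * \<phi>))"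
proof -
  have "Cinf UNIV (\<lambda>\<phi>. sin (\<kappa> * \<phi>))" "Cinf UNIV (\<lambda>\<phi>. cos (\<kappa> * \<phi>))"
    using Cinf_compose[OF _ _ _ Cinf_affine[of \<kappa> 0] Cinf_sin_cos(1)[of UNIV]] Cinf_compose[OF _ _ _ Cinf_affine[of \<kappa> 0] Cinf_sin_cos(2)[of UNIV]]
    by simp_all
  then have "Cinf UNIV (\<lambda>\<phi>. complex_of_real (cos (\<kappa> * \<phi>)) + \<i> * complex_of_real (sin (\<kappa> * \<phi>)))"
    by (intro Cinf_add Cinf_mult Cinf_const Cinf_of_real) auto
  moreover have "complex_of_real (cos (\<kappa> * \<phi>)) + \<i> * complex_of_real (sin (\<kappa> * \<phi>)) = cis (\<kappa> * \<phi>)" for \<phi>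
    by (simp add: complex_eq_iff)
  ultimately show ?thesis by simp
qed

lemma vd_cis: "((\<lambda>\<phi>. cis (\<kappa> * \<phi>)) has_vector_derivative \<i> * of_real \<kappa> * cis (\<kappa> * \<phi>)) (at \<phi>)"
proof -
  have "((\<lambda>\<phi>. \<kappa> * \<phi>) has_vector_derivative \<kappa>) (at \<phi>)"
    unfolding has_real_derivative_iff_has_vector_derivative[symmetric] by (auto intro!: derivative_eq_intros)
  moreover have "(cis has_vector_derivative \<i> * cis (\<kappa> * \<phi>)) (at (\<kappa> * \<phi>))"
    unfolding has_vector_derivative_def by (auto intro!: derivative_eq_intros simp: scaleR_conv_of_real algebra_simps)
  ultimately have "(cis \<circ> (\<lambda>\<phi>. \<kappa> * \<phi>) has_vector_derivative \<kappa> *\<^sub>R (\<i> * cis (\<kappa> * \<phi>))) (at \<phi>)"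
    by (rule vector_diff_chain_at)
  moreover have "\<kappa> *\<^sub>R (\<i> * cis (\<kappa> * \<phi>)) = \<i> * of_real \<kappa> * cis (\<kappa> * \<phi>)"
    by (simp add: scaleR_conv_of_real)
  ultimately show ?thesis by (simp only: o_def)
qed

lemma TT_tn: "Cinf UNIV f \<Longrightarrow> Cinf UNIV g \<Longrightarrow> TT (tn f g \<kappa> i)"
  unfolding tn_def by (intro TT_base Cinf_cis)

lemma tn_derivatives:
  assumes f: "(f has_vector_derivative f') (at r)" and g: "(g has_vector_derivative g') (at \<theta>)"
  shows "d_r (tn f g \<kappa> i) (r, \<theta>, \<phi>) = (f' * g \<theta> * cis (\<kappa> * \<phi>)) *s axis i 1"
    and "d_theta (tn f g \<kappa> i) (r, \<theta>, \<phi>) = (f r * g' * cis (\<kappa> * \<phi>)) *s axis i 1"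
    and "d_phi (tn f g \<kappa> i) (r, \<theta>, \<phi>) = (f r * g \<theta> * (\<i> * of_real \<kappa> * cis (\<kappa> * \<phi>))) *s axis i 1"
  using frechet_derivative_at[OF product_has_derivative[OF f g vd_cis], symmetric]
  by (simp_all add: d_r_def d_theta_def d_phi_def tn_def)

text \<open>Signs of the Weyl representation: \<open>\<alpha>\<^sup>3\<close> acts on component \<open>i\<close> as \<open>sgr i\<close>, the angular part
  couples component \<open>i\<close> to \<open>pr i\<close> with sign \<open>osg i\<close> and angular potential \<open>tau i * \<kappa> / sin \<theta>\<close>.\<close>

definition sgr :: "4 \<Rightarrow> real" where "sgr i = (if i = 1 \<or> i = 4 then 1 else -1)"
definition osg :: "4 \<Rightarrow> real" where "osg i = (if i = 1 \<or> i = 2 then 1 else -1)"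
definition tau :: "4 \<Rightarrow> real" where "tau i = (if i = 1 \<or> i = 3 then 1 else -1)"
definition pr :: "4 \<Rightarrow> 4" where "pr i = (if i = 1 then 2 else if i = 2 then 1 else if i = 3 then 4 else 3)"

text \<open>A separated field goes to a sum of two: the radial derivative and the
  \<open>gamma0\<close> part of \<open>Mphi\<close> keep component \<open>i\<close>, the angular
  operator moves it to \<open>pr i\<close>. Only differentiability at the given point is asked, so
  products with cutoffs can be inserted directly.\<close>

lemma frakH_tn:
  assumes a: "a \<noteq> 0" and f: "(f has_vector_derivative f' r) (at r)" and g: "(g has_vector_derivative g' \<theta>) (at \<theta>)"
  shows "frakH a 0 e 0 (tn f g \<kappa> i) (r, \<theta>, \<phi>) =
     tn (\<lambda>r. - \<i> * of_real (sgr i) * f' r + of_real (a * \<kappa> / (varpi a r)\<^sup>2) * f r) g \<kappa> i (r, \<theta>, \<phi>)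
   + tn (\<lambda>r. - \<i> * of_real (osg i / varpi a r) * f r) (\<lambda>\<theta>. g' \<theta> - of_real (tau i * \<kappa> / sin \<theta>) * g \<theta>) \<kappa> (pr i) (r, \<theta>, \<phi>)"
proof -
  consider "i = 1" | "i = 2" | "i = 3" | "i = 4" using exhaust_4[of i] by blast
  then show ?thesis
    by cases (simp_all add: vec_eq_iff forall_4 frakH_components[OF a] tn_derivatives[OF f g] tn_nth axis_def
        sgr_def osg_def tau_def pr_def A0t_def algebra_simps power2_eq_square)
qed

text \<open>All approximation takes place in this part of \<open>Dom\<close>, where smoothness of
  sums comes from \<open>TT\<close>. Density and range statements for it imply those for
  \<open>Dom\<close>.\<close>

definition DT :: "field4 set" where
  "DT = {\<psi> \<in> Dom. TT \<psi>}"

lemma DT_add: "\<psi> \<in> DT \<Longrightarrow> \<eta> \<in> DT \<Longrightarrow> (\<lambda>x. \<psi> x + \<eta> x) \<in> DT"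
proof -
  assume p: "\<psi> \<in> DT" and n: "\<eta> \<in> DT"
  obtain K where K: "compact K" "K \<subseteq> RTstar" "\<And>r \<theta> \<phi>. (r, \<theta>) \<notin> K \<Longrightarrow> \<psi> (r, \<theta>, \<phi>) = 0"
    using p by (auto simp: DT_def Dom_def)
  obtain L where L: "compact L" "L \<subseteq> RTstar" "\<And>r \<theta> \<phi>. (r, \<theta>) \<notin> L \<Longrightarrow> \<eta> (r, \<theta>, \<phi>) = 0"
    using n by (auto simp: DT_def Dom_def)
  have "\<exists>K. compact K \<and> K \<subseteq> RTstar \<and> (\<forall>r \<theta> \<phi>. (r, \<theta>) \<notin> K \<longrightarrow> \<psi> (r, \<theta>, \<phi>) + \<eta> (r, \<theta>, \<phi>) = 0)"
    using K L by (intro exI[of _ "K \<union> L"]) (auto intro: compact_Un)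
  then show ?thesis using p n by (auto simp: DT_def Dom_def intro: TT_add TT_smooth)
qed

lemma DT_smult: "\<psi> \<in> DT \<Longrightarrow> (\<lambda>x. c *s \<psi> x) \<in> DT"
proof -
  assume p: "\<psi> \<in> DT"
  obtain K where K: "compact K" "K \<subseteq> RTstar" "\<And>r \<theta> \<phi>. (r, \<theta>) \<notin> K \<Longrightarrow> \<psi> (r, \<theta>, \<phi>) = 0"
    using p by (auto simp: DT_def Dom_def)
  have "\<exists>K. compact K \<and> K \<subseteq> RTstar \<and> (\<forall>r \<theta> \<phi>. (r, \<theta>) \<notin> K \<longrightarrow> c *s \<psi> (r, \<theta>, \<phi>) = 0)"
    using K by (intro exI[of _ "K"]) auto
  moreover have "c *s (- v) = - (c *s v)" for v :: bisp by (simp add: vec_eq_iff)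
  ultimately show ?thesis using p by (auto simp: DT_def Dom_def intro: TT_smult TT_smooth)
qed

text \<open>The three vanishing conditions confine the support to a closed rectangle away from the
  poles minus an open square around the ring, a compact subset of \<open>RTstar\<close>.\<close>

lemma DT_I:
  assumes t: "TT \<psi>" and per: "\<And>r \<theta> \<phi>. \<psi> (r, \<theta>, \<phi> + 2 * pi) = - \<psi> (r, \<theta>, \<phi>)"
    and d: "\<delta> > 0" "\<epsilon> > 0"
    and R: "\<And>r \<theta> \<phi>. \<bar>r\<bar> > R \<Longrightarrow> \<psi> (r, \<theta>, \<phi>) = 0"
    and D: "\<And>r \<theta> \<phi>. \<theta> \<notin> {\<delta>..pi-\<delta>} \<Longrightarrow> \<psi> (r, \<theta>, \<phi>) = 0"
    and E: "\<And>r \<theta> \<phi>. \<bar>r\<bar> < \<epsilon> \<Longrightarrow> \<bar>\<theta> - pi / 2\<bar> < \<epsilon> \<Longrightarrow> \<psi> (r, \<theta>, \<phi>) = 0"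
  shows "\<psi> \<in> DT"
proof -
  define K where "K = ({-R..R} \<times> {\<delta>..pi-\<delta>}) - ({-\<epsilon><..<\<epsilon>} \<times> {pi/2-\<epsilon><..<pi/2+\<epsilon>})"
  have "compact K" unfolding K_def by (intro compact_diff compact_Times open_Times) auto
  moreover have "K \<subseteq> RTstar" using d by (auto simp: K_def RTstar_def)
  moreover have "\<forall>r \<theta> \<phi>. (r, \<theta>) \<notin> K \<longrightarrow> \<psi> (r, \<theta>, \<phi>) = 0"
  proof (intro allI impI)
    fix r \<theta> \<phi> assume "(r, \<theta>) \<notin> K"
    then consider "\<bar>r\<bar> > R" | "\<theta> \<notin> {\<delta>..pi-\<delta>}" | "\<bar>r\<bar> < \<epsilon>" "\<bar>\<theta> - pi / 2\<bar> < \<epsilon>"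
      by (fastforce simp: K_def)
    then show "\<psi> (r, \<theta>, \<phi>) = 0" using R D E by cases auto
  qed
  ultimately show ?thesis using t per by (auto simp: DT_def Dom_def intro: TT_smooth)
qed

lemma cis_half_integer_shift:
  assumes "\<kappa> - 1/2 \<in> \<int>" shows "cis (\<kappa> * (\<phi> + 2 * pi)) = - cis (\<kappa> * \<phi>)"
proof -
  obtain k where k: "\<kappa> = of_int k + 1/2" using assms by (metis Ints_cases diff_add_cancel)
  have "\<kappa> * (\<phi> + 2 * pi) = \<kappa> * \<phi> + (2 * pi * of_int k + pi)" by (simp add: k algebra_simps)
  then show ?thesis by (simp add: cis_mult[symmetric])
qed

lemma tn_antiperiodic:
  "\<kappa> - 1/2 \<in> \<int> \<Longrightarrow> tn f g \<kappa> i (r, \<theta>, \<phi> + 2 * pi) = - tn f g \<kappa> i (r, \<theta>, \<phi>)"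
  by (simp add: tn_def cis_half_integer_shift vec_eq_iff)

section \<open>Boundedness of the operator on its domain\<close>

lemma emeasure_MZ:
  assumes "A \<in> sets borel" shows "emeasure MZ A = emeasure lborel (Zset \<inter> A)"
proof -
  have "emeasure MZ A = (\<integral>\<^sup>+x. ennreal (indicator Zset x) * indicator A x \<partial>lborel)"
    unfolding MZ_def by (rule emeasure_density) (use assms in auto)
  also have "\<dots> = (\<integral>\<^sup>+x. indicator (Zset \<inter> A) x \<partial>lborel)"
    by (intro nn_integral_cong) (auto simp: indicator_def)
  also have "\<dots> = emeasure lborel (Zset \<inter> A)" using assms by (intro nn_integral_indicator) auto
  finally show ?thesis .
qed

lemma AE_MZ_I: "(\<And>x. x \<in> Zset \<Longrightarrow> P x) \<Longrightarrow> AE x in MZ. P x"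
  unfolding MZ_def by (subst AE_density) (auto simp: indicator_def)

text \<open>The azimuth is left free, since \<open>Zset\<close> already confines it to an interval
  of length \<open>2 * pi\<close>.\<close>

definition rtbox :: "real \<Rightarrow> real \<Rightarrow> real \<Rightarrow> real \<Rightarrow> pt set" where
  "rtbox r1 r2 t1 t2 = {r1..r2} \<times> {t1..t2} \<times> UNIV"

lemma rtbox_borel [measurable]: "rtbox r1 r2 t1 t2 \<in> sets borel"
  unfolding rtbox_def by (intro borel_closed closed_Times) auto

lemma emeasure_MZ_rtbox:
  assumes "r1 \<le> r2" "t1 \<le> t2"
  shows "emeasure MZ (rtbox r1 r2 t1 t2) \<le> ennreal ((r2 - r1) * (t2 - t1) * (2 * pi))"
proof -
  have "emeasure MZ (rtbox r1 r2 t1 t2) \<le> emeasure lborel (cbox (r1, t1, 0) (r2, t2, 2 * pi))"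
    unfolding emeasure_MZ[OF rtbox_borel]
    by (intro emeasure_mono) (auto simp: Zset_def rtbox_def cbox_Pair_eq intro!: borel_closed closed_Times)
  also have "\<dots> = ennreal (measure lborel (cbox (r1, t1, 0) (r2, t2, 2 * pi)))"
    by (rule emeasure_eq_ennreal_measure) (use emeasure_lborel_cbox_finite[of "(r1, t1, 0)" "(r2, t2, 2 * pi)"] in \<open>simp add: less_top\<close>)
  also have "\<dots> = ennreal ((r2 - r1) * (t2 - t1) * (2 * pi))"
    using assms by (simp add: content_Pair mult.assoc)
  finally show ?thesis .
qed

text \<open>The explicit side lengths matter: on shrinking boxes the volume is balanced against
  gradients of order one over the scale.\<close>

lemma l2_rtbox:
  fixes f :: "pt \<Rightarrow> 'v::{second_countable_topology,real_normed_vector}"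
  assumes f [measurable]: "f \<in> borel_measurable borel" and B: "\<And>x. x \<in> Zset \<Longrightarrow> norm (f x) \<le> B"
    and s: "\<And>x. x \<in> Zset \<Longrightarrow> x \<notin> rtbox r1 r2 t1 t2 \<Longrightarrow> f x = 0" and le: "r1 \<le> r2" "t1 \<le> t2"
  shows "l2 MZ f" and "nrm MZ f \<le> sqrt ((r2 - r1) * (t2 - t1) * (2 * pi)) * B"
proof -
  let ?S = "rtbox r1 r2 t1 t2"
  have fin: "emeasure MZ ?S < \<infinity>"
    using emeasure_MZ_rtbox[OF le] le_less_trans by fastforce
  have i: "integrable MZ (\<lambda>x. (norm (f x))\<^sup>2)"
  proof (rule integrableI_bounded_set[where A="?S" and B="B\<^sup>2"])
    show "AE x in MZ. x \<in> ?S \<longrightarrow> norm ((norm (f x))\<^sup>2) \<le> B\<^sup>2"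
      by (rule AE_MZ_I) (auto intro!: power_mono B)
    show "AE x in MZ. x \<notin> ?S \<longrightarrow> (norm (f x))\<^sup>2 = 0"
      by (rule AE_MZ_I) (auto simp: s)
  qed (use fin in auto)
  then show l: "l2 MZ f" by (simp add: l2_def)
  have B0: "B \<ge> 0" using order.trans[OF norm_ge_zero B[of "(0, 0, 0)"]] by (simp add: Zset_def)
  have "(nrm MZ f)\<^sup>2 \<le> (LINT x|MZ. indicator ?S x *\<^sub>R B\<^sup>2)"
    unfolding nrm_sq
  proof (rule integral_mono_AE[OF i])
    show "integrable MZ (\<lambda>x. indicator ?S x *\<^sub>R B\<^sup>2)"
      using fin by (intro integrable_scaleR_left integrable_real_indicator) auto
    show "AE x in MZ. (norm (f x))\<^sup>2 \<le> indicator ?S x *\<^sub>R B\<^sup>2"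
      by (rule AE_MZ_I) (auto intro!: power_mono B simp: indicator_def s)
  qed
  also have "\<dots> = measure MZ ?S * B\<^sup>2" using fin by simp
  also have "\<dots> \<le> ((r2 - r1) * (t2 - t1) * (2 * pi)) * B\<^sup>2"
    using le by (intro mult_right_mono) (auto simp: measure_def intro!: enn2real_leI emeasure_MZ_rtbox)
  also have "\<dots> = (sqrt ((r2 - r1) * (t2 - t1) * (2 * pi)) * B)\<^sup>2"
    using le by (simp add: power_mult_distrib)
  finally show "nrm MZ f \<le> sqrt ((r2 - r1) * (t2 - t1) * (2 * pi)) * B"
    by (rule power2_le_imp_le) (use le B0 in auto)
qed

text \<open>Bounded on \<open>Zset\<close>, with bounded support in \<open>r\<close>, the only
  unbounded direction. Unlike continuity with compact support this survives multiplication by merely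
  measurable bounded coefficients, and it gives integrability as well as square
  integrability.\<close>

definition BC :: "(pt \<Rightarrow> complex) \<Rightarrow> bool" where
  "BC f \<longleftrightarrow> f \<in> borel_measurable borel \<and> (\<exists>B R. \<forall>x\<in>Zset. norm (f x) \<le> B \<and> (\<bar>fst x\<bar> > R \<longrightarrow> f x = 0))"

lemma BC_I: "f \<in> borel_measurable borel \<Longrightarrow> (\<And>x. x \<in> Zset \<Longrightarrow> norm (f x) \<le> B) \<Longrightarrow>
    (\<And>x. x \<in> Zset \<Longrightarrow> \<bar>fst x\<bar> > R \<Longrightarrow> f x = 0) \<Longrightarrow> BC f"
  unfolding BC_def by (intro conjI exI[of _ B] exI[of _ R]) auto

lemma BC_add:
  assumes "BC f" "BC g" shows "BC (\<lambda>x. f x + g x)"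
proof -
  obtain B R where B: "\<forall>x\<in>Zset. norm (f x) \<le> B \<and> (\<bar>fst x\<bar> > R \<longrightarrow> f x = 0)" using assms(1) unfolding BC_def by auto
  obtain C S where C: "\<forall>x\<in>Zset. norm (g x) \<le> C \<and> (\<bar>fst x\<bar> > S \<longrightarrow> g x = 0)" using assms(2) unfolding BC_def by auto
  show ?thesis
  proof (rule BC_I)
    show "(\<lambda>x. f x + g x) \<in> borel_measurable borel" using assms by (auto simp: BC_def)
    show "norm (f x + g x) \<le> B + C" if "x \<in> Zset" for x
      using B C that by (intro order.trans[OF norm_triangle_ineq] add_mono) auto
    show "f x + g x = 0" if "x \<in> Zset" "\<bar>fst x\<bar> > max R S" for x using B C that by auto
  qed
qed

lemma BC_mult:
  assumes c: "c \<in> borel_measurable borel" "\<And>x. x \<in> Zset \<Longrightarrow> norm (c x) \<le> C" and f: "BC f"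
  shows "BC (\<lambda>x. c x * f x)"
proof -
  obtain B R where B: "\<forall>x\<in>Zset. norm (f x) \<le> B \<and> (\<bar>fst x\<bar> > R \<longrightarrow> f x = 0)" using f unfolding BC_def by auto
  show ?thesis
  proof (rule BC_I)
    show "(\<lambda>x. c x * f x) \<in> borel_measurable borel" using c f by (auto simp: BC_def)
    show "norm (c x * f x) \<le> C * B" if "x \<in> Zset" for x
      unfolding norm_mult using B c(2)[OF that] that order.trans[OF norm_ge_zero c(2)[OF that]]
      by (intro mult_mono) auto
    show "c x * f x = 0" if "x \<in> Zset" "\<bar>fst x\<bar> > R" for x using B that by auto
  qed
qed

lemma norm_bisp_le_sum: "norm (v :: bisp) \<le> (\<Sum>i\<in>UNIV. norm (v $ i))"
  unfolding norm_vec_def by (rule L2_set_le_sum) auto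

lemma BC_l2:
  assumes "\<And>i. BC (\<lambda>x. F x $ i)" shows "l2 MZ (F :: field4)"
proof -
  have "\<forall>i. \<exists>B R. \<forall>x\<in>Zset. norm (F x $ i) \<le> B \<and> (\<bar>fst x\<bar> > R \<longrightarrow> F x $ i = 0)"
    using assms unfolding BC_def by blast
  then obtain B where "\<forall>i. \<exists>R. \<forall>x\<in>Zset. norm (F x $ i) \<le> B i \<and> (\<bar>fst x\<bar> > R \<longrightarrow> F x $ i = 0)"
    by (auto dest!: choice)
  then obtain R where BR: "\<forall>i. \<forall>x\<in>Zset. norm (F x $ i) \<le> B i \<and> (\<bar>fst x\<bar> > R i \<longrightarrow> F x $ i = 0)"
    by (auto dest!: choice)
  define S where "S = (\<Sum>i\<in>UNIV. \<bar>R i\<bar>)"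
  have S: "S \<ge> 0" unfolding S_def by (rule sum_nonneg) simp
  have RS: "R i \<le> S" for i
  proof -
    have "\<bar>R i\<bar> \<le> S" unfolding S_def by (rule member_le_sum) auto
    then show ?thesis by simp
  qed
  show ?thesis
  proof (rule l2_rtbox(1))
    show "F \<in> borel_measurable borel" by (rule vec_measurableI) (use assms in \<open>auto simp: BC_def\<close>)
    show "norm (F x) \<le> (\<Sum>i\<in>UNIV. B i)" if "x \<in> Zset" for x
      using BR that by (intro order.trans[OF norm_bisp_le_sum sum_mono]) auto
    show "F x = 0" if "x \<in> Zset" "x \<notin> rtbox (-S) S 0 pi" for x
    proof -
      obtain r \<theta> \<phi> where x: "x = (r, \<theta>, \<phi>)" by (metis prod_cases3)
      have rS: "\<bar>r\<bar> > S" using that by (auto simp: x Zset_def rtbox_def)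
      have "F x $ i = 0" for i
      proof -
        have "\<bar>fst x\<bar> > R i" using rS RS[of i] by (simp add: x)
        then show ?thesis using BR that(1) by blast
      qed
      then show ?thesis by (simp add: vec_eq_iff)
    qed
  qed (use S in auto)
qed

text \<open>Differentiability of a first derivative implies its continuity, so lists of length at
  most one are all that is extracted from \<open>smooth_on\<close>.\<close>

lemma Dom_derivatives:
  assumes "\<psi> \<in> Dom"
  shows "continuous_on UNIV \<psi>" "continuous_on UNIV (d_r \<psi>)" "continuous_on UNIV (d_theta \<psi>)" "continuous_on UNIV (d_phi \<psi>)"
    and "\<psi> differentiable (at x)"
proof -
  have s: "iter_deriv \<psi> vs differentiable_on UNIV" for vs using assms by (simp add: Dom_def smooth_on_def)
  then have c: "continuous_on UNIV (iter_deriv \<psi> vs)" for vs by (rule differentiable_imp_continuous_on)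
  show "continuous_on UNIV \<psi>" "continuous_on UNIV (d_r \<psi>)" "continuous_on UNIV (d_theta \<psi>)" "continuous_on UNIV (d_phi \<psi>)"
    using c[of "[]"] c[of "[(1,0,0)]"] c[of "[(0,1,0)]"] c[of "[(0,0,1)]"]
    by (simp_all add: d_r_def[abs_def] d_theta_def[abs_def] d_phi_def[abs_def])
  show "\<psi> differentiable (at x)" using s[of "[]"] unfolding differentiable_on_def by (metis UNIV_I iter_deriv.simps(1))
qed

lemma Dom_support:
  assumes "\<psi> \<in> Dom"
  shows "\<exists>K. compact K \<and> K \<subseteq> RTstar \<and> (\<forall>r \<theta> \<phi>. (r, \<theta>) \<notin> K \<longrightarrow> \<psi> (r, \<theta>, \<phi>) = 0
    \<and> d_r \<psi> (r, \<theta>, \<phi>) = 0 \<and> d_theta \<psi> (r, \<theta>, \<phi>) = 0 \<and> d_phi \<psi> (r, \<theta>, \<phi>) = 0)"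
proof -
  obtain K where K: "compact K" "K \<subseteq> RTstar" "\<And>r \<theta> \<phi>. (r, \<theta>) \<notin> K \<Longrightarrow> \<psi> (r, \<theta>, \<phi>) = 0"
    using assms by (auto simp: Dom_def)
  have z: "frechet_derivative \<psi> (at (r, \<theta>, \<phi>)) v = 0" if "(r, \<theta>) \<notin> K" for r \<theta> \<phi> v
  proof -
    have o: "open ((\<lambda>x :: pt. (fst x, fst (snd x))) -` (- K))"
      by (intro open_vimage continuous_intros) (use K in \<open>auto intro: compact_imp_closed simp: open_closed\<close>)
    have "((\<lambda>_. 0 :: bisp) has_derivative (\<lambda>_. 0)) (at (r, \<theta>, \<phi>))" by simp
    then have "(\<psi> has_derivative (\<lambda>_. 0)) (at (r, \<theta>, \<phi>))"
      by (rule has_derivative_transform_within_open[OF _ o]) (use that K(3) in auto)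
    from frechet_derivative_at[OF this] show ?thesis by metis
  qed
  show ?thesis by (rule exI[of _ K]) (use K z in \<open>auto simp: d_r_def d_theta_def d_phi_def\<close>)
qed

lemma BC_compact_support:
  fixes f :: field4
  assumes c: "continuous_on UNIV f" and K: "compact K" "\<And>r \<theta> \<phi>. (r, \<theta>) \<notin> K \<Longrightarrow> f (r, \<theta>, \<phi>) = 0"
  shows "BC (\<lambda>x. f x $ i)"
proof -
  have m: "(\<lambda>x. f x $ i) \<in> borel_measurable borel"
    using vec_nth_measurable[OF borel_measurable_continuous_onI[OF c]] .
  define L where "L = (\<lambda>(p, \<phi>). (fst p, snd p, \<phi>)) ` (K \<times> {0..2*pi})"
  have "compact L" unfolding L_def case_prod_unfold
    by (intro compact_continuous_image continuous_intros compact_Times K) auto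
  then have "bounded (f ` L)"
    by (intro compact_imp_bounded compact_continuous_image continuous_on_subset[OF c]) auto
  then obtain B where B: "B > 0" "\<And>x. x \<in> L \<Longrightarrow> norm (f x) \<le> B" by (auto simp: bounded_pos)
  have "norm (f x $ i) \<le> B" if x: "x \<in> Zset" for x
  proof -
    obtain r \<theta> \<phi> where p: "x = (r, \<theta>, \<phi>)" by (metis prod_cases3)
    have "norm (f x) \<le> B"
    proof (cases "(r, \<theta>) \<in> K")
      case True
      then have "x \<in> L" using x by (force simp: L_def p Zset_def)
      then show ?thesis by (rule B)
    qed (use B K(2) p in simp)
    then show ?thesis using Finite_Cartesian_Product.norm_nth_le[of "f x" i] by (rule order.trans[rotated])
  qed
  moreover obtain R where R: "\<And>p. p \<in> K \<Longrightarrow> norm p \<le> R" using compact_imp_bounded[OF K(1)] by (auto simp: bounded_iff)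
  have "f x $ i = 0" if "\<bar>fst x\<bar> > R" for x
  proof -
    obtain r \<theta> \<phi> where p: "x = (r, \<theta>, \<phi>)" by (metis prod_cases3)
    have "(r, \<theta>) \<notin> K" using R[of "(r, \<theta>)"] that norm_fst_le[of r \<theta>] by (auto simp: p)
    then show ?thesis using K(2) p by simp
  qed
  ultimately show ?thesis using m by (intro BC_I) auto
qed

text \<open>Away from the ring \<open>absrho\<close> cancels against the denominator of
  \<open>A0t\<close>, and \<open>\<bar>r\<bar> \<le> varpi\<close> together with
  \<open>\<bar>a\<bar> \<le> varpi\<close> bounds the rest. On the ring the factor
  \<open>absrho\<close> makes the term 0.\<close>

lemma absrho_potential:
  assumes "a \<noteq> 0"
  shows "\<bar>e * absrho a r \<theta> * A0t a Q r \<theta> / varpi a r\<bar> \<le> \<bar>e * Q\<bar> / \<bar>a\<bar>"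
proof (cases "absrho a r \<theta> = 0")
  case False
  have v: "varpi a r > 0" by (rule varpi_pos[OF assms])
  have rv: "\<bar>r\<bar> \<le> varpi a r" unfolding varpi_def by (rule real_le_rsqrt) simp
  have "\<bar>e * absrho a r \<theta> * A0t a Q r \<theta> / varpi a r\<bar> = \<bar>e * Q\<bar> * (\<bar>r\<bar> / varpi a r) * (1 / varpi a r)"
    using False v by (simp add: A0t_def abs_mult abs_divide)
  also have "\<dots> \<le> \<bar>e * Q\<bar> * 1 * (1 / \<bar>a\<bar>)"
    using v rv inverse_varpi_le[OF assms, of r] by (intro mult_mono) auto
  finally show ?thesis by simp
qed simp

lemma rho_le_varpi: "norm (rho a r \<theta>) \<le> varpi a r"
proof -
  have "a\<^sup>2 * (cos \<theta>)\<^sup>2 \<le> a\<^sup>2 * 1" by (intro mult_left_mono) (auto simp: abs_square_le_1)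
  then show ?thesis unfolding rho_def varpi_def cmod_def by (simp add: power_mult_distrib)
qed

lemma borel_measurable_of_real_comp:
  "f \<in> borel_measurable M \<Longrightarrow> (\<lambda>x. complex_of_real (f x)) \<in> borel_measurable M"
  by (rule measurable_compose[OF _ borel_measurable_continuous_onI]) (auto intro: continuous_intros)

lemma coefficients_measurable [measurable]:
  "(\<lambda>x::pt. fst x) \<in> borel_measurable borel"
  "(\<lambda>x::pt. varpi a (fst x)) \<in> borel_measurable borel"
  "(\<lambda>x::pt. absrho a (fst x) (fst (snd x))) \<in> borel_measurable borel"
  "(\<lambda>x::pt. rho a (fst x) (fst (snd x))) \<in> borel_measurable borel"
  "(\<lambda>x::pt. sin (fst (snd x))) \<in> borel_measurable borel"
proof -
  have "(\<lambda>x::pt. rho a (fst x) (fst (snd x))) = (\<lambda>x. of_real (fst x) + \<i> * of_real (a * cos (fst (snd x))))"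
    by (auto simp: rho_def complex_eq_iff)
  moreover have "(\<lambda>x::pt. of_real (fst x) + \<i> * of_real (a * cos (fst (snd x)))) \<in> borel_measurable borel"
    by (intro borel_measurable_continuous_onI continuous_intros)
  ultimately show "(\<lambda>x::pt. rho a (fst x) (fst (snd x))) \<in> borel_measurable borel" by simp
qed (unfold varpi_def absrho_def, (intro borel_measurable_continuous_onI continuous_intros)+)

lemma Dom_BC:
  assumes "\<psi> \<in> Dom"
  shows "BC (\<lambda>x. \<psi> x $ i)" "BC (\<lambda>x. d_r \<psi> x $ i)" "BC (\<lambda>x. d_theta \<psi> x $ i)" "BC (\<lambda>x. d_phi \<psi> x $ i)"
  using Dom_support[OF assms] BC_compact_support[OF Dom_derivatives(1)[OF assms]] BC_compact_support[OF Dom_derivatives(2)[OF assms]]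
    BC_compact_support[OF Dom_derivatives(3)[OF assms]] BC_compact_support[OF Dom_derivatives(4)[OF assms]] by auto

text \<open>The cosecant is unbounded on \<open>Zset\<close>, but bounded on the compact support,
  which avoids the poles; this is where the support condition of \<open>Dom\<close> controls the
  coefficients.\<close>

lemma csc_d_phi_BC:
  assumes \<psi>: "\<psi> \<in> Dom"
  shows "BC (\<lambda>x. of_real (1 / sin (fst (snd x))) * d_phi \<psi> x $ i)"
proof -
  obtain K where K: "compact K" "K \<subseteq> RTstar"
    "\<And>r \<theta> \<phi>. (r, \<theta>) \<notin> K \<Longrightarrow> d_phi \<psi> (r, \<theta>, \<phi>) = 0" using Dom_support[OF \<psi>] by auto
  have "continuous_on K (\<lambda>p. 1 / sin (snd p))"
  proof (intro continuous_intros)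
    show "\<forall>p\<in>K. sin (snd p) \<noteq> 0"
    proof
      fix p assume "p \<in> K"
      then have "0 < snd p" "snd p < pi" using K(2) by (auto simp: RTstar_def)
      then show "sin (snd p) \<noteq> 0" using sin_gt_zero[of "snd p"] by simp
    qed
  qed
  then have "bounded ((\<lambda>p. 1 / sin (snd p)) ` K)"
    by (intro compact_imp_bounded compact_continuous_image K(1))
  then obtain B where B: "\<And>p. p \<in> K \<Longrightarrow> \<bar>1 / sin (snd p)\<bar> \<le> B" by (auto simp: bounded_iff)
  \<comment> \<open>A globally bounded measurable substitute for the cosecant, equal to it wherever
    the derivative can be nonzero.\<close>
  define q where "q x = (if \<bar>1 / sin (fst (snd x))\<bar> \<le> B then complex_of_real (1 / sin (fst (snd x))) else 0)" for x :: pt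
  have "(\<lambda>x. of_real (1 / sin (fst (snd x))) * d_phi \<psi> x $ i) = (\<lambda>x. q x * d_phi \<psi> x $ i)"
  proof
    fix x :: pt
    obtain r \<theta> \<phi> where p: "x = (r, \<theta>, \<phi>)" by (metis prod_cases3)
    show "of_real (1 / sin (fst (snd x))) * d_phi \<psi> x $ i = q x * d_phi \<psi> x $ i"
      using B[of "(r, \<theta>)"] K(3)[of r \<theta> \<phi>] by (cases "(r, \<theta>) \<in> K") (auto simp: q_def p)
  qed
  moreover have "BC (\<lambda>x. q x * d_phi \<psi> x $ i)"
  proof (rule BC_mult[OF _ _ Dom_BC(4)[OF \<psi>]])
    show "q \<in> borel_measurable borel" unfolding q_def[abs_def] by measurable
    show "norm (q x) \<le> \<bar>B\<bar>" for x by (auto simp: q_def norm_divide)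
  qed
  ultimately show ?thesis by simp
qed

lemma frakH_BC:
  assumes a: "a \<noteq> 0" and \<psi>: "\<psi> \<in> Dom"
  shows "BC (\<lambda>x. frakH a m e Q \<psi> x $ i)"
proof -
  note b = Dom_BC[OF \<psi>] and csc = csc_d_phi_BC[OF \<psi>]
  have v: "0 < varpi a r" "1 / varpi a r \<le> 1 / \<bar>a\<bar>" for r using varpi_pos[OF a] inverse_varpi_le[OF a] by auto
  have w: "BC (\<lambda>x. of_real (1 / varpi a (fst x)) * f x)" if "BC f" for f
  proof (rule BC_mult[OF _ _ that, of _ "1 / \<bar>a\<bar>"])
    show "norm (complex_of_real (1 / varpi a (fst x))) \<le> 1 / \<bar>a\<bar>" for x :: pt
      using v(1)[of "fst x"] v(2)[of "fst x"] by (simp add: norm_divide)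
  qed measurable
  have w2: "BC (\<lambda>x. of_real (a / varpi a (fst x)) * f x)" if "BC f" for f
  proof (rule BC_mult[OF _ _ that, of _ 1])
    show "norm (complex_of_real (a / varpi a (fst x))) \<le> 1" for x :: pt
      using mult_left_mono[OF v(2)[of "fst x"], of "\<bar>a\<bar>"] v(1)[of "fst x"] a by (simp add: norm_divide)
  qed measurable
  have pot: "BC (\<lambda>x. of_real (e * absrho a (fst x) (fst (snd x)) * A0t a Q (fst x) (fst (snd x)) / varpi a (fst x)) * f x)" if "BC f" for f
  proof (rule BC_mult[OF _ _ that])
    show "(\<lambda>x::pt. complex_of_real (e * absrho a (fst x) (fst (snd x)) * A0t a Q (fst x) (fst (snd x)) / varpi a (fst x))) \<in> borel_measurable borel"
      unfolding A0t_def
      by (rule borel_measurable_of_real_comp, intro borel_measurable_divide borel_measurable_times borel_measurable_uminus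
          coefficients_measurable borel_measurable_const)
    show "norm (complex_of_real (e * absrho a (fst x) (fst (snd x)) * A0t a Q (fst x) (fst (snd x)) / varpi a (fst x))) \<le> \<bar>e * Q\<bar> / \<bar>a\<bar>" for x :: pt
      unfolding norm_of_real by (rule absrho_potential[OF a])
  qed
  have mr: "norm (of_real (m / varpi a r) * rho a r \<theta>) \<le> \<bar>m\<bar>" for r \<theta>
  proof -
    have "norm (of_real (m / varpi a r) * rho a r \<theta>) = \<bar>m\<bar> * (norm (rho a r \<theta>) / varpi a r)"
      using v(1)[of r] by (simp add: norm_mult norm_divide)
    also have "\<dots> \<le> \<bar>m\<bar> * 1" using v(1)[of r] rho_le_varpi[of a r \<theta>] by (intro mult_left_mono) auto
    finally show ?thesis by simp
  qed
  have mass: "BC (\<lambda>x. of_real (m / varpi a (fst x)) * rho a (fst x) (fst (snd x)) * f x)"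
    "BC (\<lambda>x. of_real (m / varpi a (fst x)) * cnj (rho a (fst x) (fst (snd x))) * f x)" if "BC f" for f
    by (rule BC_mult[OF _ _ that, of _ "\<bar>m\<bar>"], measurable, use mr in \<open>simp add: norm_mult norm_divide\<close>)+
  have k: "BC (\<lambda>x. k * f x)" if "BC f" for f k by (rule BC_mult[OF _ _ that, of _ "norm k"]) auto
  have neg: "BC (\<lambda>x. - f x)" if "BC f" for f using k[OF that, of "-1"] by simp
  have "frakH a m e Q \<psi> = (\<lambda>x. frakH a m e Q \<psi> (fst x, fst (snd x), snd (snd x)))" by simp
  consider "i = 1" | "i = 2" | "i = 3" | "i = 4" using exhaust_4[of i] by blast
  then show ?thesis
  proof cases
    case 1
    have "BC (\<lambda>x. - \<i> * (d_r \<psi> x $ 1 + of_real (1 / varpi a (fst x)) * (d_theta \<psi> x $ 2 + of_real (a / varpi a (fst x)) * d_phi \<psi> x $ 1 + (- \<i>) * (of_real (1 / sin (fst (snd x))) * d_phi \<psi> x $ 2)))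
      + of_real (e * absrho a (fst x) (fst (snd x)) * A0t a Q (fst x) (fst (snd x)) / varpi a (fst x)) * \<psi> x $ 1 + of_real (m / varpi a (fst x)) * cnj (rho a (fst x) (fst (snd x))) * \<psi> x $ 3)"
      by (intro BC_add k w w2 csc pot mass b)
    moreover have "frakH a m e Q \<psi> x $ 1 = - \<i> * (d_r \<psi> x $ 1 + of_real (1 / varpi a (fst x)) * (d_theta \<psi> x $ 2 + of_real (a / varpi a (fst x)) * d_phi \<psi> x $ 1 + (- \<i>) * (of_real (1 / sin (fst (snd x))) * d_phi \<psi> x $ 2)))
      + of_real (e * absrho a (fst x) (fst (snd x)) * A0t a Q (fst x) (fst (snd x)) / varpi a (fst x)) * \<psi> x $ 1 + of_real (m / varpi a (fst x)) * cnj (rho a (fst x) (fst (snd x))) * \<psi> x $ 3" for x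
      using frakH_components(1)[OF a, of m e Q \<psi> "fst x" "fst (snd x)" "snd (snd x)"] by simp
    ultimately show ?thesis using 1 by presburger
  next
    case 2
    have "BC (\<lambda>x. - \<i> * (- d_r \<psi> x $ 2 + of_real (1 / varpi a (fst x)) * (d_theta \<psi> x $ 1 + of_real (a / varpi a (fst x)) * d_phi \<psi> x $ 2 + \<i> * (of_real (1 / sin (fst (snd x))) * d_phi \<psi> x $ 1)))
      + of_real (e * absrho a (fst x) (fst (snd x)) * A0t a Q (fst x) (fst (snd x)) / varpi a (fst x)) * \<psi> x $ 2 + of_real (m / varpi a (fst x)) * cnj (rho a (fst x) (fst (snd x))) * \<psi> x $ 4)"
      by (intro BC_add k neg w w2 csc pot mass b)
    moreover have "frakH a m e Q \<psi> x $ 2 = - \<i> * (- d_r \<psi> x $ 2 + of_real (1 / varpi a (fst x)) * (d_theta \<psi> x $ 1 + of_real (a / varpi a (fst x)) * d_phi \<psi> x $ 2 + \<i> * (of_real (1 / sin (fst (snd x))) * d_phi \<psi> x $ 1)))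
      + of_real (e * absrho a (fst x) (fst (snd x)) * A0t a Q (fst x) (fst (snd x)) / varpi a (fst x)) * \<psi> x $ 2 + of_real (m / varpi a (fst x)) * cnj (rho a (fst x) (fst (snd x))) * \<psi> x $ 4" for x
      using frakH_components(2)[OF a, of m e Q \<psi> "fst x" "fst (snd x)" "snd (snd x)"] by simp
    ultimately show ?thesis using 2 by presburger
  next
    case 3
    have "BC (\<lambda>x. - \<i> * (- d_r \<psi> x $ 3 + of_real (1 / varpi a (fst x)) * (- d_theta \<psi> x $ 4 + of_real (a / varpi a (fst x)) * d_phi \<psi> x $ 3 + \<i> * (of_real (1 / sin (fst (snd x))) * d_phi \<psi> x $ 4)))
      + of_real (e * absrho a (fst x) (fst (snd x)) * A0t a Q (fst x) (fst (snd x)) / varpi a (fst x)) * \<psi> x $ 3 + of_real (m / varpi a (fst x)) * rho a (fst x) (fst (snd x)) * \<psi> x $ 1)"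
      by (intro BC_add k neg w w2 csc pot mass b)
    moreover have "frakH a m e Q \<psi> x $ 3 = - \<i> * (- d_r \<psi> x $ 3 + of_real (1 / varpi a (fst x)) * (- d_theta \<psi> x $ 4 + of_real (a / varpi a (fst x)) * d_phi \<psi> x $ 3 + \<i> * (of_real (1 / sin (fst (snd x))) * d_phi \<psi> x $ 4)))
      + of_real (e * absrho a (fst x) (fst (snd x)) * A0t a Q (fst x) (fst (snd x)) / varpi a (fst x)) * \<psi> x $ 3 + of_real (m / varpi a (fst x)) * rho a (fst x) (fst (snd x)) * \<psi> x $ 1" for x
      using frakH_components(3)[OF a, of m e Q \<psi> "fst x" "fst (snd x)" "snd (snd x)"] by simp
    ultimately show ?thesis using 3 by presburger
  next
    case 4
    have "BC (\<lambda>x. - \<i> * (d_r \<psi> x $ 4 + of_real (1 / varpi a (fst x)) * (- d_theta \<psi> x $ 3 + of_real (a / varpi a (fst x)) * d_phi \<psi> x $ 4 + (- \<i>) * (of_real (1 / sin (fst (snd x))) * d_phi \<psi> x $ 3)))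
      + of_real (e * absrho a (fst x) (fst (snd x)) * A0t a Q (fst x) (fst (snd x)) / varpi a (fst x)) * \<psi> x $ 4 + of_real (m / varpi a (fst x)) * rho a (fst x) (fst (snd x)) * \<psi> x $ 2)"
      by (intro BC_add k neg w w2 csc pot mass b)
    moreover have "frakH a m e Q \<psi> x $ 4 = - \<i> * (d_r \<psi> x $ 4 + of_real (1 / varpi a (fst x)) * (- d_theta \<psi> x $ 3 + of_real (a / varpi a (fst x)) * d_phi \<psi> x $ 4 + (- \<i>) * (of_real (1 / sin (fst (snd x))) * d_phi \<psi> x $ 3)))
      + of_real (e * absrho a (fst x) (fst (snd x)) * A0t a Q (fst x) (fst (snd x)) / varpi a (fst x)) * \<psi> x $ 4 + of_real (m / varpi a (fst x)) * rho a (fst x) (fst (snd x)) * \<psi> x $ 2" for x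
      using frakH_components(4)[OF a, of m e Q \<psi> "fst x" "fst (snd x)" "snd (snd x)"] by simp
    ultimately show ?thesis using 4 by presburger
  qed
qed

lemma frakH_l2: "a \<noteq> 0 \<Longrightarrow> \<psi> \<in> Dom \<Longrightarrow> l2 MZ (frakH a m e Q \<psi>)"
  by (intro BC_l2 frakH_BC)

lemma Dom_l2: "\<psi> \<in> Dom \<Longrightarrow> l2 MZ \<psi>"
  by (intro BC_l2 Dom_BC)

section \<open>The closure of the massless operator\<close>

text \<open>The closure of the massless operator on \<open>DT\<close>, encoded by approximability
  instead of sequences. It is built to accommodate the separated eigenfields, whose supports may
  reach the poles and the ring and which then lie outside \<open>DT\<close>.\<close>

definition clg :: "real \<Rightarrow> real \<Rightarrow> (field4 \<times> field4) set" where
  "clg a e = {(x, y). l2 MZ x \<and> l2 MZ y \<and> (\<forall>\<epsilon>>0. \<exists>\<psi>\<in>DT. nrm MZ (\<lambda>p. \<psi> p - x p) < \<epsilon>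
      \<and> nrm MZ (\<lambda>p. frakH a 0 e 0 \<psi> p - y p) < \<epsilon>)}"

lemma DT_Dom: "\<psi> \<in> DT \<Longrightarrow> \<psi> \<in> Dom"
  by (simp add: DT_def)

lemma zero_DT: "(\<lambda>_. 0) \<in> DT"
proof -
  have "(\<lambda>_. 0) \<in> Dom"
    unfolding Dom_def using TT_smooth[OF TT_base[of "\<lambda>_. 0" "\<lambda>_. 0" "\<lambda>_. 0" 0]] Cinf_const[of UNIV "0::complex"]
    by (auto simp: case_prod_unfold intro!: exI[of _ "{}"])
  moreover have "TT (\<lambda>_. 0)"
    using TT_base[of "\<lambda>_. 0" "\<lambda>_. 0" "\<lambda>_. 0" 0] Cinf_const[of UNIV "0::complex"] by (simp add: case_prod_unfold)
  ultimately show ?thesis by (simp add: DT_def)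
qed

lemma frakH_DT_add:
  assumes "a \<noteq> 0" "\<psi> \<in> DT" "\<eta> \<in> DT"
  shows "frakH a m e Q (\<lambda>x. \<psi> x + \<eta> x) = (\<lambda>x. frakH a m e Q \<psi> x + frakH a m e Q \<eta> x)"
  by (rule ext, rule frakH_add) (use assms in \<open>auto intro!: Dom_derivatives(5) DT_Dom\<close>)

lemma frakH_DT_smult:
  assumes "a \<noteq> 0" "\<psi> \<in> DT"
  shows "frakH a m e Q (\<lambda>x. c *s \<psi> x) = (\<lambda>x. c *s frakH a m e Q \<psi> x)"
  by (rule ext, rule frakH_smult) (use assms in \<open>auto intro!: Dom_derivatives(5) DT_Dom\<close>)

lemma nrm_diff_add_le:
  assumes "l2 M f" "l2 M g" "l2 M u" "l2 M v"
  shows "nrm M (\<lambda>p. (f p + g p) - (u p + v p)) \<le> nrm M (\<lambda>p. f p - u p) + nrm M (\<lambda>p. g p - v p)"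
proof -
  have "(\<lambda>p. (f p + g p) - (u p + v p)) = (\<lambda>p. (f p - u p) + (g p - v p))" by (auto simp: algebra_simps)
  then show ?thesis using nrm_triangle[OF l2_diff[OF assms(1,3)] l2_diff[OF assms(2,4)]] by simp
qed

context
  fixes a e :: real
  assumes a: "a \<noteq> 0"
begin

lemma clg_l2: "(x, y) \<in> clg a e \<Longrightarrow> l2 MZ x" "(x, y) \<in> clg a e \<Longrightarrow> l2 MZ y"
  by (auto simp: clg_def)

lemma clg_DT: "\<psi> \<in> DT \<Longrightarrow> (\<psi>, frakH a 0 e 0 \<psi>) \<in> clg a e"
  unfolding clg_def mem_Collect_eq prod.case
  by (intro conjI allI impI Dom_l2 frakH_l2[OF a] DT_Dom; (rule bexI[of _ \<psi>])?) auto

lemma clg_approx: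
  "(x, y) \<in> clg a e \<Longrightarrow> \<epsilon> > 0 \<Longrightarrow> \<exists>\<psi>\<in>DT. nrm MZ (\<lambda>p. \<psi> p - x p) < \<epsilon> \<and> nrm MZ (\<lambda>p. frakH a 0 e 0 \<psi> p - y p) < \<epsilon>"
  unfolding clg_def by blast

lemma clg_add:
  assumes "(x, y) \<in> clg a e" "(x', y') \<in> clg a e"
  shows "((\<lambda>p. x p + x' p), (\<lambda>p. y p + y' p)) \<in> clg a e"
  unfolding clg_def mem_Collect_eq prod.case
proof (intro conjI allI impI)
  fix \<epsilon> :: real assume e: "\<epsilon> > 0"
  then have e2: "\<epsilon> / 2 > 0" by simp
  obtain \<psi> where p: "\<psi> \<in> DT" "nrm MZ (\<lambda>p. \<psi> p - x p) < \<epsilon> / 2" "nrm MZ (\<lambda>p. frakH a 0 e 0 \<psi> p - y p) < \<epsilon> / 2"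
    using clg_approx[OF assms(1) e2] by blast
  obtain \<eta> where n: "\<eta> \<in> DT" "nrm MZ (\<lambda>p. \<eta> p - x' p) < \<epsilon> / 2" "nrm MZ (\<lambda>p. frakH a 0 e 0 \<eta> p - y' p) < \<epsilon> / 2"
    using clg_approx[OF assms(2) e2] by blast
  note l = Dom_l2[OF DT_Dom[OF p(1)]] Dom_l2[OF DT_Dom[OF n(1)]] frakH_l2[OF a DT_Dom[OF p(1)]] frakH_l2[OF a DT_Dom[OF n(1)]]
    clg_l2[OF assms(1)] clg_l2[OF assms(2)]
  show "\<exists>\<psi>\<in>DT. nrm MZ (\<lambda>p. \<psi> p - (x p + x' p)) < \<epsilon> \<and> nrm MZ (\<lambda>p. frakH a 0 e 0 \<psi> p - (y p + y' p)) < \<epsilon>"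
  proof (intro bexI conjI)
    show "(\<lambda>p. \<psi> p + \<eta> p) \<in> DT" by (rule DT_add[OF p(1) n(1)])
    show "nrm MZ (\<lambda>q. (\<psi> q + \<eta> q) - (x q + x' q)) < \<epsilon>"
      by (rule le_less_trans[OF nrm_diff_add_le]) (use l p n in auto)
    show "nrm MZ (\<lambda>q. frakH a 0 e 0 (\<lambda>p. \<psi> p + \<eta> p) q - (y q + y' q)) < \<epsilon>"
      unfolding frakH_DT_add[OF a p(1) n(1)]
      by (rule le_less_trans[OF nrm_diff_add_le]) (use l p n in auto)
  qed
qed (use assms in \<open>auto intro: l2_add clg_l2\<close>)

lemma clg_smult:
  assumes "(x, y) \<in> clg a e"
  shows "((\<lambda>p. c *s x p), (\<lambda>p. c *s y p)) \<in> clg a e"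
  unfolding clg_def mem_Collect_eq prod.case
proof (intro conjI allI impI)
  fix \<epsilon> :: real assume e: "\<epsilon> > 0"
  then have e2: "\<epsilon> / (norm c + 1) > 0" by (simp add: add_nonneg_pos)
  obtain \<psi> where p: "\<psi> \<in> DT" "nrm MZ (\<lambda>p. \<psi> p - x p) < \<epsilon> / (norm c + 1)" "nrm MZ (\<lambda>p. frakH a 0 e 0 \<psi> p - y p) < \<epsilon> / (norm c + 1)"
    using clg_approx[OF assms(1) e2] by blast
  have s: "nrm MZ (\<lambda>p. c *s f p - c *s g p) < \<epsilon>" if "nrm MZ (\<lambda>p. f p - g p) < \<epsilon> / (norm c + 1)" for f g :: field4
  proof -
    have "nrm MZ (\<lambda>p. c *s f p - c *s g p) = norm c * nrm MZ (\<lambda>p. f p - g p)"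
      unfolding nrm_smult[symmetric] by (simp add: vector_ssub_ldistrib)
    also have "\<dots> \<le> norm c * (\<epsilon> / (norm c + 1))" using that by (intro mult_left_mono) auto
    also have "\<dots> = \<epsilon> * (norm c / (norm c + 1))" by simp
    also have "\<dots> < \<epsilon> * 1" using e by (intro mult_strict_left_mono) (auto simp: add_nonneg_pos)
    finally show ?thesis by simp
  qed
  show "\<exists>\<psi>\<in>DT. nrm MZ (\<lambda>p. \<psi> p - c *s x p) < \<epsilon> \<and> nrm MZ (\<lambda>p. frakH a 0 e 0 \<psi> p - c *s y p) < \<epsilon>"
    by (rule bexI[OF _ DT_smult[OF p(1), of c]]) (auto simp: frakH_DT_smult[OF a p(1)] intro!: s p)
qed (use assms in \<open>auto intro: l2_smult clg_l2\<close>)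

lemma clg_closed:
  assumes x: "l2 MZ x" "l2 MZ y"
    and ap: "\<And>\<epsilon>. \<epsilon> > 0 \<Longrightarrow> \<exists>x' y'. (x', y') \<in> clg a e \<and> nrm MZ (\<lambda>p. x' p - x p) < \<epsilon> \<and> nrm MZ (\<lambda>p. y' p - y p) < \<epsilon>"
  shows "(x, y) \<in> clg a e"
  unfolding clg_def mem_Collect_eq prod.case
proof (intro conjI allI impI x)
  fix \<epsilon> :: real assume "\<epsilon> > 0"
  then have e2: "\<epsilon> / 2 > 0" by simp
  obtain x' y' where x': "(x', y') \<in> clg a e" "nrm MZ (\<lambda>p. x' p - x p) < \<epsilon> / 2" "nrm MZ (\<lambda>p. y' p - y p) < \<epsilon> / 2"
    using ap[OF e2] by auto
  obtain \<psi> where p: "\<psi> \<in> DT" "nrm MZ (\<lambda>p. \<psi> p - x' p) < \<epsilon> / 2" "nrm MZ (\<lambda>p. frakH a 0 e 0 \<psi> p - y' p) < \<epsilon> / 2"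
    using clg_approx[OF x'(1) e2] by blast
  have "nrm MZ (\<lambda>p. \<psi> p - x p) < \<epsilon>"
    using nrm_triangle3[OF Dom_l2[OF DT_Dom[OF p(1)]] clg_l2(1)[OF x'(1)] x(1)] p x' by linarith
  moreover have "nrm MZ (\<lambda>p. frakH a 0 e 0 \<psi> p - y p) < \<epsilon>"
    using nrm_triangle3[OF frakH_l2[OF a DT_Dom[OF p(1)], of 0 e 0] clg_l2(2)[OF x'(1)] x(2)] p x' by linarith
  ultimately show "\<exists>\<psi>\<in>DT. nrm MZ (\<lambda>p. \<psi> p - x p) < \<epsilon> \<and> nrm MZ (\<lambda>p. frakH a 0 e 0 \<psi> p - y p) < \<epsilon>"
    using p(1) by blast
qed

lemma clg_zero: "((\<lambda>_. 0), (\<lambda>_. 0)) \<in> clg a e"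
proof -
  have "frakH a 0 e 0 (\<lambda>_. 0) = (\<lambda>_. 0)" using frakH_DT_smult[OF a zero_DT, of 0 e 0 0] by simp
  then show ?thesis using clg_DT[OF zero_DT] by simp
qed

lemma clg_sum:
  assumes "\<And>j. j \<in> F \<Longrightarrow> (X j, Y j) \<in> clg a e"
  shows "((\<lambda>p. \<Sum>j\<in>F. X j p), (\<lambda>p. \<Sum>j\<in>F. Y j p)) \<in> clg a e"
  using assms by (induction F rule: infinite_finite_induct) (auto intro: clg_zero clg_add)

end

lemma l2_sum:
  assumes "\<And>j. j \<in> F \<Longrightarrow> l2 M (f j)" shows "l2 M (\<lambda>p. \<Sum>j\<in>F. f j p)"
  using assms by (induction F rule: infinite_finite_induct) (auto intro: l2_zero l2_add)

lemma nrm_sum_le: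
  assumes "\<And>j. j \<in> F \<Longrightarrow> l2 M (f j)"
  shows "nrm M (\<lambda>p. \<Sum>j\<in>F. f j p) \<le> (\<Sum>j\<in>F. nrm M (f j))"
  using assms
proof (induction F rule: infinite_finite_induct)
  case (insert i F)
  have "nrm M (\<lambda>p. f i p + (\<Sum>j\<in>F. f j p)) \<le> nrm M (f i) + nrm M (\<lambda>p. \<Sum>j\<in>F. f j p)"
    by (intro nrm_triangle l2_sum insert) auto
  then show ?case using insert by simp
qed auto

text \<open>Pythagoras: at each point at most one summand is nonzero, so \<open>n\<close> functions
  of norm at most \<open>B\<close> add up to norm at most \<open>sqrt n * B\<close> instead of
  \<open>n * B\<close>. Averaging exploits exactly this gain.\<close>

lemma nrm_sum_disjoint:
  fixes G :: "nat \<Rightarrow> field4"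
  assumes F: "finite F" and l: "\<And>j. l2 MZ (G j)" and b: "\<And>j. nrm MZ (G j) \<le> B"
    and dis: "\<And>i j p. p \<in> Zset \<Longrightarrow> i \<noteq> j \<Longrightarrow> G i p = 0 \<or> G j p = 0"
  shows "nrm MZ (\<lambda>p. \<Sum>j\<in>F. G j p) \<le> sqrt (card F) * B"
proof -
  have sq: "(norm (\<Sum>j\<in>F. G j p))\<^sup>2 = (\<Sum>j\<in>F. (norm (G j p))\<^sup>2)" if p: "p \<in> Zset" for p
  proof (cases "\<exists>k\<in>F. G k p \<noteq> 0")
    case True
    then obtain k where k: "k \<in> F" "G k p \<noteq> 0" by blast
    have z: "G j p = 0" if "j \<noteq> k" for j using dis[OF p that] k by auto
    have "(\<Sum>j\<in>F. G j p) = G k p"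
      using sum.remove[OF F k(1), of "\<lambda>j. G j p"] z by (simp add: sum.neutral)
    moreover have "(\<Sum>j\<in>F. (norm (G j p))\<^sup>2) = (norm (G k p))\<^sup>2"
      using sum.remove[OF F k(1), of "\<lambda>j. (norm (G j p))\<^sup>2"] z by (simp add: sum.neutral)
    ultimately show ?thesis by simp
  qed (simp add: sum.neutral)
  have B0: "B \<ge> 0" using b[of 0] nrm_nonneg order.trans by blast
  have "(nrm MZ (\<lambda>p. \<Sum>j\<in>F. G j p))\<^sup>2 = (LINT p|MZ. (\<Sum>j\<in>F. (norm (G j p))\<^sup>2))"
    unfolding nrm_sq
  proof (rule integral_cong_AE)
    have "(\<lambda>p. \<Sum>j\<in>F. G j p) \<in> borel_measurable MZ" using l2_sum[of F MZ G] l by (simp add: l2_def)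
    then show "(\<lambda>p. (norm (\<Sum>j\<in>F. G j p))\<^sup>2) \<in> borel_measurable MZ" by measurable
    have "G j \<in> borel_measurable MZ" for j using l by (simp add: l2_def)
    then show "(\<lambda>p. \<Sum>j\<in>F. (norm (G j p))\<^sup>2) \<in> borel_measurable MZ" by measurable
    show "AE p in MZ. (norm (\<Sum>j\<in>F. G j p))\<^sup>2 = (\<Sum>j\<in>F. (norm (G j p))\<^sup>2)"
      by (rule AE_MZ_I) (rule sq)
  qed
  also have "\<dots> = (\<Sum>j\<in>F. (nrm MZ (G j))\<^sup>2)"
    unfolding nrm_sq by (rule Bochner_Integration.integral_sum) (use l in \<open>auto simp: l2_def\<close>)
  also have "\<dots> \<le> (\<Sum>j\<in>F. B\<^sup>2)" by (intro sum_mono power_mono b) auto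
  also have "\<dots> = (sqrt (card F) * B)\<^sup>2" by (simp add: power_mult_distrib)
  finally show ?thesis by (rule power2_le_imp_le) (use B0 in simp)
qed

text \<open>A codimension two singular set has zero capacity: a single cutoff at scale \<open>\<epsilon>\<close> has a gradient
  term \<open>G\<close> of bounded but not small norm. Averaging cutoffs at many scales, whose gradients have
  disjoint supports, makes this term small.\<close>

lemma clg_average:
  assumes a: "a \<noteq> 0" and x: "l2 MZ x" and y: "l2 MZ y"
    and XY: "\<And>j::nat. (X j, Y j) \<in> clg a e" and G: "\<And>j. l2 MZ (G j)"
    and lX: "(\<lambda>j. nrm MZ (\<lambda>p. X j p - x p)) \<longlonglongrightarrow> 0" and lY: "(\<lambda>j. nrm MZ (\<lambda>p. Y j p - G j p - y p)) \<longlonglongrightarrow> 0"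
    and b: "\<And>j. nrm MZ (G j) \<le> B"
    and dis: "\<And>i j p. p \<in> Zset \<Longrightarrow> i \<noteq> j \<Longrightarrow> G i p = 0 \<or> G j p = 0"
  shows "(x, y) \<in> clg a e"
proof (rule clg_closed[OF a x y])
  fix \<epsilon> :: real assume e: "\<epsilon> > 0"
  have B0: "B \<ge> 0" using b[of 0] nrm_nonneg order.trans by blast
  have "\<forall>\<^sub>F j in sequentially. nrm MZ (\<lambda>p. X j p - x p) < \<epsilon> / 2 \<and> nrm MZ (\<lambda>p. Y j p - G j p - y p) < \<epsilon> / 2"
    using e by (intro eventually_conj order_tendstoD(2)[OF lX] order_tendstoD(2)[OF lY]) auto
  then obtain J where J: "\<And>j. j \<ge> J \<Longrightarrow> nrm MZ (\<lambda>p. X j p - x p) < \<epsilon> / 2 \<and> nrm MZ (\<lambda>p. Y j p - G j p - y p) < \<epsilon> / 2"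
    by (auto simp: eventually_sequentially)
  \<comment> \<open>\<open>B / sqrt N\<close> will bound the average of \<open>N\<close> gradient
    terms; this choice pushes it below \<open>\<epsilon> / 2\<close>.\<close>
  obtain N :: nat where N: "(2 * B / \<epsilon> + 1)\<^sup>2 < real N" using reals_Archimedean2 by blast
  have N0: "real N > 0" using N by (meson le_less_trans zero_le_power2)
  have sN: "B / sqrt N < \<epsilon> / 2"
  proof -
    have "2 * B / \<epsilon> + 1 < sqrt N" using N by (rule real_less_rsqrt)
    then have "2 * B / \<epsilon> < sqrt N" by simp
    then show ?thesis using e N0 by (simp add: field_simps)
  qed
  \<comment> \<open>A window of \<open>N\<close> scales, all beyond the index from which the
    convergent terms are small.\<close>
  define F where "F = {J..<J + N}"
  have F: "finite F" "card F = N" "\<And>j. j \<in> F \<Longrightarrow> j \<ge> J" by (auto simp: F_def)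
  let ?c = "complex_of_real (1 / N)"
  have avg: "?c *s (\<Sum>j\<in>F. z) = z" for z :: bisp
  proof -
    have eq: "(\<Sum>j\<in>F. z) = of_nat N *s z"
      using F(2) by (simp add: vec_eq_iff sum_component del: sum_constant) simp
    show ?thesis unfolding eq using N0 by (simp add: vec_eq_iff)
  qed
  have nc: "norm ?c = 1 / N" by (simp only: norm_of_real) simp
  have lXY: "l2 MZ (X j)" "l2 MZ (Y j)" for j using clg_l2[OF a XY] by auto
  have est: "nrm MZ (\<lambda>p. ?c *s (\<Sum>j\<in>F. U j p)) \<le> \<epsilon> / 2"
    if U: "\<And>j. l2 MZ (U j)" "\<And>j. j \<ge> J \<Longrightarrow> nrm MZ (U j) < \<epsilon> / 2" for U :: "nat \<Rightarrow> field4"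
  proof -
    have "nrm MZ (\<lambda>p. ?c *s (\<Sum>j\<in>F. U j p)) = (1 / N) * nrm MZ (\<lambda>p. \<Sum>j\<in>F. U j p)" unfolding nrm_smult nc ..
    also have "\<dots> \<le> (1 / N) * (\<Sum>j\<in>F. nrm MZ (U j))" by (intro mult_left_mono nrm_sum_le U) auto
    also have "\<dots> \<le> (1 / N) * (\<Sum>j\<in>F. \<epsilon> / 2)"
      using U(2) F(3) by (intro mult_left_mono sum_mono) (auto intro: less_imp_le)
    also have "\<dots> = \<epsilon> / 2" using N0 F by simp
    finally show ?thesis .
  qed
  have linX: "?c *s (\<Sum>j\<in>F. X j p) - x p = ?c *s (\<Sum>j\<in>F. X j p - x p)" for p
    using avg[of "x p"] by (simp only: sum_subtractf vector_ssub_ldistrib)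
  have linY: "?c *s (\<Sum>j\<in>F. Y j p) - y p = ?c *s (\<Sum>j\<in>F. Y j p - G j p - y p) + ?c *s (\<Sum>j\<in>F. G j p)" for p
  proof -
    have "?c *s (\<Sum>j\<in>F. Y j p - G j p - y p) = ?c *s (\<Sum>j\<in>F. Y j p) - ?c *s (\<Sum>j\<in>F. G j p) - y p"
      using avg[of "y p"] by (simp only: sum_subtractf vector_ssub_ldistrib)
    then show ?thesis by simp
  qed
  show "\<exists>x' y'. (x', y') \<in> clg a e \<and> nrm MZ (\<lambda>p. x' p - x p) < \<epsilon> \<and> nrm MZ (\<lambda>p. y' p - y p) < \<epsilon>"
  proof (intro exI conjI)
    show "((\<lambda>p. ?c *s (\<Sum>j\<in>F. X j p)), (\<lambda>p. ?c *s (\<Sum>j\<in>F. Y j p))) \<in> clg a e"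
      by (intro clg_smult clg_sum a XY)
    have "nrm MZ (\<lambda>p. ?c *s (\<Sum>j\<in>F. X j p) - x p) \<le> \<epsilon> / 2"
      unfolding linX by (rule est) (use J x lXY in \<open>auto intro: l2_diff\<close>)
    then show "nrm MZ (\<lambda>p. ?c *s (\<Sum>j\<in>F. X j p) - x p) < \<epsilon>" using e by simp
    have "nrm MZ (\<lambda>p. ?c *s (\<Sum>j\<in>F. Y j p) - y p)
      \<le> nrm MZ (\<lambda>p. ?c *s (\<Sum>j\<in>F. Y j p - G j p - y p)) + nrm MZ (\<lambda>p. ?c *s (\<Sum>j\<in>F. G j p))"
      unfolding linY by (intro nrm_triangle l2_smult l2_sum l2_diff lXY G y)
    also have "nrm MZ (\<lambda>p. ?c *s (\<Sum>j\<in>F. Y j p - G j p - y p)) \<le> \<epsilon> / 2"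
      by (rule est) (use J in \<open>auto intro!: l2_diff y G lXY\<close>)
    also have "nrm MZ (\<lambda>p. ?c *s (\<Sum>j\<in>F. G j p)) < \<epsilon> / 2"
    proof -
      have "nrm MZ (\<lambda>p. ?c *s (\<Sum>j\<in>F. G j p)) = (1 / N) * nrm MZ (\<lambda>p. \<Sum>j\<in>F. G j p)" unfolding nrm_smult nc ..
      also have "\<dots> \<le> (1 / N) * (sqrt N * B)"
        using nrm_sum_disjoint[OF F(1) G b dis] F(2) by (intro mult_left_mono) auto
      also have "\<dots> = B / sqrt N" using N0
        by (metis (no_types, opaque_lifting) divide_divide_eq_right mult.commute mult.left_neutral
            real_sqrt_gt_0_iff real_div_sqrt less_imp_le times_divide_eq_left times_divide_eq_right)
      finally show ?thesis using sN by linarith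
    qed
    finally show "nrm MZ (\<lambda>p. ?c *s (\<Sum>j\<in>F. Y j p) - y p) < \<epsilon>" by simp
  qed
qed

section \<open>Removing the ring and the poles\<close>

lemma tn_measurable:
  assumes "f \<in> borel_measurable borel" "g \<in> borel_measurable borel"
  shows "tn f g \<kappa> i \<in> borel_measurable borel"
proof (rule vec_measurableI)
  fix j
  have m: "(\<lambda>x::pt. fst x) \<in> borel_measurable borel" "(\<lambda>x::pt. fst (snd x)) \<in> borel_measurable borel"
    "(\<lambda>x::pt. cis (\<kappa> * snd (snd x))) \<in> borel_measurable borel"
    by (intro borel_measurable_continuous_onI continuous_intros)+
  have "(\<lambda>x. f (fst x) * g (fst (snd x)) * cis (\<kappa> * snd (snd x))) \<in> borel_measurable borel"
    by (intro borel_measurable_times m measurable_compose[OF m(1) assms(1)] measurable_compose[OF m(2) assms(2)])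
  then have "(\<lambda>x. if i = j then f (fst x) * g (fst (snd x)) * cis (\<kappa> * snd (snd x)) else 0) \<in> borel_measurable borel"
    by (cases "i = j") simp_all
  moreover have "(\<lambda>x. tn f g \<kappa> i x $ j) = (\<lambda>x. if i = j then f (fst x) * g (fst (snd x)) * cis (\<kappa> * snd (snd x)) else 0)"
    using tn_nth[of f g \<kappa> i _ _ _ j] by (auto simp: fun_eq_iff)
  ultimately show "(\<lambda>x. tn f g \<kappa> i x $ j) \<in> borel_measurable borel" by simp
qed

lemma tn_bound:
  assumes m: "f \<in> borel_measurable borel" "g \<in> borel_measurable borel"
    and A: "\<And>r. norm (f r) \<le> A" and B: "\<And>\<theta>. \<theta> \<in> {0..pi} \<Longrightarrow> norm (g \<theta>) \<le> B"
    and s: "\<And>r \<theta>. \<theta> \<in> {0..pi} \<Longrightarrow> r \<notin> {r1..r2} \<or> \<theta> \<notin> {t1..t2} \<Longrightarrow> f r * g \<theta> = 0"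
    and le: "r1 \<le> r2" "t1 \<le> t2"
  shows "l2 MZ (tn f g \<kappa> i) \<and> nrm MZ (tn f g \<kappa> i) \<le> sqrt ((r2 - r1) * (t2 - t1) * (2 * pi)) * (A * B)"
proof -
  have A0: "A \<ge> 0" using A[of 0] norm_ge_zero order.trans by blast
  have bd: "norm (tn f g \<kappa> i x) \<le> A * B" if "x \<in> Zset" for x
  proof -
    obtain r \<theta> \<phi> where x: "x = (r, \<theta>, \<phi>)" by (metis prod_cases3)
    have "\<theta> \<in> {0..pi}" using that by (auto simp: x Zset_def)
    then show ?thesis unfolding x norm_tn by (intro mult_mono A B A0) auto
  qed
  have z: "tn f g \<kappa> i x = 0" if "x \<in> Zset" "x \<notin> rtbox r1 r2 t1 t2" for x
  proof -
    obtain r \<theta> \<phi> where x: "x = (r, \<theta>, \<phi>)" by (metis prod_cases3)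
    have "\<theta> \<in> {0..pi}" "r \<notin> {r1..r2} \<or> \<theta> \<notin> {t1..t2}" using that by (auto simp: x Zset_def rtbox_def)
    from s[OF this] show ?thesis by (simp add: x tn_def vec_eq_iff)
  qed
  show ?thesis
    using l2_rtbox[OF tn_measurable[OF m] bd z le] by auto
qed

lemma tn_l2:
  assumes m: "f \<in> borel_measurable borel" "g \<in> borel_measurable borel"
    and A: "\<And>r. norm (f r) \<le> A" and B: "\<And>\<theta>. \<theta> \<in> {0..pi} \<Longrightarrow> norm (g \<theta>) \<le> B"
    and R: "\<And>r. \<bar>r\<bar> > R \<Longrightarrow> f r = 0"
  shows "l2 MZ (tn f g \<kappa> i)"
proof (rule conjunct1[OF tn_bound[OF m A B, of "- \<bar>R\<bar>" "\<bar>R\<bar>" 0 pi]])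
  show "f r * g \<theta> = 0" if "\<theta> \<in> {0..pi}" "r \<notin> {- \<bar>R\<bar>..\<bar>R\<bar>} \<or> \<theta> \<notin> {0..pi}" for r \<theta>
    using that R[of r] by (auto simp: not_le)
qed auto

lemma Cc_measurable: "f \<in> Cc \<Longrightarrow> f \<in> borel_measurable borel"
  by (intro borel_measurable_continuous_onI Cc_continuous)

section \<open>Cutoff scales and convergence of cut-off fields\<close>

lemma AE_MZ_r_nonzero: "AE x in MZ. fst x \<noteq> 0"
proof -
  have "negligible {x :: pt. x \<bullet> (1, 0, 0) = 0}"
    by (rule negligible_standard_hyperplane) (simp add: Basis_prod_def zero_prod_def)
  then have "{x :: pt. fst x = 0} \<in> null_sets lebesgue"
    by (simp add: negligible_iff_null_sets inner_prod_def)
  moreover have "{x :: pt. fst x = 0} \<in> sets lborel"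
    unfolding sets_lborel by (intro borel_closed closed_Collect_eq continuous_intros)
  ultimately have "{x :: pt. fst x = 0} \<in> null_sets lborel"
    by (simp add: null_sets_completion_iff)
  then have "AE x :: pt in lborel. fst x \<noteq> 0" by (rule AE_I'[where N="{x. fst x = 0}"]) auto
  then show ?thesis unfolding MZ_def by (subst AE_density) auto
qed

text \<open>Ratio 4, because the gradient shell of scale \<open>j\<close> reaches from
  \<open>scl j / 2\<close> to \<open>scl j\<close>: with ratio 2 consecutive shells would share a
  boundary.\<close>

definition scl :: "nat \<Rightarrow> real" where "scl j = (1/4) ^ j"

lemma scl_pos: "scl j > 0" by (simp add: scl_def)


lemma scl_tendsto: "scl \<longlonglongrightarrow> 0"
  unfolding scl_def[abs_def] by (rule LIMSEQ_power_zero) simp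

lemma scl_separated:
  assumes "scl i / 2 \<le> t" "t \<le> scl i" "scl j / 2 \<le> t" "t \<le> scl j"
  shows "i = j"
proof -
  have *: False if "k < l" "scl k / 2 \<le> t" "t \<le> scl l" for k l
  proof -
    have "scl l \<le> scl (Suc k)" unfolding scl_def by (rule power_decreasing) (use that in auto)
    also have "\<dots> = scl k / 4" by (simp add: scl_def)
    finally show False using that scl_pos[of k] by linarith
  qed
  show ?thesis using *[of i j] *[of j i] assms by (cases i j rule: linorder_cases) auto
qed

lemma scl_bump_tendsto:
  assumes "t \<noteq> 0" shows "(\<lambda>j. bump (t / scl j)) \<longlonglongrightarrow> 0"
proof -
  have "\<forall>\<^sub>F j in sequentially. scl j < \<bar>t\<bar>" using assms by (intro order_tendstoD(2)[OF scl_tendsto]) auto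
  then have "\<forall>\<^sub>F j in sequentially. bump (t / scl j) = 0"
  proof eventually_elim
    case (elim j)
    then have "\<bar>t / scl j\<bar> \<ge> 1" using scl_pos[of j] by (simp add: abs_divide)
    then show ?case by (rule bump_0)
  qed
  then show ?thesis by (rule tendsto_eventually)
qed

lemma dbump_scaled_nonzero:
  assumes "dbump (t / scl j) \<noteq> 0" shows "scl j / 2 \<le> \<bar>t\<bar>" "\<bar>t\<bar> \<le> scl j"
proof -
  have "1 / 2 \<le> \<bar>t / scl j\<bar>" "\<bar>t / scl j\<bar> \<le> 1" using dbump_0[of "t / scl j"] assms by (auto simp: not_less[symmetric])
  then show "scl j / 2 \<le> \<bar>t\<bar>" "\<bar>t\<bar> \<le> scl j" using scl_pos[of j] by (auto simp: abs_divide field_simps)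
qed

lemma bump_scaled_nonzero:
  assumes "bump (t / scl j) \<noteq> 0" shows "\<bar>t\<bar> \<le> scl j"
proof -
  have "\<bar>t / scl j\<bar> \<le> 1" using bump_0[of "t / scl j"] assms by (cases "\<bar>t / scl j\<bar> \<ge> 1") auto
  then show "\<bar>t\<bar> \<le> scl j" using scl_pos[of j] by (auto simp: abs_divide field_simps)
qed

lemma inverse_varpi_coefficient:
  assumes a: "a \<noteq> 0" and f: "f \<in> Cc"
  shows "(\<lambda>r. - \<i> * of_real (c / varpi a r) * f r) \<in> Cc"
    "(\<lambda>r. - \<i> * of_real s * vd f r + of_real (a * \<kappa> / (varpi a r)\<^sup>2) * f r) \<in> Cc"
proof -
  have w: "Cinf UNIV (\<lambda>r. complex_of_real (1 / varpi a r))"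
    by (intro Cinf_of_real Cinf_inverse_varpi a) auto
  have "(\<lambda>r. (- \<i> * of_real c) * (of_real (1 / varpi a r) * f r)) \<in> Cc"
    by (intro Cc_cmult Cc_mult_left w f)
  then show "(\<lambda>r. - \<i> * of_real (c / varpi a r) * f r) \<in> Cc" by (simp add: mult_ac)
  have "(\<lambda>r. (- \<i> * of_real s) * vd f r + of_real (a * \<kappa>) * (of_real (1 / varpi a r) * (of_real (1 / varpi a r) * f r))) \<in> Cc"
    by (intro Cc_add Cc_cmult Cc_mult_left w f Cc_derivative)
  then show "(\<lambda>r. - \<i> * of_real s * vd f r + of_real (a * \<kappa> / (varpi a r)\<^sup>2) * f r) \<in> Cc"
    by (simp add: mult_ac power2_eq_square)
qed

lemma smult_real_zero_bound:
  assumes "0 \<le> t" "t \<le> 1"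
  shows "norm (- (complex_of_real t *s (v::bisp))) \<le> norm v"
proof -
  have "t * norm v \<le> 1 * norm v" using assms by (intro mult_right_mono) auto
  then show ?thesis using assms by (simp add: norm_smult_vec)
qed

text \<open>Dominated convergence with a choice at each point: the cutoff tends to 0 or the field
  vanishes. The second alternative covers the poles, where the polar cutoff stays at 1.\<close>

lemma nrm_scaled_tendsto:
  fixes b :: "nat \<Rightarrow> pt \<Rightarrow> real" and g :: field4
  assumes g: "l2 MZ g" and m: "\<And>j. b j \<in> borel_measurable borel" and b: "\<And>j x. 0 \<le> b j x" "\<And>j x. b j x \<le> 1"
    and lim: "AE x in MZ. (\<lambda>j. b j x) \<longlonglongrightarrow> 0 \<or> g x = 0"
  shows "(\<lambda>j. nrm MZ (\<lambda>x. - (complex_of_real (b j x) *s g x))) \<longlonglongrightarrow> 0"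
proof (rule nrm_dominated[OF g])
  show "(\<lambda>x. - (complex_of_real (b j x) *s g x)) \<in> borel_measurable MZ" for j
    using smult_measurable[OF borel_measurable_of_real_comp[OF m[of j]], of g] g
    by (simp add: l2_def borel_measurable_uminus)
  show "AE x in MZ. norm (- (complex_of_real (b j x) *s g x)) \<le> norm (g x)" for j
    by (rule AE_MZ_I) (rule smult_real_zero_bound[OF b])
  have "(\<lambda>j. - (complex_of_real (b j x) *s g x)) \<longlonglongrightarrow> 0" if "(\<lambda>j. b j x) \<longlonglongrightarrow> 0 \<or> g x = 0" for x
  proof (cases "g x = 0")
    case False
    with that have "(\<lambda>j. b j x) \<longlonglongrightarrow> 0" by simp
    then have "(\<lambda>j. complex_of_real (b j x)) \<longlonglongrightarrow> of_real 0" by (rule tendsto_of_real)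
    from bounded_linear.tendsto[OF bounded_linear_smult_left[of "g x"] this]
    have "(\<lambda>j. complex_of_real (b j x) *s g x) \<longlonglongrightarrow> 0" by simp
    from tendsto_minus[OF this] show ?thesis by simp
  qed simp
  then show "AE x in MZ. (\<lambda>j. - (complex_of_real (b j x) *s g x)) \<longlonglongrightarrow> 0" using lim by auto
qed

text \<open>Bookkeeping for the Leibniz rule. Here \<open>c1\<close>, \<open>c2\<close> are the
  coefficients of the image of the original field, \<open>d1\<close>, \<open>d2\<close> those for
  the field multiplied by the cutoff \<open>t\<close>, and \<open>g1\<close>, \<open>g2\<close> the
  gradient terms; once these are subtracted, exactly \<open>- t\<close> times the original image is
  left.\<close>

lemma cutoff_vector_identity:
  assumes "d1 = g1 + t * c1" "d2 = g2 + t * c2"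
  shows "((c1 *s E1 + c2 *s E2) + (-1) *s (d1 *s E1 + d2 *s E2)) - (-1) *s (g1 *s E1 + g2 *s E2) - (c1 *s E1 + c2 *s E2)
    = - (t *s (c1 *s E1 + c2 *s (E2 :: bisp)))"
  unfolding assms by (simp add: vec_eq_iff algebra_simps)

text \<open>The factor \<open>1 - B j r * T j \<theta>\<close> removes a square of side comparable
  to \<open>scl j\<close> around the ring. Its gradient is of order \<open>1 / scl j\<close> on an
  area of order \<open>scl j ^ 2\<close>, so the gradient term \<open>G j\<close> is bounded in norm
  uniformly in \<open>j\<close> and the averaging principle applies.\<close>

lemma clg_ring:
  assumes a: "a \<noteq> 0" and \<kappa>: "\<kappa> - 1/2 \<in> \<int>" and f: "f \<in> Cc" and g: "Cinf UNIV g"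
    and \<delta>: "\<delta> > 0" and sg: "\<And>\<theta>. \<theta> \<notin> {\<delta>..pi-\<delta>} \<Longrightarrow> g \<theta> = 0"
  shows "(tn f g \<kappa> i, frakH a 0 e 0 (tn f g \<kappa> i)) \<in> clg a e"
proof -
  define B where "B j r = bump ((r - 0) / scl j)" for j r
  define T where "T j \<theta> = bump ((\<theta> - pi / 2) / scl j)" for j \<theta>
  define dB where "dB j r = dbump ((r - 0) / scl j) / scl j" for j r
  define dT where "dT j \<theta> = dbump ((\<theta> - pi / 2) / scl j) / scl j" for j \<theta>
  have B: "Cinf UNIV (\<lambda>r. complex_of_real (B j r))" "((\<lambda>r. complex_of_real (B j r)) has_vector_derivative of_real (dB j r)) (at r)"
    and T: "Cinf UNIV (\<lambda>r. complex_of_real (T j r))" "((\<lambda>r. complex_of_real (T j r)) has_vector_derivative of_real (dT j r)) (at r)" for j r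
    unfolding B_def T_def dB_def dT_def
    by (intro Cinf_of_real bump_scaled scl_pos open_UNIV has_vector_derivative_of_real
        has_real_derivative_iff_has_vector_derivative[THEN iffD2])+
  have Bb: "0 \<le> B j r" "B j r \<le> 1" "0 \<le> T j r" "T j r \<le> 1" for j r by (auto simp: B_def T_def bump_bounds)
  have g_Cc: "g \<in> Cc"
  proof (rule CcI[OF g, of "pi"])
    show "g x = 0" if "\<bar>x\<bar> > pi" for x using that \<delta> by (intro sg) auto
  qed
  let ?x = "tn f g \<kappa> i"
  let ?H = "frakH a 0 e 0"
  let ?f1 = "\<lambda>r. - \<i> * of_real (sgr i) * vd f r + of_real (a * \<kappa> / (varpi a r)\<^sup>2) * f r"
  let ?f2 = "\<lambda>r. - \<i> * of_real (osg i / varpi a r) * f r"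
  let ?g2 = "\<lambda>\<theta>. vd g \<theta> - of_real (tau i * \<kappa> / sin \<theta>) * g \<theta>"
  note fd = Cc_D[OF f] and gd = Cc_D[OF g_Cc]
  have Hx: "?H ?x p = tn ?f1 g \<kappa> i p + tn ?f2 ?g2 \<kappa> (pr i) p" for p
  proof -
    obtain r \<theta> \<phi> where p: "p = (r, \<theta>, \<phi>)" by (metis prod_cases3)
    show ?thesis unfolding p by (rule frakH_tn[OF a fd gd])
  qed
  obtain F where F: "F > 0" "\<And>r. norm (f r) \<le> F" using Cc_bounded[OF f] by blast
  obtain F1 where F1: "\<And>r. norm (?f1 r) \<le> F1" using Cc_bounded[OF inverse_varpi_coefficient(2)[OF a f]] by blast
  obtain F2 where F2: "\<And>r. norm (?f2 r) \<le> F2" using Cc_bounded[OF inverse_varpi_coefficient(1)[OF a f]] by blast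
  obtain Gb where Gb: "Gb > 0" "\<And>r. norm (g r) \<le> Gb" using Cc_bounded[OF g_Cc] by blast
  obtain R where R: "\<And>r. \<bar>r\<bar> > R \<Longrightarrow> f r = 0" using Cc_supp[OF f] by auto
  have F1s: "\<exists>R. \<forall>r. \<bar>r\<bar> > R \<longrightarrow> ?f1 r = 0" using Cc_supp[OF inverse_varpi_coefficient(2)[OF a f]] by blast
  \<comment> \<open>The cosecant is smooth on the open interval, while near and beyond its ends
    \<open>g\<close> vanishes; these two open sets cover the line.\<close>
  have g2: "Cinf UNIV ?g2"
  proof -
    have "Cinf {0<..<pi} ?g2"
    proof (intro Cinf_diff Cinf_mult Cinf_of_real)
      have "Cinf {0<..<pi} (\<lambda>\<theta>. (tau i * \<kappa>) * inverse (sin \<theta>))"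
        by (intro Cinf_mult Cinf_const Cinf_inverse Cinf_sin_cos) (auto dest: sin_gt_zero)
      then show "Cinf {0<..<pi} (\<lambda>\<theta>. tau i * \<kappa> / sin \<theta>)" by (simp add: divide_inverse)
    qed (auto intro: Cinf_subset[OF g] Cinf_subset[OF Cinf_derivative[OF g]])
    moreover have "Cinf ({..<\<delta>} \<union> {pi-\<delta><..}) ?g2"
    proof (rule Cinf_cong[where f="\<lambda>_. 0"])
      fix \<theta> assume th: "\<theta> \<in> {..<\<delta>} \<union> {pi-\<delta><..}"
      have "((\<lambda>_. 0) has_vector_derivative 0) (at \<theta>)" by simp
      then have "(g has_vector_derivative 0) (at \<theta>)"
        by (rule has_vector_derivative_transform_within_open[where S="{..<\<delta>} \<union> {pi-\<delta><..}"]) (use th in \<open>auto simp: sg\<close>)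
      then show "0 = ?g2 \<theta>" using th by (auto simp: vector_derivative_at sg)
    qed (auto intro!: Cinf_const open_Un)
    ultimately have "Cinf ({0<..<pi} \<union> ({..<\<delta>} \<union> {pi-\<delta><..})) ?g2" by (rule Cinf_Un)
    also have "{0<..<pi} \<union> ({..<\<delta>} \<union> {pi-\<delta><..}) = UNIV" using \<delta> by (auto simp: not_less)
    finally show ?thesis .
  qed
  obtain G2 where G2: "\<And>\<theta>. \<theta> \<in> {0..pi} \<Longrightarrow> norm (?g2 \<theta>) \<le> G2"
  proof -
    have "bounded (?g2 ` {0..pi})"
      by (intro compact_imp_bounded compact_continuous_image continuous_on_subset[OF Cinf_continuous_on[OF g2]]) auto
    then show ?thesis using that by (auto simp: bounded_iff simp del: atLeastAtMost_iff)
  qed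
  have lx: "l2 MZ ?x"
    by (rule tn_l2[OF Cc_measurable[OF f] Cc_measurable[OF g_Cc] F(2) Gb(2) R])
  have ly: "l2 MZ (?H ?x)"
  proof -
    obtain R1 where R1: "\<And>r. \<bar>r\<bar> > R1 \<Longrightarrow> ?f1 r = 0" using F1s by blast
    have "l2 MZ (tn ?f1 g \<kappa> i)"
      by (rule tn_l2[OF Cc_measurable[OF inverse_varpi_coefficient(2)[OF a f]] Cc_measurable[OF g_Cc] F1 Gb(2) R1])
    moreover have "l2 MZ (tn ?f2 ?g2 \<kappa> (pr i))"
      by (rule tn_l2[OF Cc_measurable[OF inverse_varpi_coefficient(1)[OF a f]] borel_measurable_continuous_onI[OF Cinf_continuous_on[OF g2]] F2 G2, of R])
        (simp_all add: R)
    ultimately show ?thesis unfolding Hx[abs_def] by (rule l2_add)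
  qed
  define u where "u j = tn (\<lambda>r. of_real (B j r) * f r) (\<lambda>\<theta>. of_real (T j \<theta>) * g \<theta>) \<kappa> i" for j
  define X where "X j = (\<lambda>p. ?x p + (-1) *s u j p)" for j
  define G where "G j = (\<lambda>p. (-1) *s (tn (\<lambda>r. (- \<i> * of_real (sgr i)) * (of_real (dB j r) * f r)) (\<lambda>\<theta>. of_real (T j \<theta>) * g \<theta>) \<kappa> i p
      + tn (\<lambda>r. of_real (B j r) * ?f2 r) (\<lambda>\<theta>. of_real (dT j \<theta>) * g \<theta>) \<kappa> (pr i) p))" for j
  have uTT: "TT (u j)" for j unfolding u_def by (intro TT_tn Cinf_mult B T g Cc_Cinf[OF f] open_UNIV)
  have xTT: "TT ?x" by (intro TT_tn g Cc_Cinf[OF f])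
  have diff: "?x differentiable (at p)" "u j differentiable (at p)" for p j
    using TT_derivative[OF xTT] TT_derivative[OF uTT[of j]] by blast+
  have ux: "u j p = complex_of_real (B j (fst p) * T j (fst (snd p))) *s ?x p" for j p
  proof -
    obtain r \<theta> \<phi> where p: "p = (r, \<theta>, \<phi>)" by (metis prod_cases3)
    show ?thesis by (simp add: p u_def tn_def vec_eq_iff)
  qed
  have XDT: "X j \<in> DT" for j
  proof (rule DT_I[where R=R and \<delta>=\<delta> and \<epsilon>="scl j / 2"])
    show "TT (X j)" unfolding X_def by (intro TT_add TT_smult xTT uTT)
    show "X j (r, \<theta>, \<phi> + 2 * pi) = - X j (r, \<theta>, \<phi>)" for r \<theta> \<phi>
      unfolding X_def u_def tn_antiperiodic[OF \<kappa>] by (simp add: vec_eq_iff)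
    show "X j (r, \<theta>, \<phi>) = 0" if "\<bar>r\<bar> > R" for r \<theta> \<phi>
      using R[OF that] by (simp add: X_def u_def tn_def vec_eq_iff)
    show "X j (r, \<theta>, \<phi>) = 0" if "\<theta> \<notin> {\<delta>..pi-\<delta>}" for r \<theta> \<phi>
      using sg[OF that] by (simp add: X_def u_def tn_def vec_eq_iff)
    show "X j (r, \<theta>, \<phi>) = 0" if "\<bar>r\<bar> < scl j / 2" "\<bar>\<theta> - pi / 2\<bar> < scl j / 2" for r \<theta> \<phi>
    proof -
      have "B j r = 1" "T j \<theta> = 1"
        unfolding B_def T_def by (rule bump_1, use that scl_pos[of j] in \<open>simp add: abs_divide field_simps\<close>)+
      then show ?thesis by (simp add: X_def ux vec_eq_iff)
    qed
  qed (use \<delta> scl_pos in auto)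
  have HX: "?H (X j) p - G j p - ?H ?x p = - (complex_of_real (B j (fst p) * T j (fst (snd p))) *s ?H ?x p)" for j p
  proof -
    obtain r \<theta> \<phi> where p: "p = (r, \<theta>, \<phi>)" by (metis prod_cases3)
    have dd: "(\<lambda>x. (-1) *s u j x) differentiable (at p)" using TT_derivative[OF TT_smult[OF uTT]] by blast
    have HXu: "?H (X j) p = ?H ?x p + (-1) *s ?H (u j) p"
      unfolding X_def using frakH_add[OF a diff(1) dd, of 0 e 0] frakH_smult[OF a diff(2)[of j p], of 0 e 0 "-1"] by simp
    have Hu: "?H (u j) p = tn (\<lambda>r. - \<i> * of_real (sgr i) * (of_real (B j r) * vd f r + of_real (dB j r) * f r) + of_real (a * \<kappa> / (varpi a r)\<^sup>2) * (of_real (B j r) * f r)) (\<lambda>\<theta>. of_real (T j \<theta>) * g \<theta>) \<kappa> i p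
       + tn (\<lambda>r. - \<i> * of_real (osg i / varpi a r) * (of_real (B j r) * f r)) (\<lambda>\<theta>. (of_real (T j \<theta>) * vd g \<theta> + of_real (dT j \<theta>) * g \<theta>) - of_real (tau i * \<kappa> / sin \<theta>) * (of_real (T j \<theta>) * g \<theta>)) \<kappa> (pr i) p"
      unfolding p u_def by (rule frakH_tn[OF a has_vector_derivative_mult[OF B(2) fd] has_vector_derivative_mult[OF T(2) gd]])
    show ?thesis unfolding HXu Hu Hx G_def unfolding p tn_def prod.case fst_conv snd_conv
      by (rule cutoff_vector_identity) (simp_all add: algebra_simps add_divide_distrib)
  qed
  obtain C where C: "C \<ge> 0" "\<And>t. \<bar>dbump t\<bar> \<le> C" using dbump_bounded by blast
  have dBb: "\<bar>dB j r\<bar> \<le> C / scl j" "\<bar>dT j r\<bar> \<le> C / scl j" for j r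
    using C scl_pos[of j] by (auto simp: dB_def dT_def abs_divide intro!: divide_right_mono)
  have Gj: "l2 MZ (G j)" "nrm MZ (G j) \<le> sqrt (8 * pi) * (C * F * Gb) + sqrt (8 * pi) * (F2 * (C * Gb))" for j
  proof -
    let ?G1 = "tn (\<lambda>r. (- \<i> * of_real (sgr i)) * (of_real (dB j r) * f r)) (\<lambda>\<theta>. of_real (T j \<theta>) * g \<theta>) \<kappa> i"
    let ?G2 = "tn (\<lambda>r. of_real (B j r) * ?f2 r) (\<lambda>\<theta>. of_real (dT j \<theta>) * g \<theta>) \<kappa> (pr i)"
    have meas: "(\<lambda>r. complex_of_real (dB j r)) \<in> borel_measurable borel" "(\<lambda>r. complex_of_real (dT j r)) \<in> borel_measurable borel"
      using Cinf_continuous_on[OF Cinf_derivative[OF B(1)[of j]]] Cinf_continuous_on[OF Cinf_derivative[OF T(1)[of j]]]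
      by (auto intro: borel_measurable_continuous_onI simp: vector_derivative_at[OF B(2)] vector_derivative_at[OF T(2)])
    have meas2: "(\<lambda>r. complex_of_real (B j r)) \<in> borel_measurable borel" "(\<lambda>r. complex_of_real (T j r)) \<in> borel_measurable borel"
      using Cinf_continuous_on[OF B(1)[of j]] Cinf_continuous_on[OF T(1)[of j]] by (auto intro: borel_measurable_continuous_onI)
    have F20: "F2 \<ge> 0" using order.trans[OF norm_ge_zero F2[of 0]] .
    have sp: "scl j > 0" by (rule scl_pos)
    \<comment> \<open>Two sides of length \<open>2 * scl j\<close> and one of length
      \<open>2 * pi\<close>: the square root of the volume supplies the factor \<open>scl j\<close>
      that cancels the gradient.\<close>
    have fac: "sqrt ((scl j - (- scl j)) * ((pi / 2 + scl j) - (pi / 2 - scl j)) * (2 * pi)) = sqrt (8 * pi) * scl j"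
    proof -
      have "(scl j - (- scl j)) * ((pi / 2 + scl j) - (pi / 2 - scl j)) * (2 * pi) = 8 * pi * (scl j)\<^sup>2"
        by (simp add: power2_eq_square)
      then show ?thesis using sp by (simp only: real_sqrt_mult real_sqrt_abs abs_of_pos)
    qed
    have 1: "l2 MZ ?G1 \<and> nrm MZ ?G1 \<le> sqrt ((scl j - (- scl j)) * ((pi / 2 + scl j) - (pi / 2 - scl j)) * (2 * pi)) * ((C / scl j * F) * Gb)"
    proof (rule tn_bound)
      show "(\<lambda>r. - \<i> * complex_of_real (sgr i) * (complex_of_real (dB j r) * f r)) \<in> borel_measurable borel"
        by (intro borel_measurable_times meas Cc_measurable f borel_measurable_const)
      show "(\<lambda>\<theta>. complex_of_real (T j \<theta>) * g \<theta>) \<in> borel_measurable borel"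
        by (intro borel_measurable_times meas2 Cc_measurable g_Cc)
      show "norm (- \<i> * complex_of_real (sgr i) * (complex_of_real (dB j r) * f r)) \<le> C / scl j * F" for r
      proof -
        have "\<bar>dB j r\<bar> * norm (f r) \<le> C / scl j * F" using F C sp by (intro mult_mono dBb) auto
        then show ?thesis by (simp add: norm_mult sgr_def)
      qed
      show "norm (complex_of_real (T j \<theta>) * g \<theta>) \<le> Gb" for \<theta>
        using mult_mono[OF Bb(4)[of j \<theta>] Gb(2)[of \<theta>]] Bb(3)[of j \<theta>] by (simp add: norm_mult)
      show "- \<i> * complex_of_real (sgr i) * (complex_of_real (dB j r) * f r) * (complex_of_real (T j \<theta>) * g \<theta>) = 0"
        if "r \<notin> {- scl j..scl j} \<or> \<theta> \<notin> {pi / 2 - scl j..pi / 2 + scl j}" for r \<theta>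
      proof -
        have "dB j r = 0 \<or> T j \<theta> = 0"
          using that dbump_scaled_nonzero(2)[of r j] bump_scaled_nonzero[of "\<theta> - pi / 2" j]
          unfolding dB_def T_def by fastforce
        then show ?thesis by auto
      qed
    qed (use sp in auto)
    have 2: "l2 MZ ?G2 \<and> nrm MZ ?G2 \<le> sqrt ((scl j - (- scl j)) * ((pi / 2 + scl j) - (pi / 2 - scl j)) * (2 * pi)) * (F2 * (C / scl j * Gb))"
    proof (rule tn_bound)
      show "(\<lambda>r. complex_of_real (B j r) * ?f2 r) \<in> borel_measurable borel"
        by (intro borel_measurable_times meas2 Cc_measurable[OF inverse_varpi_coefficient(1)[OF a f]])
      show "(\<lambda>\<theta>. complex_of_real (dT j \<theta>) * g \<theta>) \<in> borel_measurable borel"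
        by (intro borel_measurable_times meas Cc_measurable g_Cc)
      show "norm (complex_of_real (dT j \<theta>) * g \<theta>) \<le> C / scl j * Gb" for \<theta>
      proof -
        have "\<bar>dT j \<theta>\<bar> * norm (g \<theta>) \<le> C / scl j * Gb" using Gb C sp by (intro mult_mono dBb) auto
        then show ?thesis by (simp add: norm_mult)
      qed
      show "norm (complex_of_real (B j r) * ?f2 r) \<le> F2" for r
        using mult_mono[OF Bb(2)[of j r] F2[of r]] Bb(1)[of j r] by (simp only: norm_mult[of "complex_of_real (B j r)"]) simp
      show "complex_of_real (B j r) * ?f2 r * (complex_of_real (dT j \<theta>) * g \<theta>) = 0"
        if "r \<notin> {- scl j..scl j} \<or> \<theta> \<notin> {pi / 2 - scl j..pi / 2 + scl j}" for r \<theta>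
      proof -
        have "B j r = 0 \<or> dT j \<theta> = 0"
          using that bump_scaled_nonzero[of r j] dbump_scaled_nonzero(2)[of "\<theta> - pi / 2" j]
          unfolding dT_def B_def by fastforce
        then show ?thesis by auto
      qed
    qed (use sp in auto)
    have c1: "sqrt (8 * pi) * scl j * ((C / scl j * F) * Gb) = sqrt (8 * pi) * (C * F * Gb)"
      "sqrt (8 * pi) * scl j * (F2 * (C / scl j * Gb)) = sqrt (8 * pi) * (F2 * (C * Gb))"
      using sp by simp_all
    show "l2 MZ (G j)" unfolding G_def by (intro l2_smult l2_add conjunct1[OF 1] conjunct1[OF 2])
    have "nrm MZ (G j) = nrm MZ (\<lambda>p. ?G1 p + ?G2 p)" unfolding G_def nrm_smult by simp
    also have "\<dots> \<le> nrm MZ ?G1 + nrm MZ ?G2" by (intro nrm_triangle conjunct1[OF 1] conjunct1[OF 2])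
    finally show "nrm MZ (G j) \<le> sqrt (8 * pi) * (C * F * Gb) + sqrt (8 * pi) * (F2 * (C * Gb))"
      using conjunct2[OF 1] conjunct2[OF 2] unfolding fac c1 by linarith
  qed
  \<comment> \<open>Where the derivative of one factor and the other factor are both nonzero, the
    larger of the two distances lies in the shell of scale \<open>j\<close>. Disjointness of
    supports thus becomes a statement about one real number.\<close>
  have Gsupp: "scl j / 2 \<le> max \<bar>r\<bar> \<bar>\<theta> - pi / 2\<bar> \<and> max \<bar>r\<bar> \<bar>\<theta> - pi / 2\<bar> \<le> scl j"
    if "G j (r, \<theta>, \<phi>) \<noteq> 0" for j r \<theta> \<phi>
  proof -
    have "(dB j r \<noteq> 0 \<and> T j \<theta> \<noteq> 0) \<or> (B j r \<noteq> 0 \<and> dT j \<theta> \<noteq> 0)"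
      using that by (auto simp: G_def tn_def vec_eq_iff)
    then show ?thesis
      using dbump_scaled_nonzero[of r j] bump_scaled_nonzero[of "\<theta> - pi / 2" j]
        bump_scaled_nonzero[of r j] dbump_scaled_nonzero[of "\<theta> - pi / 2" j]
      by (auto simp: dB_def T_def dT_def B_def max_def)
  qed
  have mBT: "(\<lambda>p::pt. B j (fst p) * T j (fst (snd p))) \<in> borel_measurable borel" for j
  proof -
    have "continuous_on UNIV bump" by (rule Cinf_continuous_on[OF Cinf_bump])
    then show ?thesis unfolding B_def T_def using scl_pos[of j]
      by (intro borel_measurable_continuous_onI continuous_intros) (auto intro!: continuous_on_compose2[of UNIV bump] continuous_intros)
  qed
  have bBT: "0 \<le> B j (fst p) * T j (fst (snd p))" "B j (fst p) * T j (fst (snd p)) \<le> 1" for j and p :: pt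
    using Bb by (auto intro: mult_le_one)
  \<comment> \<open>Convergence off the null set \<open>r = 0\<close>, which contains the ring, is
    enough; there the radial factor alone tends to 0.\<close>
  have limBT: "AE p in MZ. (\<lambda>j. B j (fst p) * T j (fst (snd p))) \<longlonglongrightarrow> 0 \<or> g' p = 0" for g' :: field4
    using AE_MZ_r_nonzero
  proof eventually_elim
    case (elim p)
    have "(\<lambda>j. B j (fst p) * T j (fst (snd p))) \<longlonglongrightarrow> 0"
    proof (rule Lim_null_comparison)
      show "(\<lambda>j. B j (fst p)) \<longlonglongrightarrow> 0" using scl_bump_tendsto[OF elim] by (simp add: B_def)
      show "\<forall>\<^sub>F j in sequentially. norm (B j (fst p) * T j (fst (snd p))) \<le> B j (fst p)"
        using Bb by (intro always_eventually allI) (simp add: mult_left_le)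
    qed
    then show ?case by simp
  qed
  show ?thesis
  proof (rule clg_average[OF a lx ly, where X=X and Y="\<lambda>j. ?H (X j)" and G=G])
    show "(X j, ?H (X j)) \<in> clg a e" for j by (rule clg_DT[OF a XDT])
    have XX: "X j p - ?x p = - (complex_of_real (B j (fst p) * T j (fst (snd p))) *s ?x p)" for j p
      unfolding X_def ux by (simp add: vec_eq_iff)
    show "(\<lambda>j. nrm MZ (\<lambda>p. X j p - ?x p)) \<longlonglongrightarrow> 0"
      unfolding XX by (rule nrm_scaled_tendsto[OF lx mBT bBT limBT])
    show "(\<lambda>j. nrm MZ (\<lambda>p. ?H (X j) p - G j p - ?H ?x p)) \<longlonglongrightarrow> 0"
      unfolding HX by (rule nrm_scaled_tendsto[OF ly mBT bBT limBT])
    show "G k p = 0 \<or> G j p = 0" if "k \<noteq> j" for k j p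
    proof (rule ccontr)
      obtain r \<theta> \<phi> where p: "p = (r, \<theta>, \<phi>)" by (metis prod_cases3)
      assume "\<not> ?thesis"
      then have "G k (r, \<theta>, \<phi>) \<noteq> 0" "G j (r, \<theta>, \<phi>) \<noteq> 0" by (auto simp: p)
      from Gsupp[OF this(1)] Gsupp[OF this(2)] have "k = j" by (blast intro: scl_separated)
      with that show False by simp
    qed
  qed (rule Gj)+
qed

text \<open>Multiplication by the square root of the usual spherical weight, appropriate because the
  inner product uses the flat measure in \<open>\<theta>\<close>. With this factor split off, the
  angular profiles become functions smooth across the poles; it also provides the decay that cutting
  off at the poles consumes.\<close>

definition wsq :: "(real \<Rightarrow> complex) \<Rightarrow> real \<Rightarrow> complex" where
  "wsq u \<theta> = (if 0 < \<theta> \<and> \<theta> < pi then of_real (sqrt (sin \<theta>)) * u \<theta> else 0)"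

text \<open>The reciprocal \<open>q\<close> of the root has derivative
  \<open>- cos \<theta> * q ^ 3 / 2\<close>, polynomial in \<open>q\<close>, so the bootstrap rule
  applies to it; the root itself is \<open>sin \<theta> * q\<close>.\<close>

lemma Cinf_sqrt_sin: "Cinf {0<..<pi} (\<lambda>\<theta>. sqrt (sin \<theta>))"
proof -
  have pos: "sin \<theta> > 0" if "\<theta> \<in> {0<..<pi}" for \<theta> using that by (auto intro: sin_gt_zero)
  have q: "Cinf {0<..<pi} (\<lambda>\<theta>. inverse (sqrt (sin \<theta>)))"
  proof (rule Cinf_I)
    fix \<theta> :: real assume th: "\<theta> \<in> {0<..<pi}"
    note s = pos[OF th]
    have "((\<lambda>\<theta>. sqrt (sin \<theta>)) has_field_derivative inverse (sqrt (sin \<theta>)) / 2 * cos \<theta>) (at \<theta>)"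
      by (rule DERIV_chain2[OF DERIV_real_sqrt[OF s] DERIV_sin])
    have nz: "sqrt (sin \<theta>) \<noteq> 0" using s by simp
    have "((\<lambda>\<theta>. inverse (sqrt (sin \<theta>))) has_field_derivative
       - (inverse (sqrt (sin \<theta>)) * (inverse (sqrt (sin \<theta>)) / 2 * cos \<theta>) * inverse (sqrt (sin \<theta>)))) (at \<theta>)"
      by (rule DERIV_inverse'[OF \<open>((\<lambda>\<theta>. sqrt (sin \<theta>)) has_field_derivative _) _\<close> nz])
    moreover have "- (q * (q / 2 * c) * q) = (-1/2) * (c * (q * (q * q)))" for q c :: real by simp
    ultimately show "((\<lambda>\<theta>. inverse (sqrt (sin \<theta>))) has_vector_derivative
       (-1/2) * (cos \<theta> * (inverse (sqrt (sin \<theta>)) * (inverse (sqrt (sin \<theta>)) * inverse (sqrt (sin \<theta>)))))) (at \<theta>)"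
      unfolding has_real_derivative_iff_has_vector_derivative by (simp only:)
  next
    fix n assume q: "Ck n {0<..<pi} (\<lambda>\<theta>. inverse (sqrt (sin \<theta>)))"
    have c: "Ck n {0<..<pi} (cos :: real \<Rightarrow> real)"
      using Cinf_sin_cos(2)[of "{0<..<pi}"] by (simp add: Cinf_def)
    show "Ck n {0<..<pi} (\<lambda>\<theta>. (-1/2) * (cos \<theta> * (inverse (sqrt (sin \<theta>)) * (inverse (sqrt (sin \<theta>)) * inverse (sqrt (sin \<theta>))))))"
      by (intro Ck_mult Ck_const q c open_greaterThanLessThan)
  qed auto
  have "Cinf {0<..<pi} (\<lambda>\<theta>. sin \<theta> * inverse (sqrt (sin \<theta>)))"
    by (intro Cinf_mult Cinf_sin_cos q) auto
  then show ?thesis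
  proof (rule Cinf_cong[rotated -1])
    show "sin x * inverse (sqrt (sin x)) = sqrt (sin x)" if "x \<in> {0<..<pi}" for x
      using pos[OF that] by (simp add: real_div_sqrt flip: divide_inverse)
  qed auto
qed

text \<open>A crude linear bound, serving to confine \<open>sin \<theta> \<le> t\<close> to an
  interval of length \<open>4 * t\<close> at each pole. Up to \<open>pi / 3\<close> the cosine is at
  least \<open>1 / 2\<close>; beyond that the sine itself is.\<close>

lemma sin_ge_quarter:
  assumes "0 \<le> x" "x \<le> pi / 2" shows "x / 4 \<le> sin x"
proof (cases "x \<le> pi / 3")
  case True
  have "(\<lambda>x. sin x - x / 4) 0 \<le> (\<lambda>x. sin x - x / 4) x"
  proof (rule DERIV_nonneg_imp_nondecreasing[OF assms(1)])
    fix y assume y: "0 \<le> y" "y \<le> x"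
    have "cos (pi / 3) \<le> cos y" using y True by (intro cos_monotone_0_pi_le) auto
    then have "0 \<le> cos y - 1 / 4" by (simp add: cos_60)
    moreover have "((\<lambda>x. sin x - x / 4) has_real_derivative cos y - 1 / 4) (at y)"
      by (auto intro!: derivative_eq_intros)
    ultimately show "\<exists>d. ((\<lambda>x. sin x - x / 4) has_real_derivative d) (at y) \<and> 0 \<le> d" by blast
  qed
  then show ?thesis by simp
next
  case False
  have "sin (pi / 6) \<le> sin x" using False assms by (intro sin_monotone_2pi_le) auto
  then have "1 / 2 \<le> sin x" by (simp add: sin_30)
  moreover have "x / 4 \<le> 1 / 2" using assms pi_less_4 by linarith
  ultimately show ?thesis by linarith
qed

lemma sin_small_interval:
  assumes "\<theta> \<in> {0..pi}" "sin \<theta> \<le> t"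
  shows "\<theta> \<le> pi / 2 \<Longrightarrow> \<theta> \<in> {0..4 * t}" "\<not> \<theta> \<le> pi / 2 \<Longrightarrow> \<theta> \<in> {pi - 4 * t..pi}"
proof -
  show "\<theta> \<in> {0..4 * t}" if "\<theta> \<le> pi / 2" using sin_ge_quarter[of \<theta>] assms that by auto
  show "\<theta> \<in> {pi - 4 * t..pi}" if "\<not> \<theta> \<le> pi / 2" using sin_ge_quarter[of "pi - \<theta>"] assms that by (auto simp: not_le)
qed

lemma wsq_measurable: "u \<in> borel_measurable borel \<Longrightarrow> wsq u \<in> borel_measurable borel"
  unfolding wsq_def[abs_def]
proof (rule measurable_If)
  assume u: "u \<in> borel_measurable borel"
  have "(\<lambda>\<theta>::real. complex_of_real (sqrt (sin \<theta>))) \<in> borel_measurable borel"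
    by (intro borel_measurable_continuous_onI continuous_intros)
  then show "(\<lambda>\<theta>. complex_of_real (sqrt (sin \<theta>)) * u \<theta>) \<in> borel_measurable borel"
    using u by (rule borel_measurable_times)
  have "{\<theta> \<in> space borel. 0 < \<theta> \<and> \<theta> < pi} = {0<..<pi}" by auto
  then show "{\<theta> \<in> space borel. 0 < \<theta> \<and> \<theta> < pi} \<in> sets borel" by simp
qed simp

lemma tn_add_right: "tn f (\<lambda>\<theta>. g \<theta> + h \<theta>) \<kappa> i p = tn f g \<kappa> i p + tn f h \<kappa> i p"
  by (auto simp: tn_def vec_eq_iff algebra_simps split: prod.splits)

text \<open>Hypothesis \<open>ode\<close> says that the angular operator sends \<open>wsq u\<close>
  to \<open>wsq w\<close>. The factor \<open>1 - bump (sin \<theta> / scl j)\<close> makes the field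
  vanish near the poles, where the ring lemma takes over. In the transition strips the gradient is
  of order \<open>1 / scl j\<close>, the field of order \<open>sqrt (scl j)\<close> and the width of
  order \<open>scl j\<close>: the norm stays bounded with no power to spare, so averaging over
  scales is required again.\<close>

lemma clg_pole:
  assumes a: "a \<noteq> 0" and \<kappa>: "\<kappa> - 1/2 \<in> \<int>" and f: "f \<in> Cc" and u: "Cinf UNIV u" and w: "Cinf UNIV w"
    and ode: "\<And>\<theta>. of_real (sin \<theta>) * vd u \<theta> + of_real (cos \<theta> / 2 - tau i * \<kappa>) * u \<theta> = of_real (sin \<theta>) * w \<theta>"
  shows "(tn f (wsq u) \<kappa> i,
     (\<lambda>p. tn (\<lambda>r. - \<i> * of_real (sgr i) * vd f r + of_real (a * \<kappa> / (varpi a r)\<^sup>2) * f r) (wsq u) \<kappa> i p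
       + tn (\<lambda>r. - \<i> * of_real (osg i / varpi a r) * f r) (wsq w) \<kappa> (pr i) p)) \<in> clg a e"
proof -
  let ?f1 = "\<lambda>r. - \<i> * of_real (sgr i) * vd f r + of_real (a * \<kappa> / (varpi a r)\<^sup>2) * f r"
  let ?f2 = "\<lambda>r. - \<i> * of_real (osg i / varpi a r) * f r"
  let ?x = "tn f (wsq u) \<kappa> i"
  let ?y = "\<lambda>p. tn ?f1 (wsq u) \<kappa> i p + tn ?f2 (wsq w) \<kappa> (pr i) p"
  let ?H = "frakH a 0 e 0"
  have f1: "?f1 \<in> Cc" by (rule inverse_varpi_coefficient(2)[OF a f])
  have f2: "?f2 \<in> Cc" by (rule inverse_varpi_coefficient(1)[OF a f])
  obtain F where F: "\<And>r. norm (f r) \<le> F" using Cc_bounded[OF f] by blast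
  obtain F1 where F1: "\<And>r. norm (?f1 r) \<le> F1" using Cc_bounded[OF f1] by blast
  obtain F2 where F2: "\<And>r. norm (?f2 r) \<le> F2" using Cc_bounded[OF f2] by blast
  obtain R0 where R0: "\<And>r. \<bar>r\<bar> > R0 \<Longrightarrow> f r = 0" using Cc_supp[OF f] by auto
  obtain R1 where R1: "\<And>r. \<bar>r\<bar> > R1 \<Longrightarrow> ?f1 r = 0" using Cc_supp[OF f1] by blast
  define R where "R = \<bar>R0\<bar>"
  have R: "R \<ge> 0" "\<And>r. \<bar>r\<bar> > R \<Longrightarrow> f r = 0" using R0 by (auto simp: R_def)
  have bnd: "\<exists>B\<ge>0. \<forall>\<theta>\<in>{0..pi}. norm (v \<theta>) \<le> B" if "Cinf UNIV v" for v :: "real \<Rightarrow> complex"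
  proof -
    have "bounded (v ` {0..pi})"
      by (intro compact_imp_bounded compact_continuous_image continuous_on_subset[OF Cinf_continuous_on[OF that]]) auto
    then obtain B where "B > 0" "\<forall>\<theta>\<in>{0..pi}. norm (v \<theta>) \<le> B" by (auto simp: bounded_pos simp del: atLeastAtMost_iff)
    then show ?thesis by (intro exI[of _ B]) auto
  qed
  obtain U where U: "U \<ge> 0" "\<And>\<theta>. \<theta> \<in> {0..pi} \<Longrightarrow> norm (u \<theta>) \<le> U" using bnd[OF u] by blast
  obtain W where W: "W \<ge> 0" "\<And>\<theta>. \<theta> \<in> {0..pi} \<Longrightarrow> norm (w \<theta>) \<le> W" using bnd[OF w] by blast
  have wsqb: "norm (wsq v \<theta>) \<le> B" if "\<And>\<theta>. \<theta> \<in> {0..pi} \<Longrightarrow> norm (v \<theta>) \<le> B" "B \<ge> 0" for v B \<theta>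
  proof (cases "0 < \<theta> \<and> \<theta> < pi")
    case True
    have "sqrt (sin \<theta>) * norm (v \<theta>) \<le> 1 * B"
      using True that by (intro mult_mono) (auto intro: less_imp_le sin_gt_zero)
    moreover have "sin \<theta> > 0" using True by (intro sin_gt_zero) auto
    ultimately show ?thesis using True by (simp add: wsq_def norm_mult)
  next
    case False
    then show ?thesis using that(2) by (auto simp: wsq_def)
  qed
  have mu: "wsq u \<in> borel_measurable borel" and mw: "wsq w \<in> borel_measurable borel"
    by (intro wsq_measurable borel_measurable_continuous_onI Cinf_continuous_on u w)+
  have lx: "l2 MZ ?x" by (rule tn_l2[OF Cc_measurable[OF f] mu F wsqb[OF U(2,1)] R0])
  have ly: "l2 MZ ?y"
  proof (rule l2_add)
    show "l2 MZ (tn ?f1 (wsq u) \<kappa> i)" by (rule tn_l2[OF Cc_measurable[OF f1] mu F1 wsqb[OF U(2,1)] R1])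
    show "l2 MZ (tn ?f2 (wsq w) \<kappa> (pr i))"
      by (rule tn_l2[OF Cc_measurable[OF f2] mw F2 wsqb[OF W(2,1)], of R0]) (simp_all add: R0)
  qed
  define b where "b j \<theta> = bump (sin \<theta> / scl j)" for j \<theta>
  define db where "db j \<theta> = dbump (sin \<theta> / scl j) * (cos \<theta> / scl j)" for j \<theta>
  define v where "v j \<theta> = of_real (1 - b j \<theta>) * wsq u \<theta>" for j \<theta>
  have b01: "0 \<le> b j \<theta>" "b j \<theta> \<le> 1" for j \<theta> by (auto simp: b_def bump_bounds)
  have Cb: "Cinf UNIV (b j)" for j
  proof -
    have "Cinf UNIV (\<lambda>\<theta>. bump ((\<lambda>\<theta>. (1 / scl j) * sin \<theta>) \<theta>))"
      by (rule Cinf_compose[OF _ _ _ Cinf_mult[OF _ Cinf_const Cinf_sin_cos(1)] Cinf_bump]) auto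
    then show ?thesis by (simp add: b_def[abs_def])
  qed
  have dbd: "(b j has_vector_derivative db j \<theta>) (at \<theta>)" for j \<theta>
  proof -
    have "((\<lambda>\<theta>. sin \<theta> / scl j) has_vector_derivative (cos \<theta> / scl j)) (at \<theta>)"
      unfolding has_real_derivative_iff_has_vector_derivative[symmetric]
      by (auto intro!: derivative_eq_intros simp: scl_def)
    from vector_diff_chain_at[OF this bump_derivative] show ?thesis
      by (simp add: b_def[abs_def] db_def o_def mult.commute)
  qed
  have v0: "v j \<theta> = 0" if "\<theta> < scl j / 2 \<or> \<theta> > pi - scl j / 2" for j \<theta>
  proof (cases "0 < \<theta> \<and> \<theta> < pi")
    case True
    have "0 < sin \<theta>" using True by (intro sin_gt_zero) auto
    moreover have "sin \<theta> \<le> scl j / 2"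
    proof (cases "\<theta> < scl j / 2")
      case True2: True
      have "sin \<theta> \<le> \<theta>" using True by (intro sin_x_le_x) auto
      then show ?thesis using True2 by simp
    next
      case False
      have "sin (pi - \<theta>) \<le> pi - \<theta>" using True by (intro sin_x_le_x) auto
      then show ?thesis using False that by simp
    qed
    ultimately have "b j \<theta> = 1" unfolding b_def using scl_pos[of j]
      by (intro bump_1) (simp add: abs_divide field_simps)
    then show ?thesis by (simp add: v_def)
  qed (auto simp: v_def wsq_def)
  let ?O = "\<lambda>j. {..<scl j / 2} \<union> {pi - scl j / 2<..}"
  have cover: "{0<..<pi} \<union> ?O j = UNIV" for j using scl_pos[of j] by (auto simp: not_less)
  have Cwsq: "Cinf {0<..<pi} (wsq u)"
  proof (rule Cinf_cong)
    show "Cinf {0<..<pi} (\<lambda>\<theta>. of_real (sqrt (sin \<theta>)) * u \<theta>)"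
      by (intro Cinf_mult Cinf_of_real Cinf_sqrt_sin Cinf_subset[OF u]) auto
  qed (auto simp: wsq_def)
  have Cv: "Cinf UNIV (v j)" for j
  proof -
    have "Cinf {0<..<pi} (v j)" unfolding v_def[abs_def]
      by (intro Cinf_mult Cinf_of_real Cinf_diff Cinf_const Cwsq Cinf_subset[OF Cb]) auto
    moreover have "Cinf (?O j) (v j)"
      by (rule Cinf_cong[where f="\<lambda>_. 0"]) (auto intro!: Cinf_const open_Un simp: v0)
    ultimately show ?thesis using Cinf_Un cover by metis
  qed
  \<comment> \<open>Differentiating \<open>sqrt (sin \<theta>)\<close> produces the half-cosine term
    of \<open>ode\<close>, up to the common factor
    \<open>sqrt (sin \<theta>) / sin \<theta>\<close>; the cutoff contributes only the summand with
    \<open>db\<close>.\<close>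
  have dv: "vd (v j) \<theta> - of_real (tau i * \<kappa> / sin \<theta>) * v j \<theta> = of_real (1 - b j \<theta>) * wsq w \<theta> + of_real (- db j \<theta>) * wsq u \<theta>" for j \<theta>
  proof (cases "0 < \<theta> \<and> \<theta> < pi")
    case True
    then have th: "\<theta> \<in> {0<..<pi}" and s: "sin \<theta> > 0" by (auto intro: sin_gt_zero)
    have "((\<lambda>\<theta>. sqrt (sin \<theta>)) has_field_derivative (cos \<theta> / (2 * sqrt (sin \<theta>)))) (at \<theta>)"
      using s by (auto intro!: derivative_eq_intros simp: field_simps)
    from has_vector_derivative_mult[OF has_vector_derivative_of_real[OF this] Cinf_D[OF u UNIV_I]]
    have "((\<lambda>\<theta>. of_real (sqrt (sin \<theta>)) * u \<theta>) has_vector_derivative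
       (of_real (sqrt (sin \<theta>)) * vd u \<theta> + of_real (cos \<theta> / (2 * sqrt (sin \<theta>))) * u \<theta>)) (at \<theta>)" .
    then have "(wsq u has_vector_derivative
       (of_real (sqrt (sin \<theta>)) * vd u \<theta> + of_real (cos \<theta> / (2 * sqrt (sin \<theta>))) * u \<theta>)) (at \<theta>)"
      by (rule has_vector_derivative_transform_within_open[where S="{0<..<pi}"]) (use th in \<open>auto simp: wsq_def\<close>)
    from has_vector_derivative_mult[OF has_vector_derivative_of_real[OF has_real_derivative_iff_has_vector_derivative[THEN iffD2,
       OF has_vector_derivative_diff[OF has_vector_derivative_const dbd]]] this]
    have "vd (v j) \<theta> = of_real (1 - b j \<theta>) * (of_real (sqrt (sin \<theta>)) * vd u \<theta> + of_real (cos \<theta> / (2 * sqrt (sin \<theta>))) * u \<theta>)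
       + of_real (0 - db j \<theta>) * wsq u \<theta>"
      unfolding v_def[abs_def] by (rule vector_derivative_at)
    moreover have "of_real (sqrt (sin \<theta>)) * vd u \<theta> + of_real (cos \<theta> / (2 * sqrt (sin \<theta>))) * u \<theta>
       - of_real (tau i * \<kappa> / sin \<theta>) * (of_real (sqrt (sin \<theta>)) * u \<theta>) = of_real (sqrt (sin \<theta>)) * w \<theta>"
    proof -
      have ss: "cos \<theta> / (2 * sqrt (sin \<theta>)) = sqrt (sin \<theta>) * (cos \<theta> / 2) / sin \<theta>"
        using s by (simp add: field_simps)
      have "of_real (sqrt (sin \<theta>)) * vd u \<theta> + of_real (cos \<theta> / (2 * sqrt (sin \<theta>))) * u \<theta>
       - of_real (tau i * \<kappa> / sin \<theta>) * (of_real (sqrt (sin \<theta>)) * u \<theta>)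
        = of_real (sqrt (sin \<theta>)) * (of_real (sin \<theta>) * vd u \<theta> + of_real (cos \<theta> / 2 - tau i * \<kappa>) * u \<theta>) / of_real (sin \<theta>)"
        unfolding ss using s by (simp add: field_simps)
      then show ?thesis unfolding ode using s by simp
    qed
    moreover have "V - k * (\<beta> * S) = \<beta> * W + \<gamma> * S" if "V = \<beta> * D + \<gamma> * S" "D - k * S = W" for V \<beta> \<gamma> D S k W :: complex
      unfolding that(1) that(2)[symmetric] by (simp add: algebra_simps)
    ultimately show ?thesis using True by (simp only: v_def wsq_def if_True diff_0 simp_thms)
  next
    case False
    then have th: "\<theta> \<in> ?O j" using scl_pos[of j] by (auto simp: not_less)
    have "((\<lambda>_. 0) has_vector_derivative 0) (at \<theta>)" by simp
    then have "(v j has_vector_derivative 0) (at \<theta>)"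
      by (rule has_vector_derivative_transform_within_open[where S="?O j"]) (use th in \<open>auto simp: v0\<close>)
    then show ?thesis using False by (auto simp: vector_derivative_at v_def wsq_def)
  qed
  define X where "X j = tn f (v j) \<kappa> i" for j
  define G where "G j = tn ?f2 (\<lambda>\<theta>. of_real (- db j \<theta>) * wsq u \<theta>) \<kappa> (pr i)" for j
  have XC: "(X j, ?H (X j)) \<in> clg a e" for j
    unfolding X_def
  proof (rule clg_ring[OF a \<kappa> f Cv])
    show "scl j / 2 > 0" using scl_pos[of j] by simp
    show "v j \<theta> = 0" if "\<theta> \<notin> {scl j / 2..pi - scl j / 2}" for \<theta> using that by (intro v0) auto
  qed
  have XX: "X j p - ?x p = - (complex_of_real (b j (fst (snd p))) *s ?x p)" for j p
  proof -
    obtain r \<theta> \<phi> where p: "p = (r, \<theta>, \<phi>)" by (metis prod_cases3)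
    show ?thesis by (simp add: X_def p tn_def v_def vec_eq_iff algebra_simps)
  qed
  have HX: "?H (X j) p - G j p - ?y p = - (complex_of_real (b j (fst (snd p))) *s ?y p)" for j p
  proof -
    obtain r \<theta> \<phi> where p: "p = (r, \<theta>, \<phi>)" by (metis prod_cases3)
    have "?H (X j) p = tn ?f1 (v j) \<kappa> i p + tn ?f2 (\<lambda>\<theta>. vd (v j) \<theta> - of_real (tau i * \<kappa> / sin \<theta>) * v j \<theta>) \<kappa> (pr i) p"
      unfolding p X_def by (rule frakH_tn[OF a Cc_D[OF f] Cinf_D[OF Cv UNIV_I]])
    also have "\<dots> = tn ?f1 (v j) \<kappa> i p + (tn ?f2 (\<lambda>\<theta>. of_real (1 - b j \<theta>) * wsq w \<theta>) \<kappa> (pr i) p + G j p)"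
      unfolding dv G_def tn_add_right ..
    finally show ?thesis
      by (simp add: p tn_def v_def vec_eq_iff algebra_simps add_divide_distrib diff_divide_distrib)
  qed
  obtain C where C: "C \<ge> 0" "\<And>t. \<bar>dbump t\<bar> \<le> C" using dbump_bounded by blast
  define c where "c = sqrt (R * 16 * pi) * (F2 * (C * U))"
  have Gj: "l2 MZ (G j) \<and> nrm MZ (G j) \<le> 2 * c" for j
  proof -
    have sp: "scl j > 0" by (rule scl_pos)
    let ?g = "\<lambda>\<theta>. of_real (- db j \<theta>) * wsq u \<theta>"
    \<comment> \<open>The support consists of one strip at each pole, of width at most
      \<open>4 * scl j\<close>. Splitting at \<open>pi / 2\<close> estimates them separately, and
      each contributes at most \<open>c\<close>.\<close>
    let ?g1 = "\<lambda>\<theta>. if \<theta> \<le> pi / 2 then ?g \<theta> else 0"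
    let ?g2 = "\<lambda>\<theta>. if \<theta> \<le> pi / 2 then 0 else ?g \<theta>"
    have mdb: "db j \<in> borel_measurable borel"
      using Cinf_continuous_on[OF Cinf_derivative[OF Cb[of j]]]
      by (auto intro: borel_measurable_continuous_onI simp: vector_derivative_at[OF dbd])
    have mg: "?g \<in> borel_measurable borel"
      by (intro borel_measurable_times borel_measurable_of_real_comp borel_measurable_uminus mdb mu)
    have mg12: "?g1 \<in> borel_measurable borel" "?g2 \<in> borel_measurable borel" using mg by measurable
    have nz: "0 < \<theta> \<and> \<theta> < pi \<and> sin \<theta> \<le> scl j" if "?g \<theta> \<noteq> 0" for \<theta>
    proof -
      have "0 < \<theta> \<and> \<theta> < pi" "dbump (sin \<theta> / scl j) \<noteq> 0" using that by (auto simp: wsq_def db_def split: if_splits)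
      then show ?thesis using dbump_scaled_nonzero(2)[of "sin \<theta>" j] by auto
    qed
    have gb: "norm (?g \<theta>) \<le> C / sqrt (scl j) * U" for \<theta>
    proof (cases "?g \<theta> = 0")
      case False
      note n = nz[OF False]
      have s: "sin \<theta> > 0" using n by (intro sin_gt_zero) auto
      have "\<bar>dbump (sin \<theta> / scl j)\<bar> * \<bar>cos \<theta>\<bar> \<le> C * 1" by (intro mult_mono C) auto
      then have "\<bar>db j \<theta>\<bar> \<le> C / scl j"
        using sp by (simp add: db_def abs_mult abs_divide divide_right_mono)
      moreover have "norm (wsq u \<theta>) \<le> sqrt (scl j) * U"
        using n s U(2)[of \<theta>] U(1) sp by (auto simp: wsq_def norm_mult intro!: mult_mono)
      ultimately have "norm (?g \<theta>) \<le> C / scl j * (sqrt (scl j) * U)"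
        unfolding norm_mult norm_of_real abs_minus_cancel using C(1) sp by (intro mult_mono) auto
      also have "\<dots> = C * (sqrt (scl j) / scl j) * U" by simp
      also have "sqrt (scl j) / scl j = 1 / sqrt (scl j)" using sp
        by (metis real_div_sqrt less_imp_le divide_divide_eq_right mult.left_neutral real_sqrt_gt_0_iff
            nonzero_divide_eq_eq less_numeral_extra(3) divide_divide_eq_left mult.commute)
      finally show ?thesis by simp
    next
      case True
      show ?thesis unfolding True using C(1) U(1) sp by simp
    qed
    have F20: "F2 \<ge> 0" using order.trans[OF norm_ge_zero F2[of 0]] .
    have gb0: "0 \<le> C / sqrt (scl j) * U" using C(1) U(1) sp by simp
    \<comment> \<open>The volume of the strip contributes \<open>sqrt (scl j)\<close>, which cancels
      the \<open>1 / sqrt (scl j)\<close> in the bound of the profile.\<close>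
    have fac: "sqrt ((R - (- R)) * (4 * scl j) * (2 * pi)) * (F2 * (C / sqrt (scl j) * U)) = c"
    proof -
      have "(R - (- R)) * (4 * scl j) * (2 * pi) = (R * 16 * pi) * scl j" by simp
      then have "sqrt ((R - (- R)) * (4 * scl j) * (2 * pi)) = sqrt (R * 16 * pi) * sqrt (scl j)"
        by (simp only: real_sqrt_mult)
      then show ?thesis using sp by (simp add: c_def)
    qed
    have f2R: "?f2 r = 0" if "r \<notin> {-R..R}" for r using that R(2)[of r] by (auto simp: abs_if)
    have 1: "l2 MZ (tn ?f2 ?g1 \<kappa> (pr i)) \<and> nrm MZ (tn ?f2 ?g1 \<kappa> (pr i)) \<le> sqrt ((R - (- R)) * (4 * scl j - 0) * (2 * pi)) * (F2 * (C / sqrt (scl j) * U))"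
    proof (rule tn_bound[OF Cc_measurable[OF f2] mg12(1) F2])
      show "norm (?g1 \<theta>) \<le> C / sqrt (scl j) * U" for \<theta> using gb[of \<theta>] gb0 by simp
      show "?f2 r * ?g1 \<theta> = 0" if "\<theta> \<in> {0..pi}" "r \<notin> {-R..R} \<or> \<theta> \<notin> {0..4 * scl j}" for r \<theta>
      proof (cases "r \<in> {-R..R} \<and> \<theta> \<le> pi / 2")
        case True
        then have "?g \<theta> = 0" using nz[of \<theta>] sin_small_interval(1)[OF that(1), of "scl j"] that(2) by blast
        then show ?thesis by (simp only: if_cancel mult_zero_right)
      qed (use f2R in auto)
    qed (use R sp in auto)
    have 2: "l2 MZ (tn ?f2 ?g2 \<kappa> (pr i)) \<and> nrm MZ (tn ?f2 ?g2 \<kappa> (pr i)) \<le> sqrt ((R - (- R)) * (pi - (pi - 4 * scl j)) * (2 * pi)) * (F2 * (C / sqrt (scl j) * U))"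
    proof (rule tn_bound[OF Cc_measurable[OF f2] mg12(2) F2])
      show "norm (?g2 \<theta>) \<le> C / sqrt (scl j) * U" for \<theta> using gb[of \<theta>] gb0 by simp
      show "?f2 r * ?g2 \<theta> = 0" if "\<theta> \<in> {0..pi}" "r \<notin> {-R..R} \<or> \<theta> \<notin> {pi - 4 * scl j..pi}" for r \<theta>
      proof (cases "r \<in> {-R..R} \<and> \<not> \<theta> \<le> pi / 2")
        case True
        then have "?g \<theta> = 0" using nz[of \<theta>] sin_small_interval(2)[OF that(1), of "scl j"] that(2) by blast
        then show ?thesis by (simp only: if_cancel mult_zero_right)
      qed (use f2R in auto)
    qed (use R sp in auto)
    have Geq: "G j = (\<lambda>p. tn ?f2 ?g1 \<kappa> (pr i) p + tn ?f2 ?g2 \<kappa> (pr i) p)"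
      unfolding G_def tn_add_right[symmetric] by (rule ext, rule arg_cong[where f="\<lambda>g. tn ?f2 g \<kappa> (pr i) _"]) auto
    have "nrm MZ (G j) \<le> c + c"
      unfolding Geq using 1 2 fac by (intro order.trans[OF nrm_triangle] add_mono) auto
    moreover have "l2 MZ (G j)" unfolding Geq using 1 2 by (intro l2_add) auto
    ultimately show ?thesis by simp
  qed
  have Gsupp: "0 < \<theta> \<and> \<theta> < pi \<and> scl j / 2 \<le> \<bar>sin \<theta>\<bar> \<and> \<bar>sin \<theta>\<bar> \<le> scl j" if "G j (r, \<theta>, \<phi>) \<noteq> 0" for j r \<theta> \<phi>
  proof -
    have "dbump (sin \<theta> / scl j) \<noteq> 0" "0 < \<theta> \<and> \<theta> < pi" using that by (auto simp: G_def tn_def vec_eq_iff db_def wsq_def split: if_splits)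
    then show ?thesis using dbump_scaled_nonzero[of "sin \<theta>" j] by auto
  qed
  have mb: "(\<lambda>p::pt. b j (fst (snd p))) \<in> borel_measurable borel" for j
    by (rule borel_measurable_continuous_onI, rule continuous_on_compose2[OF Cinf_continuous_on[OF Cb]])
      (auto intro!: continuous_intros)
  have lim: "AE p in MZ. (\<lambda>j. b j (fst (snd p))) \<longlonglongrightarrow> 0 \<or> g p = 0"
    if z: "\<And>r \<theta> \<phi>. \<not> (0 < \<theta> \<and> \<theta> < pi) \<Longrightarrow> g (r, \<theta>, \<phi>) = 0" for g :: field4
  proof (rule AE_MZ_I)
    fix p :: pt
    obtain r \<theta> \<phi> where p: "p = (r, \<theta>, \<phi>)" by (metis prod_cases3)
    show "(\<lambda>j. b j (fst (snd p))) \<longlonglongrightarrow> 0 \<or> g p = 0"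
    proof (cases "0 < \<theta> \<and> \<theta> < pi")
      case True
      then have "sin \<theta> \<noteq> 0" using sin_gt_zero[of \<theta>] by auto
      then show ?thesis using scl_bump_tendsto[of "sin \<theta>"] by (simp add: p b_def)
    qed (auto simp: p z)
  qed
  show ?thesis
  proof (rule clg_average[OF a lx ly XC, where G=G])
    show "(\<lambda>j. nrm MZ (\<lambda>p. X j p - ?x p)) \<longlonglongrightarrow> 0"
      unfolding XX by (rule nrm_scaled_tendsto[OF lx mb b01 lim]) (auto simp: tn_def wsq_def)
    show "(\<lambda>j. nrm MZ (\<lambda>p. ?H (X j) p - G j p - ?y p)) \<longlonglongrightarrow> 0"
      unfolding HX by (rule nrm_scaled_tendsto[OF ly mb b01 lim]) (auto simp: tn_def wsq_def)
    show "G k p = 0 \<or> G j p = 0" if "k \<noteq> j" for k j p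
    proof (rule ccontr)
      obtain r \<theta> \<phi> where p: "p = (r, \<theta>, \<phi>)" by (metis prod_cases3)
      assume "\<not> ?thesis"
      then have "G k (r, \<theta>, \<phi>) \<noteq> 0" "G j (r, \<theta>, \<phi>) \<noteq> 0" by (auto simp: p)
      from Gsupp[OF this(1)] Gsupp[OF this(2)] have "k = j" by (blast intro: scl_separated)
      with that show False by simp
    qed
  qed (use Gj in blast)+
qed

section \<open>Angular eigenfunctions\<close>

text \<open>With \<open>y = sin\<^sup>2 (\<theta>/2)\<close> the angular operators act triangularly on powers of \<open>y\<close>; the coefficients
  below are those of the (terminating) hypergeometric eigenpolynomials.\<close>

fun jc :: "nat \<Rightarrow> nat \<Rightarrow> nat \<Rightarrow> real" where
  "jc k n 0 = 1"
| "jc k n (Suc j) = jc k n j * ((real (k + 1 + j))\<^sup>2 - (real (k + 1 + n))\<^sup>2) / (real (Suc j) * real (k + 1 + j))"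

definition hp :: "nat \<Rightarrow> nat \<Rightarrow> real \<Rightarrow> real" where
  "hp a b \<theta> = sin (\<theta> / 2) ^ a * cos (\<theta> / 2) ^ b"

text \<open>Up to normalisation this is
  \<open>sin (\<theta> / 2) ^ k * cos (\<theta> / 2) ^ (k + 1)\<close> times the Jacobi polynomial
  of degree \<open>n\<close> with parameters \<open>k\<close> and \<open>k + 1\<close> at
  \<open>cos \<theta>\<close>. In \<open>qq\<close> the two parameters, and the two exponents, are
  interchanged.\<close>

definition pp :: "nat \<Rightarrow> nat \<Rightarrow> real \<Rightarrow> real" where
  "pp k n \<theta> = (\<Sum>j\<le>n. jc k n j * hp (k + 2 * j) (k + 1) \<theta>)"

definition qq :: "nat \<Rightarrow> nat \<Rightarrow> real \<Rightarrow> real" where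
  "qq k n \<theta> = (\<Sum>j\<le>n. jc k n j * (real (k + 1 + n) / real (k + 1 + j)) * hp (k + 1 + 2 * j) k \<theta>)"

lemma jc_terminates: "jc k n (Suc n) = 0"
  by simp

lemma jc_nonzero: "j \<le> n \<Longrightarrow> jc k n j \<noteq> 0"
proof (induction j)
  case (Suc j)
  have "(real (k + 1 + j))\<^sup>2 \<noteq> (real (k + 1 + n))\<^sup>2"
    using Suc.prems by (intro less_imp_neq power_strict_mono) auto
  then show ?case using Suc by simp
qed simp

text \<open>The truncated exponents at \<open>a = 0\<close> and \<open>b = 0\<close> are harmless,
  since their coefficients vanish there.\<close>

definition dhp :: "nat \<Rightarrow> nat \<Rightarrow> real \<Rightarrow> real" where
  "dhp a b \<theta> = real a / 2 * (sin (\<theta> / 2) ^ (a - 1) * cos (\<theta> / 2) ^ (b + 1)) - real b / 2 * (sin (\<theta> / 2) ^ (a + 1) * cos (\<theta> / 2) ^ (b - 1))"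

lemma hp_derivative: "(hp a b has_field_derivative dhp a b \<theta>) (at \<theta>)"
  unfolding hp_def[abs_def] dhp_def
  by (auto intro!: derivative_eq_intros simp: algebra_simps)

text \<open>The factor \<open>sin \<theta>\<close>, twice the product of the half-angle functions,
  restores the lowered exponents, so the angular equations become identities between half-angle
  monomials.\<close>

lemma sin_dhp: "sin \<theta> * dhp a b \<theta> = real a * hp a (b + 2) \<theta> - real b * hp (a + 2) b \<theta>"
proof -
  have s: "sin \<theta> = 2 * sin (\<theta> / 2) * cos (\<theta> / 2)" using sin_double[of "\<theta> / 2"] by simp
  have 1: "2 * S * C * (real a / 2 * (S ^ (a - 1) * C ^ (b + 1))) = real a * (S ^ a * C ^ (b + 2))" for S C :: real
    by (cases a) (simp_all add: algebra_simps power2_eq_square)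
  have 2: "2 * S * C * (real b / 2 * (S ^ (a + 1) * C ^ (b - 1))) = real b * (S ^ (a + 2) * C ^ b)" for S C :: real
    by (cases b) (simp_all add: algebra_simps power2_eq_square)
  show ?thesis unfolding dhp_def hp_def s right_diff_distrib 1 2 ..
qed

lemma half_angle:
  fixes \<theta> :: real
  shows "cos \<theta> = cos (\<theta> / 2) ^ 2 - sin (\<theta> / 2) ^ 2" "sin (\<theta> / 2) ^ 2 + cos (\<theta> / 2) ^ 2 = 1"
  "sin \<theta> = 2 * sin (\<theta> / 2) * cos (\<theta> / 2)"
  using cos_double[of "\<theta> / 2"] sin_double[of "\<theta> / 2"] by auto

text \<open>Inserting \<open>S ^ 2 + C ^ 2 = 1\<close> into the constant terms makes both sides
  homogeneous, and monomials can be compared. The index \<open>j - 1\<close> is truncated at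
  \<open>j = 0\<close>, where its coefficient \<open>real j\<close> is 0.\<close>

lemma hp_lower:
  "sin \<theta> * dhp (k + 2 * j) (k + 1) \<theta> + (cos \<theta> / 2 - (real k + 1/2)) * hp (k + 2 * j) (k + 1) \<theta>
     = sin \<theta> * (- real (k + 1 + j) * hp (k + 1 + 2 * j) k \<theta> + real j * hp (k + 1 + 2 * (j - 1)) k \<theta>)"
proof -
  define S where "S = sin (\<theta> / 2)"
  define C where "C = cos (\<theta> / 2)"
  have SC: "S\<^sup>2 + C\<^sup>2 = 1" unfolding S_def C_def by (rule half_angle)
  have c: "cos \<theta> / 2 - (real k + 1/2) = (C\<^sup>2 - S\<^sup>2) / 2 - (real k + 1/2) * (S\<^sup>2 + C\<^sup>2)"
    unfolding SC using half_angle(1)[of \<theta>] by (simp add: S_def C_def)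
  have jj: "real j * hp (k + 1 + 2 * (j - 1)) k \<theta> * (2 * S * C) = 2 * real j * (S\<^sup>2 + C\<^sup>2) * (S ^ (k + 2 * j) * C ^ (k + 1))"
    unfolding SC by (cases j) (simp_all add: hp_def S_def[symmetric] C_def[symmetric] algebra_simps)
  have "sin \<theta> * (- real (k + 1 + j) * hp (k + 1 + 2 * j) k \<theta> + real j * hp (k + 1 + 2 * (j - 1)) k \<theta>)
     = (2 * S * C) * (- real (k + 1 + j)) * hp (k + 1 + 2 * j) k \<theta> + real j * hp (k + 1 + 2 * (j - 1)) k \<theta> * (2 * S * C)"
    unfolding half_angle(3)[of \<theta>] S_def[symmetric] C_def[symmetric] by (simp add: algebra_simps)
  then show ?thesis unfolding sin_dhp c jj
    by (simp add: hp_def S_def[symmetric] C_def[symmetric] algebra_simps power2_eq_square add_divide_distrib diff_divide_distrib)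
qed

text \<open>This direction is diagonal in \<open>j\<close>, while the opposite one mixes
  neighbouring powers; the recursion of \<open>jc\<close> is therefore dictated by the
  latter.\<close>

lemma hp_raise:
  "sin \<theta> * dhp (k + 1 + 2 * j) k \<theta> + (cos \<theta> / 2 + (real k + 1/2)) * hp (k + 1 + 2 * j) k \<theta>
     = sin \<theta> * (real (k + 1 + j) * hp (k + 2 * j) (k + 1) \<theta>)"
proof -
  define S where "S = sin (\<theta> / 2)"
  define C where "C = cos (\<theta> / 2)"
  have SC: "S\<^sup>2 + C\<^sup>2 = 1" unfolding S_def C_def by (rule half_angle)
  have c: "cos \<theta> / 2 + (real k + 1/2) = (C\<^sup>2 - S\<^sup>2) / 2 + (real k + 1/2) * (S\<^sup>2 + C\<^sup>2)"
    unfolding SC using half_angle(1)[of \<theta>] by (simp add: S_def C_def)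
  show ?thesis unfolding sin_dhp c unfolding half_angle(3)[of \<theta>]
    by (simp add: hp_def S_def[symmetric] C_def[symmetric] algebra_simps power2_eq_square add_divide_distrib diff_divide_distrib)
qed

definition dpp :: "nat \<Rightarrow> nat \<Rightarrow> real \<Rightarrow> real" where
  "dpp k n \<theta> = (\<Sum>j\<le>n. jc k n j * dhp (k + 2 * j) (k + 1) \<theta>)"

definition dqq :: "nat \<Rightarrow> nat \<Rightarrow> real \<Rightarrow> real" where
  "dqq k n \<theta> = (\<Sum>j\<le>n. jc k n j * (real (k + 1 + n) / real (k + 1 + j)) * dhp (k + 1 + 2 * j) k \<theta>)"

lemma pp_derivative: "(pp k n has_field_derivative dpp k n \<theta>) (at \<theta>)"
  and qq_derivative: "(qq k n has_field_derivative dqq k n \<theta>) (at \<theta>)"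
  unfolding pp_def[abs_def] dpp_def qq_def[abs_def] dqq_def
  by (intro DERIV_sum DERIV_cmult hp_derivative)+

text \<open>After an index shift both sides are expansions in \<open>hp (k + 1 + 2 * j) k\<close>,
  and equality of the coefficients is the recursion defining \<open>jc\<close>, with
  \<open>k + 1 + n\<close> as eigenvalue. The expansion closes at \<open>j = n\<close> because
  \<open>jc k n (n + 1)\<close> is 0.\<close>

lemma pp_ode:
  "sin \<theta> * dpp k n \<theta> + (cos \<theta> / 2 - (real k + 1/2)) * pp k n \<theta> = sin \<theta> * (- real (k + 1 + n) * qq k n \<theta>)"
proof -
  have "sin \<theta> * dpp k n \<theta> + (cos \<theta> / 2 - (real k + 1/2)) * pp k n \<theta>
    = (\<Sum>j\<le>n. jc k n j * (sin \<theta> * dhp (k + 2 * j) (k + 1) \<theta> + (cos \<theta> / 2 - (real k + 1/2)) * hp (k + 2 * j) (k + 1) \<theta>))"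
    unfolding dpp_def pp_def by (simp add: sum_distrib_left sum.distrib[symmetric] algebra_simps)
  also have "\<dots> = sin \<theta> * ((\<Sum>j\<le>n. jc k n j * (- real (k + 1 + j)) * hp (k + 1 + 2 * j) k \<theta>) + (\<Sum>j\<le>n. jc k n j * real j * hp (k + 1 + 2 * (j - 1)) k \<theta>))"
    unfolding hp_lower by (simp add: sum_distrib_left sum.distrib[symmetric] algebra_simps)
  also have "(\<Sum>j\<le>n. jc k n j * real j * hp (k + 1 + 2 * (j - 1)) k \<theta>) = (\<Sum>j\<le>n. jc k n (Suc j) * real (Suc j) * hp (k + 1 + 2 * j) k \<theta>)"
  proof -
    \<comment> \<open>The added top summand vanishes by termination, and the bottom one by its
      factor \<open>real j\<close>; after the shift the range is again
      \<open>j \<le> n\<close>.\<close>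
    have "(\<Sum>j\<le>n. jc k n j * real j * hp (k + 1 + 2 * (j - 1)) k \<theta>) = (\<Sum>j\<le>Suc n. jc k n j * real j * hp (k + 1 + 2 * (j - 1)) k \<theta>)"
      using jc_terminates[of k n] by (simp del: jc.simps)
    also have "\<dots> = (\<Sum>j\<le>n. jc k n (Suc j) * real (Suc j) * hp (k + 1 + 2 * j) k \<theta>)"
      by (subst sum.atMost_Suc_shift) (simp del: jc.simps)
    finally show ?thesis .
  qed
  also have "(\<Sum>j\<le>n. jc k n j * (- real (k + 1 + j)) * hp (k + 1 + 2 * j) k \<theta>) + (\<Sum>j\<le>n. jc k n (Suc j) * real (Suc j) * hp (k + 1 + 2 * j) k \<theta>)
     = - real (k + 1 + n) * qq k n \<theta>"
    unfolding qq_def sum_distrib_left sum.distrib[symmetric]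
  proof (intro sum.cong refl)
    fix j
    have key: "c * (- v) + c * (v\<^sup>2 - N\<^sup>2) / (s * v) * s = - N * (c * (N / v))" if "v \<noteq> 0" "s \<noteq> 0" for c v N s :: real
      using that by (simp add: field_simps power2_eq_square)
    have "jc k n j * (- real (k + 1 + j)) + jc k n (Suc j) * real (Suc j) = - real (k + 1 + n) * (jc k n j * (real (k + 1 + n) / real (k + 1 + j)))"
      unfolding jc.simps by (rule key) auto
    then show "jc k n j * (- real (k + 1 + j)) * hp (k + 1 + 2 * j) k \<theta> + jc k n (Suc j) * real (Suc j) * hp (k + 1 + 2 * j) k \<theta>
       = - real (k + 1 + n) * (jc k n j * (real (k + 1 + n) / real (k + 1 + j)) * hp (k + 1 + 2 * j) k \<theta>)"
      by (simp only: distrib_right[symmetric] mult.assoc[symmetric])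
  qed
  finally show ?thesis .
qed

lemma qq_ode:
  "sin \<theta> * dqq k n \<theta> + (cos \<theta> / 2 + (real k + 1/2)) * qq k n \<theta> = sin \<theta> * (real (k + 1 + n) * pp k n \<theta>)"
proof -
  have "sin \<theta> * dqq k n \<theta> + (cos \<theta> / 2 + (real k + 1/2)) * qq k n \<theta>
    = (\<Sum>j\<le>n. jc k n j * (real (k + 1 + n) / real (k + 1 + j)) * (sin \<theta> * dhp (k + 1 + 2 * j) k \<theta> + (cos \<theta> / 2 + (real k + 1/2)) * hp (k + 1 + 2 * j) k \<theta>))"
    unfolding dqq_def qq_def sum_distrib_left sum.distrib[symmetric] by (intro sum.cong refl) algebra
  also have "\<dots> = (\<Sum>j\<le>n. sin \<theta> * (real (k + 1 + n) * (jc k n j * hp (k + 2 * j) (k + 1) \<theta>)))"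
    unfolding hp_raise
  proof (intro sum.cong refl)
    fix j
    have key: "c * (N / v) * (s * (v * h)) = s * (N * (c * h))" if "v \<noteq> 0" for c v N s h :: real
      using that by simp
    show "jc k n j * (real (k + 1 + n) / real (k + 1 + j)) * (sin \<theta> * (real (k + 1 + j) * hp (k + 2 * j) (k + 1) \<theta>))
      = sin \<theta> * (real (k + 1 + n) * (jc k n j * hp (k + 2 * j) (k + 1) \<theta>))"
      by (rule key) simp
  qed
  finally show ?thesis unfolding pp_def by (simp add: sum_distrib_left)
qed

lemma Cinf_hp: "Cinf UNIV (hp a b)"
proof -
  have "Cinf UNIV (\<lambda>\<theta>. sin ((1/2) * \<theta> + 0))" "Cinf UNIV (\<lambda>\<theta>. cos ((1/2) * \<theta> + 0))"
    using Cinf_compose[OF _ _ _ Cinf_affine[of "1/2" 0] Cinf_sin_cos(1)[OF open_UNIV]]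
      Cinf_compose[OF _ _ _ Cinf_affine[of "1/2" 0] Cinf_sin_cos(2)[OF open_UNIV]] by blast+
  then have "Cinf UNIV (\<lambda>\<theta>. sin (\<theta> / 2))" "Cinf UNIV (\<lambda>\<theta>. cos (\<theta> / 2))" by simp_all
  then show ?thesis unfolding hp_def[abs_def] by (intro Cinf_mult Cinf_power) auto
qed

lemma Cinf_pp: "Cinf UNIV (pp k n)" and Cinf_qq: "Cinf UNIV (qq k n)"
  unfolding pp_def[abs_def] qq_def[abs_def]
  by (intro Cinf_sum Cinf_mult Cinf_const Cinf_hp open_UNIV)+

text \<open>For half-integers this is \<open>\<bar>\<kappa>\<bar> - 1/2\<close>, the exponent
  \<open>k\<close> of the profiles.\<close>

definition mode :: "real \<Rightarrow> nat" where "mode \<kappa> = nat \<lfloor>\<bar>\<kappa>\<bar>\<rfloor>"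

text \<open>The sign of the angular potential \<open>tau i * \<kappa> / sin \<theta>\<close> decides
  which of the two profiles sits in component \<open>i\<close>; the other one sits in
  \<open>pr i\<close>.\<close>

definition ang :: "real \<Rightarrow> 4 \<Rightarrow> nat \<Rightarrow> real \<Rightarrow> complex" where
  "ang \<kappa> i n \<theta> = of_real (if (tau i = 1) = (\<kappa> > 0) then pp (mode \<kappa>) n \<theta> else qq (mode \<kappa>) n \<theta>)"

lemma mode_half_integer:
  assumes "\<kappa> - 1/2 \<in> \<int>" shows "\<bar>\<kappa>\<bar> = real (mode \<kappa>) + 1/2"
proof -
  obtain k where k: "\<kappa> = of_int k + 1/2" using assms by (metis Ints_cases diff_add_cancel)
  show ?thesis
  proof (cases "k \<ge> 0")
    case True
    then have "\<bar>\<kappa>\<bar> = of_int k + 1/2" by (simp add: k)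
    moreover have "\<lfloor>of_int k + 1/2 :: real\<rfloor> = k" by linarith
    ultimately show ?thesis using True by (simp add: mode_def)
  next
    case False
    then have "\<bar>\<kappa>\<bar> = of_int (- k - 1) + 1/2" by (simp add: k)
    moreover have "\<lfloor>of_int (- k - 1) + 1/2 :: real\<rfloor> = - k - 1" by linarith
    ultimately show ?thesis using False by (simp add: mode_def)
  qed
qed

lemma Cinf_ang: "Cinf UNIV (ang \<kappa> i n)"
  unfolding ang_def[abs_def] by (cases "(tau i = 1) = (\<kappa> > 0)") (auto intro!: Cinf_of_real Cinf_pp Cinf_qq)

lemma sign_identities: "tau (pr i) = - tau i" "osg (pr i) = osg i" "sgr i = osg i * tau i" "pr (pr i) = i" "sgr (pr i) = - sgr i"
    "tau i = 1 \<or> tau i = -1" "sgr i = 1 \<or> sgr i = -1"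
  using exhaust_4[of i] by (auto simp: tau_def pr_def osg_def sgr_def)

text \<open>Only signs are at stake: \<open>tau i * \<kappa>\<close> is \<open>k + 1/2\<close> or
  its negative, which selects the equation of \<open>pp\<close> or of \<open>qq\<close>, and the
  same sign \<open>tau i * sgn \<kappa>\<close> multiplies the eigenvalue.\<close>

lemma ang_ode:
  assumes "\<kappa> - 1/2 \<in> \<int>"
  shows "of_real (sin \<theta>) * vd (ang \<kappa> i n) \<theta> + of_real (cos \<theta> / 2 - tau i * \<kappa>) * ang \<kappa> i n \<theta>
    = of_real (sin \<theta>) * (of_real (- (tau i * (sgn \<kappa> * real (mode \<kappa> + 1 + n)))) * ang \<kappa> (pr i) n \<theta>)"
proof -
  let ?k = "mode \<kappa>"
  note m = mode_half_integer[OF assms]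
  have dp: "((\<lambda>\<theta>. complex_of_real (pp ?k n \<theta>)) has_vector_derivative of_real (dpp ?k n \<theta>)) (at \<theta>)"
    "((\<lambda>\<theta>. complex_of_real (qq ?k n \<theta>)) has_vector_derivative of_real (dqq ?k n \<theta>)) (at \<theta>)"
    by (intro has_vector_derivative_of_real pp_derivative qq_derivative)+
  have c: "of_real s * of_real d + of_real x * of_real p = of_real s * (of_real y * of_real q :: complex)"
    if "s * d + x * p = s * (y * q)" for s d x p y q :: real
    using arg_cong[OF that, of complex_of_real] by simp
  show ?thesis
  proof (cases "(tau i = 1) = (\<kappa> > 0)")
    case True
    have t: "tau i * \<kappa> = real ?k + 1/2" "tau i * sgn \<kappa> = 1" using True m sign_identities(6)[of i] by (auto simp: sgn_if)
    have a: "ang \<kappa> i n = (\<lambda>\<theta>. of_real (pp ?k n \<theta>))" "ang \<kappa> (pr i) n = (\<lambda>\<theta>. of_real (qq ?k n \<theta>))"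
      using True sign_identities(1,6)[of i] by (auto simp: ang_def fun_eq_iff)
    show ?thesis unfolding a vector_derivative_at[OF dp(1)] mult.assoc[symmetric] t
      by (rule c[unfolded mult.assoc[symmetric]]) (use pp_ode[of \<theta> ?k n] t in \<open>simp add: mult.assoc\<close>)
  next
    case False
    have t: "tau i * \<kappa> = - (real ?k + 1/2)" "tau i * sgn \<kappa> = -1" using False m sign_identities(6)[of i] by (auto simp: sgn_if)
    have a: "ang \<kappa> i n = (\<lambda>\<theta>. of_real (qq ?k n \<theta>))" "ang \<kappa> (pr i) n = (\<lambda>\<theta>. of_real (pp ?k n \<theta>))"
      using False sign_identities(1,6)[of i] by (auto simp: ang_def fun_eq_iff)
    show ?thesis unfolding a vector_derivative_at[OF dp(2)] mult.assoc[symmetric] t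
      by (rule c[unfolded mult.assoc[symmetric]]) (use qq_ode[of \<theta> ?k n] t in \<open>simp add: mult.assoc algebra_simps\<close>)
  qed
qed

section \<open>Closed subspaces and the range of the massless operator\<close>

text \<open>A closed subspace described by representatives. Its last clause gives closure under
  limits and, with distance 0, invariance under changes on null sets.\<close>

definition csub :: "field4 set \<Rightarrow> bool" where
  "csub S \<longleftrightarrow> (\<forall>h\<in>S. l2 MZ h) \<and> (\<forall>h\<in>S. \<forall>k\<in>S. (\<lambda>p. h p + k p) \<in> S) \<and> (\<forall>h\<in>S. \<forall>c. (\<lambda>p. c *s h p) \<in> S)
     \<and> (\<forall>h. l2 MZ h \<longrightarrow> (\<forall>\<epsilon>>0. \<exists>k\<in>S. nrm MZ (\<lambda>p. k p - h p) < \<epsilon>) \<longrightarrow> h \<in> S)"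

lemma csub_l2: "csub S \<Longrightarrow> h \<in> S \<Longrightarrow> l2 MZ h"
  and csub_add: "csub S \<Longrightarrow> h \<in> S \<Longrightarrow> k \<in> S \<Longrightarrow> (\<lambda>p. h p + k p) \<in> S"
  and csub_smult: "csub S \<Longrightarrow> h \<in> S \<Longrightarrow> (\<lambda>p. c *s h p) \<in> S"
  unfolding csub_def by blast+

lemma csub_closed: "csub S \<Longrightarrow> l2 MZ h \<Longrightarrow> (\<And>\<epsilon>. \<epsilon> > 0 \<Longrightarrow> \<exists>k\<in>S. nrm MZ (\<lambda>p. k p - h p) < \<epsilon>) \<Longrightarrow> h \<in> S"
  unfolding csub_def by simp

lemma csub_zero: "csub S \<Longrightarrow> S \<noteq> {} \<Longrightarrow> (\<lambda>_. 0) \<in> S"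
proof -
  assume "csub S" "S \<noteq> {}"
  then obtain h where h: "h \<in> S" by blast
  from csub_smult[OF \<open>csub S\<close> h, of 0] show ?thesis by simp
qed

lemma csub_sum:
  assumes "csub S" "S \<noteq> {}" "\<And>j. j \<in> F \<Longrightarrow> h j \<in> S"
  shows "(\<lambda>p. \<Sum>j\<in>F. h j p) \<in> S"
  using assms(3) by (induction F rule: infinite_finite_induct) (auto intro: csub_zero[OF assms(1,2)] csub_add[OF assms(1)])

lemma csub_uminus: "csub S \<Longrightarrow> h \<in> S \<Longrightarrow> (\<lambda>p. - h p) \<in> S"
  using csub_smult[of S h "-1"] by simp

lemma csub_diff: "csub S \<Longrightarrow> h \<in> S \<Longrightarrow> k \<in> S \<Longrightarrow> (\<lambda>p. h p - k p) \<in> S"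
  using csub_add[OF _ _ csub_uminus, of S h k] by simp

lemma csub_limit:
  assumes "csub S" "l2 MZ h" "\<And>n. s n \<in> S" "(\<lambda>n. nrm MZ (\<lambda>p. s n p - h p)) \<longlonglongrightarrow> 0"
  shows "h \<in> S"
proof (rule csub_closed[OF assms(1,2)])
  fix e :: real assume "e > 0"
  then have "\<forall>\<^sub>F n in sequentially. nrm MZ (\<lambda>p. s n p - h p) < e" by (rule order_tendstoD(2)[OF assms(4)])
  then show "\<exists>k\<in>S. nrm MZ (\<lambda>p. k p - h p) < e" using assms(3) by (auto simp: eventually_sequentially)
qed

text \<open>The closure of the range of \<open>L\<close> on \<open>DT\<close>. Dense range means
  that every square-integrable field belongs to it, and being a closed subspace it can be filled
  generator by generator. With the identity for \<open>L\<close> it expresses density of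
  \<open>DT\<close> itself.\<close>

definition reach :: "(field4 \<Rightarrow> field4) \<Rightarrow> field4 set" where
  "reach L = {h. l2 MZ h \<and> (\<forall>\<epsilon>>0. \<exists>\<psi>\<in>DT. nrm MZ (\<lambda>p. L \<psi> p - h p) < \<epsilon>)}"

lemma csub_reach:
  assumes L: "\<And>\<psi>. \<psi> \<in> DT \<Longrightarrow> l2 MZ (L \<psi>)"
    and add: "\<And>\<psi> \<eta>. \<psi> \<in> DT \<Longrightarrow> \<eta> \<in> DT \<Longrightarrow> L (\<lambda>p. \<psi> p + \<eta> p) = (\<lambda>p. L \<psi> p + L \<eta> p)"
    and sm: "\<And>\<psi> c. \<psi> \<in> DT \<Longrightarrow> L (\<lambda>p. c *s \<psi> p) = (\<lambda>p. c *s L \<psi> p)"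
  shows "csub (reach L)"
proof -
  have 1: "(\<lambda>p. h p + k p) \<in> reach L" if h: "h \<in> reach L" and k: "k \<in> reach L" for h k
  proof -
    have l: "l2 MZ h" "l2 MZ k" using h k by (auto simp: reach_def)
    have "\<exists>\<psi>\<in>DT. nrm MZ (\<lambda>p. L \<psi> p - (h p + k p)) < e" if "e > 0" for e
    proof -
      have e2: "e / 2 > 0" using that by simp
      obtain \<psi> where p: "\<psi> \<in> DT" "nrm MZ (\<lambda>p. L \<psi> p - h p) < e / 2" using h e2 unfolding reach_def by blast
      obtain \<eta> where n: "\<eta> \<in> DT" "nrm MZ (\<lambda>p. L \<eta> p - k p) < e / 2" using k e2 unfolding reach_def by blast
      have "nrm MZ (\<lambda>p. (L \<psi> p + L \<eta> p) - (h p + k p)) \<le> nrm MZ (\<lambda>p. L \<psi> p - h p) + nrm MZ (\<lambda>p. L \<eta> p - k p)"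
        by (intro nrm_diff_add_le L l p n)
      then show ?thesis using p n by (intro bexI[OF _ DT_add[OF p(1) n(1)]]) (simp add: add)
    qed
    then show ?thesis using l by (auto simp: reach_def intro: l2_add)
  qed
  have 2: "(\<lambda>p. c *s h p) \<in> reach L" if h: "h \<in> reach L" for h c
  proof -
    have l: "l2 MZ h" using h by (auto simp: reach_def)
    have "\<exists>\<psi>\<in>DT. nrm MZ (\<lambda>p. L \<psi> p - c *s h p) < e" if e: "e > 0" for e
    proof -
      have e2: "e / (norm c + 1) > 0" using e by (simp add: add_nonneg_pos)
      obtain \<psi> where p: "\<psi> \<in> DT" "nrm MZ (\<lambda>p. L \<psi> p - h p) < e / (norm c + 1)" using h e2 unfolding reach_def by blast
      have "nrm MZ (\<lambda>p. c *s L \<psi> p - c *s h p) = norm c * nrm MZ (\<lambda>p. L \<psi> p - h p)"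
        unfolding nrm_smult[symmetric] by (simp add: vector_ssub_ldistrib)
      also have "\<dots> \<le> norm c * (e / (norm c + 1))" using p by (intro mult_left_mono) auto
      also have "\<dots> = e * (norm c / (norm c + 1))" by simp
      also have "\<dots> < e * 1" using e by (intro mult_strict_left_mono) (auto simp: add_nonneg_pos)
      finally show ?thesis by (intro bexI[OF _ DT_smult[OF p(1), of c]]) (simp add: sm[OF p(1)])
    qed
    then show ?thesis using l by (auto simp: reach_def intro: l2_smult)
  qed
  have 3: "h \<in> reach L" if l: "l2 MZ h" and ap: "\<forall>\<epsilon>>0. \<exists>k\<in>reach L. nrm MZ (\<lambda>p. k p - h p) < \<epsilon>" for h
  proof -
    have "\<exists>\<psi>\<in>DT. nrm MZ (\<lambda>p. L \<psi> p - h p) < e" if "e > 0" for e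
    proof -
      have e2: "e / 2 > 0" using that by simp
      obtain k where k: "k \<in> reach L" "nrm MZ (\<lambda>p. k p - h p) < e / 2" using ap e2 by blast
      obtain \<psi> where p: "\<psi> \<in> DT" "nrm MZ (\<lambda>p. L \<psi> p - k p) < e / 2" using k e2 unfolding reach_def by blast
      have lk: "l2 MZ k" using k by (simp add: reach_def)
      from nrm_triangle3[OF L[OF p(1)] lk l] p k show ?thesis by (intro bexI[OF _ p(1)]) linarith
    qed
    then show ?thesis using l by (simp add: reach_def)
  qed
  show ?thesis unfolding csub_def using 1 2 3 by (auto simp: reach_def)
qed

lemma ennreal_integral_le_nn_integral:
  assumes "f \<in> borel_measurable M" "\<And>x. 0 \<le> f x"
  shows "ennreal (LINT x|M. f x) \<le> (\<integral>\<^sup>+x. ennreal (f x) \<partial>M)"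
  using assms by (subst integral_eq_nn_integral) (auto simp: ennreal_enn2real_if)

text \<open>Tonelli separates off the radial integral. The radial factor has to enter through its
  mean-square norm, the only norm in which the radial system is solved; a supremum suffices for the
  angular factor, and \<open>2 * pi ^ 2\<close> is the area of the angular rectangle.\<close>

lemma nrm_tn_le:
  assumes f: "l2 lborel f" and g: "g \<in> borel_measurable borel" and B: "\<And>\<theta>. \<theta> \<in> {0..pi} \<Longrightarrow> norm (g \<theta>) \<le> B"
  shows "nrm MZ (tn f g \<kappa> i) \<le> sqrt (2 * pi\<^sup>2) * B * nrm lborel f"
proof -
  have B0: "B \<ge> 0" using order.trans[OF norm_ge_zero B[of 0]] by simp
  have fm: "f \<in> borel_measurable borel" using f by (simp add: l2_def)
  have tm: "tn f g \<kappa> i \<in> borel_measurable borel" by (rule tn_measurable[OF fm g])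
  let ?S = "{0..pi} \<times> {0..2*pi} :: (real \<times> real) set"
  have S: "?S \<in> sets borel" by (intro borel_closed closed_Times) auto
  have eS: "emeasure lborel ?S = ennreal (2 * pi\<^sup>2)"
  proof -
    have "?S = cbox (0, 0) (pi, 2 * pi)" by (simp add: cbox_Pair_eq)
    moreover have "emeasure lborel (cbox (0, 0) (pi, 2 * pi)) = ennreal (measure lborel (cbox (0, 0) (pi, 2 * pi)))"
      by (rule emeasure_eq_ennreal_measure) (use emeasure_lborel_cbox_finite[of "(0, 0)" "(pi, 2 * pi)"] in \<open>simp add: less_top\<close>)
    ultimately show ?thesis by (simp add: content_Pair power2_eq_square)
  qed
  have nm: "(\<lambda>x. (norm (tn f g \<kappa> i x))\<^sup>2) \<in> borel_measurable borel" using tm by measurable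
  have "ennreal ((nrm MZ (tn f g \<kappa> i))\<^sup>2) \<le> (\<integral>\<^sup>+x. ennreal ((norm (tn f g \<kappa> i x))\<^sup>2) \<partial>MZ)"
    unfolding nrm_sq by (rule ennreal_integral_le_nn_integral) (use nm in auto)
  also have "\<dots> = (\<integral>\<^sup>+x. ennreal (indicator Zset x) * ennreal ((norm (tn f g \<kappa> i x))\<^sup>2) \<partial>lborel)"
    unfolding MZ_def using nm by (intro nn_integral_density) auto
  also have "\<dots> \<le> (\<integral>\<^sup>+x. (case x of (r, q) \<Rightarrow> ennreal ((norm (f r))\<^sup>2) * (ennreal (B\<^sup>2) * indicator ?S q)) \<partial>lborel)"
  proof (rule nn_integral_mono)
    fix x :: pt
    obtain r \<theta> \<phi> where x: "x = (r, \<theta>, \<phi>)" by (metis prod_cases3)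
    show "ennreal (indicator Zset x) * ennreal ((norm (tn f g \<kappa> i x))\<^sup>2) \<le> (case x of (r, q) \<Rightarrow> ennreal ((norm (f r))\<^sup>2) * (ennreal (B\<^sup>2) * indicator ?S q))"
    proof (cases "x \<in> Zset")
      case True
      then have th: "\<theta> \<in> {0..pi}" "(\<theta>, \<phi>) \<in> ?S" by (auto simp: x Zset_def)
      have "(norm (f r) * norm (g \<theta>))\<^sup>2 \<le> (norm (f r) * B)\<^sup>2"
        using B[OF th(1)] by (intro power_mono mult_left_mono) auto
      then show ?thesis using True th
        by (simp add: x norm_tn power_mult_distrib ennreal_mult[symmetric] del: ennreal_mult)
    qed simp
  qed
  also have "\<dots> = (\<integral>\<^sup>+x. (case x of (r, q) \<Rightarrow> ennreal ((norm (f r))\<^sup>2) * (ennreal (B\<^sup>2) * indicator ?S q)) \<partial>(lborel \<Otimes>\<^sub>M lborel))"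
    unfolding lborel_prod ..
  also have "\<dots> = (\<integral>\<^sup>+r. \<integral>\<^sup>+q. ennreal ((norm (f r))\<^sup>2) * (ennreal (B\<^sup>2) * indicator ?S q) \<partial>lborel \<partial>lborel)"
    by (subst lborel.nn_integral_fst[symmetric]) (use fm S in \<open>auto intro!: borel_measurable_times_ennreal\<close>)
  also have "\<dots> = (\<integral>\<^sup>+r. ennreal ((norm (f r))\<^sup>2) * (ennreal (B\<^sup>2) * ennreal (2 * pi\<^sup>2)) \<partial>lborel)"
    using S by (simp add: nn_integral_cmult nn_integral_cmult_indicator eS)
  also have "\<dots> = (\<integral>\<^sup>+r. ennreal ((norm (f r))\<^sup>2) \<partial>lborel) * (ennreal (B\<^sup>2) * ennreal (2 * pi\<^sup>2))"
    using fm by (intro nn_integral_multc) auto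
  also have "(\<integral>\<^sup>+r. ennreal ((norm (f r))\<^sup>2) \<partial>lborel) = ennreal ((nrm lborel f)\<^sup>2)"
    unfolding nrm_sq by (rule nn_integral_eq_integral) (use f in \<open>auto simp: l2_def\<close>)
  also have "ennreal ((nrm lborel f)\<^sup>2) * (ennreal (B\<^sup>2) * ennreal (2 * pi\<^sup>2)) = ennreal ((sqrt (2 * pi\<^sup>2) * B * nrm lborel f)\<^sup>2)"
    by (simp add: ennreal_mult[symmetric] power_mult_distrib mult_ac)
  finally have "(nrm MZ (tn f g \<kappa> i))\<^sup>2 \<le> (sqrt (2 * pi\<^sup>2) * B * nrm lborel f)\<^sup>2" by simp
  then show ?thesis by (rule power2_le_imp_le) (use B0 in auto)
qed

lemma wsq_cmult: "wsq (\<lambda>\<theta>. c * v \<theta>) = (\<lambda>\<theta>. c * wsq v \<theta>)"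
  by (auto simp: wsq_def)

lemma wsq_bounded:
  assumes "Cinf UNIV u" shows "\<exists>B\<ge>0. \<forall>\<theta>\<in>{0..pi}. norm (wsq u \<theta>) \<le> B"
proof -
  have "bounded (u ` {0..pi})"
    by (intro compact_imp_bounded compact_continuous_image continuous_on_subset[OF Cinf_continuous_on[OF assms]]) auto
  then obtain B where B: "B > 0" "\<forall>\<theta>\<in>{0..pi}. norm (u \<theta>) \<le> B" by (auto simp: bounded_pos simp del: atLeastAtMost_iff)
  have "norm (wsq u \<theta>) \<le> B" if "\<theta> \<in> {0..pi}" for \<theta>
  proof (cases "0 < \<theta> \<and> \<theta> < pi")
    case True
    then have "sin \<theta> > 0" by (intro sin_gt_zero) auto
    moreover have "sqrt (sin \<theta>) * norm (u \<theta>) \<le> 1 * B" using B that by (intro mult_mono) auto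
    ultimately show ?thesis using True by (simp add: wsq_def norm_mult)
  qed (use B in \<open>auto simp: wsq_def\<close>)
  then show ?thesis using B by (intro exI[of _ B]) auto
qed

section \<open>The massless operator shifted by an imaginary unit\<close>

definition shiftH :: "real \<Rightarrow> real \<Rightarrow> real \<Rightarrow> field4 \<Rightarrow> field4" where
  "shiftH a e \<sigma> \<psi> = (\<lambda>p. frakH a 0 e 0 \<psi> p + (complex_of_real \<sigma> * \<i>) *s \<psi> p)"

lemma csub_shiftH: "a \<noteq> 0 \<Longrightarrow> csub (reach (shiftH a e \<sigma>))"
proof (rule csub_reach)
  assume a: "a \<noteq> 0"
  show "l2 MZ (shiftH a e \<sigma> \<psi>)" if "\<psi> \<in> DT" for \<psi>
    unfolding shiftH_def by (intro l2_add l2_smult frakH_l2 a Dom_l2 DT_Dom that)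
  show "shiftH a e \<sigma> (\<lambda>p. \<psi> p + \<eta> p) = (\<lambda>p. shiftH a e \<sigma> \<psi> p + shiftH a e \<sigma> \<eta> p)" if "\<psi> \<in> DT" "\<eta> \<in> DT" for \<psi> \<eta>
    unfolding shiftH_def frakH_DT_add[OF a that] by (auto simp: vec_eq_iff algebra_simps)
  show "shiftH a e \<sigma> (\<lambda>p. c *s \<psi> p) = (\<lambda>p. c *s shiftH a e \<sigma> \<psi> p)" if "\<psi> \<in> DT" for \<psi> c
    unfolding shiftH_def frakH_DT_smult[OF a that] by (auto simp: vec_eq_iff algebra_simps)
qed

lemma csub_id: "csub (reach (\<lambda>\<psi>. \<psi>))"
  by (rule csub_reach) (auto intro: Dom_l2 DT_Dom)

lemma clg_reach_id: "(x, y) \<in> clg a e \<Longrightarrow> x \<in> reach (\<lambda>\<psi>. \<psi>)"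
  unfolding clg_def reach_def by blast

lemma clg_reach_shiftH:
  assumes a: "a \<noteq> 0" and xy: "(x, y) \<in> clg a e" and s: "\<sigma> \<in> {1, -1}"
  shows "(\<lambda>p. y p + (complex_of_real \<sigma> * \<i>) *s x p) \<in> reach (shiftH a e \<sigma>)"
proof -
  note l = clg_l2[OF a xy]
  have "\<exists>\<psi>\<in>DT. nrm MZ (\<lambda>p. shiftH a e \<sigma> \<psi> p - (y p + (complex_of_real \<sigma> * \<i>) *s x p)) < \<epsilon>" if "\<epsilon> > 0" for \<epsilon>
  proof -
    have "\<epsilon> / 2 > 0" using that by simp
    from clg_approx[OF a xy this] obtain \<psi> where p: "\<psi> \<in> DT" "nrm MZ (\<lambda>p. \<psi> p - x p) < \<epsilon> / 2"
      "nrm MZ (\<lambda>p. frakH a 0 e 0 \<psi> p - y p) < \<epsilon> / 2" by blast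
    have "nrm MZ (\<lambda>p. shiftH a e \<sigma> \<psi> p - (y p + (complex_of_real \<sigma> * \<i>) *s x p))
      \<le> nrm MZ (\<lambda>p. frakH a 0 e 0 \<psi> p - y p) + nrm MZ (\<lambda>p. (complex_of_real \<sigma> * \<i>) *s \<psi> p - (complex_of_real \<sigma> * \<i>) *s x p)"
      unfolding shiftH_def by (intro nrm_diff_add_le l2_smult frakH_l2 a Dom_l2 DT_Dom p l)
    also have "nrm MZ (\<lambda>p. (complex_of_real \<sigma> * \<i>) *s \<psi> p - (complex_of_real \<sigma> * \<i>) *s x p) = nrm MZ (\<lambda>p. \<psi> p - x p)"
      using s nrm_smult[of MZ "complex_of_real \<sigma> * \<i>" "\<lambda>p. \<psi> p - x p"] by (auto simp: vector_ssub_ldistrib norm_mult)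
    finally show ?thesis using p by (intro bexI[OF _ p(1)]) linarith
  qed
  then show ?thesis unfolding reach_def using l by (auto intro: l2_add l2_smult)
qed

text \<open>For an eigenprofile the angular operator returns a multiple of the partner profile,
  placed in component \<open>pr i\<close>. The two profiles thus span an invariant block in which
  only the radial factor varies.\<close>

lemma clg_block:
  assumes a: "a \<noteq> 0" and \<kappa>: "\<kappa> - 1/2 \<in> \<int>" and f: "f \<in> Cc"
  shows "(tn f (wsq (ang \<kappa> i n)) \<kappa> i,
     (\<lambda>p. tn (\<lambda>r. - \<i> * of_real (sgr i) * vd f r + of_real (a * \<kappa> / (varpi a r)\<^sup>2) * f r) (wsq (ang \<kappa> i n)) \<kappa> i p
       + tn (\<lambda>r. of_real (sgr i) * (\<i> * (of_real (sgn \<kappa> * real (mode \<kappa> + 1 + n) / varpi a r) * f r))) (wsq (ang \<kappa> (pr i) n)) \<kappa> (pr i) p)) \<in> clg a e"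
proof -
  let ?c = "complex_of_real (- (tau i * (sgn \<kappa> * real (mode \<kappa> + 1 + n))))"
  have C: "Cinf UNIV (\<lambda>\<theta>. ?c * ang \<kappa> (pr i) n \<theta>)" by (intro Cinf_mult Cinf_const Cinf_ang open_UNIV)
  have eq: "tn (\<lambda>r. - \<i> * of_real (osg i / varpi a r) * f r) (wsq (\<lambda>\<theta>. ?c * ang \<kappa> (pr i) n \<theta>)) \<kappa> (pr i)
    = tn (\<lambda>r. of_real (sgr i) * (\<i> * (of_real (sgn \<kappa> * real (mode \<kappa> + 1 + n) / varpi a r) * f r))) (wsq (ang \<kappa> (pr i) n)) \<kappa> (pr i)"
    unfolding wsq_cmult sign_identities(3)[of i] by (auto simp: tn_def fun_eq_iff)
  show ?thesis
    using clg_pole[OF a \<kappa> f Cinf_ang[of \<kappa> i n] C ang_ode[OF \<kappa>], of e, unfolded eq] .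
qed

text \<open>The radial system is solved approximately with right-hand side \<open>h\<close> in
  component \<open>i\<close> and 0 in \<open>pr i\<close>; its solution, multiplied by the two
  profiles, is an element of the closure on which the block formulas give the image.\<close>

lemma range_contains_eigenmodes:
  assumes a: "a \<noteq> 0" and \<kappa>: "\<kappa> - 1/2 \<in> \<int>" and h: "h \<in> Cc" and s: "\<sigma> \<in> {1, -1}"
  shows "tn h (wsq (ang \<kappa> i n)) \<kappa> i \<in> reach (shiftH a e \<sigma>)"
proof (rule csub_closed[OF csub_shiftH[OF a]])
  let ?u = "wsq (ang \<kappa> i n)" and ?v = "wsq (ang \<kappa> (pr i) n)"
  let ?\<mu> = "sgn \<kappa> * real (mode \<kappa> + 1 + n)"
  have mu: "?u \<in> borel_measurable borel" "?v \<in> borel_measurable borel"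
    by (intro wsq_measurable borel_measurable_continuous_onI Cinf_continuous_on Cinf_ang)+
  obtain U where U: "U \<ge> 0" "\<And>\<theta>. \<theta> \<in> {0..pi} \<Longrightarrow> norm (?u \<theta>) \<le> U" using wsq_bounded[OF Cinf_ang] by blast
  obtain V where V: "V \<ge> 0" "\<And>\<theta>. \<theta> \<in> {0..pi} \<Longrightarrow> norm (?v \<theta>) \<le> V" using wsq_bounded[OF Cinf_ang] by blast
  have tl2: "l2 MZ (tn f w \<kappa> j)" if f: "f \<in> Cc" and w: "w \<in> borel_measurable borel" "\<And>\<theta>. \<theta> \<in> {0..pi} \<Longrightarrow> norm (w \<theta>) \<le> W" for f w W j
  proof -
    obtain F where F: "\<And>r. norm (f r) \<le> F" using Cc_bounded[OF f] by blast
    obtain R where R: "\<And>r. \<bar>r\<bar> > R \<Longrightarrow> f r = 0" using Cc_supp[OF f] by auto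
    show ?thesis by (rule tn_l2[OF Cc_measurable[OF f] w(1) F w(2) R])
  qed
  show "l2 MZ (tn h ?u \<kappa> i)" by (rule tl2[OF h mu(1) U(2)])
  fix \<epsilon> :: real assume e: "\<epsilon> > 0"
  \<comment> \<open>The constant of the norm estimate plus 1, so that it is positive and strictly
    exceeds what both residuals together produce.\<close>
  define c where "c = sqrt (2 * pi\<^sup>2) * (U + V) + 1"
  have c: "c > 0" unfolding c_def using U(1) V(1) by (intro add_nonneg_pos) auto
  have ec: "\<epsilon> / c > 0" using e c by simp
  have sg: "sgr i \<in> {1, -1}" using sign_identities(7)[of i] by auto
  obtain f g where f: "f \<in> Cc" and g: "g \<in> Cc" and fg: "nrm lborel (\<lambda>r.
     (of_real (sgr i) * (- \<i> * (vd f r + of_real (?\<mu> / varpi a r) * g r)) + of_real (a * \<kappa> / (varpi a r)\<^sup>2) * f r + of_real \<sigma> * \<i> * f r - h r,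
      of_real (sgr i) * (\<i> * (vd g r + of_real (?\<mu> / varpi a r) * f r)) + of_real (a * \<kappa> / (varpi a r)\<^sup>2) * g r + of_real \<sigma> * \<i> * g r - 0)) < \<epsilon> / c"
    using radial_operator_dense_range[OF a sg s h Cc_zero ec, of ?\<mu> \<kappa>] by auto
  define F1 where "F1 r = of_real (sgr i) * (- \<i> * (vd f r + of_real (?\<mu> / varpi a r) * g r)) + of_real (a * \<kappa> / (varpi a r)\<^sup>2) * f r + of_real \<sigma> * \<i> * f r - h r" for r
  define F2 where "F2 r = of_real (sgr i) * (\<i> * (vd g r + of_real (?\<mu> / varpi a r) * f r)) + of_real (a * \<kappa> / (varpi a r)\<^sup>2) * g r + of_real \<sigma> * \<i> * g r" for r
  have F1C: "F1 \<in> Cc"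
  proof -
    have "(\<lambda>r. (- \<i> * of_real (sgr i) * vd f r + of_real (a * \<kappa> / (varpi a r)\<^sup>2) * f r) + (of_real (sgr i) * (- \<i> * of_real (?\<mu> / varpi a r) * g r) + (of_real \<sigma> * \<i> * f r + (-1) * h r))) \<in> Cc"
      by (intro Cc_add inverse_varpi_coefficient a f g Cc_cmult h)
    then show ?thesis by (simp add: F1_def[abs_def] algebra_simps)
  qed
  have F2C: "F2 \<in> Cc"
  proof -
    have "(\<lambda>r. (- \<i> * of_real (- sgr i) * vd g r + of_real (a * \<kappa> / (varpi a r)\<^sup>2) * g r) + ((- of_real (sgr i)) * (- \<i> * of_real (?\<mu> / varpi a r) * f r) + of_real \<sigma> * \<i> * g r)) \<in> Cc"
      by (intro Cc_add inverse_varpi_coefficient a f g Cc_cmult h)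
    then show ?thesis by (simp add: F2_def[abs_def] algebra_simps)
  qed
  have pl: "l2 lborel (\<lambda>r. (F1 r, F2 r))"
  proof -
    obtain R where R: "\<And>r. \<bar>r\<bar> > R \<Longrightarrow> F1 r = 0" using Cc_supp[OF F1C] by auto
    obtain S where S: "\<And>r. \<bar>r\<bar> > S \<Longrightarrow> F2 r = 0" using Cc_supp[OF F2C] by auto
    show ?thesis
      by (rule l2_compact_support[where R="max R S"])
        (auto simp: R S zero_prod_def intro!: continuous_on_Pair Cc_continuous F1C F2C)
  qed
  have n1: "nrm lborel F1 < \<epsilon> / c"
    by (rule le_less_trans[OF nrm_mono[OF pl] fg[folded F1_def F2_def, unfolded diff_0_right, folded F2_def]]) (rule norm_fst_le)
  have n2: "nrm lborel F2 < \<epsilon> / c"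
    by (rule le_less_trans[OF nrm_mono[OF pl] fg[folded F1_def F2_def, unfolded diff_0_right, folded F2_def]]) (rule norm_snd_le)
  define y1 where "y1 = (\<lambda>p. tn (\<lambda>r. - \<i> * of_real (sgr i) * vd f r + of_real (a * \<kappa> / (varpi a r)\<^sup>2) * f r) ?u \<kappa> i p
       + tn (\<lambda>r. of_real (sgr i) * (\<i> * (of_real (?\<mu> / varpi a r) * f r))) ?v \<kappa> (pr i) p)"
  define y2 where "y2 = (\<lambda>p. tn (\<lambda>r. - \<i> * of_real (- sgr i) * vd g r + of_real (a * \<kappa> / (varpi a r)\<^sup>2) * g r) ?v \<kappa> (pr i) p
       + tn (\<lambda>r. of_real (- sgr i) * (\<i> * (of_real (?\<mu> / varpi a r) * g r))) ?u \<kappa> i p)"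
  have c1: "(tn f ?u \<kappa> i, y1) \<in> clg a e" unfolding y1_def by (rule clg_block[OF a \<kappa> f])
  have c2: "(tn g ?v \<kappa> (pr i), y2) \<in> clg a e" unfolding y2_def
    using clg_block[OF a \<kappa> g, of "pr i" n e] unfolding sign_identities(4,5) .
  let ?k = "\<lambda>p. (y1 p + y2 p) + (complex_of_real \<sigma> * \<i>) *s (tn f ?u \<kappa> i p + tn g ?v \<kappa> (pr i) p)"
  have kin: "?k \<in> reach (shiftH a e \<sigma>)" by (rule clg_reach_shiftH[OF a clg_add[OF a c1 c2] s])
  \<comment> \<open>Terms with the same angular profile are collected from both blocks, so the error
    is the pair of radial residuals times the profiles.\<close>
  have keq: "?k p - tn h ?u \<kappa> i p = tn F1 ?u \<kappa> i p + tn F2 ?v \<kappa> (pr i) p" for p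
  proof -
    obtain r \<theta> \<phi> where p: "p = (r, \<theta>, \<phi>)" by (metis prod_cases3)
    show ?thesis unfolding y1_def y2_def p tn_def prod.case F1_def F2_def
      by (simp add: vec_eq_iff algebra_simps)
  qed
  have "nrm MZ (\<lambda>p. ?k p - tn h ?u \<kappa> i p) \<le> nrm MZ (tn F1 ?u \<kappa> i) + nrm MZ (tn F2 ?v \<kappa> (pr i))"
    unfolding keq by (intro nrm_triangle tl2[OF F1C mu(1) U(2)] tl2[OF F2C mu(2) V(2)])
  also have "\<dots> \<le> sqrt (2 * pi\<^sup>2) * U * nrm lborel F1 + sqrt (2 * pi\<^sup>2) * V * nrm lborel F2"
    by (intro add_mono nrm_tn_le l2_Cc F1C F2C mu U V)
  also have "\<dots> \<le> sqrt (2 * pi\<^sup>2) * U * (\<epsilon> / c) + sqrt (2 * pi\<^sup>2) * V * (\<epsilon> / c)"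
    using n1 n2 U(1) V(1) by (intro add_mono mult_left_mono) auto
  also have "\<dots> = (c - 1) * (\<epsilon> / c)" by (simp add: c_def algebra_simps add_divide_distrib)
  also have "\<dots> < c * (\<epsilon> / c)" using ec by (intro mult_strict_right_mono) auto
  also have "\<dots> = \<epsilon>" using c by simp
  finally show "\<exists>k\<in>reach (shiftH a e \<sigma>). nrm MZ (\<lambda>p. k p - tn h ?u \<kappa> i p) < \<epsilon>" by (rule bexI[OF _ kin])
qed

section \<open>Density\<close>

text \<open>In contrast to \<open>tn\<close> the azimuthal factor is arbitrary, as needed for
  products of interval bumps.\<close>

definition te :: "(real \<Rightarrow> complex) \<Rightarrow> (real \<Rightarrow> complex) \<Rightarrow> (real \<Rightarrow> complex) \<Rightarrow> 4 \<Rightarrow> field4" where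
  "te f g h i = (\<lambda>(r, \<theta>, \<phi>). (f r * g \<theta> * h \<phi>) *s axis i 1)"

lemma norm_te: "norm (te f g h i (r, \<theta>, \<phi>)) = norm (f r) * norm (g \<theta>) * norm (h \<phi>)"
  by (simp add: te_def norm_smult_vec norm_axis_1 norm_mult)

lemma te_bound:
  assumes m: "f \<in> borel_measurable borel" "g \<in> borel_measurable borel" "h \<in> borel_measurable borel"
    and A: "\<And>r. norm (f r) \<le> A" and B: "\<And>\<theta>. \<theta> \<in> {0..pi} \<Longrightarrow> norm (g \<theta>) \<le> B"
    and C: "\<And>\<phi>. \<phi> \<in> {0..2*pi} \<Longrightarrow> norm (h \<phi>) \<le> C"
    and R: "\<And>r. \<bar>r\<bar> > R \<Longrightarrow> f r = 0" "R \<ge> 0"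
  shows "l2 MZ (te f g h i) \<and> nrm MZ (te f g h i) \<le> sqrt (2 * R * pi * (2 * pi)) * (A * B * C)"
proof -
  have A0: "A \<ge> 0" using order.trans[OF norm_ge_zero A[of 0]] .
  have B0: "B \<ge> 0" using order.trans[OF norm_ge_zero B[of 0]] by simp
  have meas: "te f g h i \<in> borel_measurable borel"
  proof (rule vec_measurableI)
    fix j
    have m': "(\<lambda>x::pt. fst x) \<in> borel_measurable borel" "(\<lambda>x::pt. fst (snd x)) \<in> borel_measurable borel"
      "(\<lambda>x::pt. snd (snd x)) \<in> borel_measurable borel"
      by (intro borel_measurable_continuous_onI continuous_intros)+
    have "(\<lambda>x. f (fst x) * g (fst (snd x)) * h (snd (snd x))) \<in> borel_measurable borel"
      by (intro borel_measurable_times measurable_compose[OF m'(1) m(1)] measurable_compose[OF m'(2) m(2)] measurable_compose[OF m'(3) m(3)])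
    from borel_measurable_times[OF this borel_measurable_const[of "axis i 1 $ j"]]
    show "(\<lambda>x. te f g h i x $ j) \<in> borel_measurable borel" by (simp add: te_def case_prod_unfold)
  qed
  have bd: "norm (te f g h i x) \<le> A * B * C" if "x \<in> Zset" for x
  proof -
    obtain r \<theta> \<phi> where x: "x = (r, \<theta>, \<phi>)" by (metis prod_cases3)
    have "\<theta> \<in> {0..pi}" "\<phi> \<in> {0..2*pi}" using that by (auto simp: x Zset_def)
    then show ?thesis unfolding x norm_te by (intro mult_mono A B C A0 mult_nonneg_nonneg B0) auto
  qed
  have z: "te f g h i x = 0" if "x \<in> Zset" "x \<notin> rtbox (-R) R 0 pi" for x
  proof -
    obtain r \<theta> \<phi> where x: "x = (r, \<theta>, \<phi>)" by (metis prod_cases3)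
    have "\<bar>r\<bar> > R" using that by (auto simp: x Zset_def rtbox_def)
    from R(1)[OF this] show ?thesis by (simp add: x te_def vec_eq_iff)
  qed
  have "l2 MZ (te f g h i)"
    by (rule l2_rtbox(1)[of _ _ "- R" R 0 pi, OF meas bd z]) (use R(2) in auto)
  moreover have "nrm MZ (te f g h i) \<le> sqrt ((R - (- R)) * (pi - 0) * (2 * pi)) * (A * B * C)"
    by (rule l2_rtbox(2)[of _ _ "- R" R 0 pi, OF meas bd z]) (use R(2) in auto)
  ultimately show ?thesis by simp
qed

subsection \<open>Polynomials in the polar angle\<close>

definition mono_base :: "real \<Rightarrow> 4 \<Rightarrow> nat \<Rightarrow> real \<Rightarrow> real" where
  "mono_base \<kappa> i j \<theta> = (if (tau i = 1) = (\<kappa> > 0) then hp (mode \<kappa> + 2 * j) (mode \<kappa> + 1) \<theta> else hp (mode \<kappa> + 1 + 2 * j) (mode \<kappa>) \<theta>)"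

definition ang_coeff :: "real \<Rightarrow> 4 \<Rightarrow> nat \<Rightarrow> nat \<Rightarrow> real" where
  "ang_coeff \<kappa> i n j = (if (tau i = 1) = (\<kappa> > 0) then jc (mode \<kappa>) n j else jc (mode \<kappa>) n j * (real (mode \<kappa> + 1 + n) / real (mode \<kappa> + 1 + j)))"

lemma ang_expansion: "ang \<kappa> i n \<theta> = (\<Sum>j\<le>n. of_real (ang_coeff \<kappa> i n j) * of_real (mono_base \<kappa> i j \<theta>))"
  by (simp add: ang_def pp_def qq_def ang_coeff_def mono_base_def)

lemma ang_coeff_nonzero: "ang_coeff \<kappa> i n n \<noteq> 0"
  using jc_nonzero[of n n "mode \<kappa>"] by (simp add: ang_coeff_def)

lemma mono_base_power: "mono_base \<kappa> i j \<theta> = mono_base \<kappa> i 0 \<theta> * ((sin (\<theta> / 2))\<^sup>2) ^ j"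
  by (simp add: mono_base_def hp_def power_add power_mult)

lemma Cinf_mono_base: "Cinf UNIV (mono_base \<kappa> i j)"
  unfolding mono_base_def[abs_def] by (cases "(tau i = 1) = (\<kappa> > 0)") (auto intro!: Cinf_hp)

lemma mono_base_bounds:
  assumes "0 < \<theta>" "\<theta> < pi" shows "0 < mono_base \<kappa> i j \<theta>" "mono_base \<kappa> i j \<theta> \<le> 1"
proof -
  have s: "0 < sin (\<theta> / 2)" "0 < cos (\<theta> / 2)" using assms by (auto intro!: sin_gt_zero cos_gt_zero)
  have h: "0 < hp a b \<theta> \<and> hp a b \<theta> \<le> 1" for a b
    using s unfolding hp_def by (auto intro!: mult_le_one power_le_one)
  show "0 < mono_base \<kappa> i j \<theta>" "mono_base \<kappa> i j \<theta> \<le> 1" using h by (auto simp: mono_base_def)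
qed

lemma tn_wsq_sum:
  "tn f (wsq (\<lambda>\<theta>. \<Sum>j\<in>F. c j * u j \<theta>)) \<kappa> i p = (\<Sum>j\<in>F. c j *s tn f (wsq (u j)) \<kappa> i p)"
  by (cases p) (auto simp: tn_def wsq_def vec_eq_iff sum_distrib_left sum_distrib_right sum_component algebra_simps)

text \<open>The profiles are triangular in powers of \<open>(sin (\<theta> / 2)) ^ 2\<close>, with
  nonzero diagonal coefficients; strong induction inverts the triangle.\<close>

lemma csub_monomials:
  assumes S: "csub S" and A: "\<And>n. tn f (wsq (ang \<kappa> i n)) \<kappa> i \<in> S"
  shows "tn f (wsq (\<lambda>\<theta>. of_real (mono_base \<kappa> i j \<theta>))) \<kappa> i \<in> S"
proof (induction j rule: less_induct)
  case (less n)
  have ne: "S \<noteq> {}" using A by blast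
  let ?m = "\<lambda>j. tn f (wsq (\<lambda>\<theta>. of_real (mono_base \<kappa> i j \<theta>))) \<kappa> i"
  let ?c = "\<lambda>j. complex_of_real (ang_coeff \<kappa> i n j)"
  have c0: "?c n \<noteq> 0" using ang_coeff_nonzero by simp
  have s: "(\<lambda>p. \<Sum>j<n. ?c j *s ?m j p) \<in> S" by (intro csub_sum S ne csub_smult less) auto
  have "(\<lambda>p. (1 / ?c n) *s (tn f (wsq (ang \<kappa> i n)) \<kappa> i p - (\<Sum>j<n. ?c j *s ?m j p))) \<in> S"
    by (intro csub_smult csub_diff S A s)
  also have "(\<lambda>p. (1 / ?c n) *s (tn f (wsq (ang \<kappa> i n)) \<kappa> i p - (\<Sum>j<n. ?c j *s ?m j p))) = ?m n"
  proof
    fix p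
    have "tn f (wsq (ang \<kappa> i n)) \<kappa> i p = (\<Sum>j\<le>n. ?c j *s ?m j p)"
      unfolding ang_expansion[abs_def] by (rule tn_wsq_sum)
    also have "\<dots> = (\<Sum>j<n. ?c j *s ?m j p) + ?c n *s ?m n p"
      by (simp add: lessThan_Suc_atMost[symmetric])
    finally show "(1 / ?c n) *s (tn f (wsq (ang \<kappa> i n)) \<kappa> i p - (\<Sum>j<n. ?c j *s ?m j p)) = ?m n p"
      using c0 by simp
  qed
  finally show ?case .
qed

text \<open>In the variable \<open>y = (sin (\<theta> / 2)) ^ 2\<close> the available profiles are a
  fixed positive weight \<open>W\<close> times all polynomials. Division of \<open>g\<close> by
  \<open>W\<close> leaves a continuous function because \<open>g\<close> vanishes near the poles.
  Uniform polynomial approximation of the quotient then approximates \<open>g\<close> as well, since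
  \<open>W \<le> 1\<close>.\<close>

lemma csub_polar:
  fixes g :: "real \<Rightarrow> real"
  assumes S: "csub S" and A: "\<And>n. tn f (wsq (ang \<kappa> i n)) \<kappa> i \<in> S" and f: "f \<in> Cc"
    and g: "continuous_on UNIV g" and \<delta>: "\<delta> > 0" and sg: "\<And>\<theta>. \<theta> \<notin> {\<delta>..pi-\<delta>} \<Longrightarrow> g \<theta> = 0"
  shows "tn f (\<lambda>\<theta>. of_real (g \<theta>)) \<kappa> i \<in> S"
proof (rule csub_closed[OF S])
  have ne: "S \<noteq> {}" using A by blast
  let ?m = "\<lambda>j. tn f (wsq (\<lambda>\<theta>. of_real (mono_base \<kappa> i j \<theta>))) \<kappa> i"
  have gm: "(\<lambda>\<theta>. complex_of_real (g \<theta>)) \<in> borel_measurable borel"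
    by (intro borel_measurable_continuous_onI continuous_intros g)
  obtain B where B: "\<And>\<theta>. \<theta> \<in> {0..pi} \<Longrightarrow> \<bar>g \<theta>\<bar> \<le> B"
  proof -
    have "bounded (g ` {0..pi})"
      by (intro compact_imp_bounded compact_continuous_image continuous_on_subset[OF g]) auto
    then show ?thesis using that by (auto simp: bounded_iff simp del: atLeastAtMost_iff)
  qed
  obtain F where F: "\<And>r. norm (f r) \<le> F" using Cc_bounded[OF f] by blast
  obtain R where R: "\<And>r. \<bar>r\<bar> > R \<Longrightarrow> f r = 0" using Cc_supp[OF f] by auto
  show lg: "l2 MZ (tn f (\<lambda>\<theta>. of_real (g \<theta>)) \<kappa> i)"
    by (rule tn_l2[OF Cc_measurable[OF f] gm F _ R, of B]) (use B in auto)
  define W where "W \<theta> = sqrt (sin \<theta>) * mono_base \<kappa> i 0 \<theta>" for \<theta>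
  have W: "0 < W \<theta>" "W \<theta> \<le> 1" if "0 < \<theta>" "\<theta> < pi" for \<theta>
  proof -
    have "0 < sin \<theta>" using that by (intro sin_gt_zero) auto
    then show "0 < W \<theta>" "W \<theta> \<le> 1" using mono_base_bounds[OF that, of \<kappa> i 0] by (auto simp: W_def intro!: mult_le_one)
  qed
  define q where "q \<theta> = (if 0 < \<theta> \<and> \<theta> < pi then g \<theta> / W \<theta> else 0)" for \<theta>
  have cq: "continuous_on UNIV q"
  proof -
    have "continuous_on {0<..<pi} q"
    proof (rule continuous_on_eq)
      show "continuous_on {0<..<pi} (\<lambda>\<theta>. g \<theta> / W \<theta>)"
      proof (rule continuous_on_divide)
        show "continuous_on {0<..<pi} W" unfolding W_def[abs_def]
          by (intro continuous_intros continuous_on_subset[OF Cinf_continuous_on[OF Cinf_mono_base]]) auto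
        show "\<forall>\<theta>\<in>{0<..<pi}. W \<theta> \<noteq> 0" using W(1) by (metis greaterThanLessThan_iff less_irrefl)
      qed (auto intro: continuous_on_subset[OF g])
    qed (auto simp: q_def)
    moreover have "continuous_on ({..<\<delta>} \<union> {pi-\<delta><..}) q"
      by (rule continuous_on_eq[OF continuous_on_const[of _ 0]]) (auto simp: q_def sg)
    ultimately have "continuous_on ({0<..<pi} \<union> ({..<\<delta>} \<union> {pi-\<delta><..})) q"
      by (intro continuous_on_open_Un[OF _ open_Un]) auto
    also have "{0<..<pi} \<union> ({..<\<delta>} \<union> {pi-\<delta><..}) = UNIV" using \<delta> by (auto simp: not_less)
    finally show ?thesis .
  qed
  \<comment> \<open>On the range from 0 to \<open>pi\<close> the inverse of
    \<open>y = (sin (\<theta> / 2)) ^ 2\<close> is \<open>2 * arcsin (sqrt y)\<close>.\<close>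
  have cF: "continuous_on {0..1} (\<lambda>x. q (2 * arcsin (sqrt x)))"
  proof (rule continuous_on_compose2[OF cq])
    have "- 1 \<le> sqrt x \<and> sqrt x \<le> 1" if "x \<in> {0..1}" for x :: real
    proof -
      have "0 \<le> sqrt x" using that by simp
      then show ?thesis using that by (auto simp del: real_sqrt_ge_0_iff)
    qed
    then show "continuous_on {0..1} (\<lambda>x. 2 * arcsin (sqrt x))"
      by (intro continuous_intros) auto
  qed auto
  fix \<epsilon> :: real assume e: "\<epsilon> > 0"
  define c where "c = sqrt (2 * pi\<^sup>2) * nrm lborel f + 1"
  have c: "c > 0" unfolding c_def by (intro add_nonneg_pos) auto
  have ec: "\<epsilon> / c > 0" using e c by simp
  obtain P where P: "real_polynomial_function P" "\<And>x. x \<in> {0..1} \<Longrightarrow> \<bar>q (2 * arcsin (sqrt x)) - P x\<bar> < \<epsilon> / c"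
    using Stone_Weierstrass_real_polynomial_function[OF compact_Icc cF ec] by blast
  obtain b N where b: "P = (\<lambda>x. \<Sum>j\<le>N. b j * x ^ j)" using P(1) unfolding real_polynomial_function_iff_sum by blast
  let ?v = "\<lambda>\<theta>. \<Sum>j\<le>N. complex_of_real (b j) * of_real (mono_base \<kappa> i j \<theta>)"
  let ?k = "tn f (wsq ?v) \<kappa> i"
  have Cv: "Cinf UNIV ?v" by (intro Cinf_sum Cinf_mult Cinf_const Cinf_of_real Cinf_mono_base open_UNIV)
  have kS: "?k \<in> S"
  proof -
    have "(\<lambda>p. \<Sum>j\<le>N. complex_of_real (b j) *s ?m j p) \<in> S"
      by (intro csub_sum csub_smult S ne csub_monomials[OF S A])
    then show ?thesis unfolding tn_wsq_sum[abs_def, symmetric] by (simp add: tn_wsq_sum[symmetric])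
  qed
  have wm: "wsq ?v \<in> borel_measurable borel"
    by (intro wsq_measurable borel_measurable_continuous_onI Cinf_continuous_on Cv)
  have diff: "?k p - tn f (\<lambda>\<theta>. of_real (g \<theta>)) \<kappa> i p = tn f (\<lambda>\<theta>. wsq ?v \<theta> - of_real (g \<theta>)) \<kappa> i p" for p
    by (cases p) (simp add: tn_def vec_eq_iff algebra_simps)
  have close: "norm (wsq ?v \<theta> - of_real (g \<theta>)) \<le> \<epsilon> / c" if "\<theta> \<in> {0..pi}" for \<theta>
  proof (cases "0 < \<theta> \<and> \<theta> < pi")
    case True
    let ?y = "(sin (\<theta> / 2))\<^sup>2"
    have sp: "0 < sin (\<theta> / 2)" using True by (intro sin_gt_zero) auto
    have y: "?y \<in> {0..1}" by (auto simp: abs_square_le_1)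
    have as: "2 * arcsin (sqrt ?y) = \<theta>" using True sp by (simp add: arcsin_sin)
    have vy: "?v \<theta> = of_real (mono_base \<kappa> i 0 \<theta> * P ?y)"
    proof -
      have "?v \<theta> = of_real (\<Sum>j\<le>N. b j * (mono_base \<kappa> i 0 \<theta> * ?y ^ j))"
        unfolding of_real_sum of_real_mult[symmetric] mono_base_power[symmetric] ..
      then show ?thesis unfolding b by (simp only: sum_distrib_left mult.left_commute)
    qed
    have "wsq ?v \<theta> = of_real (W \<theta> * P ?y)"
      using True unfolding wsq_def vy W_def by simp
    moreover have "g \<theta> = W \<theta> * q \<theta>" using True W[of \<theta>] by (simp add: q_def)
    ultimately have "wsq ?v \<theta> - of_real (g \<theta>) = of_real (W \<theta> * (P ?y - q \<theta>))" by (simp add: algebra_simps)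
    then have "norm (wsq ?v \<theta> - of_real (g \<theta>)) = W \<theta> * \<bar>q \<theta> - P ?y\<bar>"
      using W[of \<theta>] True by (simp only: norm_of_real) (simp add: abs_mult)
    also have "\<dots> \<le> 1 * (\<epsilon> / c)"
      using W[of \<theta>] True P(2)[OF y] as by (intro mult_mono) auto
    finally show ?thesis by simp
  next
    case False
    then have "\<theta> \<notin> {\<delta>..pi-\<delta>}" using \<delta> by auto
    then show ?thesis using False sg ec by (auto simp: wsq_def)
  qed
  have "nrm MZ (\<lambda>p. ?k p - tn f (\<lambda>\<theta>. of_real (g \<theta>)) \<kappa> i p) \<le> sqrt (2 * pi\<^sup>2) * (\<epsilon> / c) * nrm lborel f"
    unfolding diff by (rule nrm_tn_le[OF l2_Cc[OF f] _ close]) (intro borel_measurable_diff wm gm)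
  also have "\<dots> = (c - 1) * (\<epsilon> / c)" by (simp add: c_def)
  also have "\<dots> < c * (\<epsilon> / c)" using ec by (intro mult_strict_right_mono) auto
  also have "\<dots> = \<epsilon>" using c by simp
  finally show "\<exists>k\<in>S. nrm MZ (\<lambda>p. k p - tn f (\<lambda>\<theta>. of_real (g \<theta>)) \<kappa> i p) < \<epsilon>" by (rule bexI[OF _ kS])
qed

subsection \<open>Trigonometric polynomials\<close>

inductive TP :: "(real \<Rightarrow> complex) \<Rightarrow> bool" where
  TP_base: "TP (\<lambda>\<phi>. c * cis (of_int k * \<phi>))"
| TP_add: "TP p \<Longrightarrow> TP q \<Longrightarrow> TP (\<lambda>\<phi>. p \<phi> + q \<phi>)"

lemma TP_mult_base: "TP p \<Longrightarrow> TP (\<lambda>\<phi>. c * cis (of_int k * \<phi>) * p \<phi>)"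
proof (induction rule: TP.induct)
  case (TP_base d l)
  have "(\<lambda>\<phi>. c * cis (of_int k * \<phi>) * (d * cis (of_int l * \<phi>))) = (\<lambda>\<phi>. (c * d) * cis (of_int (k + l) * \<phi>))"
    by (auto simp: fun_eq_iff distrib_right cis_mult[symmetric])
  then show ?case using TP.TP_base by (simp only:)
next
  case (TP_add p q)
  then show ?case using TP.TP_add by (simp add: distrib_left)
qed

lemma TP_mult: "TP p \<Longrightarrow> TP q \<Longrightarrow> TP (\<lambda>\<phi>. p \<phi> * q \<phi>)"
proof (induction rule: TP.induct)
  case (TP_base c k)
  then show ?case by (rule TP_mult_base)
next
  case (TP_add p p')
  then show ?case using TP.TP_add by (simp add: distrib_right)
qed

lemma TP_const: "TP (\<lambda>_. c)"
  using TP_base[of c 0] by simp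

text \<open>On the circle a real linear functional of the plane is a combination of
  \<open>cis \<phi>\<close> and \<open>cis (- \<phi>)\<close>; sums and products stay
  trigonometric.\<close>

lemma TP_real_polynomial: "real_polynomial_function p \<Longrightarrow> TP (\<lambda>\<phi>. of_real (p (cis \<phi>)))"
proof (induction rule: real_polynomial_function.induct)
  case (linear L)
  have "cis \<phi> = cos \<phi> *\<^sub>R 1 + sin \<phi> *\<^sub>R \<i>" for \<phi> by (simp add: complex_eq_iff)
  then have "L (cis \<phi>) = cos \<phi> * L 1 + sin \<phi> * L \<i>" for \<phi>
    using linear by (simp add: bounded_linear.linear linear_add linear_scale)
  moreover have "complex_of_real (cos \<phi> * L 1 + sin \<phi> * L \<i>) =
     ((L 1 - \<i> * L \<i>) / 2) * cis (of_int 1 * \<phi>) + ((L 1 + \<i> * L \<i>) / 2) * cis (of_int (-1) * \<phi>)" for \<phi>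
    by (simp add: complex_eq_iff field_simps)
  ultimately show ?case using TP_add[OF TP_base TP_base] by presburger
next
  case (add p q)
  then show ?case using TP_add by simp
next
  case (mult p q)
  then show ?case using TP_mult by simp
qed (rule TP_const)

text \<open>Carried to the unit circle by \<open>Arg2pi\<close>, the function stays continuous
  across the branch cut because it vanishes near both ends of the interval. Stone-Weierstrass on the
  circle gives polynomials in the two real coordinates, and their restrictions are
  trigonometric.\<close>

lemma trig_polynomial_dense:
  fixes h :: "real \<Rightarrow> complex"
  assumes h: "continuous_on UNIV h" and \<delta>: "0 < \<delta>" "\<delta> \<le> pi" and sh: "\<And>\<phi>. \<phi> \<notin> {\<delta>..2*pi-\<delta>} \<Longrightarrow> h \<phi> = 0" and e: "\<epsilon> > 0"
  shows "\<exists>p. TP p \<and> (\<forall>\<phi>\<in>{0..2*pi}. norm (h \<phi> - p \<phi>) < \<epsilon>)"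
proof -
  let ?S = "sphere (0::complex) 1"
  define G where "G z = h (Arg2pi z)" for z
  have polar: "z = cis (Arg2pi z)" if "z \<in> ?S" for z
    using Arg2pi_eq[of z] that by (simp add: cis_conv_exp mult.commute)
  \<comment> \<open>A neighbourhood of the cut: a real part above \<open>cos \<delta>\<close> forces
    the argument to within \<open>\<delta>\<close> of 0 or of \<open>2 * pi\<close>.\<close>
  have near: "G z = 0" if "z \<in> ?S" "Re z > cos \<delta>" for z
  proof -
    let ?t = "Arg2pi z"
    have t: "0 \<le> ?t" "?t < 2 * pi" using Arg2pi_ge_0 Arg2pi_lt_2pi by auto
    have c: "cos ?t > cos \<delta>" using that polar[OF that(1)] by (metis cis.sel(1))
    have "?t \<notin> {\<delta>..2*pi-\<delta>}"
    proof
      assume *: "?t \<in> {\<delta>..2*pi-\<delta>}"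
      show False
      proof (cases "?t \<le> pi")
        case True
        then show False using c cos_monotone_0_pi_le[of \<delta> ?t] * \<delta> by auto
      next
        case False
        then have "cos (2 * pi - ?t) \<le> cos \<delta>" using * \<delta> by (intro cos_monotone_0_pi_le) auto
        then show False using c by simp
      qed
    qed
    then show ?thesis by (simp add: G_def sh)
  qed
  have cG: "continuous_on ?S G"
    unfolding continuous_on_eq_continuous_within
  proof
    fix z assume z: "z \<in> ?S"
    show "continuous (at z within ?S) G"
    proof (cases "z \<in> \<real>\<^sub>\<ge>\<^sub>0")
      case False
      have "continuous (at z) (h \<circ> Arg2pi)"
        using continuous_at_Arg2pi[OF False] h by (intro continuous_at_compose) (auto simp: continuous_on_eq_continuous_at)
      then show ?thesis unfolding G_def[abs_def] o_def by (rule continuous_at_imp_continuous_within)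
    next
      case True
      then have "z = 1" using z by (auto simp: complex_nonneg_Reals_iff complex_eq_iff cmod_def)
      have c1: "cos \<delta> < 1" using \<delta> cos_monotone_0_pi[of 0 \<delta>] by simp
      have "\<forall>\<^sub>F w in at z within ?S. cos \<delta> < Re w"
      proof (rule order_tendstoD(1))
        show "(Re \<longlongrightarrow> Re z) (at z within ?S)" by (intro tendsto_intros)
        show "cos \<delta> < Re z" using c1 \<open>z = 1\<close> by simp
      qed
      moreover have "\<forall>\<^sub>F w in at z within ?S. w \<in> ?S" by (auto simp: eventually_at_filter)
      ultimately have "\<forall>\<^sub>F w in at z within ?S. 0 = G w" by eventually_elim (metis near)
      then have "(G \<longlongrightarrow> 0) (at z within ?S)" by (rule Lim_transform_eventually[OF tendsto_const])
      moreover have "G z = 0" using near[OF z] c1 \<open>z = 1\<close> by simp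
      ultimately show ?thesis by (simp add: continuous_within)
    qed
  qed
  obtain P where P: "polynomial_function P" "\<And>z. z \<in> ?S \<Longrightarrow> norm (G z - P z) < \<epsilon>"
    using Stone_Weierstrass_polynomial_function[OF compact_sphere cG e] by blast
  have "TP (\<lambda>\<phi>. of_real (Re (P (cis \<phi>))) + \<i> * of_real (Im (P (cis \<phi>))))"
  proof (intro TP_add TP_mult TP_const)
    have "real_polynomial_function (Re \<circ> P)" "real_polynomial_function (Im \<circ> P)"
      using P(1) bounded_linear_Re bounded_linear_Im unfolding polynomial_function_def by blast+
    from TP_real_polynomial[OF this(1)] TP_real_polynomial[OF this(2)]
    show "TP (\<lambda>\<phi>. of_real (Re (P (cis \<phi>))))" "TP (\<lambda>\<phi>. of_real (Im (P (cis \<phi>))))" by simp_all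
  qed
  then have "TP (\<lambda>\<phi>. P (cis \<phi>))" by (simp flip: complex_eq)
  moreover have "norm (h \<phi> - P (cis \<phi>)) < \<epsilon>" if "\<phi> \<in> {0..2*pi}" for \<phi>
  proof -
    have "G (cis \<phi>) = h \<phi>"
    proof (cases "\<phi> = 2 * pi")
      case True
      \<comment> \<open>The point with angle \<open>2 * pi\<close> has argument 0, so both end
        values of \<open>h\<close> have to agree.\<close>
      have "h 0 = 0" "h (2 * pi) = 0" using \<delta> by (auto intro!: sh)
      then show ?thesis using True by (simp add: G_def Arg2pi_of_real[of 1, simplified])
    next
      case False
      then have "Arg2pi (exp (\<i> * of_real \<phi>)) = \<phi>" using that by (subst Arg2pi_exp) auto
      then show ?thesis by (simp add: G_def cis_conv_exp)
    qed
    then show ?thesis using P(2)[of "cis \<phi>"] by simp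
  qed
  ultimately show ?thesis by blast
qed


text \<open>Multiplication by \<open>cis (- \<phi> / 2)\<close> turns half-integer modes into
  integer ones. The twisted function is approximated by a trigonometric polynomial and twisted back,
  at no cost since the factor has modulus 1.\<close>

lemma csub_azimuthal:
  fixes f g :: "real \<Rightarrow> complex" and h :: "real \<Rightarrow> complex"
  assumes S: "csub S" and A: "\<And>\<kappa>. \<kappa> - 1/2 \<in> \<int> \<Longrightarrow> tn f g \<kappa> i \<in> S"
    and f: "f \<in> Cc" and g: "continuous_on UNIV g"
    and h: "continuous_on UNIV h" and \<delta>: "0 < \<delta>" "\<delta> \<le> pi" and sh: "\<And>\<phi>. \<phi> \<notin> {\<delta>..2*pi-\<delta>} \<Longrightarrow> h \<phi> = 0"
  shows "te f g h i \<in> S"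
proof (rule csub_closed[OF S])
  note fm = Cc_measurable[OF f] and gm = borel_measurable_continuous_onI[OF g] and hm = borel_measurable_continuous_onI[OF h]
  have bd: "\<exists>B\<ge>0. \<forall>x\<in>{u..v}. norm (k x) \<le> B" if "continuous_on UNIV k" for k :: "real \<Rightarrow> complex" and u v
  proof -
    have "bounded (k ` {u..v})"
      by (intro compact_imp_bounded compact_continuous_image continuous_on_subset[OF that]) auto
    then obtain B where "B > 0" "\<forall>x\<in>{u..v}. norm (k x) \<le> B" by (auto simp: bounded_pos simp del: atLeastAtMost_iff)
    then show ?thesis by (intro exI[of _ B]) auto
  qed
  obtain F where F: "F > 0" "\<And>r. norm (f r) \<le> F" using Cc_bounded[OF f] by blast
  obtain G where G: "G \<ge> 0" "\<And>\<theta>. \<theta> \<in> {0..pi} \<Longrightarrow> norm (g \<theta>) \<le> G" using bd[OF g, of 0 pi] by blast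
  obtain H where H: "H \<ge> 0" "\<And>\<phi>. \<phi> \<in> {0..2*pi} \<Longrightarrow> norm (h \<phi>) \<le> H" using bd[OF h, of 0 "2*pi"] by blast
  obtain R where R: "R > 0" "\<And>r. \<bar>r\<bar> > R \<Longrightarrow> f r = 0" using Cc_supp[OF f] by auto
  show lt: "l2 MZ (te f g h i)" using te_bound[OF fm gm hm F(2) G(2) H(2) R(2)] R(1) by auto
  fix \<epsilon> :: real assume e: "\<epsilon> > 0"
  define c where "c = sqrt (2 * R * pi * (2 * pi)) * (F * G) + 1"
  have c: "c > 0" unfolding c_def using R(1) F(1) G(1) by (intro add_nonneg_pos) auto
  have ec: "\<epsilon> / c > 0" using e c by simp
  let ?h = "\<lambda>\<phi>. cis (- (1/2) * \<phi>) * h \<phi>"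
  have ch: "continuous_on UNIV ?h"
    by (intro continuous_intros h Cinf_continuous_on[OF Cinf_cis])
  obtain p where p: "TP p" "\<And>\<phi>. \<phi> \<in> {0..2*pi} \<Longrightarrow> norm (?h \<phi> - p \<phi>) < \<epsilon> / c"
    using trig_polynomial_dense[OF ch \<delta> _ ec] sh by auto
  have pS: "te f g (\<lambda>\<phi>. cis ((1/2) * \<phi>) * p \<phi>) i \<in> S" using p(1)
  proof (induction rule: TP.induct)
    case (TP_base d k)
    have k: "(of_int k + 1/2 :: real) - 1/2 \<in> \<int>" by simp
    have "(\<lambda>x. d *s tn f g (of_int k + 1/2) i x) \<in> S" by (intro csub_smult S A k)
    also have "(\<lambda>x. d *s tn f g (of_int k + 1/2) i x) = te f g (\<lambda>\<phi>. cis ((1/2) * \<phi>) * (d * cis (of_int k * \<phi>))) i"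
    proof
      fix x :: pt
      obtain r \<theta> \<phi> where x: "x = (r, \<theta>, \<phi>)" by (metis prod_cases3)
      have "cis ((of_int k + 1/2) * \<phi>) = cis ((1/2) * \<phi>) * cis (of_int k * \<phi>)"
        by (simp add: cis_mult algebra_simps)
      then show "d *s tn f g (of_int k + 1/2) i x = te f g (\<lambda>\<phi>. cis ((1/2) * \<phi>) * (d * cis (of_int k * \<phi>))) i x"
        by (simp add: x tn_def te_def vec_eq_iff)
    qed
    finally show ?case .
  next
    case (TP_add p q)
    have "(\<lambda>x. te f g (\<lambda>\<phi>. cis ((1/2) * \<phi>) * p \<phi>) i x + te f g (\<lambda>\<phi>. cis ((1/2) * \<phi>) * q \<phi>) i x) \<in> S"
      by (intro csub_add S TP_add)
    also have "(\<lambda>x. te f g (\<lambda>\<phi>. cis ((1/2) * \<phi>) * p \<phi>) i x + te f g (\<lambda>\<phi>. cis ((1/2) * \<phi>) * q \<phi>) i x)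
      = te f g (\<lambda>\<phi>. cis ((1/2) * \<phi>) * (p \<phi> + q \<phi>)) i"
      by (auto simp: te_def fun_eq_iff vec_eq_iff algebra_simps)
    finally show ?case .
  qed
  have pm: "(\<lambda>\<phi>. cis ((1/2) * \<phi>) * p \<phi>) \<in> borel_measurable borel"
  proof -
    have "continuous_on UNIV p" using p(1)
      by (induction rule: TP.induct) (intro continuous_intros Cinf_continuous_on[OF Cinf_cis]; assumption?)+
    then show ?thesis
      by (intro borel_measurable_continuous_onI continuous_intros Cinf_continuous_on[OF Cinf_cis])
  qed
  have diff: "te f g (\<lambda>\<phi>. cis ((1/2) * \<phi>) * p \<phi>) i x - te f g h i x = te f g (\<lambda>\<phi>. cis ((1/2) * \<phi>) * p \<phi> - h \<phi>) i x" for x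
    by (cases x) (simp add: te_def vec_eq_iff algebra_simps)
  have close: "norm (cis ((1/2) * \<phi>) * p \<phi> - h \<phi>) \<le> \<epsilon> / c" if "\<phi> \<in> {0..2*pi}" for \<phi>
  proof -
    have "cis ((1/2) * \<phi>) * ?h \<phi> = h \<phi>" by (simp add: cis_mult mult.assoc[symmetric])
    then have "cis ((1/2) * \<phi>) * p \<phi> - h \<phi> = cis ((1/2) * \<phi>) * (p \<phi> - ?h \<phi>)" by (simp only: right_diff_distrib)
    then have "norm (cis ((1/2) * \<phi>) * p \<phi> - h \<phi>) = norm (p \<phi> - ?h \<phi>)" by (simp only: norm_mult norm_cis mult_1)
    then show ?thesis using p(2)[OF that] by (simp add: norm_minus_commute)
  qed
  have "nrm MZ (\<lambda>x. te f g (\<lambda>\<phi>. cis ((1/2) * \<phi>) * p \<phi>) i x - te f g h i x) \<le> sqrt (2 * R * pi * (2 * pi)) * (F * G * (\<epsilon> / c))"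
    unfolding diff
    using te_bound[OF fm gm borel_measurable_diff[OF pm hm] F(2) G(2) close R(2)] R(1) by auto
  also have "\<dots> = (c - 1) * (\<epsilon> / c)" by (simp add: c_def)
  also have "\<dots> < c * (\<epsilon> / c)" using ec by (intro mult_strict_right_mono) auto
  also have "\<dots> = \<epsilon>" using c by simp
  finally show "\<exists>k\<in>S. nrm MZ (\<lambda>x. k x - te f g h i x) < \<epsilon>" by (rule bexI[OF _ pS])
qed

subsection \<open>From boxes to all square-integrable fields\<close>

text \<open>Tends pointwise to the indicator of the open interval from below, with support at
  distance at least \<open>1 / (n + 1)\<close> from its ends. This margin keeps the polar and
  azimuthal factors away from the ends of their ranges, as the two approximation lemmas
  require.\<close>

definition ibump :: "real \<Rightarrow> real \<Rightarrow> nat \<Rightarrow> real \<Rightarrow> real" where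
  "ibump u v n x = smooth_step (real (Suc n) * (x - u) - 1) * smooth_step (real (Suc n) * (v - x) - 1)"

lemma Cinf_ibump: "Cinf UNIV (ibump u v n)"
proof -
  have "Cinf UNIV (\<lambda>x. smooth_step (real (Suc n) * x + (- real (Suc n) * u - 1)))"
    "Cinf UNIV (\<lambda>x. smooth_step ((- real (Suc n)) * x + (real (Suc n) * v - 1)))"
    using Cinf_compose[OF _ _ _ Cinf_affine[of "real (Suc n)" "- real (Suc n) * u - 1"] Cinf_smooth_step]
      Cinf_compose[OF _ _ _ Cinf_affine[of "- real (Suc n)" "real (Suc n) * v - 1"] Cinf_smooth_step] by blast+
  then have "Cinf UNIV (\<lambda>x. smooth_step (real (Suc n) * x + (- real (Suc n) * u - 1)) * smooth_step ((- real (Suc n)) * x + (real (Suc n) * v - 1)))"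
    by (intro Cinf_mult) auto
  moreover have "ibump u v n = (\<lambda>x. smooth_step (real (Suc n) * x + (- real (Suc n) * u - 1)) * smooth_step ((- real (Suc n)) * x + (real (Suc n) * v - 1)))"
    unfolding ibump_def by (auto simp: fun_eq_iff algebra_simps)
  ultimately show ?thesis by simp
qed

lemma ibump_bounds: "0 \<le> ibump u v n x" "ibump u v n x \<le> 1"
  using smooth_step_bounds by (auto simp: ibump_def intro: mult_le_one)

lemma ibump_zero: "x \<notin> {u + 1 / Suc n..v - 1 / Suc n} \<Longrightarrow> ibump u v n x = 0"
proof -
  assume "x \<notin> {u + 1 / Suc n..v - 1 / Suc n}"
  then have "real (Suc n) * (x - u) - 1 \<le> 0 \<or> real (Suc n) * (v - x) - 1 \<le> 0"
    by (auto simp: field_simps)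
  then show ?thesis by (auto simp: ibump_def smooth_step_0)
qed

lemma ibump_le_indicator: "ibump u v n x \<le> indicator {u<..<v} x"
proof (cases "x \<in> {u<..<v}")
  case False
  moreover have "1 / real (Suc n) > 0" by simp
  ultimately have "x \<notin> {u + 1 / Suc n..v - 1 / Suc n}"
    unfolding atLeastAtMost_iff greaterThanLessThan_iff by linarith
  then show ?thesis by (simp add: ibump_zero)
qed (simp add: ibump_bounds)

lemma ibump_tendsto: "(\<lambda>n. ibump u v n x) \<longlonglongrightarrow> indicator {u<..<v} x"
proof (cases "x \<in> {u<..<v}")
  case True
  have ev: "\<forall>\<^sub>F n in sequentially. 1 \<le> real (Suc n) * d - 1" if "d > 0" for d
  proof -
    obtain m :: nat where m: "2 / d < real m" using reals_Archimedean2 by blast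
    have "1 \<le> real (Suc n) * d - 1" if "n \<ge> m" for n
    proof -
      have "2 / d \<le> real (Suc n)" using m that by linarith
      then show ?thesis using \<open>d > 0\<close> by (simp add: field_simps)
    qed
    then show ?thesis unfolding eventually_sequentially by blast
  qed
  have "\<forall>\<^sub>F n in sequentially. ibump u v n x = indicator {u<..<v} x"
  proof (rule eventually_mono)
    show "\<forall>\<^sub>F n in sequentially. 1 \<le> real (Suc n) * (x - u) - 1 \<and> 1 \<le> real (Suc n) * (v - x) - 1"
      by (intro eventually_conj ev) (use True in auto)
    show "ibump u v n x = indicator {u<..<v} x" if "1 \<le> real (Suc n) * (x - u) - 1 \<and> 1 \<le> real (Suc n) * (v - x) - 1" for n
      using that True by (simp add: ibump_def smooth_step_1 del: of_nat_Suc)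
  qed
  then show ?thesis by (rule tendsto_eventually)
next
  case False
  have "ibump u v n x = 0" for n
    using ibump_le_indicator[of u v n x] ibump_bounds(1)[of u v n x] False by simp
  then show ?thesis using False by simp
qed

definition unit_on :: "pt set \<Rightarrow> 4 \<Rightarrow> field4" where
  "unit_on A i x = of_real (indicator A x) *s axis i 1"

lemma norm_of_real_axis: "norm (of_real t *s (axis i 1 :: bisp)) = \<bar>t\<bar>"
  by (simp add: norm_smult_vec norm_axis_1)

text \<open>Truncation in \<open>r\<close> makes indicators square-integrable; the faces of
  \<open>Zset\<close> left out are null sets.\<close>

definition zbox :: "real \<Rightarrow> pt set" where
  "zbox N = {-N<..<N} \<times> {0<..<pi} \<times> {0<..<2*pi}"

lemma zbox_borel [measurable]: "zbox N \<in> sets borel"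
  unfolding zbox_def by (intro borel_open open_Times) auto

lemma real_field_measurable:
  assumes "t \<in> borel_measurable borel"
  shows "(\<lambda>x::pt. complex_of_real (t x) *s (axis i 1 :: bisp)) \<in> borel_measurable borel"
  using smult_measurable[OF borel_measurable_of_real_comp[OF assms] borel_measurable_const[of "axis i 1"]] .

lemma unit_on_l2:
  assumes A: "A \<in> sets borel" shows "l2 MZ (unit_on (A \<inter> zbox N) i)"
proof (rule l2_rtbox(1))
  have "A \<inter> zbox N \<in> sets borel" using A by simp
  then show "unit_on (A \<inter> zbox N) i \<in> borel_measurable borel"
    unfolding unit_on_def[abs_def] by (intro real_field_measurable borel_measurable_indicator)
  show "norm (unit_on (A \<inter> zbox N) i x) \<le> 1" for x
    unfolding unit_on_def norm_of_real_axis by (simp add: indicator_def)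
  show "unit_on (A \<inter> zbox N) i x = 0" if "x \<notin> rtbox (-\<bar>N\<bar>) \<bar>N\<bar> 0 pi" for x
    using that by (cases x) (auto simp: unit_on_def indicator_def zbox_def rtbox_def)
qed auto

lemma pt_box: "box (a1, a2, a3) (b1, b2, b3) = ({a1<..<b1} \<times> {a2<..<b2} \<times> {a3<..<b3} :: pt set)"
  by (auto simp: box_def Basis_prod_def inner_prod_def ball_Un)

context
  fixes S :: "field4 set"
  assumes S: "csub S"
    and te_S: "\<And>u1 v1 u2 v2 u3 v3 n i. 0 \<le> u2 \<Longrightarrow> v2 \<le> pi \<Longrightarrow> 0 \<le> u3 \<Longrightarrow> v3 \<le> 2 * pi \<Longrightarrow>
       te (\<lambda>r. of_real (ibump u1 v1 n r)) (\<lambda>\<theta>. of_real (ibump u2 v2 n \<theta>)) (\<lambda>\<phi>. of_real (ibump u3 v3 n \<phi>)) i \<in> S"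
begin

lemma unit_on_box: "unit_on (box a b \<inter> zbox N) i \<in> S"
proof -
  obtain a1 a2 a3 b1 b2 b3 where ab: "a = (a1, a2, a3)" "b = (b1, b2, b3)" by (metis prod_cases3)
  define u1 v1 u2 v2 u3 v3 where "u1 = max a1 (-N)" and "v1 = min b1 N" and "u2 = max a2 0" and "v2 = min b2 pi"
    and "u3 = max a3 0" and "v3 = min b3 (2 * pi)"
  have box: "box a b \<inter> zbox N = {u1<..<v1} \<times> {u2<..<v2} \<times> {u3<..<v3}"
    by (auto simp: ab pt_box zbox_def u1_def v1_def u2_def v2_def u3_def v3_def)
  have bb: "box a b \<in> sets borel" by simp
  let ?t = "\<lambda>n. te (\<lambda>r. of_real (ibump u1 v1 n r)) (\<lambda>\<theta>. of_real (ibump u2 v2 n \<theta>)) (\<lambda>\<phi>. of_real (ibump u3 v3 n \<phi>)) i"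
  have tS: "?t n \<in> S" for n by (rule te_S) (auto simp: u2_def v2_def u3_def v3_def)
  have teq: "?t n x = of_real (ibump u1 v1 n (fst x) * ibump u2 v2 n (fst (snd x)) * ibump u3 v3 n (snd (snd x))) *s axis i 1" for n x
    by (cases x) (simp add: te_def)
  have ueq: "unit_on (box a b \<inter> zbox N) i x = of_real (indicator {u1<..<v1} (fst x) * indicator {u2<..<v2} (fst (snd x)) * indicator {u3<..<v3} (snd (snd x))) *s axis i 1" for x
    unfolding box by (cases x) (simp add: unit_on_def indicator_times)
  have lu: "l2 MZ (unit_on (box a b \<inter> zbox N) i)" by (rule unit_on_l2[OF bb])
  have lt: "l2 MZ (?t n)" for n by (rule csub_l2[OF S tS])
  show ?thesis
  proof (rule csub_limit[OF S lu tS])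
    show "(\<lambda>n. nrm MZ (\<lambda>p. ?t n p - unit_on (box a b \<inter> zbox N) i p)) \<longlonglongrightarrow> 0"
    proof (rule nrm_dominated[OF lu])
      show "(\<lambda>p. ?t n p - unit_on (box a b \<inter> zbox N) i p) \<in> borel_measurable MZ" for n
        using l2_measurable[OF l2_diff[OF lt lu]] .
      show "AE p in MZ. norm (?t n p - unit_on (box a b \<inter> zbox N) i p) \<le> norm (unit_on (box a b \<inter> zbox N) i p)" for n
      proof (rule AE_MZ_I)
        fix p
        let ?A = "ibump u1 v1 n (fst p) * ibump u2 v2 n (fst (snd p)) * ibump u3 v3 n (snd (snd p))"
        let ?B = "indicator {u1<..<v1} (fst p) * indicator {u2<..<v2} (fst (snd p)) * indicator {u3<..<v3} (snd (snd p)) :: real"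
        have "0 \<le> ?A" "?A \<le> ?B" using ibump_bounds(1) ibump_le_indicator by (auto intro!: mult_mono mult_nonneg_nonneg)
        then have "\<bar>?A - ?B\<bar> \<le> \<bar>?B\<bar>" by linarith
        moreover have "?t n p - unit_on (box a b \<inter> zbox N) i p = of_real (?A - ?B) *s axis i 1"
          unfolding teq ueq by (simp add: vec_eq_iff algebra_simps)
        ultimately show "norm (?t n p - unit_on (box a b \<inter> zbox N) i p) \<le> norm (unit_on (box a b \<inter> zbox N) i p)"
          unfolding ueq by (simp only: norm_of_real_axis)
      qed
      show "AE p in MZ. (\<lambda>n. ?t n p - unit_on (box a b \<inter> zbox N) i p) \<longlonglongrightarrow> 0"
      proof (rule AE_MZ_I)
        fix p
        have "(\<lambda>n. ?t n p) \<longlonglongrightarrow> unit_on (box a b \<inter> zbox N) i p"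
          unfolding teq ueq
          by (intro bounded_linear.tendsto[OF bounded_linear_smult_left] tendsto_of_real tendsto_mult ibump_tendsto)
        then show "(\<lambda>n. ?t n p - unit_on (box a b \<inter> zbox N) i p) \<longlonglongrightarrow> 0" by (simp add: LIM_zero_iff)
      qed
    qed
  qed
qed

lemma S_nonempty: "S \<noteq> {}"
  using unit_on_box by blast

text \<open>Open boxes are stable under intersection and generate the Borel sets. Complements are
  formed relative to \<open>zbox N\<close>, and countable disjoint unions are handled by dominated
  convergence.\<close>

lemma unit_on_borel: "A \<in> sets borel \<Longrightarrow> unit_on (A \<inter> zbox N) i \<in> S"
proof -
  assume "A \<in> sets (borel :: pt measure)"
  then have A: "A \<in> sigma_sets UNIV (range (\<lambda>(a, b). box a b :: pt set))"
    unfolding borel_eq_box by simp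
  have stable: "Int_stable (range (\<lambda>(a, b). box a b :: pt set))"
  proof (rule Int_stableI)
    have box: "\<exists>u v. A = box u v" if A: "A \<in> range (\<lambda>(a, b). box a b :: pt set)" for A
    proof -
      obtain x where "A = (case x of (a, b) \<Rightarrow> box a b)" using A by (rule rangeE)
      then have "A = box (fst x) (snd x)" by (simp only: case_prod_unfold)
      then show ?thesis by (intro exI)
    qed
    fix A B assume "A \<in> range (\<lambda>(a, b). box a b :: pt set)" "B \<in> range (\<lambda>(a, b). box a b :: pt set)"
    from box[OF this(1)] box[OF this(2)] obtain a b c d where AB: "A = box a b" "B = box c d" by (elim exE)
    have "A \<inter> B = (case (\<Sum>i\<in>Basis. max (a \<bullet> i) (c \<bullet> i) *\<^sub>R i, \<Sum>i\<in>Basis. min (b \<bullet> i) (d \<bullet> i) *\<^sub>R i) of (a, b) \<Rightarrow> box a b)"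
      unfolding AB box_Int_box prod.case ..
    then show "A \<inter> B \<in> range (\<lambda>(a, b). box a b)" by (rule range_eqI)
  qed
  have "range (\<lambda>(a, b). box a b :: pt set) \<subseteq> Pow UNIV" by simp
  from stable this A show ?thesis
  proof (induction rule: sigma_sets_induct_disjoint)
    case (basic A)
    then show ?case using unit_on_box by auto
  next
    case empty
    have "unit_on ({} \<inter> zbox N) i = (\<lambda>_. 0)" by (simp add: unit_on_def fun_eq_iff)
    then show ?case using csub_zero[OF S S_nonempty] by simp
  next
    case (compl A)
    have "unit_on (UNIV \<inter> zbox N) i \<in> S"
    proof -
      have "UNIV \<inter> zbox N = box (-N, 0, 0) (N, pi, 2 * pi) \<inter> zbox N" unfolding pt_box zbox_def by auto
      then show ?thesis using unit_on_box by metis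
    qed
    from csub_diff[OF S this compl.IH]
    have "(\<lambda>p. unit_on (UNIV \<inter> zbox N) i p - unit_on (A \<inter> zbox N) i p) \<in> S" .
    also have "(\<lambda>p. unit_on (UNIV \<inter> zbox N) i p - unit_on (A \<inter> zbox N) i p) = unit_on ((UNIV - A) \<inter> zbox N) i"
      by (auto simp: unit_on_def fun_eq_iff indicator_def)
    finally show ?case .
  next
    case (union F)
    have Fb: "F j \<in> sets borel" for j using union.hyps(2) unfolding borel_eq_box by auto
    let ?U = "unit_on ((\<Union>j. F j) \<inter> zbox N) i"
    let ?s = "\<lambda>n p. \<Sum>j<n. unit_on (F j \<inter> zbox N) i p"
    have seq: "?s n = unit_on ((\<Union>j<n. F j) \<inter> zbox N) i" for n
    proof
      fix p
      have "indicator ((\<Union>j<n. F j) \<inter> zbox N) p = (\<Sum>j<n. indicator (F j \<inter> zbox N) p :: real)"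
        unfolding indicator_inter_arith sum_distrib_right[symmetric]
        by (subst indicator_UN_disjoint) (use union.hyps(1) in \<open>auto intro: disjoint_family_on_mono[of _ UNIV]\<close>)
      then show "?s n p = unit_on ((\<Union>j<n. F j) \<inter> zbox N) i p"
        by (simp add: unit_on_def vec_eq_iff sum_component sum_distrib_right)
    qed
    have lU: "l2 MZ ?U" using Fb by (intro unit_on_l2) auto
    have sS: "?s n \<in> S" for n by (intro csub_sum S S_nonempty union.IH)
    show ?case
    proof (rule csub_limit[OF S lU sS])
      show "(\<lambda>n. nrm MZ (\<lambda>p. ?s n p - ?U p)) \<longlonglongrightarrow> 0"
      proof (rule nrm_dominated[OF lU])
        show "(\<lambda>p. ?s n p - ?U p) \<in> borel_measurable MZ" for n
          using l2_measurable[OF l2_diff[OF csub_l2[OF S sS] lU]] .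
        have eq: "?s n p - ?U p = of_real (indicator ((\<Union>j<n. F j) \<inter> zbox N) p - indicator ((\<Union>j. F j) \<inter> zbox N) p) *s axis i 1" for n p
          unfolding seq[THEN fun_cong] by (simp add: unit_on_def vec_eq_iff algebra_simps)
        show "AE p in MZ. norm (?s n p - ?U p) \<le> norm (?U p)" for n
          unfolding eq unfolding unit_on_def norm_of_real_axis by (rule AE_MZ_I) (auto simp: indicator_def)
        show "AE p in MZ. (\<lambda>n. ?s n p - ?U p) \<longlonglongrightarrow> 0"
        proof (rule AE_MZ_I, rule tendsto_eventually)
          fix p
          show "\<forall>\<^sub>F n in sequentially. ?s n p - ?U p = 0"
          proof (cases "\<exists>j. p \<in> F j")
            case True
            then obtain j where j: "p \<in> F j" by blast
            have "?s n p - ?U p = 0" if "n \<ge> Suc j" for n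
              unfolding eq using j that by (auto simp: indicator_def)
            then show ?thesis unfolding eventually_sequentially by blast
          next
            case False
            then have "?s n p - ?U p = 0" for n unfolding eq by (auto simp: indicator_def)
            then show ?thesis by simp
          qed
        qed
      qed
    qed
  qed
qed

text \<open>Induction over nonnegative measurable functions. Square integrability belongs to the
  claim proved by induction, since each intermediate function needs its own; it passes to summands
  and to increasing approximants because the whole dominates them.\<close>

lemma real_field_in_S:
  assumes t: "t \<in> borel_measurable borel" "\<And>x. 0 \<le> t x"
  shows "l2 MZ (\<lambda>x. complex_of_real (t x * indicator (zbox N) x) *s axis i 1) \<longrightarrow>
    (\<lambda>x. complex_of_real (t x * indicator (zbox N) x) *s axis i 1) \<in> S"
  using t
proof (induction rule: borel_measurable_induct_real)
  case (set A)
  have "(\<lambda>x. complex_of_real (indicator A x * indicator (zbox N) x) *s axis i 1) = unit_on (A \<inter> zbox N) i"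
    by (simp add: unit_on_def fun_eq_iff indicator_inter_arith)
  then show ?case using unit_on_borel set by simp
next
  case (mult u c)
  let ?f = "\<lambda>x. complex_of_real (u x * indicator (zbox N) x) *s axis i 1 :: bisp"
  have eq: "(\<lambda>x. complex_of_real (c * u x * indicator (zbox N) x) *s axis i 1) = (\<lambda>x. of_real c *s ?f x)"
    by (simp add: fun_eq_iff vec_eq_iff)
  show ?case
  proof
    assume l: "l2 MZ (\<lambda>x. complex_of_real (c * u x * indicator (zbox N) x) *s axis i 1)"
    show "(\<lambda>x. complex_of_real (c * u x * indicator (zbox N) x) *s axis i 1) \<in> S"
    proof (cases "c = 0")
      case True
      then show ?thesis using csub_zero[OF S S_nonempty] by simp
    next
      case False
      have "(\<lambda>x. of_real (1 / c) *s (of_real c *s ?f x)) = ?f" using False by (simp add: fun_eq_iff vec_eq_iff)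
      then have "l2 MZ ?f" using l2_smult[OF l[unfolded eq], of "of_real (1 / c)"] by simp
      then have "?f \<in> S" using mult by blast
      then show ?thesis unfolding eq by (rule csub_smult[OF S])
    qed
  qed
next
  case (add u v)
  let ?f = "\<lambda>u x. complex_of_real (u x * indicator (zbox N) x) *s axis i 1 :: bisp"
  have eq: "?f (\<lambda>x. v x + u x) = (\<lambda>x. ?f v x + ?f u x)"
    by (simp add: fun_eq_iff vec_eq_iff algebra_simps)
  have m: "?f u \<in> borel_measurable MZ" "?f v \<in> borel_measurable MZ"
    using add by (auto intro!: real_field_measurable)
  show ?case
  proof
    assume l: "l2 MZ (?f (\<lambda>x. v x + u x))"
    have "l2 MZ (?f u)" "l2 MZ (?f v)"
      by (rule l2_bound[OF l m(1)], unfold norm_of_real_axis abs_mult, intro mult_right_mono, use add in simp, simp)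
        (rule l2_bound[OF l m(2)], unfold norm_of_real_axis abs_mult, intro mult_right_mono, use add in simp, simp)
    then have "?f u \<in> S" "?f v \<in> S" using add by blast+
    then show "?f (\<lambda>x. v x + u x) \<in> S" unfolding eq by (intro csub_add S)
  qed
next
  case (seq U)
  let ?f = "\<lambda>u x. complex_of_real (u x * indicator (zbox N) x) *s axis i 1 :: bisp"
  show ?case
  proof
    assume l: "l2 MZ (?f t)"
    have le: "U n x \<le> t x" for n x
    proof -
      have "incseq (\<lambda>n. U n x)" using seq.hyps(3) unfolding incseq_def le_fun_def by blast
      moreover have "(\<lambda>n. U n x) \<longlonglongrightarrow> t x" using seq.hyps(4) by simp
      ultimately show ?thesis by (rule incseq_le)
    qed
    have m: "?f (U n) \<in> borel_measurable MZ" for n using seq.hyps(1) by (auto intro!: real_field_measurable)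
    have lU: "l2 MZ (?f (U n))" for n
      by (rule l2_bound[OF l m], unfold norm_of_real_axis abs_mult, intro mult_right_mono)
        (use le[of n] seq.hyps(2)[of n] in \<open>auto intro: order.trans[OF _ abs_ge_self] simp del: split_paired_All\<close>)
    show "?f t \<in> S"
    proof (rule csub_limit[OF S l])
      show "?f (U n) \<in> S" for n using seq.IH[of n] lU by blast
      show "(\<lambda>n. nrm MZ (\<lambda>p. ?f (U n) p - ?f t p)) \<longlonglongrightarrow> 0"
      proof (rule nrm_dominated[OF l])
        show "(\<lambda>p. ?f (U n) p - ?f t p) \<in> borel_measurable MZ" for n using l2_measurable[OF l2_diff[OF lU l]] .
        have eq: "?f (U n) p - ?f t p = of_real ((U n p - t p) * indicator (zbox N) p) *s axis i 1" for n p
          by (simp add: vec_eq_iff algebra_simps)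
        show "AE p in MZ. norm (?f (U n) p - ?f t p) \<le> norm (?f t p)" for n
          unfolding eq norm_of_real_axis abs_mult
        proof (intro AE_MZ_I mult_right_mono)
          fix p
          show "\<bar>U n p - t p\<bar> \<le> \<bar>t p\<bar>" using le[of n p] seq.hyps(2)[of n p] by linarith
        qed simp
        show "AE p in MZ. (\<lambda>n. ?f (U n) p - ?f t p) \<longlonglongrightarrow> 0"
        proof (rule AE_MZ_I)
          fix p
          have "(\<lambda>n. ?f (U n) p) \<longlonglongrightarrow> ?f t p"
            by (intro bounded_linear.tendsto[OF bounded_linear_smult_left] tendsto_of_real tendsto_mult tendsto_const) (use seq.hyps(4) in simp)
          then show "(\<lambda>n. ?f (U n) p - ?f t p) \<longlonglongrightarrow> 0" by (simp add: LIM_zero_iff)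
        qed
      qed
    qed
  qed
qed

end

lemma AE_lborel_coordinate:
  fixes b :: "'a::euclidean_space"
  assumes "b \<in> Basis" shows "AE x in lborel. x \<bullet> b \<noteq> c"
proof -
  have "negligible {x. x \<bullet> b = c}" by (rule negligible_standard_hyperplane[OF assms])
  moreover have "{x. x \<bullet> b = c} \<in> sets lborel"
    unfolding sets_lborel by (intro borel_closed closed_Collect_eq continuous_intros)
  ultimately have "{x. x \<bullet> b = c} \<in> null_sets lborel"
    by (simp add: negligible_iff_null_sets null_sets_completion_iff)
  then show ?thesis by (rule AE_I'[where N="{x. x \<bullet> b = c}"]) auto
qed

lemma AE_MZ_interior: "AE x in MZ. 0 < fst (snd x) \<and> fst (snd x) < pi \<and> 0 < snd (snd x) \<and> snd (snd x) < 2 * pi"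
proof -
  have b: "((0, 1, 0) :: pt) \<in> Basis" "((0, 0, 1) :: pt) \<in> Basis" by (simp_all add: Basis_prod_def zero_prod_def)
  have "AE x in lborel. x \<bullet> (0, 1, 0) \<noteq> 0 \<and> x \<bullet> (0, 1, 0) \<noteq> pi \<and> x \<bullet> ((0, 0, 1) :: pt) \<noteq> 0 \<and> x \<bullet> (0, 0, 1) \<noteq> 2 * pi"
    by (intro AE_conjI AE_lborel_coordinate b)
  then have "AE x in lborel. x \<in> Zset \<longrightarrow> 0 < fst (snd x) \<and> fst (snd x) < pi \<and> 0 < snd (snd x) \<and> snd (snd x) < 2 * pi"
  proof eventually_elim
    case (elim x)
    then show ?case by (cases x) (auto simp: Zset_def inner_prod_def less_le)
  qed
  then show ?thesis unfolding MZ_def by (subst AE_density) (auto simp: indicator_def elim: eventually_mono)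
qed

lemma l2_in_S:
  assumes S: "csub S"
    and te_S: "\<And>u1 v1 u2 v2 u3 v3 n i. 0 \<le> u2 \<Longrightarrow> v2 \<le> pi \<Longrightarrow> 0 \<le> u3 \<Longrightarrow> v3 \<le> 2 * pi \<Longrightarrow>
       te (\<lambda>r. of_real (ibump u1 v1 n r)) (\<lambda>\<theta>. of_real (ibump u2 v2 n \<theta>)) (\<lambda>\<phi>. of_real (ibump u3 v3 n \<phi>)) i \<in> S"
    and f: "l2 MZ f"
  shows "f \<in> S"
proof -
  note ne = S_nonempty[OF S te_S]
  have fm [measurable]: "f \<in> borel_measurable borel" using f by (simp add: l2_def)
  let ?F = "\<lambda>N t i x. complex_of_real (t x * indicator (zbox N) x) *s axis i 1 :: bisp"
  have part: "?F N (\<lambda>x. max 0 (t x)) i \<in> S"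
    if t: "t \<in> borel_measurable borel" "\<And>x. \<bar>t x\<bar> \<le> norm (f x)" for t :: "pt \<Rightarrow> real" and N i
  proof -
    have m: "(\<lambda>x. max 0 (t x)) \<in> borel_measurable borel" using t(1) by (intro borel_measurable_max) auto
    have "l2 MZ (?F N (\<lambda>x. max 0 (t x)) i)"
    proof (rule l2_bound[OF f])
      show "?F N (\<lambda>x. max 0 (t x)) i \<in> borel_measurable MZ"
        using m by (auto intro!: real_field_measurable)
      show "norm (?F N (\<lambda>x. max 0 (t x)) i x) \<le> norm (f x)" for x
        using t(2)[of x] unfolding norm_of_real_axis by (auto simp: indicator_def)
    qed
    then show ?thesis using real_field_in_S[OF S te_S m, of N i] by simp
  qed
  have bnd: "\<bar>Re (f x $ i)\<bar> \<le> norm (f x)" "\<bar>Im (f x $ i)\<bar> \<le> norm (f x)" for x i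
    using abs_Re_le_cmod[of "f x $ i"] abs_Im_le_cmod[of "f x $ i"] Finite_Cartesian_Product.norm_nth_le[of "f x" i] by linarith+
  \<comment> \<open>Positive and negative parts of the real and imaginary parts of all components,
    recombined to \<open>f\<close> cut off to \<open>zbox N\<close>.\<close>
  define fN where "fN N x = (\<Sum>i\<in>UNIV. (?F N (\<lambda>x. max 0 (Re (f x $ i))) i x - ?F N (\<lambda>x. max 0 (- Re (f x $ i))) i x)
     + \<i> *s (?F N (\<lambda>x. max 0 (Im (f x $ i))) i x - ?F N (\<lambda>x. max 0 (- Im (f x $ i))) i x))" for N x
  have fNS: "fN N \<in> S" for N
  proof -
    have mm: "(\<lambda>x. Re (f x $ i)) \<in> borel_measurable borel" "(\<lambda>x. Im (f x $ i)) \<in> borel_measurable borel" for i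
      by measurable
    show ?thesis unfolding fN_def[abs_def]
      by (intro csub_sum csub_add csub_diff csub_smult S ne part)
        (use mm bnd in \<open>auto intro: borel_measurable_uminus\<close>)
  qed
  have fNeq: "fN N x = of_real (indicator (zbox N) x) *s f x" for N x
  proof -
    have mx: "max 0 t - max 0 (- t) = t" for t :: real by auto
    have comp: "?F N (\<lambda>x. max 0 (Re (f x $ i))) i x - ?F N (\<lambda>x. max 0 (- Re (f x $ i))) i x
     + \<i> *s (?F N (\<lambda>x. max 0 (Im (f x $ i))) i x - ?F N (\<lambda>x. max 0 (- Im (f x $ i))) i x)
      = (of_real (indicator (zbox N) x) * f x $ i) *s axis i 1" for i
    proof -
      let ?I = "indicator (zbox N) x :: real"
      have "?F N (\<lambda>x. max 0 (Re (f x $ i))) i x - ?F N (\<lambda>x. max 0 (- Re (f x $ i))) i x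
     + \<i> *s (?F N (\<lambda>x. max 0 (Im (f x $ i))) i x - ?F N (\<lambda>x. max 0 (- Im (f x $ i))) i x)
       = (of_real ((max 0 (Re (f x $ i)) - max 0 (- Re (f x $ i))) * ?I) + \<i> * of_real ((max 0 (Im (f x $ i)) - max 0 (- Im (f x $ i))) * ?I)) *s axis i 1"
        by (simp add: vec_eq_iff algebra_simps)
      also have "\<dots> = (of_real ?I * f x $ i) *s axis i 1"
        unfolding mx by (intro arg_cong[where f="\<lambda>c. c *s axis i 1"]) (simp add: complex_eq_iff)
      finally show ?thesis .
    qed
    show ?thesis unfolding fN_def comp
      by (simp add: vec_eq_iff sum_component axis_def if_distrib[of "\<lambda>z. _ * z"] cong: if_cong)
  qed
  show ?thesis
  proof (rule csub_limit[OF S f, of "\<lambda>n. fN (real n)"])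
    show "fN (real n) \<in> S" for n by (rule fNS)
    show "(\<lambda>n. nrm MZ (\<lambda>p. fN (real n) p - f p)) \<longlonglongrightarrow> 0"
    proof (rule nrm_dominated[OF f])
      show "(\<lambda>p. fN (real n) p - f p) \<in> borel_measurable MZ" for n
        using l2_measurable[OF l2_diff[OF csub_l2[OF S fNS] f]] .
      show "AE p in MZ. norm (fN (real n) p - f p) \<le> norm (f p)" for n
        unfolding fNeq by (rule AE_MZ_I) (auto simp: indicator_def)
      show "AE p in MZ. (\<lambda>n. fN (real n) p - f p) \<longlonglongrightarrow> 0"
        using AE_MZ_interior
      proof eventually_elim
        case (elim p)
        obtain m :: nat where m: "\<bar>fst p\<bar> < real m" using reals_Archimedean2 by blast
        have "fN (real n) p - f p = 0" if "n \<ge> m" for n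
        proof -
          have "real m \<le> real n" using that by simp
          then have "p \<in> zbox (real n)" using elim m by (cases p) (auto simp: zbox_def)
          then show ?thesis by (simp add: fNeq)
        qed
        then have "\<forall>\<^sub>F n in sequentially. fN (real n) p - f p = 0" unfolding eventually_sequentially by blast
        then show ?case by (rule tendsto_eventually)
      qed
    qed
  qed
qed

text \<open>The three factors are released one at a time: the radial bump is itself admissible, the
  polar bump is approximated within a fixed mode, and the azimuthal bump by combining modes.\<close>

lemma csub_eigenmodes_all:
  assumes S: "csub S" and modes: "\<And>f \<kappa> i n. f \<in> Cc \<Longrightarrow> \<kappa> - 1/2 \<in> \<int> \<Longrightarrow> tn f (wsq (ang \<kappa> i n)) \<kappa> i \<in> S"
    and f: "l2 MZ f"
  shows "f \<in> S"
proof (rule l2_in_S[OF S _ f])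
  fix u1 v1 u2 v2 u3 v3 :: real and n i
  assume u: "0 \<le> u2" "v2 \<le> pi" "0 \<le> u3" "v3 \<le> 2 * pi"
  let ?d = "1 / real (Suc n)"
  have d1: "?d \<le> 1" by simp have d: "0 < ?d" "?d \<le> pi" using d1 pi_gt3 by (simp, linarith)
  have C: "Cinf UNIV (\<lambda>r. complex_of_real (ibump u v n r))" for u v by (intro Cinf_of_real Cinf_ibump open_UNIV)
  have r: "(\<lambda>r. complex_of_real (ibump u1 v1 n r)) \<in> Cc"
  proof (rule CcI[OF C, of "\<bar>u1\<bar> + \<bar>v1\<bar>"])
    fix x assume "\<bar>x\<bar> > \<bar>u1\<bar> + \<bar>v1\<bar>"
    then have "x \<notin> {u1 + ?d..v1 - ?d}" using d(1) unfolding atLeastAtMost_iff by linarith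
    then show "complex_of_real (ibump u1 v1 n x) = 0" by (simp add: ibump_zero del: of_nat_Suc)
  qed
  have z: "ibump u v n x = 0" if "x \<notin> {?d..w - ?d}" "0 \<le> u" "v \<le> w" for u v w x
  proof (rule ibump_zero)
    show "x \<notin> {u + ?d..v - ?d}" using that unfolding atLeastAtMost_iff by linarith
  qed
  show "te (\<lambda>r. of_real (ibump u1 v1 n r)) (\<lambda>\<theta>. of_real (ibump u2 v2 n \<theta>)) (\<lambda>\<phi>. of_real (ibump u3 v3 n \<phi>)) i \<in> S"
  proof (rule csub_azimuthal[OF S _ r Cinf_continuous_on[OF C] Cinf_continuous_on[OF C] d])
    show "tn (\<lambda>r. of_real (ibump u1 v1 n r)) (\<lambda>\<theta>. of_real (ibump u2 v2 n \<theta>)) \<kappa> i \<in> S" if "\<kappa> - 1/2 \<in> \<int>" for \<kappa>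
      by (rule csub_polar[OF S modes[OF r that] r Cinf_continuous_on[OF Cinf_ibump] d(1)]) (rule z[OF _ u(1,2)])
    show "complex_of_real (ibump u3 v3 n \<phi>) = 0" if "\<phi> \<notin> {?d..2 * pi - ?d}" for \<phi>
      using z[OF that u(3,4)] by simp
  qed
qed

section \<open>Symmetry\<close>

lemma BC_integrable: "BC f \<Longrightarrow> integrable MZ f"
proof -
  assume f: "BC f"
  obtain B R where B: "\<forall>x\<in>Zset. norm (f x) \<le> B \<and> (\<bar>fst x\<bar> > R \<longrightarrow> f x = 0)" using f unfolding BC_def by auto
  let ?S = "rtbox (-\<bar>R\<bar>) \<bar>R\<bar> 0 pi"
  have fin: "emeasure MZ ?S < \<infinity>"
    using emeasure_MZ_rtbox[of "-\<bar>R\<bar>" "\<bar>R\<bar>" 0 pi] le_less_trans by fastforce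
  show ?thesis
  proof (rule integrableI_bounded_set[where A="?S" and B=B])
    show "f \<in> borel_measurable MZ" using f by (simp add: BC_def)
    show "AE x in MZ. x \<in> ?S \<longrightarrow> norm (f x) \<le> B" by (rule AE_MZ_I) (use B in auto)
    show "AE x in MZ. x \<notin> ?S \<longrightarrow> f x = 0"
    proof (rule AE_MZ_I, rule impI)
      fix x assume x: "x \<in> Zset" "x \<notin> ?S"
      obtain r \<theta> \<phi> where p: "x = (r, \<theta>, \<phi>)" by (metis prod_cases3)
      have "\<bar>fst x\<bar> > R" using x by (auto simp: p Zset_def rtbox_def)
      then show "f x = 0" using B x by blast
    qed
  qed (use fin in auto)
qed

lemma BC_cnj: "BC f \<Longrightarrow> BC (\<lambda>x. cnj (f x))"
  unfolding BC_def by auto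

lemma BC_times:
  assumes "BC f" "BC g" shows "BC (\<lambda>x. f x * g x)"
proof -
  obtain B R where B: "\<forall>x\<in>Zset. norm (f x) \<le> B \<and> (\<bar>fst x\<bar> > R \<longrightarrow> f x = 0)" using assms(1) unfolding BC_def by auto
  show ?thesis by (rule BC_mult[OF _ _ assms(2), of f B]) (use B assms(1) in \<open>auto simp: BC_def\<close>)
qed

section \<open>Iterated integrals with a vanishing inner integral\<close>

lemma integral_zero_r:
  fixes f :: "pt \<Rightarrow> complex"
  assumes "integrable lborel f" "\<And>q. (LINT r|lborel. f (r, q)) = 0"
  shows "(LINT x|lborel. f x) = 0"
proof -
  have "(LINT q|lborel. LINT r|lborel. f (r, q)) = (LINT x|(lborel \<Otimes>\<^sub>M lborel). f x)"
    using lborel_pair.integral_snd[of "\<lambda>r q. f (r, q)"] assms(1) by (simp add: lborel_prod)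
  then show ?thesis using assms(2) by (simp add: lborel_prod)
qed

text \<open>On a slice that is not integrable the Bochner integral is 0 by default, so vanishing has
  to be shown for integrable slices only.\<close>

lemma integral_zero_inner:
  fixes f :: "pt \<Rightarrow> complex"
  assumes "integrable lborel f" "\<And>r. integrable lborel (\<lambda>q. f (r, q)) \<Longrightarrow> (LINT q|lborel. f (r, q)) = 0"
  shows "(LINT x|lborel. f x) = 0"
proof -
  have "(LINT r|lborel. LINT q|lborel. f (r, q)) = (LINT x|(lborel \<Otimes>\<^sub>M lborel). f x)"
    by (rule lborel_pair.integral_fst') (use assms(1) in \<open>simp add: lborel_prod\<close>)
  moreover have "(LINT q|lborel. f (r, q)) = 0" for r
    using assms(2)[of r] not_integrable_integral_eq[of lborel "\<lambda>q. f (r, q)"] by blast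
  ultimately show ?thesis by (simp add: lborel_prod)
qed

lemma integral_zero_theta:
  fixes f :: "pt \<Rightarrow> complex"
  assumes "integrable lborel f" "\<And>r \<phi>. (LINT \<theta>|lborel. f (r, \<theta>, \<phi>)) = 0"
  shows "(LINT x|lborel. f x) = 0"
proof (rule integral_zero_inner[OF assms(1)])
  fix r assume i: "integrable lborel (\<lambda>q. f (r, q))"
  have "(LINT \<phi>|lborel. LINT \<theta>|lborel. f (r, \<theta>, \<phi>)) = (LINT x|(lborel \<Otimes>\<^sub>M lborel). f (r, x))"
    using lborel_pair.integral_snd[of "\<lambda>\<theta> \<phi>. f (r, \<theta>, \<phi>)"] i by (simp add: lborel_prod case_prod_unfold)
  then show "(LINT q|lborel. f (r, q)) = 0" using assms(2) by (simp add: lborel_prod)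
qed

lemma integral_zero_phi:
  fixes f :: "pt \<Rightarrow> complex"
  assumes "integrable lborel f" "\<And>r \<theta>. (LINT \<phi>|lborel. f (r, \<theta>, \<phi>)) = 0"
  shows "(LINT x|lborel. f x) = 0"
proof (rule integral_zero_inner[OF assms(1)])
  fix r assume i: "integrable lborel (\<lambda>q. f (r, q))"
  have "(LINT \<theta>|lborel. LINT \<phi>|lborel. f (r, \<theta>, \<phi>)) = (LINT x|(lborel \<Otimes>\<^sub>M lborel). f (r, x))"
    by (rule lborel_pair.integral_fst'[of "\<lambda>x. f (r, x)"]) (use i in \<open>simp add: lborel_prod\<close>)
  then show "(LINT q|lborel. f (r, q)) = 0" using assms(2) by (simp add: lborel_prod)
qed

lemma Dom_line_derivatives:
  assumes "\<psi> \<in> Dom"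
  shows "((\<lambda>r. \<psi> (r, \<theta>, \<phi>) $ i) has_vector_derivative d_r \<psi> (r, \<theta>, \<phi>) $ i) (at r)"
    and "((\<lambda>\<theta>. \<psi> (r, \<theta>, \<phi>) $ i) has_vector_derivative d_theta \<psi> (r, \<theta>, \<phi>) $ i) (at \<theta>)"
    and "((\<lambda>\<phi>. \<psi> (r, \<theta>, \<phi>) $ i) has_vector_derivative d_phi \<psi> (r, \<theta>, \<phi>) $ i) (at \<phi>)"
proof -
  have D: "(\<psi> has_derivative frechet_derivative \<psi> (at x)) (at x)" for x
    using Dom_derivatives(5)[OF assms] by (simp add: frechet_derivative_works)
  have lin: "linear (frechet_derivative \<psi> (at x))" for x
    by (rule has_derivative_linear[OF D])
  have line: "((\<lambda>t. \<psi> (l t) $ i) has_vector_derivative frechet_derivative \<psi> (at (l t)) v $ i) (at t)"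
    if l: "(l has_vector_derivative v) (at t)" for l :: "real \<Rightarrow> pt" and v t
  proof -
    have "((\<lambda>t. \<psi> (l t)) has_derivative (\<lambda>h. frechet_derivative \<psi> (at (l t)) (h *\<^sub>R v))) (at t)"
      using diff_chain_at[OF l[unfolded has_vector_derivative_def] D] by (simp add: o_def)
    then have "((\<lambda>t. \<psi> (l t)) has_vector_derivative frechet_derivative \<psi> (at (l t)) v) (at t)"
      unfolding has_vector_derivative_def by (simp add: linear_scale[OF lin])
    then show ?thesis by (rule bounded_linear.has_vector_derivative[OF bounded_linear_vec_nth])
  qed
  have vb: "((\<lambda>t. (t, \<theta>, \<phi>)) has_vector_derivative (1, 0, 0)) (at r)"
    "((\<lambda>t. (r, t, \<phi>)) has_vector_derivative (0, 1, 0)) (at \<theta>)"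
    "((\<lambda>t. (r, \<theta>, t)) has_vector_derivative (0, 0, 1)) (at \<phi>)"
    by (auto intro!: has_vector_derivative_Pair derivative_eq_intros simp: zero_prod_def)
  show "((\<lambda>r. \<psi> (r, \<theta>, \<phi>) $ i) has_vector_derivative d_r \<psi> (r, \<theta>, \<phi>) $ i) (at r)"
    "((\<lambda>\<theta>. \<psi> (r, \<theta>, \<phi>) $ i) has_vector_derivative d_theta \<psi> (r, \<theta>, \<phi>) $ i) (at \<theta>)"
    "((\<lambda>\<phi>. \<psi> (r, \<theta>, \<phi>) $ i) has_vector_derivative d_phi \<psi> (r, \<theta>, \<phi>) $ i) (at \<phi>)"
    unfolding d_r_def d_theta_def d_phi_def by (rule line[OF vb(1)] line[OF vb(2)] line[OF vb(3)])+
qed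

definition null_integral :: "(pt \<Rightarrow> complex) \<Rightarrow> bool" where
  "null_integral f \<longleftrightarrow> integrable MZ f \<and> (LINT x|MZ. f x) = 0"

lemma null_integral_add: "null_integral f \<Longrightarrow> null_integral g \<Longrightarrow> null_integral (\<lambda>x. f x + g x)"
  and null_integral_diff: "null_integral f \<Longrightarrow> null_integral g \<Longrightarrow> null_integral (\<lambda>x. f x - g x)"
  and null_integral_cmult: "null_integral f \<Longrightarrow> null_integral (\<lambda>x. c * f x)"
  by (auto simp: null_integral_def)

text \<open>The product rule for \<open>cnj (\<psi> x $ i) * \<eta> x $ j\<close>. Two component
  indices are needed because the angular matrices are off-diagonal.\<close>

definition leib :: "(field4 \<Rightarrow> field4) \<Rightarrow> field4 \<Rightarrow> field4 \<Rightarrow> 4 \<Rightarrow> 4 \<Rightarrow> pt \<Rightarrow> complex" where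
  "leib d \<psi> \<eta> i j x = cnj (d \<psi> x $ i) * \<eta> x $ j + cnj (\<psi> x $ i) * d \<eta> x $ j"

lemma integral_derivative_zero:
  fixes F f :: "real \<Rightarrow> complex"
  assumes "u \<le> v" "\<And>x. (F has_vector_derivative f x) (at x)" "continuous_on UNIV f" "F u = F v"
  shows "(LINT x|lborel. indicator {u..v} x *\<^sub>R f x) = 0"
  using integral_FTC_atLeastAtMost[OF assms(1), of F f] assms(2,4) continuous_on_subset[OF assms(3)]
  by (auto intro: has_vector_derivative_at_within)

lemma leib_BC: "\<psi> \<in> Dom \<Longrightarrow> \<eta> \<in> Dom \<Longrightarrow> BC (leib d_r \<psi> \<eta> i j)"
  "\<psi> \<in> Dom \<Longrightarrow> \<eta> \<in> Dom \<Longrightarrow> BC (leib d_theta \<psi> \<eta> i j)"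
  "\<psi> \<in> Dom \<Longrightarrow> \<eta> \<in> Dom \<Longrightarrow> BC (leib d_phi \<psi> \<eta> i j)"
  unfolding leib_def[abs_def] by (intro BC_add BC_times BC_cnj Dom_BC; assumption)+

lemma leib_line_derivative:
  assumes \<psi>: "\<psi> \<in> Dom" and \<eta>: "\<eta> \<in> Dom"
  shows "((\<lambda>r. cnj (\<psi> (r, \<theta>, \<phi>) $ i) * \<eta> (r, \<theta>, \<phi>) $ j) has_vector_derivative leib d_r \<psi> \<eta> i j (r, \<theta>, \<phi>)) (at r)"
    and "((\<lambda>\<theta>. cnj (\<psi> (r, \<theta>, \<phi>) $ i) * \<eta> (r, \<theta>, \<phi>) $ j) has_vector_derivative leib d_theta \<psi> \<eta> i j (r, \<theta>, \<phi>)) (at \<theta>)"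
    and "((\<lambda>\<phi>. cnj (\<psi> (r, \<theta>, \<phi>) $ i) * \<eta> (r, \<theta>, \<phi>) $ j) has_vector_derivative leib d_phi \<psi> \<eta> i j (r, \<theta>, \<phi>)) (at \<phi>)"
  using has_vector_derivative_mult[OF has_vector_derivative_cnj[OF Dom_line_derivatives(1)[OF \<psi>]] Dom_line_derivatives(1)[OF \<eta>]]
    has_vector_derivative_mult[OF has_vector_derivative_cnj[OF Dom_line_derivatives(2)[OF \<psi>]] Dom_line_derivatives(2)[OF \<eta>]]
    has_vector_derivative_mult[OF has_vector_derivative_cnj[OF Dom_line_derivatives(3)[OF \<psi>]] Dom_line_derivatives(3)[OF \<eta>]]
  by (simp_all add: leib_def add.commute)

lemma leib_continuous:
  assumes \<psi>: "\<psi> \<in> Dom" and \<eta>: "\<eta> \<in> Dom"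
  shows "continuous_on UNIV (leib d_r \<psi> \<eta> i j)" "continuous_on UNIV (leib d_theta \<psi> \<eta> i j)"
    "continuous_on UNIV (leib d_phi \<psi> \<eta> i j)"
  unfolding leib_def[abs_def] using Dom_derivatives(1-4)[OF \<psi>] Dom_derivatives(1-4)[OF \<eta>]
  by (auto intro!: continuous_intros)

lemma leib_line_continuous:
  assumes \<psi>: "\<psi> \<in> Dom" and \<eta>: "\<eta> \<in> Dom"
  shows "continuous_on UNIV (\<lambda>r. leib d_r \<psi> \<eta> i j (r, \<theta>, \<phi>))" "continuous_on UNIV (\<lambda>\<theta>. leib d_theta \<psi> \<eta> i j (r, \<theta>, \<phi>))"
    "continuous_on UNIV (\<lambda>\<phi>. leib d_phi \<psi> \<eta> i j (r, \<theta>, \<phi>))"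
proof -
  have l: "continuous_on UNIV (\<lambda>r. (r, \<theta>, \<phi>))" "continuous_on UNIV (\<lambda>\<theta>. (r, \<theta>, \<phi>))" "continuous_on UNIV (\<lambda>\<phi>. (r, \<theta>, \<phi>))"
    by (intro continuous_intros)+
  show "continuous_on UNIV (\<lambda>r. leib d_r \<psi> \<eta> i j (r, \<theta>, \<phi>))"
    by (rule continuous_on_compose2[OF leib_continuous(1)[OF \<psi> \<eta>] l(1) subset_UNIV])
  show "continuous_on UNIV (\<lambda>\<theta>. leib d_theta \<psi> \<eta> i j (r, \<theta>, \<phi>))"
    by (rule continuous_on_compose2[OF leib_continuous(2)[OF \<psi> \<eta>] l(2) subset_UNIV])
  show "continuous_on UNIV (\<lambda>\<phi>. leib d_phi \<psi> \<eta> i j (r, \<theta>, \<phi>))"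
    by (rule continuous_on_compose2[OF leib_continuous(3)[OF \<psi> \<eta>] l(3) subset_UNIV])
qed

lemma null_integral_iff:
  assumes "BC f" shows "null_integral f \<longleftrightarrow> (LINT x|lborel. indicator Zset x *\<^sub>R f x) = 0"
  using BC_integrable[OF assms] assms by (simp add: null_integral_def integral_MZ BC_def)

lemma BC_lborel: "BC f \<Longrightarrow> integrable lborel (\<lambda>x. indicator Zset x *\<^sub>R f x)"
  using BC_integrable[of f] unfolding BC_def by (metis integrable_MZ)

lemma integral_zero_cmult:
  fixes f g :: "real \<Rightarrow> complex"
  assumes "\<And>x. f x = c * g x" "(LINT x|lborel. g x) = 0" shows "(LINT x|lborel. f x) = 0"
  unfolding assms(1) by (simp add: assms(2))

lemma null_integral_leib_r:
  assumes \<psi>: "\<psi> \<in> Dom" and \<eta>: "\<eta> \<in> Dom"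
  shows "null_integral (leib d_r \<psi> \<eta> i j)"
  unfolding null_integral_iff[OF leib_BC(1)[OF assms]]
proof (rule integral_zero_r[OF BC_lborel[OF leib_BC(1)[OF assms]]])
  fix q :: "real \<times> real"
  obtain \<theta> \<phi> where q: "q = (\<theta>, \<phi>)" by force
  obtain K where K: "compact K" "\<And>r \<theta> \<phi>. (r, \<theta>) \<notin> K \<Longrightarrow> \<psi> (r, \<theta>, \<phi>) = 0" "\<And>r \<theta> \<phi>. (r, \<theta>) \<notin> K \<Longrightarrow> d_r \<psi> (r, \<theta>, \<phi>) = 0"
    using Dom_support[OF \<psi>] by auto
  obtain R where R: "R > 0" "\<And>x. x \<in> K \<Longrightarrow> norm x < R" using compact_imp_bounded[OF K(1)] bounded_pos_less by metis
  have out: "\<psi> (r, \<theta>, \<phi>) = 0" "d_r \<psi> (r, \<theta>, \<phi>) = 0" if "\<bar>r\<bar> \<ge> R" for r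
  proof -
    have "(r, \<theta>) \<notin> K" using R(2)[of "(r, \<theta>)"] that norm_fst_le[of r \<theta>] by auto
    then show "\<psi> (r, \<theta>, \<phi>) = 0" "d_r \<psi> (r, \<theta>, \<phi>) = 0" using K by auto
  qed
  have z: "(LINT r|lborel. indicator {-R..R} r *\<^sub>R leib d_r \<psi> \<eta> i j (r, \<theta>, \<phi>)) = 0"
    by (rule integral_derivative_zero[OF _ leib_line_derivative(1)[OF assms] leib_line_continuous(1)[OF assms]])
      (use R(1) out(1)[of R] out(1)[of "-R"] in auto)
  have "indicator Zset (r, q) *\<^sub>R leib d_r \<psi> \<eta> i j (r, q) = (if (\<theta>, \<phi>) \<in> {0..pi} \<times> {0..2*pi} then 1 else 0) * (indicator {-R..R} r *\<^sub>R leib d_r \<psi> \<eta> i j (r, \<theta>, \<phi>))" for r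
    using out[of r] by (cases "\<bar>r\<bar> \<ge> R") (auto simp: q Zset_def indicator_def leib_def)
  then show "(LINT r|lborel. indicator Zset (r, q) *\<^sub>R leib d_r \<psi> \<eta> i j (r, q)) = 0"
    by (rule integral_zero_cmult[OF _ z])
qed

text \<open>The weight depends on \<open>r\<close> only and is a constant in the polar integral; the
  boundary terms vanish because the support avoids the poles.\<close>

lemma null_integral_leib_theta:
  assumes a: "a \<noteq> 0" and \<psi>: "\<psi> \<in> Dom" and \<eta>: "\<eta> \<in> Dom"
  shows "null_integral (\<lambda>x. of_real (1 / varpi a (fst x)) * leib d_theta \<psi> \<eta> i j x)"
proof -
  have b: "BC (\<lambda>x. of_real (1 / varpi a (fst x)) * leib d_theta \<psi> \<eta> i j x)"
  proof (rule BC_mult[OF _ _ leib_BC(2)[OF \<psi> \<eta>], of _ "1 / \<bar>a\<bar>"])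
    show "norm (complex_of_real (1 / varpi a (fst x))) \<le> 1 / \<bar>a\<bar>" for x :: pt
      using varpi_pos[OF a, of "fst x"] inverse_varpi_le[OF a, of "fst x"] by (simp add: norm_divide)
  qed measurable
  show ?thesis unfolding null_integral_iff[OF b]
  proof (rule integral_zero_theta[OF BC_lborel[OF b]])
    fix r \<phi> :: real
    have out: "\<psi> (r, 0, \<phi>) = 0" "\<psi> (r, pi, \<phi>) = 0"
    proof -
      obtain K where "K \<subseteq> RTstar" "\<And>r \<theta> \<phi>. (r, \<theta>) \<notin> K \<Longrightarrow> \<psi> (r, \<theta>, \<phi>) = 0" using Dom_support[OF \<psi>] by auto
      moreover have "(r, 0) \<notin> RTstar" "(r, pi) \<notin> RTstar" by (simp_all add: RTstar_def)
      ultimately show "\<psi> (r, 0, \<phi>) = 0" "\<psi> (r, pi, \<phi>) = 0" by blast+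
    qed
    have z: "(LINT \<theta>|lborel. indicator {0..pi} \<theta> *\<^sub>R leib d_theta \<psi> \<eta> i j (r, \<theta>, \<phi>)) = 0"
      by (rule integral_derivative_zero[OF _ leib_line_derivative(2)[OF \<psi> \<eta>] leib_line_continuous(2)[OF \<psi> \<eta>]])
        (use out in auto)
    have "indicator Zset (r, \<theta>, \<phi>) *\<^sub>R (of_real (1 / varpi a (fst (r, \<theta>, \<phi>))) * leib d_theta \<psi> \<eta> i j (r, \<theta>, \<phi>))
      = (if \<phi> \<in> {0..2*pi} then of_real (1 / varpi a r) else 0) * (indicator {0..pi} \<theta> *\<^sub>R leib d_theta \<psi> \<eta> i j (r, \<theta>, \<phi>))" for \<theta>
      by (auto simp: Zset_def indicator_def)
    then show "(LINT \<theta>|lborel. indicator Zset (r, \<theta>, \<phi>) *\<^sub>R (of_real (1 / varpi a (fst (r, \<theta>, \<phi>))) * leib d_theta \<psi> \<eta> i j (r, \<theta>, \<phi>))) = 0"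
    by (rule integral_zero_cmult[OF _ z])
  qed
qed

text \<open>The product of two antiperiodic fields is periodic, so the boundary values at 0 and
  \<open>2 * pi\<close> agree. Any weight in \<open>r\<close> and \<open>\<theta>\<close> is
  constant in the inner integral.\<close>

lemma null_integral_leib_phi:
  assumes b: "BC (\<lambda>x. w (fst x) (fst (snd x)) * leib d_phi \<psi> \<eta> i j x)" and \<psi>: "\<psi> \<in> Dom" and \<eta>: "\<eta> \<in> Dom"
  shows "null_integral (\<lambda>x. w (fst x) (fst (snd x)) * leib d_phi \<psi> \<eta> i j x)"
  unfolding null_integral_iff[OF b]
proof (rule integral_zero_phi[OF BC_lborel[OF b]])
  fix r \<theta> :: real
  have per: "\<psi> (r, \<theta>, 2 * pi) = - \<psi> (r, \<theta>, 0)" "\<eta> (r, \<theta>, 2 * pi) = - \<eta> (r, \<theta>, 0)"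
    proof -
    have "\<zeta> (r, \<theta>, 0 + 2 * pi) = - \<zeta> (r, \<theta>, 0)" if "\<zeta> \<in> Dom" for \<zeta> using that unfolding Dom_def by blast
    then show "\<psi> (r, \<theta>, 2 * pi) = - \<psi> (r, \<theta>, 0)" "\<eta> (r, \<theta>, 2 * pi) = - \<eta> (r, \<theta>, 0)" using \<psi> \<eta> by simp_all
  qed
  have z: "(LINT \<phi>|lborel. indicator {0..2*pi} \<phi> *\<^sub>R leib d_phi \<psi> \<eta> i j (r, \<theta>, \<phi>)) = 0"
    by (rule integral_derivative_zero[OF _ leib_line_derivative(3)[OF \<psi> \<eta>] leib_line_continuous(3)[OF \<psi> \<eta>]])
      (use per in auto)
  have "indicator Zset (r, \<theta>, \<phi>) *\<^sub>R (w (fst (r, \<theta>, \<phi>)) (fst (snd (r, \<theta>, \<phi>))) * leib d_phi \<psi> \<eta> i j (r, \<theta>, \<phi>))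
    = (if \<theta> \<in> {0..pi} then w r \<theta> else 0) * (indicator {0..2*pi} \<phi> *\<^sub>R leib d_phi \<psi> \<eta> i j (r, \<theta>, \<phi>))" for \<phi>
    by (auto simp: Zset_def indicator_def)
  then show "(LINT \<phi>|lborel. indicator Zset (r, \<theta>, \<phi>) *\<^sub>R (w (fst (r, \<theta>, \<phi>)) (fst (snd (r, \<theta>, \<phi>))) * leib d_phi \<psi> \<eta> i j (r, \<theta>, \<phi>))) = 0"
    by (rule integral_zero_cmult[OF _ z])
qed

lemma null_integral_leib_phi_weights:
  assumes a: "a \<noteq> 0" and \<psi>: "\<psi> \<in> Dom" and \<eta>: "\<eta> \<in> Dom"
  shows "null_integral (\<lambda>x. of_real (a / (varpi a (fst x))\<^sup>2) * leib d_phi \<psi> \<eta> i j x)"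
    and "null_integral (\<lambda>x. of_real (1 / (varpi a (fst x) * sin (fst (snd x)))) * leib d_phi \<psi> \<eta> i j x)"
proof -
  have v: "0 < varpi a r" "1 / varpi a r \<le> 1 / \<bar>a\<bar>" for r using varpi_pos[OF a] inverse_varpi_le[OF a] by auto
  have n: "norm (complex_of_real (1 / varpi a r)) \<le> 1 / \<bar>a\<bar>" for r
    using v(1)[of r] v(2)[of r] by (simp add: norm_divide)
  have w: "BC (\<lambda>x. of_real (1 / varpi a (fst x)) * f x)" if "BC f" for f
    by (rule BC_mult[OF _ n that]) measurable
  have k: "BC (\<lambda>x. k * f x)" if "BC f" for f k by (rule BC_mult[OF _ _ that, of _ "norm k"]) auto
  have "BC (\<lambda>x. of_real a * (of_real (1 / varpi a (fst x)) * (of_real (1 / varpi a (fst x)) * leib d_phi \<psi> \<eta> i j x)))"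
    by (intro k w leib_BC \<psi> \<eta>)
  then have b1: "BC (\<lambda>x. of_real (a / (varpi a (fst x))\<^sup>2) * leib d_phi \<psi> \<eta> i j x)"
    by (simp add: power2_eq_square)
  have "BC (\<lambda>x. of_real (1 / varpi a (fst x)) * (cnj (of_real (1 / sin (fst (snd x))) * d_phi \<psi> x $ i) * \<eta> x $ j
    + cnj (\<psi> x $ i) * (of_real (1 / sin (fst (snd x))) * d_phi \<eta> x $ j)))"
    by (intro w BC_add BC_times BC_cnj csc_d_phi_BC Dom_BC(1) \<psi> \<eta>)
  then have b2: "BC (\<lambda>x. of_real (1 / (varpi a (fst x) * sin (fst (snd x)))) * leib d_phi \<psi> \<eta> i j x)"
    by (simp add: leib_def add_divide_distrib mult.commute)
  show "null_integral (\<lambda>x. of_real (a / (varpi a (fst x))\<^sup>2) * leib d_phi \<psi> \<eta> i j x)"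
    by (rule null_integral_leib_phi[of "\<lambda>r \<theta>. of_real (a / (varpi a r)\<^sup>2)", OF b1 \<psi> \<eta>])
  show "null_integral (\<lambda>x. of_real (1 / (varpi a (fst x) * sin (fst (snd x)))) * leib d_phi \<psi> \<eta> i j x)"
    by (rule null_integral_leib_phi[of "\<lambda>r \<theta>. of_real (1 / (varpi a r * sin \<theta>))", OF b2 \<psi> \<eta>])
qed

text \<open>The difference of the integrands is a combination of total derivatives, each with a
  weight independent of its own variable; this is why the flat measure makes the operator symmetric.
  The zeroth order terms cancel pointwise, as the potential is real and the two mass blocks are
  conjugate to each other.\<close>

lemma frakH_symmetric:
  assumes a: "a \<noteq> 0" and \<psi>: "\<psi> \<in> Dom" and \<eta>: "\<eta> \<in> Dom"
  shows "ip (frakH a m e Q \<psi>) \<eta> = ip \<psi> (frakH a m e Q \<eta>)"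
proof -
  let ?H = "frakH a m e Q"
  let ?R = "leib d_r \<psi> \<eta>" and ?T = "\<lambda>i j x. complex_of_real (1 / varpi a (fst x)) * leib d_theta \<psi> \<eta> i j x"
    and ?P = "\<lambda>i j x. complex_of_real (a / (varpi a (fst x))\<^sup>2) * leib d_phi \<psi> \<eta> i j x"
    and ?C = "\<lambda>i j x. complex_of_real (1 / (varpi a (fst x) * sin (fst (snd x)))) * leib d_phi \<psi> \<eta> i j x"
  let ?J = "\<lambda>x. \<i> * ((?R 1 1 x - ?R 2 2 x - ?R 3 3 x + ?R 4 4 x) + (?T 1 2 x + ?T 2 1 x - ?T 3 4 x - ?T 4 3 x)
    + (?P 1 1 x + ?P 2 2 x + ?P 3 3 x + ?P 4 4 x) + \<i> * (?C 2 1 x - ?C 1 2 x + ?C 3 4 x - ?C 4 3 x))"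
  have eq: "hin (?H \<psi> x) (\<eta> x) - hin (\<psi> x) (?H \<eta> x) = ?J x" for x
  proof -
    obtain r \<theta> \<phi> where x: "x = (r, \<theta>, \<phi>)" by (metis prod_cases3)
    define v where "v = complex_of_real (1 / varpi a r)"
    define s where "s = complex_of_real (1 / sin \<theta>)"
    define q where "q = complex_of_real (e * absrho a r \<theta> * A0t a Q r \<theta> / varpi a r)"
    define \<mu> where "\<mu> = complex_of_real (m / varpi a r)"
    have cv: "cnj v = v" "cnj s = s" "cnj q = q" "cnj \<mu> = \<mu>" by (auto simp: v_def s_def q_def \<mu>_def)
    have w: "complex_of_real (a / varpi a r) = of_real a * v" "complex_of_real (a / (varpi a r)\<^sup>2) = of_real a * v * v"
      "complex_of_real (1 / (varpi a r * sin \<theta>)) = v * s"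
      by (simp_all add: v_def s_def power2_eq_square)
    show ?thesis
      unfolding hin_def sum_4 x frakH_components[OF a] fst_conv snd_conv w leib_def v_def[symmetric] s_def[symmetric]
        q_def[symmetric] \<mu>_def[symmetric] complex_cnj_add complex_cnj_mult complex_cnj_diff complex_cnj_minus complex_cnj_i cv
        complex_cnj_complex_of_real complex_cnj_cnj
      by algebra
  qed
  have "null_integral ?J"
    by (intro null_integral_add null_integral_diff null_integral_cmult null_integral_leib_r null_integral_leib_theta
        null_integral_leib_phi_weights a \<psi> \<eta>)
  then have "(LINT x|MZ. hin (?H \<psi> x) (\<eta> x) - hin (\<psi> x) (?H \<eta> x)) = 0"
    unfolding eq null_integral_def by simp
  then show ?thesis
    using hin_integrable(1)[OF frakH_l2[OF a \<psi>] Dom_l2[OF \<eta>], of m e Q] hin_integrable(1)[OF Dom_l2[OF \<psi>] frakH_l2[OF a \<eta>], of m e Q]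
    by (simp add: ip_eq frakH_l2[OF a] Dom_l2 \<psi> \<eta>)
qed

section \<open>Essential self-adjointness\<close>

text \<open>The eigenmodes of the operator with parameter 1 in place of \<open>a\<close> already
  span, and they lie in the closure of \<open>DT\<close>.\<close>

lemma DT_dense:
  assumes h: "l2 MZ h" and \<epsilon>: "\<epsilon> > 0"
  shows "\<exists>\<psi>\<in>DT. nrm MZ (\<lambda>p. \<psi> p - h p) < \<epsilon>"
proof -
  have "h \<in> reach (\<lambda>\<psi>. \<psi>)"
    by (rule csub_eigenmodes_all[OF csub_id clg_reach_id[OF clg_block[of 1]] h]) simp
  then show ?thesis using \<epsilon> by (simp add: reach_def)
qed

lemma shiftH_dense_range:
  assumes a: "a \<noteq> 0" and h: "l2 MZ h" and \<sigma>: "\<sigma> \<in> {1, -1}" and \<epsilon>: "\<epsilon> > 0"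
  shows "\<exists>\<psi>\<in>DT. nrm MZ (\<lambda>p. shiftH a e \<sigma> \<psi> p - h p) < \<epsilon>"
proof -
  have "h \<in> reach (shiftH a e \<sigma>)"
    by (rule csub_eigenmodes_all[OF csub_shiftH[OF a] range_contains_eigenmodes[OF a _ _ \<sigma>] h])
  then show ?thesis using \<epsilon> by (simp add: reach_def)
qed

section \<open>Switching on mass and potential\<close>

lemma frakH_lower_bound:
  assumes a: "a \<noteq> 0" and \<psi>: "\<psi> \<in> Dom" and \<sigma>: "\<sigma> \<in> {1, -1}"
  shows "nrm MZ \<psi> \<le> nrm MZ (\<lambda>p. frakH a m e Q \<psi> p + (complex_of_real \<sigma> * \<i>) *s \<psi> p)"
  using nrm_shift_ge[OF Dom_l2[OF \<psi>] frakH_l2[OF a \<psi>] frakH_symmetric[OF a \<psi> \<psi>, of m e Q], of \<sigma>] \<sigma> by auto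

definition zeroth_order :: "real \<Rightarrow> real \<Rightarrow> real \<Rightarrow> real \<Rightarrow> field4 \<Rightarrow> field4" where
  "zeroth_order a m e Q \<psi> = (\<lambda>p. frakH a m e Q \<psi> p - frakH a 0 e 0 \<psi> p)"

text \<open>Scaling the perturbation amounts to scaling \<open>m\<close> and \<open>Q\<close>, so
  each operator on the segment is of the same form and symmetric; hence the uniform lower
  bound.\<close>

lemma zeroth_order_scale:
  assumes a: "a \<noteq> 0"
  shows "frakH a 0 e 0 \<psi> p + t *\<^sub>R zeroth_order a m e Q \<psi> p = frakH a (t * m) e (t * Q) \<psi> p"
proof -
  obtain r \<theta> \<phi> where p: "p = (r, \<theta>, \<phi>)" by (metis prod_cases3)
  have q: "complex_of_real (e * absrho a r \<theta> * A0t a (t * Q) r \<theta> / varpi a r)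
    = of_real t * complex_of_real (e * absrho a r \<theta> * A0t a Q r \<theta> / varpi a r)"
    "complex_of_real (e * absrho a r \<theta> * A0t a 0 r \<theta> / varpi a r) = 0"
    "complex_of_real (t * m / varpi a r) = of_real t * complex_of_real (m / varpi a r)"
    "complex_of_real (0 / varpi a r) = 0"
    by (simp_all add: A0t_def)
  show ?thesis
    unfolding vec_eq_iff forall_4 zeroth_order_def p vector_add_component vector_minus_component vector_scaleR_component
      frakH_components[OF a] q scaleR_conv_of_real[where 'a=complex]
    by (simp add: algebra_simps del: of_real_divide)
qed

text \<open>Each component receives one potential term and one mass term, the latter at most
  \<open>\<bar>m\<bar>\<close> because \<open>rho\<close> is dominated by \<open>varpi\<close>.
  Summing over four components gives the factor 4.\<close>

lemma zeroth_order_bound: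
  assumes a: "a \<noteq> 0"
  shows "norm (zeroth_order a m e Q \<psi> p) \<le> 4 * (\<bar>e * Q\<bar> / \<bar>a\<bar> + \<bar>m\<bar>) * norm (\<psi> p)"
proof -
  let ?c = "\<bar>e * Q\<bar> / \<bar>a\<bar> + \<bar>m\<bar>"
  obtain r \<theta> \<phi> where p: "p = (r, \<theta>, \<phi>)" by (metis prod_cases3)
  define q where "q = complex_of_real (e * absrho a r \<theta> * A0t a Q r \<theta> / varpi a r)"
  define \<mu> where "\<mu> = complex_of_real (m / varpi a r) * rho a r \<theta>"
  define \<nu> where "\<nu> = complex_of_real (m / varpi a r) * cnj (rho a r \<theta>)"
  have v: "varpi a r > 0" by (rule varpi_pos[OF a])
  have nq: "norm q \<le> \<bar>e * Q\<bar> / \<bar>a\<bar>" unfolding q_def norm_of_real by (rule absrho_potential[OF a])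
  have "\<bar>m\<bar> / varpi a r * norm (rho a r \<theta>) \<le> \<bar>m\<bar> / varpi a r * varpi a r"
    using v by (intro mult_left_mono rho_le_varpi) auto
  then have nm: "norm \<mu> \<le> \<bar>m\<bar>" "norm \<nu> \<le> \<bar>m\<bar>" using v by (simp_all add: \<mu>_def \<nu>_def norm_mult norm_divide)
  have A0: "A0t a 0 r \<theta> = 0" by (simp add: A0t_def)
  have K: "zeroth_order a m e Q \<psi> p $ 1 = q * \<psi> p $ 1 + \<nu> * \<psi> p $ 3" "zeroth_order a m e Q \<psi> p $ 2 = q * \<psi> p $ 2 + \<nu> * \<psi> p $ 4"
    "zeroth_order a m e Q \<psi> p $ 3 = q * \<psi> p $ 3 + \<mu> * \<psi> p $ 1" "zeroth_order a m e Q \<psi> p $ 4 = q * \<psi> p $ 4 + \<mu> * \<psi> p $ 2"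
    unfolding zeroth_order_def p vector_minus_component frakH_components[OF a] q_def \<mu>_def \<nu>_def A0 by simp_all
  have le: "norm (q * \<psi> p $ i + z * \<psi> p $ j) \<le> ?c * norm (\<psi> p)" if "norm z \<le> \<bar>m\<bar>" for i j z
  proof -
    have "norm (q * \<psi> p $ i + z * \<psi> p $ j) \<le> norm q * norm (\<psi> p $ i) + norm z * norm (\<psi> p $ j)"
      by (simp only: norm_mult[symmetric] norm_triangle_ineq)
    also have "\<dots> \<le> \<bar>e * Q\<bar> / \<bar>a\<bar> * norm (\<psi> p) + \<bar>m\<bar> * norm (\<psi> p)"
      by (intro add_mono mult_mono nq that Finite_Cartesian_Product.norm_nth_le) auto
    finally show ?thesis by (simp add: distrib_right)
  qed
  have "norm (zeroth_order a m e Q \<psi> p) \<le> (\<Sum>i\<in>UNIV. norm (zeroth_order a m e Q \<psi> p $ i))" by (rule norm_bisp_le_sum)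
  also have "\<dots> \<le> ?c * norm (\<psi> p) + ?c * norm (\<psi> p) + ?c * norm (\<psi> p) + ?c * norm (\<psi> p)"
    unfolding sum_4 K by (intro add_mono le nm)
  finally show ?thesis by (simp add: algebra_simps)
qed

lemma frakH_dense_range:
  assumes a: "a \<noteq> 0" and h: "l2 MZ h" and \<sigma>: "\<sigma> \<in> {1, -1}" and \<epsilon>: "\<epsilon> > 0"
  shows "\<exists>\<psi>\<in>DT. nrm MZ (\<lambda>p. frakH a m e Q \<psi> p + (complex_of_real \<sigma> * \<i>) *s \<psi> p - h p) < \<epsilon>"
proof -
  let ?K = "zeroth_order a m e Q" and ?c = "4 * (\<bar>e * Q\<bar> / \<bar>a\<bar> + \<bar>m\<bar>)"
  have sh: "shiftH a e \<sigma> \<psi> p + t *\<^sub>R ?K \<psi> p = frakH a (t * m) e (t * Q) \<psi> p + (complex_of_real \<sigma> * \<i>) *s \<psi> p" for \<psi> t p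
    using zeroth_order_scale[OF a, of e \<psi> p t m Q] by (simp add: shiftH_def algebra_simps)
  interpret dense_range_perturbation MZ "{h. l2 MZ h}" DT "shiftH a e \<sigma>" ?K
  proof
    show "(\<lambda>_. 0) \<in> DT" by (rule zero_DT)
    show "DT \<subseteq> {h. l2 MZ h}" using Dom_l2 DT_Dom by blast
    fix x y assume x: "x \<in> DT"
    note add = frakH_DT_add[OF a]
    show "shiftH a e \<sigma> x \<in> {h. l2 MZ h}"
      unfolding shiftH_def mem_Collect_eq by (intro l2_add l2_smult frakH_l2 a Dom_l2 DT_Dom x)
    show "?K x \<in> {h. l2 MZ h}"
      unfolding zeroth_order_def mem_Collect_eq by (intro l2_diff frakH_l2 a DT_Dom x)
    assume y: "y \<in> DT"
    show "(\<lambda>p. x p + y p) \<in> DT" by (rule DT_add[OF x y])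
    show "shiftH a e \<sigma> (\<lambda>p. x p + y p) = (\<lambda>p. shiftH a e \<sigma> x p + shiftH a e \<sigma> y p)"
      unfolding shiftH_def add[OF x y] by (auto simp: vec_eq_iff algebra_simps)
    show "?K (\<lambda>p. x p + y p) = (\<lambda>p. ?K x p + ?K y p)"
      unfolding zeroth_order_def add[OF x y] by (auto simp: algebra_simps)
  next
    have z: "frakH a m e Q (\<lambda>_. 0) = (\<lambda>_. 0)" for m Q
      using frakH_DT_smult[OF a zero_DT, of m e Q 0] by simp
    show "shiftH a e \<sigma> (\<lambda>_. 0) = (\<lambda>_. 0)" "?K (\<lambda>_. 0) = (\<lambda>_. 0)"
      by (simp_all add: shiftH_def zeroth_order_def z)
  next
    show "(\<lambda>p. c *\<^sub>R x p) \<in> {h. l2 MZ h}" if "x \<in> {h. l2 MZ h}" for x :: field4 and c :: real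
    proof -
      have "c *\<^sub>R x p = complex_of_real c *s x p" for p by (simp add: vec_eq_iff scaleR_conv_of_real[where 'a=complex])
      then show ?thesis using l2_smult[of x "of_real c"] that by simp
    qed
  qed (auto intro: l2_add)
  have "dense_range (\<lambda>x p. shiftH a e \<sigma> x p + ?K x p)"
  proof (rule dense_range_perturb)
    show "dense_range (shiftH a e \<sigma>)"
      unfolding dense_range_def using shiftH_dense_range[OF a _ \<sigma>] by blast
    show "nrm MZ x \<le> nrm MZ (\<lambda>p. shiftH a e \<sigma> x p + t *\<^sub>R ?K x p)" if "x \<in> DT" for x t
      unfolding sh by (rule frakH_lower_bound[OF a DT_Dom[OF that] \<sigma>])
    show "nrm MZ (?K x) \<le> ?c * nrm MZ x" if "x \<in> DT" for x
    proof -
      have "nrm MZ (?K x) \<le> nrm MZ (\<lambda>p. of_real ?c *s x p)"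
      proof (rule nrm_mono)
        show "l2 MZ (\<lambda>p. of_real ?c *s x p)" by (intro l2_smult Dom_l2 DT_Dom that)
        show "norm (?K x p) \<le> norm (of_real ?c *s x p)" for p
          using zeroth_order_bound[OF a, of m e Q x p] by (simp only: norm_smult_vec norm_of_real) simp
      qed
      then show ?thesis by (simp only: nrm_smult norm_of_real) simp
    qed
  qed
  then show ?thesis
    unfolding dense_range_def using h \<epsilon> sh[of _ _ 1] by simp
qed

theorem theorem5:
  fixes a m e Q I :: real
  assumes "a \<noteq> 0" and "m > 0" and "e > 0" and "Q = I * pi * a"
  shows "ess_self_adjoint Dom (frakH a m e Q)"
proof (rule ess_self_adjoint_if_dense_ranges)
  note a = assms(1)
  show "l2 MZ \<psi>" "l2 MZ (frakH a m e Q \<psi>)" if "\<psi> \<in> Dom" for \<psi>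
    by (rule Dom_l2[OF that], rule frakH_l2[OF a that])
  show "ip (frakH a m e Q \<psi>) \<eta> = ip \<psi> (frakH a m e Q \<eta>)" if "\<psi> \<in> Dom" "\<eta> \<in> Dom" for \<psi> \<eta>
    by (rule frakH_symmetric[OF a that])
  show "\<exists>\<psi>\<in>Dom. nrm MZ (\<lambda>p. \<psi> p - h p) < \<epsilon>" if "l2 MZ h" "\<epsilon> > 0" for h \<epsilon>
    using DT_dense[OF that] DT_Dom by blast
  show "\<exists>\<psi>\<in>Dom. nrm MZ (\<lambda>p. frakH a m e Q \<psi> p + (complex_of_real \<sigma> * \<i>) *s \<psi> p - h p) < \<epsilon>"
    if "l2 MZ h" "\<sigma> \<in> {1, -1}" "\<epsilon> > 0" for h \<sigma> \<epsilon>
    using frakH_dense_range[OF a that] DT_Dom by blast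
qed

end
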